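(* Let $G$ be a finite group and let $R$ be either $\mathbb{Z}$ or a field of characteristic $p>0$ with $p$ dividing $|G|$. Let $g_1,\ldots,g_t$ be representatives of the conjugacy classes of $G$ and let $C_G(g_i)$ denote the centralizer of $g_i$ in $G$. Then there is an isomorphism of graded $R$-modules $$\widehat{\mathrm{HH}}^*(RG,RG)\cong\bigoplus_{i=1}^t\widehat{\mathrm{H}}^*(C_G(g_i),R).$$
   Context: A complete resolution of a finitely generated module $M$ over a two-sided Noetherian ring $\mathcal{R}$ is an exact complex $\mathbb{P}=\{P_n\}_{n\in\mathbb{Z}}$ of finitely generated projective $\mathcal{R}$-modules such that $\mathrm{Hom}_{\mathcal{R}}(\mathbb{P},\mathcal{R})$ is exact and there are a projective resolution $\mathbb{Q}\to M$ and a chain map $\mathbb{P}\to\mathbb{Q}$ that is bijective in degrees $\ge0$ and $0$ in negative degrees. One sets $\widehat{\mathrm{Ext}}^n_{\mathcal{R}}(M,N)=\mathrm{H}^n(\mathrm{Hom}_{\mathcal{R}}(\mathbb{P},N))$ for $n\in\mathbb{Z}$. For a finite group $K$ and a left $RK$-module $N$, Tate cohomology is $\widehat{\mathrm{H}}^n(K,N)=\widehat{\mathrm{Ext}}^n_{RK}(R,N)$ with $R$ the trivial module. Tate-Hochschild cohomology of $RG$ is $\widehat{\mathrm{HH}}^n(RG,M)=\widehat{\mathrm{Ext}}^n_{RG\otimes_R RG^{op}}(RG,M)$ for an $RG$-bimodule $M$, regarded as a left $RG\otimes_RRG^{op}$-module via $(a\otimes b)\cdot m=amb$. A superscript $*$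 denotes the direct sum over all $n\in\mathbb{Z}$. *)

theory Defs
  imports "HOL-Algebra.Algebra"
begin

section \<open>Rings and groups\<close>

definition ring_char :: "('r, 'x) ring_scheme \<Rightarrow> nat" where
  "ring_char R =
     (if \<exists>n::nat. n > 0 \<and> add_pow R n \<one>\<^bsub>R\<^esub> = \<zero>\<^bsub>R\<^esub>
      then LEAST n::nat. n > 0 \<and> add_pow R n \<one>\<^bsub>R\<^esub> = \<zero>\<^bsub>R\<^esub>
      else 0)"

definition centralizer :: "('g, 'x) monoid_scheme \<Rightarrow> 'g \<Rightarrow> ('g, 'x) monoid_scheme" where
  "centralizer G x = G\<lparr>carrier := {h \<in> carrier G. h \<otimes>\<^bsub>G\<^esub> x = x \<otimes>\<^bsub>G\<^esub> h}\<rparr>"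

definition conjugation :: "('g, 'x) monoid_scheme \<Rightarrow> 'g \<Rightarrow> 'g \<Rightarrow> 'g" where
  "conjugation G = (\<lambda>g. \<lambda>h \<in> carrier G. g \<otimes>\<^bsub>G\<^esub> h \<otimes>\<^bsub>G\<^esub> inv\<^bsub>G\<^esub> g)"

definition conjugacy_class_representatives ::
    "('g, 'x) monoid_scheme \<Rightarrow> nat \<Rightarrow> (nat \<Rightarrow> 'g) \<Rightarrow> bool" where
  "conjugacy_class_representatives G t g \<longleftrightarrow>
     g \<in> {1..t} \<rightarrow> carrier G \<and>
     bij_betw (\<lambda>i. orbit G (conjugation G) (g i)) {1..t}
       (orbits G (carrier G) (conjugation G))"


section \<open>Left modules over a ring\<close>

text \<open>The library's locale \<^locale>\<open>module\<close> assumes a commutative base ring.  Its record type is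
  reused here; the fields \<^const>\<open>monoid.mult\<close> and \<^const>\<open>monoid.one\<close> of a module are irrelevant and
  left \<^const>\<open>undefined\<close> where there is no canonical choice.\<close>

locale left_module = R?: ring R + M?: abelian_group M
  for R :: "('a, 'x) ring_scheme" (structure) and M :: "('a, 'm, 'y) module_scheme" (structure) +
  assumes smult_closed:
      "\<lbrakk>a \<in> carrier R; x \<in> carrier M\<rbrakk> \<Longrightarrow> a \<odot>\<^bsub>M\<^esub> x \<in> carrier M"
    and smult_l_distr:
      "\<lbrakk>a \<in> carrier R; b \<in> carrier R; x \<in> carrier M\<rbrakk> \<Longrightarrow>
       (a \<oplus> b) \<odot>\<^bsub>M\<^esub> x = a \<odot>\<^bsub>M\<^esub> x \<oplus>\<^bsub>M\<^esub> b \<odot>\<^bsub>M\<^esub> x"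
    and smult_r_distr:
      "\<lbrakk>a \<in> carrier R; x \<in> carrier M; y \<in> carrier M\<rbrakk> \<Longrightarrow>
       a \<odot>\<^bsub>M\<^esub> (x \<oplus>\<^bsub>M\<^esub> y) = a \<odot>\<^bsub>M\<^esub> x \<oplus>\<^bsub>M\<^esub> a \<odot>\<^bsub>M\<^esub> y"
    and smult_assoc:
      "\<lbrakk>a \<in> carrier R; b \<in> carrier R; x \<in> carrier M\<rbrakk> \<Longrightarrow>
       (a \<otimes> b) \<odot>\<^bsub>M\<^esub> x = a \<odot>\<^bsub>M\<^esub> (b \<odot>\<^bsub>M\<^esub> x)"
    and smult_one:
      "x \<in> carrier M \<Longrightarrow> \<one> \<odot>\<^bsub>M\<^esub> x = x"

text \<open>Homomorphisms are extensional, so that the set of them is the usual Hom group.\<close>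

definition module_homs ::
    "('a, 'x) ring_scheme \<Rightarrow> ('a, 'm, 'y) module_scheme \<Rightarrow> ('a, 'n, 'z) module_scheme
      \<Rightarrow> ('m \<Rightarrow> 'n) set" where
  "module_homs A M N =
     {f \<in> carrier M \<rightarrow>\<^sub>E carrier N.
        (\<forall>x\<in>carrier M. \<forall>y\<in>carrier M. f (x \<oplus>\<^bsub>M\<^esub> y) = f x \<oplus>\<^bsub>N\<^esub> f y) \<and>
        (\<forall>a\<in>carrier A. \<forall>x\<in>carrier M. f (a \<odot>\<^bsub>M\<^esub> x) = a \<odot>\<^bsub>N\<^esub> f x)}"

definition direct_sum ::
    "'i set \<Rightarrow> ('i \<Rightarrow> ('a, 'm, 'y) module_scheme) \<Rightarrow> ('a, 'i \<Rightarrow> 'm) module" where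
  "direct_sum I M =
     \<lparr>carrier = {f \<in> \<Pi>\<^sub>E i\<in>I. carrier (M i). finite {i \<in> I. f i \<noteq> \<zero>\<^bsub>M i\<^esub>}},
      monoid.mult = undefined,
      one = undefined,
      ring.zero = (\<lambda>i\<in>I. \<zero>\<^bsub>M i\<^esub>),
      add = (\<lambda>f g. \<lambda>i\<in>I. f i \<oplus>\<^bsub>M i\<^esub> g i),
      smult = (\<lambda>a f. \<lambda>i\<in>I. a \<odot>\<^bsub>M i\<^esub> f i)\<rparr>"

definition quotient_module ::
    "('a, 'm, 'y) module_scheme \<Rightarrow> 'm set \<Rightarrow> ('a, 'm set) module" where
  "quotient_module M B =
     \<lparr>carrier = a_rcosets\<^bsub>M\<^esub> B,
      monoid.mult = undefined,
      one = undefined,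
      ring.zero = B,
      add = set_add M,
      smult = (\<lambda>a C. \<Union>x\<in>C. B +>\<^bsub>M\<^esub> (a \<odot>\<^bsub>M\<^esub> x))\<rparr>"

definition regular_module :: "('a, 'x) ring_scheme \<Rightarrow> ('a, 'a) module" where
  "regular_module A =
     \<lparr>carrier = carrier A, monoid.mult = monoid.mult A, one = \<one>\<^bsub>A\<^esub>, ring.zero = \<zero>\<^bsub>A\<^esub>, add = add A,
      smult = monoid.mult A\<rparr>"

definition free_module :: "('a, 'x) ring_scheme \<Rightarrow> 'i set \<Rightarrow> ('a, 'i \<Rightarrow> 'a) module" where
  "free_module A I = direct_sum I (\<lambda>_. regular_module A)"

definition finitely_generated ::
    "('a, 'x) ring_scheme \<Rightarrow> ('a, 'm, 'y) module_scheme \<Rightarrow> bool" where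
  "finitely_generated A M \<longleftrightarrow>
     (\<exists>S. finite S \<and> S \<subseteq> carrier M \<and>
        (\<forall>x\<in>carrier M. \<exists>c\<in>S \<rightarrow> carrier A. x = (\<Oplus>\<^bsub>M\<^esub>s\<in>S. c s \<odot>\<^bsub>M\<^esub> s)))"

text \<open>Projective means: direct summand of a free module.  Restricting the basis of the free module
  to subsets of the element type of \<open>M\<close> is harmless, since a projective \<open>M\<close> is a direct summand of
  the free module with basis \<^term>\<open>carrier M\<close>.\<close>

definition projective ::
    "('a, 'x) ring_scheme \<Rightarrow> ('a, 'm, 'y) module_scheme \<Rightarrow> bool" where
  "projective A M \<longleftrightarrow>
     left_module A M \<and>
     (\<exists>I :: 'm set. \<exists>j\<in>module_homs A M (free_module A I). \<exists>q\<in>module_homs A (free_module A I) M.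
        \<forall>x\<in>carrier M. q (j x) = x)"


section \<open>Complexes and complete resolutions\<close>

text \<open>A complex is a family \<open>P\<close> of modules together with a differential \<open>d\<close>, where \<open>d n\<close> maps
  \<open>P n\<close> to \<open>P (n - 1)\<close>.\<close>

definition chain_complex ::
    "('a, 'x) ring_scheme \<Rightarrow> (int \<Rightarrow> ('a, 'p) module) \<Rightarrow> (int \<Rightarrow> 'p \<Rightarrow> 'p) \<Rightarrow> bool" where
  "chain_complex A P d \<longleftrightarrow>
     (\<forall>n. left_module A (P n)) \<and>
     (\<forall>n. d n \<in> module_homs A (P n) (P (n - 1))) \<and>
     (\<forall>n. \<forall>x\<in>carrier (P (n + 1)). d n (d (n + 1) x) = \<zero>\<^bsub>P (n - 1)\<^esub>)"

definition exact_at ::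
    "(int \<Rightarrow> ('a, 'p) module) \<Rightarrow> (int \<Rightarrow> 'p \<Rightarrow> 'p) \<Rightarrow> int \<Rightarrow> bool" where
  "exact_at P d n \<longleftrightarrow> d (n + 1) ` carrier (P (n + 1)) = a_kernel (P n) (P (n - 1)) (d n)"

definition chain_map ::
    "('a, 'x) ring_scheme \<Rightarrow> (int \<Rightarrow> ('a, 'p) module) \<Rightarrow> (int \<Rightarrow> 'p \<Rightarrow> 'p)
      \<Rightarrow> (int \<Rightarrow> ('a, 'q) module) \<Rightarrow> (int \<Rightarrow> 'q \<Rightarrow> 'q) \<Rightarrow> (int \<Rightarrow> 'p \<Rightarrow> 'q) \<Rightarrow> bool" where
  "chain_map A P d Q e \<phi> \<longleftrightarrow>
     (\<forall>n. \<phi> n \<in> module_homs A (P n) (Q n)) \<and>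
     (\<forall>n. \<forall>x\<in>carrier (P n). \<phi> (n - 1) (d n x) = e n (\<phi> n x))"

text \<open>A projective resolution \<open>\<epsilon>: Q \<rightarrow> M\<close> is indexed by all integers, with \<open>Q n = 0\<close> for \<open>n < 0\<close>.\<close>

definition projective_resolution ::
    "('a, 'x) ring_scheme \<Rightarrow> ('a, 'm) module \<Rightarrow> (int \<Rightarrow> ('a, 'q) module) \<Rightarrow> (int \<Rightarrow> 'q \<Rightarrow> 'q)
      \<Rightarrow> ('q \<Rightarrow> 'm) \<Rightarrow> bool" where
  "projective_resolution A M Q e \<epsilon> \<longleftrightarrow>
     chain_complex A Q e \<and>
     (\<forall>n. projective A (Q n)) \<and>
     (\<forall>n<0. carrier (Q n) = {\<zero>\<^bsub>Q n\<^esub>}) \<and>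
     (\<forall>n>0. exact_at Q e n) \<and>
     \<epsilon> \<in> module_homs A (Q 0) M \<and>
     \<epsilon> ` carrier (Q 0) = carrier M \<and>
     a_kernel (Q 0) M \<epsilon> = e 1 ` carrier (Q 1)"

text \<open>The cochain complex \<open>Hom(P, N)\<close> with \<open>Hom(P n, N)\<close> in degree \<open>n\<close> and differential
  \<open>f \<mapsto> f \<circ> d (n + 1)\<close>; the sign conventions in use change neither kernels nor images.\<close>

definition cocycles ::
    "('a, 'x) ring_scheme \<Rightarrow> (int \<Rightarrow> ('a, 'p) module) \<Rightarrow> (int \<Rightarrow> 'p \<Rightarrow> 'p) \<Rightarrow> ('a, 'n) module
      \<Rightarrow> int \<Rightarrow> ('p \<Rightarrow> 'n) set" where
  "cocycles A P d N n =
     {f \<in> module_homs A (P n) N. \<forall>x\<in>carrier (P (n + 1)). f (d (n + 1) x) = \<zero>\<^bsub>N\<^esub>}"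

definition coboundaries ::
    "('a, 'x) ring_scheme \<Rightarrow> (int \<Rightarrow> ('a, 'p) module) \<Rightarrow> (int \<Rightarrow> 'p \<Rightarrow> 'p) \<Rightarrow> ('a, 'n) module
      \<Rightarrow> int \<Rightarrow> ('p \<Rightarrow> 'n) set" where
  "coboundaries A P d N n =
     (\<lambda>h. compose (carrier (P n)) h (d n)) ` module_homs A (P (n - 1)) N"

text \<open>The projective resolution \<open>Q\<close> can be taken over the same element type as \<open>P\<close>: in degrees
  \<open>\<ge> 0\<close> it is isomorphic to \<open>P\<close>, and it is zero in negative degrees.\<close>

definition complete_resolution ::
    "('a, 'x) ring_scheme \<Rightarrow> ('a, 'm) module \<Rightarrow> (int \<Rightarrow> ('a, 'p) module) \<Rightarrow> (int \<Rightarrow> 'p \<Rightarrow> 'p)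
      \<Rightarrow> bool" where
  "complete_resolution A M P d \<longleftrightarrow>
     chain_complex A P d \<and>
     (\<forall>n. projective A (P n) \<and> finitely_generated A (P n)) \<and>
     (\<forall>n. exact_at P d n) \<and>
     (\<forall>n. cocycles A P d (regular_module A) n = coboundaries A P d (regular_module A) n) \<and>
     (\<exists>(Q :: int \<Rightarrow> ('a, 'p) module) e \<epsilon> \<phi>.
        projective_resolution A M Q e \<epsilon> \<and>
        chain_map A P d Q e \<phi> \<and>
        (\<forall>n\<ge>0. bij_betw (\<phi> n) (carrier (P n)) (carrier (Q n))) \<and>
        (\<forall>n<0. \<forall>x\<in>carrier (P n). \<phi> n x = \<zero>\<^bsub>Q n\<^esub>))"


section \<open>Tate cohomology modules\<close>

text \<open>For an \<open>R\<close>-algebra \<open>A\<close>, the group \<open>Hom\<^sub>A(M, N)\<close> is an \<open>R\<close>-module through the structure map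
  \<open>r \<mapsto> r \<cdot> 1\<close> of \<open>A\<close>.\<close>

definition hom_module ::
    "('r, 'a) module \<Rightarrow> ('a, 'm) module \<Rightarrow> ('a, 'n) module \<Rightarrow> ('r, 'm \<Rightarrow> 'n) module" where
  "hom_module A M N =
     \<lparr>carrier = module_homs A M N,
      monoid.mult = undefined,
      one = undefined,
      ring.zero = (\<lambda>x\<in>carrier M. \<zero>\<^bsub>N\<^esub>),
      add = (\<lambda>f g. \<lambda>x\<in>carrier M. f x \<oplus>\<^bsub>N\<^esub> g x),
      smult = (\<lambda>r f. \<lambda>x\<in>carrier M. (r \<odot>\<^bsub>A\<^esub> \<one>\<^bsub>A\<^esub>) \<odot>\<^bsub>N\<^esub> f x)\<rparr>"

text \<open>\<open>tate_ext A N P d n\<close> is the \<open>n\<close>-th Tate Ext module of \<open>M\<close> and \<open>N\<close> over \<open>A\<close>, computed from a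
  complete resolution \<open>(P, d)\<close> of \<open>M\<close>.\<close>

definition tate_ext ::
    "('r, 'a) module \<Rightarrow> ('a, 'n) module \<Rightarrow> (int \<Rightarrow> ('a, 'p) module) \<Rightarrow> (int \<Rightarrow> 'p \<Rightarrow> 'p) \<Rightarrow> int
      \<Rightarrow> ('r, ('p \<Rightarrow> 'n) set) module" where
  "tate_ext A N P d n =
     quotient_module ((hom_module A (P n) N)\<lparr>carrier := cocycles A P d N n\<rparr>)
       (coboundaries A P d N n)"


section \<open>Group rings, tensor products of algebras and bimodules\<close>

definition basis_element :: "('r, 'x) ring_scheme \<Rightarrow> ('g, 'y) monoid_scheme \<Rightarrow> 'g \<Rightarrow> 'g \<Rightarrow> 'r" where
  "basis_element R G g = (\<lambda>x\<in>carrier G. if x = g then \<one>\<^bsub>R\<^esub> else \<zero>\<^bsub>R\<^esub>)"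

definition monoid_ring ::
    "('r, 'x) ring_scheme \<Rightarrow> ('g, 'y) monoid_scheme \<Rightarrow> ('r, 'g \<Rightarrow> 'r) module" where
  "monoid_ring R G =
     (free_module R (carrier G))
       \<lparr>monoid.mult := (\<lambda>f h. \<lambda>z\<in>carrier G.
          \<Oplus>\<^bsub>R\<^esub>p\<in>{(x, y) \<in> carrier G \<times> carrier G.
                   f x \<noteq> \<zero>\<^bsub>R\<^esub> \<and> h y \<noteq> \<zero>\<^bsub>R\<^esub> \<and> x \<otimes>\<^bsub>G\<^esub> y = z}.
            f (fst p) \<otimes>\<^bsub>R\<^esub> h (snd p)),
        one := basis_element R G \<one>\<^bsub>G\<^esub>\<rparr>"

definition trivial_module ::
    "('r, 'x) ring_scheme \<Rightarrow> ('g, 'y) monoid_scheme \<Rightarrow> ('g \<Rightarrow> 'r, 'r) module" where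
  "trivial_module R G =
     \<lparr>carrier = carrier R, monoid.mult = monoid.mult R, one = \<one>\<^bsub>R\<^esub>, ring.zero = \<zero>\<^bsub>R\<^esub>, add = add R,
      smult = (\<lambda>f x. (\<Oplus>\<^bsub>R\<^esub>g\<in>carrier G. f g) \<otimes>\<^bsub>R\<^esub> x)\<rparr>"

definition opposite_algebra :: "('r, 'a) module \<Rightarrow> ('r, 'a) module" where
  "opposite_algebra A = A\<lparr>monoid.mult := (\<lambda>x y. y \<otimes>\<^bsub>A\<^esub> x)\<rparr>"

text \<open>The tensor product of the \<open>R\<close>-algebras \<open>A\<close> and \<open>B\<close>: the free \<open>R\<close>-module on \<open>A \<times> B\<close> modulo the
  bilinearity relations.  On the free module, \<open>(a, b) (a', b') = (a a', b b')\<close> extends to the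
  multiplication of the monoid ring.  Multiplying a relation by a basis element
  gives a relation again, so the submodule spanned by the relations is the ideal they generate.\<close>

definition tensor_relations ::
    "('r, 'x) ring_scheme \<Rightarrow> ('r, 'a) module \<Rightarrow> ('r, 'b) module \<Rightarrow> ('a \<times> 'b \<Rightarrow> 'r) set" where
  "tensor_relations R A B =
     (let F = monoid_ring R (A \<times>\<times> B); \<beta> = (\<lambda>a b. basis_element R (A \<times>\<times> B) (a, b)) in
       {\<beta> (a \<oplus>\<^bsub>A\<^esub> a') b \<ominus>\<^bsub>F\<^esub> (\<beta> a b \<oplus>\<^bsub>F\<^esub> \<beta> a' b) | a a' b.
          a \<in> carrier A \<and> a' \<in> carrier A \<and> b \<in> carrier B} \<union>
       {\<beta> a (b \<oplus>\<^bsub>B\<^esub> b') \<ominus>\<^bsub>F\<^esub> (\<beta> a b \<oplus>\<^bsub>F\<^esub> \<beta> a b') | a b b'.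
          a \<in> carrier A \<and> b \<in> carrier B \<and> b' \<in> carrier B} \<union>
       {\<beta> (r \<odot>\<^bsub>A\<^esub> a) b \<ominus>\<^bsub>F\<^esub> (r \<odot>\<^bsub>F\<^esub> \<beta> a b) | r a b.
          r \<in> carrier R \<and> a \<in> carrier A \<and> b \<in> carrier B} \<union>
       {\<beta> a (r \<odot>\<^bsub>B\<^esub> b) \<ominus>\<^bsub>F\<^esub> (r \<odot>\<^bsub>F\<^esub> \<beta> a b) | r a b.
          r \<in> carrier R \<and> a \<in> carrier A \<and> b \<in> carrier B})"

definition tensor_algebra ::
    "('r, 'x) ring_scheme \<Rightarrow> ('r, 'a) module \<Rightarrow> ('r, 'b) module
      \<Rightarrow> ('r, ('a \<times> 'b \<Rightarrow> 'r) set) module" where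
  "tensor_algebra R A B =
     (let F = monoid_ring R (A \<times>\<times> B); J = Idl\<^bsub>F\<^esub> (tensor_relations R A B); T = F Quot J in
       \<lparr>carrier = carrier T, monoid.mult = monoid.mult T, one = \<one>\<^bsub>T\<^esub>, ring.zero = \<zero>\<^bsub>T\<^esub>, add = add T,
        smult = (\<lambda>r C. (J +>\<^bsub>F\<^esub> (r \<odot>\<^bsub>F\<^esub> \<one>\<^bsub>F\<^esub>)) \<otimes>\<^bsub>T\<^esub> C)\<rparr>)"

definition enveloping_algebra ::
    "('r, 'x) ring_scheme \<Rightarrow> ('r, 'a) module \<Rightarrow> ('r, ('a \<times> 'a \<Rightarrow> 'r) set) module" where
  "enveloping_algebra R A = tensor_algebra R A (opposite_algebra A)"

text \<open>An \<open>A\<close>-bimodule, given by a left module \<open>M\<close> and a right action \<open>\<rho>\<close>, as a left module over the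
  enveloping algebra via \<open>(a \<otimes> b) m = a m b\<close>.  An element \<open>C\<close> of the tensor product is a coset of
  finitely supported functions \<open>f\<close>, each standing for the sum of all \<open>f (a, b) (a \<otimes> b)\<close>.\<close>

definition bimodule_to_left_module ::
    "('r, 'x) ring_scheme \<Rightarrow> ('r, 'a) module \<Rightarrow> ('a, 'm) module \<Rightarrow> ('m \<Rightarrow> 'a \<Rightarrow> 'm)
      \<Rightarrow> (('a \<times> 'a \<Rightarrow> 'r) set, 'm) module" where
  "bimodule_to_left_module R A M \<rho> =
     \<lparr>carrier = carrier M, monoid.mult = monoid.mult M, one = \<one>\<^bsub>M\<^esub>, ring.zero = \<zero>\<^bsub>M\<^esub>, add = add M,
      smult = (\<lambda>C m. the_elem ((\<lambda>f.
        \<Oplus>\<^bsub>M\<^esub>p\<in>{p \<in> carrier A \<times> carrier A. f p \<noteq> \<zero>\<^bsub>R\<^esub>}.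
          \<rho> ((f p \<odot>\<^bsub>A\<^esub> fst p) \<odot>\<^bsub>M\<^esub> m) (snd p)) ` C))\<rparr>"

definition regular_bimodule ::
    "('r, 'x) ring_scheme \<Rightarrow> ('r, 'a) module \<Rightarrow> (('a \<times> 'a \<Rightarrow> 'r) set, 'a) module" where
  "regular_bimodule R A = bimodule_to_left_module R A (regular_module A) (monoid.mult A)"


section \<open>Graded modules\<close>

text \<open>A graded module is a module together with its homogeneous components.\<close>

type_synonym ('r, 'm) graded_module = "('r, 'm) module \<times> (int \<Rightarrow> 'm set)"

definition total_graded :: "(int \<Rightarrow> ('r, 'm) module) \<Rightarrow> ('r, int \<Rightarrow> 'm) graded_module" where
  "total_graded H =
     (direct_sum UNIV H,
      \<lambda>n. {f \<in> carrier (direct_sum UNIV H). \<forall>k. k \<noteq> n \<longrightarrow> f k = \<zero>\<^bsub>H k\<^esub>})"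

definition graded_direct_sum ::
    "'i set \<Rightarrow> ('i \<Rightarrow> ('r, 'm) graded_module) \<Rightarrow> ('r, 'i \<Rightarrow> 'm) graded_module" where
  "graded_direct_sum I V =
     (direct_sum I (\<lambda>i. fst (V i)),
      \<lambda>n. {f \<in> carrier (direct_sum I (\<lambda>i. fst (V i))). \<forall>i\<in>I. f i \<in> snd (V i) n})"

definition graded_isomorphic ::
    "('r, 'x) ring_scheme \<Rightarrow> ('r, 'm) graded_module \<Rightarrow> ('r, 'n) graded_module \<Rightarrow> bool" where
  "graded_isomorphic R V W \<longleftrightarrow>
     (\<exists>\<Phi>\<in>module_homs R (fst V) (fst W).
        bij_betw \<Phi> (carrier (fst V)) (carrier (fst W)) \<and>
        (\<forall>n. \<Phi> ` snd V n = snd W n))"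


section \<open>Tate cohomology and Tate-Hochschild cohomology\<close>

text \<open>Here \<open>(P, d)\<close> is a complete resolution of the trivial module over the group ring, respectively
  of the bimodule \<open>A\<close> over its enveloping algebra.\<close>

definition tate_cohomology ::
    "('r, 'x) ring_scheme \<Rightarrow> ('g, 'y) monoid_scheme \<Rightarrow> ('g \<Rightarrow> 'r, 'n) module
      \<Rightarrow> (int \<Rightarrow> ('g \<Rightarrow> 'r, 'p) module) \<Rightarrow> (int \<Rightarrow> 'p \<Rightarrow> 'p)
      \<Rightarrow> ('r, int \<Rightarrow> ('p \<Rightarrow> 'n) set) graded_module" where
  "tate_cohomology R K N P d = total_graded (tate_ext (monoid_ring R K) N P d)"

definition tate_hochschild_cohomology ::
    "('r, 'x) ring_scheme \<Rightarrow> ('r, 'a) module \<Rightarrow> (('a \<times> 'a \<Rightarrow> 'r) set, 'n) module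
      \<Rightarrow> (int \<Rightarrow> (('a \<times> 'a \<Rightarrow> 'r) set, 'p) module) \<Rightarrow> (int \<Rightarrow> 'p \<Rightarrow> 'p)
      \<Rightarrow> ('r, int \<Rightarrow> ('p \<Rightarrow> 'n) set) graded_module" where
  "tate_hochschild_cohomology R A N P d = total_graded (tate_ext (enveloping_algebra R A) N P d)"

end

theory Submission
  imports Defs
begin

text \<open>The bimodule \<open>RG\<close> is coinduced from the trivial module along the diagonal \<open>G \<rightarrow> G \<times> G\<close>,
  so taking the coefficient at \<open>1\<close> identifies \<open>Hom(P, RG)\<close> over the enveloping algebra with the
  \<open>G\<close>-invariant \<open>R\<close>-linear forms on \<open>P\<close>, where \<open>g\<close> acts by \<open>g \<otimes> g\<^sup>-\<^sup>1\<close>.  Restricted to this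
  diagonal action, \<open>P\<close> is a complete resolution over \<open>RG\<close> of \<open>RG\<close> with the conjugation action, which
  is the sum of the permutation modules on the conjugacy classes.  Inducing the complete resolutions
  over the centralizers up to \<open>G\<close> gives another complete resolution of the same module, whose invariant
  linear forms are the families of forms on the given resolutions.  Two complete resolutions of
  a module are homotopy equivalent.\<close>

section \<open>Linear maps and group actions\<close>

text \<open>Three kinds of rings occur: the enveloping algebra, RG and the group rings of the
  centralizers. Modules over all of them are treated as R-modules with an action of a finite group,
  so restriction to the diagonal just changes the acting group. Projectivity enters as Higman's
  criterion: the identity is the trace of an R-linear endomorphism of finite rank. Averaging then
  turns R-linear lifts and extensions into equivariant ones without dividing by the group order,
  which need not be invertible in R. A complete resolution has no lowest degree at which a
  comparison map could start. The map starts in degree 0 from the augmentations and is continued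
  both ways: upwards by exactness, downwards by extending maps along the differential, which
  exactness of the dual permits. Finite rank matters there: only finitely many functionals have to
  be extended. The centralizer of g_i enters as the stabilizer of g_i under conjugation: an
  invariant form on the induced module is determined by its restrictions to the fibres over the
  g_i.\<close>

definition linear_maps ::
    "('r, 'x) ring_scheme \<Rightarrow> ('r, 'm, 'y) module_scheme \<Rightarrow> ('r, 'n, 'z) module_scheme
      \<Rightarrow> ('m \<Rightarrow> 'n) set" where
  "linear_maps R M N =
     {f \<in> carrier M \<rightarrow> carrier N.
        (\<forall>x\<in>carrier M. \<forall>y\<in>carrier M. f (x \<oplus>\<^bsub>M\<^esub> y) = f x \<oplus>\<^bsub>N\<^esub> f y) \<and>
        (\<forall>r\<in>carrier R. \<forall>x\<in>carrier M. f (r \<odot>\<^bsub>M\<^esub> x) = r \<odot>\<^bsub>N\<^esub> f x)}"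

lemma linear_mapsI:
  assumes "\<And>x. x \<in> carrier M \<Longrightarrow> f x \<in> carrier N"
    and "\<And>x y. \<lbrakk>x \<in> carrier M; y \<in> carrier M\<rbrakk> \<Longrightarrow> f (x \<oplus>\<^bsub>M\<^esub> y) = f x \<oplus>\<^bsub>N\<^esub> f y"
    and "\<And>r x. \<lbrakk>r \<in> carrier R; x \<in> carrier M\<rbrakk> \<Longrightarrow> f (r \<odot>\<^bsub>M\<^esub> x) = r \<odot>\<^bsub>N\<^esub> f x"
  shows "f \<in> linear_maps R M N"
  using assms by (auto simp: linear_maps_def)

lemma linear_mapsD:
  assumes "f \<in> linear_maps R M N"
  shows "x \<in> carrier M \<Longrightarrow> f x \<in> carrier N"
    and "\<lbrakk>x \<in> carrier M; y \<in> carrier M\<rbrakk> \<Longrightarrow> f (x \<oplus>\<^bsub>M\<^esub> y) = f x \<oplus>\<^bsub>N\<^esub> f y"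
    and "\<lbrakk>r \<in> carrier R; x \<in> carrier M\<rbrakk> \<Longrightarrow> f (r \<odot>\<^bsub>M\<^esub> x) = r \<odot>\<^bsub>N\<^esub> f x"
  using assms by (auto simp: linear_maps_def)

lemma linear_maps_compose:
  assumes "f \<in> linear_maps R M N" "g \<in> linear_maps R N L"
  shows "(\<lambda>x. g (f x)) \<in> linear_maps R M L"
  using linear_mapsD[OF assms(1)] linear_mapsD[OF assms(2)] by (intro linear_mapsI) simp_all

lemma linear_maps_zero:
  assumes "module R M" "module R N" "f \<in> linear_maps R M N"
  shows "f \<zero>\<^bsub>M\<^esub> = \<zero>\<^bsub>N\<^esub>"
proof -
  interpret M: module R M by fact
  interpret N: module R N by fact
  show ?thesis
    using linear_mapsD[OF assms(3)]
    by (metis M.smult_l_null M.M.zero_closed M.R.zero_closed N.smult_l_null)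
qed

lemma linear_maps_minus:
  assumes "module R M" "module R N" "f \<in> linear_maps R M N" "x \<in> carrier M"
  shows "f (\<ominus>\<^bsub>M\<^esub> x) = \<ominus>\<^bsub>N\<^esub> f x"
proof -
  interpret M: module R M by fact
  interpret N: module R N by fact
  have "f (\<ominus>\<^bsub>M\<^esub> x) \<oplus>\<^bsub>N\<^esub> f x = \<zero>\<^bsub>N\<^esub>"
    using linear_mapsD[OF assms(3)] linear_maps_zero[OF assms(1-3)] assms(4)
    by (metis M.M.a_inv_closed M.M.l_neg)
  then show ?thesis
    using linear_mapsD[OF assms(3)] assms(4) by (metis M.M.a_inv_closed N.M.minus_equality)
qed

text \<open>Only additivity is assumed, because this also serves maps that are not linear over a
  commutative ring: the action of a fixed element of a noncommutative algebra, and the map taking a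
  ring element \<open>a\<close> to \<open>a x\<close> for fixed \<open>x\<close>.\<close>

lemma additive_finsum:
  assumes "abelian_group M" "abelian_group N"
    and "f \<in> carrier M \<rightarrow> carrier N" "f \<zero>\<^bsub>M\<^esub> = \<zero>\<^bsub>N\<^esub>"
    and "\<And>x y. \<lbrakk>x \<in> carrier M; y \<in> carrier M\<rbrakk> \<Longrightarrow> f (x \<oplus>\<^bsub>M\<^esub> y) = f x \<oplus>\<^bsub>N\<^esub> f y"
    and "finite A" "g \<in> A \<rightarrow> carrier M"
  shows "f (\<Oplus>\<^bsub>M\<^esub>i\<in>A. g i) = (\<Oplus>\<^bsub>N\<^esub>i\<in>A. f (g i))"
proof -
  interpret M: abelian_group M by fact
  interpret N: abelian_group N by fact
  show ?thesis
    using assms(6,7)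
  proof (induction A rule: finite_induct)
    case (insert x A)
    then have "g \<in> A \<rightarrow> carrier M" "g x \<in> carrier M" by auto
    moreover from this assms(3) have "(\<lambda>i. f (g i)) \<in> A \<rightarrow> carrier N" "f (g x) \<in> carrier N" by auto
    ultimately show ?case using insert by (simp add: assms(5))
  qed (simp add: assms(4))
qed

lemma linear_maps_finsum:
  assumes "module R M" "module R N" "f \<in> linear_maps R M N" "finite A" "g \<in> A \<rightarrow> carrier M"
  shows "f (\<Oplus>\<^bsub>M\<^esub>i\<in>A. g i) = (\<Oplus>\<^bsub>N\<^esub>i\<in>A. f (g i))"
proof -
  interpret M: module R M by fact
  interpret N: module R N by fact
  show ?thesis
    by (rule additive_finsum)
      (use assms linear_mapsD[OF assms(3)] linear_maps_zero[OF assms(1-3)]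
        M.M.abelian_group_axioms N.M.abelian_group_axioms in auto)
qed

lemma finsum_linear_maps:
  assumes "module R M" "module R N" "finite A" "\<And>i. i \<in> A \<Longrightarrow> f i \<in> linear_maps R M N"
  shows "(\<lambda>x. \<Oplus>\<^bsub>N\<^esub>i\<in>A. f i x) \<in> linear_maps R M N"
proof -
  interpret N: module R N by fact
  note * = linear_mapsD[OF assms(4)]
  show ?thesis
  proof (rule linear_mapsI)
    fix x y assume xy: "x \<in> carrier M" "y \<in> carrier M"
    have "(\<Oplus>\<^bsub>N\<^esub>i\<in>A. f i (x \<oplus>\<^bsub>M\<^esub> y)) = (\<Oplus>\<^bsub>N\<^esub>i\<in>A. f i x \<oplus>\<^bsub>N\<^esub> f i y)"
      using * xy by (intro N.M.finsum_cong') auto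
    then show "(\<Oplus>\<^bsub>N\<^esub>i\<in>A. f i (x \<oplus>\<^bsub>M\<^esub> y)) = (\<Oplus>\<^bsub>N\<^esub>i\<in>A. f i x) \<oplus>\<^bsub>N\<^esub> (\<Oplus>\<^bsub>N\<^esub>i\<in>A. f i y)"
      using * xy by (simp add: N.M.finsum_addf Pi_def)
  next
    fix r x assume rx: "r \<in> carrier R" "x \<in> carrier M"
    have "(\<Oplus>\<^bsub>N\<^esub>i\<in>A. f i (r \<odot>\<^bsub>M\<^esub> x)) = (\<Oplus>\<^bsub>N\<^esub>i\<in>A. r \<odot>\<^bsub>N\<^esub> f i x)"
      using * rx by (intro N.M.finsum_cong') auto
    then show "(\<Oplus>\<^bsub>N\<^esub>i\<in>A. f i (r \<odot>\<^bsub>M\<^esub> x)) = r \<odot>\<^bsub>N\<^esub> (\<Oplus>\<^bsub>N\<^esub>i\<in>A. f i x)"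
      using * rx assms(3) by (simp add: N.finsum_smult_ldistr Pi_def)
  qed (use * in \<open>auto intro!: N.M.finsum_closed\<close>)
qed

lemma carrier_regular_module [simp]: "carrier (regular_module A) = carrier A"
  and zero_regular_module [simp]: "\<zero>\<^bsub>regular_module A\<^esub> = \<zero>\<^bsub>A\<^esub>"
  and add_regular_module [simp]: "add (regular_module A) = add A"
  and smult_regular_module [simp]: "smult (regular_module A) = monoid.mult A"
  by (simp_all add: regular_module_def)

lemma finsum_eqI:
  assumes "carrier M = carrier N" "add M = add N" "\<zero>\<^bsub>M\<^esub> = \<zero>\<^bsub>N\<^esub>"
  shows "finsum M f A = finsum N f A"
  using assms by (simp add: finsum_def finprod_def)

lemma finsum_regular_module [simp]: "finsum (regular_module A) f I = finsum A f I"
  by (rule finsum_eqI) simp_all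

lemma abelian_group_eqI:
  assumes "abelian_group N" "carrier M = carrier N" "add M = add N" "\<zero>\<^bsub>M\<^esub> = \<zero>\<^bsub>N\<^esub>"
  shows "abelian_group M"
proof -
  interpret N: abelian_group N by fact
  show ?thesis
    by (rule abelian_groupI) (use assms N.add.l_inv_ex in \<open>auto simp: N.a_assoc N.a_comm N.add.m_lcomm\<close>)
qed

lemma (in cring) module_regular_module: "module R (regular_module R)"
proof -
  have "abelian_group (regular_module R)"
    by (rule abelian_group_eqI[OF is_abelian_group]) simp_all
  then show ?thesis
    by (intro moduleI is_cring) (auto simp: l_distr r_distr m_assoc)
qed

lemma functional_closed:
  "\<lbrakk>\<mu> \<in> linear_maps R M (regular_module R); x \<in> carrier M\<rbrakk> \<Longrightarrow> \<mu> x \<in> carrier R"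
  using linear_mapsD(1) by fastforce

lemma functional_smult_linear:
  assumes "module R N" "\<mu> \<in> linear_maps R M (regular_module R)" "p \<in> carrier N"
  shows "(\<lambda>x. \<mu> x \<odot>\<^bsub>N\<^esub> p) \<in> linear_maps R M N"
proof -
  interpret N: module R N by fact
  show ?thesis
    using linear_mapsD[OF assms(2)] assms(3)
    by (intro linear_mapsI) (auto simp: N.smult_l_distr N.smult_assoc1)
qed

section \<open>Modules with a group action\<close>

locale group_module = module R M + K?: group K
  for R :: "('r, 'x) ring_scheme" (structure) and K :: "('k, 'y) monoid_scheme"
    and M :: "('r, 'm, 'z) module_scheme" (structure) and act :: "'k \<Rightarrow> 'm \<Rightarrow> 'm" +
  assumes act_linear: "k \<in> carrier K \<Longrightarrow> act k \<in> linear_maps R M M"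
    and act_one: "x \<in> carrier M \<Longrightarrow> act \<one>\<^bsub>K\<^esub> x = x"
    and act_mult: "\<lbrakk>k \<in> carrier K; l \<in> carrier K; x \<in> carrier M\<rbrakk>
      \<Longrightarrow> act (k \<otimes>\<^bsub>K\<^esub> l) x = act k (act l x)"
begin

lemma act_closed: "\<lbrakk>k \<in> carrier K; x \<in> carrier M\<rbrakk> \<Longrightarrow> act k x \<in> carrier M"
  by (rule linear_mapsD(1)[OF act_linear])

lemma act_inv_act: "\<lbrakk>k \<in> carrier K; x \<in> carrier M\<rbrakk> \<Longrightarrow> act (inv\<^bsub>K\<^esub> k) (act k x) = x"
  by (simp add: act_mult[symmetric] act_one)

end

text \<open>As in \<open>linear_maps\<close>, and unlike in \<open>module_homs\<close>, values off
  the carrier are arbitrary, so that sums and composites of maps can be written as plain lambda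
  terms.\<close>

definition equivariant_maps ::
    "('r, 'x) ring_scheme \<Rightarrow> ('k, 'y) monoid_scheme \<Rightarrow> ('r, 'm, 'z) module_scheme
      \<Rightarrow> ('k \<Rightarrow> 'm \<Rightarrow> 'm) \<Rightarrow> ('r, 'n, 'w) module_scheme \<Rightarrow> ('k \<Rightarrow> 'n \<Rightarrow> 'n) \<Rightarrow> ('m \<Rightarrow> 'n) set" where
  "equivariant_maps R K M a N b =
     {f \<in> linear_maps R M N. \<forall>k\<in>carrier K. \<forall>x\<in>carrier M. f (a k x) = b k (f x)}"

lemma equivariant_mapsI:
  assumes "f \<in> linear_maps R M N"
    and "\<And>k x. \<lbrakk>k \<in> carrier K; x \<in> carrier M\<rbrakk> \<Longrightarrow> f (a k x) = b k (f x)"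
  shows "f \<in> equivariant_maps R K M a N b"
  using assms by (auto simp: equivariant_maps_def)

lemma equivariant_mapsD:
  assumes "f \<in> equivariant_maps R K M a N b"
  shows "f \<in> linear_maps R M N"
    and "\<lbrakk>k \<in> carrier K; x \<in> carrier M\<rbrakk> \<Longrightarrow> f (a k x) = b k (f x)"
    and "x \<in> carrier M \<Longrightarrow> f x \<in> carrier N"
    and "\<lbrakk>x \<in> carrier M; y \<in> carrier M\<rbrakk> \<Longrightarrow> f (x \<oplus>\<^bsub>M\<^esub> y) = f x \<oplus>\<^bsub>N\<^esub> f y"
    and "\<lbrakk>r \<in> carrier R; x \<in> carrier M\<rbrakk> \<Longrightarrow> f (r \<odot>\<^bsub>M\<^esub> x) = r \<odot>\<^bsub>N\<^esub> f x"
  using assms by (auto simp: equivariant_maps_def linear_maps_def)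

lemma equivariant_maps_compose:
  assumes "f \<in> equivariant_maps R K M a N b" "g \<in> equivariant_maps R K N b L c"
  shows "(\<lambda>x. g (f x)) \<in> equivariant_maps R K M a L c"
  using assms by (auto simp: equivariant_maps_def intro: linear_maps_compose dest: linear_mapsD(1))

lemma equivariant_maps_zero_map:
  assumes "module R N" "\<And>k. k \<in> carrier K \<Longrightarrow> b k \<zero>\<^bsub>N\<^esub> = \<zero>\<^bsub>N\<^esub>"
  shows "(\<lambda>_. \<zero>\<^bsub>N\<^esub>) \<in> equivariant_maps R K M a N b"
proof -
  interpret N: module R N by fact
  show ?thesis using assms(2) by (intro equivariant_mapsI linear_mapsI) auto
qed

lemma linear_maps_add:
  assumes "module R N" "f \<in> linear_maps R M N" "g \<in> linear_maps R M N"
  shows "(\<lambda>x. f x \<oplus>\<^bsub>N\<^esub> g x) \<in> linear_maps R M N"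
proof -
  interpret N: module R N by fact
  show ?thesis
    using linear_mapsD[OF assms(2)] linear_mapsD[OF assms(3)]
    by (intro linear_mapsI) (simp_all add: N.M.a_ac N.smult_r_distr)
qed

lemma linear_maps_neg:
  assumes "module R N" "f \<in> linear_maps R M N"
  shows "(\<lambda>x. \<ominus>\<^bsub>N\<^esub> f x) \<in> linear_maps R M N"
proof -
  interpret N: module R N by fact
  show ?thesis
    using linear_mapsD[OF assms(2)]
    by (intro linear_mapsI) (simp_all add: N.M.minus_add N.smult_r_minus N.M.a_comm)
qed

lemma equivariant_maps_add:
  assumes "group_module R K N b" "f \<in> equivariant_maps R K M a N b" "g \<in> equivariant_maps R K M a N b"
  shows "(\<lambda>x. f x \<oplus>\<^bsub>N\<^esub> g x) \<in> equivariant_maps R K M a N b"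
proof -
  interpret N: group_module R K N b by fact
  note f = equivariant_mapsD[OF assms(2)] and g = equivariant_mapsD[OF assms(3)]
  show ?thesis
    using f(2,3) g(2,3) linear_mapsD(2)[OF N.act_linear]
    by (intro equivariant_mapsI linear_maps_add f(1) g(1)) (auto intro: N.module_axioms)
qed

lemma equivariant_maps_neg:
  assumes "group_module R K N b" "f \<in> equivariant_maps R K M a N b"
  shows "(\<lambda>x. \<ominus>\<^bsub>N\<^esub> f x) \<in> equivariant_maps R K M a N b"
proof -
  interpret N: group_module R K N b by fact
  note f = equivariant_mapsD[OF assms(2)]
  show ?thesis
    using f(2,3) linear_maps_minus[OF N.module_axioms N.module_axioms N.act_linear]
    by (intro equivariant_mapsI linear_maps_neg f(1)) (auto intro: N.module_axioms)
qed

section \<open>Averaging over the group and Higman's criterion\<close>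

definition trace_map ::
    "('k, 'y) monoid_scheme \<Rightarrow> ('k \<Rightarrow> 'm \<Rightarrow> 'm) \<Rightarrow> ('r, 'n, 'w) module_scheme \<Rightarrow> ('k \<Rightarrow> 'n \<Rightarrow> 'n)
      \<Rightarrow> ('m \<Rightarrow> 'n) \<Rightarrow> 'm \<Rightarrow> 'n" where
  "trace_map K a N b w x = (\<Oplus>\<^bsub>N\<^esub>k\<in>carrier K. b k (w (a (inv\<^bsub>K\<^esub> k) x)))"

text \<open>Substituting \<open>l k\<close> for \<open>k\<close> in the sum pulls \<open>l\<close>
  to the front, because (l k)^-1 l = k^-1. Any R-linear map thus yields an equivariant one, with no
  division by the order of the group.\<close>

lemma trace_map_equivariant:
  assumes "group_module R K M a" "group_module R K N b" "finite (carrier K)" "w \<in> linear_maps R M N"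
  shows "trace_map K a N b w \<in> equivariant_maps R K M a N b"
proof -
  interpret M: group_module R K M a by fact
  interpret N: group_module R K N b by fact
  have lin: "(\<lambda>x. b k (w (a (inv\<^bsub>K\<^esub> k) x))) \<in> linear_maps R M N" if "k \<in> carrier K" for k
    using that
    by (intro linear_maps_compose[OF linear_maps_compose[OF M.act_linear assms(4)] N.act_linear]) auto
  show ?thesis
  proof (rule equivariant_mapsI)
    show "trace_map K a N b w \<in> linear_maps R M N"
      unfolding trace_map_def[abs_def]
      using lin by (intro finsum_linear_maps M.module_axioms N.module_axioms assms(3))
  next
    fix l x assume l: "l \<in> carrier K" and x: "x \<in> carrier M"
    note cl = linear_mapsD(1)[OF lin]
    have im: "(\<lambda>k. l \<otimes>\<^bsub>K\<^esub> k) ` carrier K = carrier K"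
      by (rule M.surj_const_mult[OF l])
    have inj: "inj_on (\<lambda>k. l \<otimes>\<^bsub>K\<^esub> k) (carrier K)"
      using l by (auto intro!: inj_onI)
    have "trace_map K a N b w (a l x)
        = (\<Oplus>\<^bsub>N\<^esub>k\<in>(\<lambda>k. l \<otimes>\<^bsub>K\<^esub> k) ` carrier K. b k (w (a (inv\<^bsub>K\<^esub> k) (a l x))))"
      by (simp add: im trace_map_def)
    also have "\<dots> = (\<Oplus>\<^bsub>N\<^esub>k\<in>carrier K. b (l \<otimes>\<^bsub>K\<^esub> k) (w (a (inv\<^bsub>K\<^esub> (l \<otimes>\<^bsub>K\<^esub> k)) (a l x))))"
      using l x by (intro N.M.finsum_reindex inj) (auto intro!: cl M.act_closed)
    also have "\<dots> = (\<Oplus>\<^bsub>N\<^esub>k\<in>carrier K. b l (b k (w (a (inv\<^bsub>K\<^esub> k) x))))"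
    proof (rule N.M.finsum_cong')
      fix k assume k: "k \<in> carrier K"
      have "a (inv\<^bsub>K\<^esub> (l \<otimes>\<^bsub>K\<^esub> k)) (a l x) = a (inv\<^bsub>K\<^esub> k) x"
        using k l x by (simp add: M.inv_mult_group M.act_mult M.act_inv_act M.act_closed)
      then show "b (l \<otimes>\<^bsub>K\<^esub> k) (w (a (inv\<^bsub>K\<^esub> (l \<otimes>\<^bsub>K\<^esub> k)) (a l x))) = b l (b k (w (a (inv\<^bsub>K\<^esub> k) x)))"
        using k l x by (simp add: N.act_mult M.act_closed linear_mapsD(1)[OF assms(4)])
    qed (use cl l x N.act_closed in auto)
    also have "\<dots> = b l (trace_map K a N b w x)"
      unfolding trace_map_def
      using linear_maps_finsum[OF N.module_axioms N.module_axioms N.act_linear[OF l] assms(3)] cl x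
      by (simp add: Pi_def)
    finally show "trace_map K a N b w (a l x) = b l (trace_map K a N b w x)" .
  qed
qed

text \<open>On the carrier, \<open>\<theta>\<close> factors through R^n: the functionals
  \<open>\<mu> j\<close> form the map into it and the \<open>p j\<close> are the images of the
  standard basis. The indices are naturals because a definition cannot quantify over index
  types.\<close>

definition finite_rank ::
    "('r, 'x) ring_scheme \<Rightarrow> ('r, 'm, 'z) module_scheme \<Rightarrow> ('m \<Rightarrow> 'm) \<Rightarrow> bool" where
  "finite_rank R M \<theta> \<longleftrightarrow>
     (\<exists>(n::nat) \<mu> p. (\<forall>j<n. \<mu> j \<in> linear_maps R M (regular_module R) \<and> p j \<in> carrier M) \<and>
       (\<forall>x\<in>carrier M. \<theta> x = (\<Oplus>\<^bsub>M\<^esub>j\<in>{..<n}. \<mu> j x \<odot>\<^bsub>M\<^esub> p j)))"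

text \<open>Frees the index set from being an initial segment of the naturals, so that
  factorisations can be indexed by dual bases and by pairs.\<close>

lemma finite_rankI:
  assumes "module R M" "finite J"
    and "\<And>j. j \<in> J \<Longrightarrow> \<mu> j \<in> linear_maps R M (regular_module R)"
    and "\<And>j. j \<in> J \<Longrightarrow> p j \<in> carrier M"
    and "\<And>x. x \<in> carrier M \<Longrightarrow> \<theta> x = (\<Oplus>\<^bsub>M\<^esub>j\<in>J. \<mu> j x \<odot>\<^bsub>M\<^esub> p j)"
  shows "finite_rank R M \<theta>"
proof -
  interpret M: module R M by fact
  obtain h where h: "bij_betw h {0..<card J} J"
    using ex_bij_betw_nat_finite[OF assms(2)] by blast
  then have inj: "inj_on h {..<card J}" and im: "h ` {..<card J} = J"
    by (auto simp: bij_betw_def atLeast0LessThan)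
  have "(\<Oplus>\<^bsub>M\<^esub>j\<in>J. \<mu> j x \<odot>\<^bsub>M\<^esub> p j) = (\<Oplus>\<^bsub>M\<^esub>j\<in>{..<card J}. \<mu> (h j) x \<odot>\<^bsub>M\<^esub> p (h j))"
    if "x \<in> carrier M" for x
    using that assms(3,4)
    by (subst im[symmetric], intro M.M.finsum_reindex inj) (auto simp: im intro: functional_closed)
  then show ?thesis
    unfolding finite_rank_def using assms(3-5) imageI[of _ "{..<card J}" h, unfolded im]
    by (intro exI[of _ "card J"] exI[of _ "\<lambda>j. \<mu> (h j)"] exI[of _ "\<lambda>j. p (h j)"]) auto
qed

lemma finite_rank_closed:
  assumes "module R M" "finite_rank R M \<theta>" "x \<in> carrier M"
  shows "\<theta> x \<in> carrier M"
proof -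
  interpret M: module R M by fact
  show ?thesis
    using assms(2,3) unfolding finite_rank_def
    by (auto intro!: M.M.finsum_closed M.smult_closed functional_closed[OF _ assms(3)])
qed

text \<open>For \<open>M\<close> over a group ring this says that \<open>M\<close> is finitely generated projective (Higman's
  criterion, with the endomorphism factored through a finitely generated free \<open>R\<close>-module).\<close>

definition group_projective ::
    "('r, 'x) ring_scheme \<Rightarrow> ('k, 'y) monoid_scheme \<Rightarrow> ('r, 'm, 'z) module_scheme
      \<Rightarrow> ('k \<Rightarrow> 'm \<Rightarrow> 'm) \<Rightarrow> bool" where
  "group_projective R K M a \<longleftrightarrow>
     (\<exists>\<theta>. finite_rank R M \<theta> \<and> (\<forall>x\<in>carrier M. trace_map K a M a \<theta> x = x))"

text \<open>A preimage under \<open>D\<close> is chosen for each of the finitely many elements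
  \<open>u (p j)\<close>, and the coordinates of \<open>x\<close> combine these preimages linearly.
  What is lifted is \<open>u\<close> after \<open>\<theta>\<close>, not \<open>u\<close> itself;
  averaging removes \<open>\<theta>\<close> later.\<close>

lemma finite_rank_lift:
  assumes "module R M" "module R W" "module R Y" "finite_rank R M \<theta>"
    and D: "D \<in> linear_maps R W Y" and u: "u \<in> linear_maps R M Y"
    and sub: "u ` carrier M \<subseteq> D ` carrier W"
  obtains w where "w \<in> linear_maps R M W" "\<And>x. x \<in> carrier M \<Longrightarrow> D (w x) = u (\<theta> x)"
proof -
  interpret M: module R M by fact
  interpret W: module R W by fact
  interpret Y: module R Y by fact
  from assms(4) obtain n \<mu> p where
    \<mu>: "\<And>j. j < n \<Longrightarrow> \<mu> j \<in> linear_maps R M (regular_module R)" and p: "\<And>j. j < n \<Longrightarrow> p j \<in> carrier M"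
    and \<theta>: "\<And>x. x \<in> carrier M \<Longrightarrow> \<theta> x = (\<Oplus>\<^bsub>M\<^esub>j\<in>{..<n::nat}. \<mu> j x \<odot>\<^bsub>M\<^esub> p j)"
    unfolding finite_rank_def by blast
  have "\<forall>j\<in>{..<n}. \<exists>y\<in>carrier W. D y = u (p j)"
    using p sub by (auto simp: subset_iff image_iff) metis
  then obtain y where y: "\<And>j. j < n \<Longrightarrow> y j \<in> carrier W" "\<And>j. j < n \<Longrightarrow> D (y j) = u (p j)"
    by (metis lessThan_iff)
  show ?thesis
  proof (rule that)
    show "(\<lambda>x. \<Oplus>\<^bsub>W\<^esub>j\<in>{..<n}. \<mu> j x \<odot>\<^bsub>W\<^esub> y j) \<in> linear_maps R M W"
      using \<mu> y by (intro finsum_linear_maps functional_smult_linear assms) auto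
    fix x assume x: "x \<in> carrier M"
    have \<mu>x: "\<mu> j x \<in> carrier R" if "j < n" for j
      using linear_mapsD(1)[OF \<mu>[OF that] x] by simp
    have "D (\<Oplus>\<^bsub>W\<^esub>j\<in>{..<n}. \<mu> j x \<odot>\<^bsub>W\<^esub> y j) = (\<Oplus>\<^bsub>Y\<^esub>j\<in>{..<n}. D (\<mu> j x \<odot>\<^bsub>W\<^esub> y j))"
      using y \<mu>x by (intro linear_maps_finsum[OF assms(2,3) D]) auto
    also have "\<dots> = (\<Oplus>\<^bsub>Y\<^esub>j\<in>{..<n}. u (\<mu> j x \<odot>\<^bsub>M\<^esub> p j))"
      using y \<mu>x p linear_mapsD[OF D] linear_mapsD[OF u] by (intro Y.M.finsum_cong') auto
    also have "\<dots> = u (\<theta> x)"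
      unfolding \<theta>[OF x] using p \<mu>x by (intro linear_maps_finsum[OF assms(1,3) u, symmetric]) auto
    finally show "D (\<Oplus>\<^bsub>W\<^esub>j\<in>{..<n}. \<mu> j x \<odot>\<^bsub>W\<^esub> y j) = u (\<theta> x)" .
  qed
qed

text \<open>Dual to lifting: \<open>\<theta> (u x)\<close> is a combination of the fixed vectors
  \<open>p j\<close>, so extending this map along \<open>D\<close> amounts to extending the finitely
  many functionals that send \<open>x\<close> to \<open>\<mu> j (u x)\<close>.\<close>

lemma finite_rank_extend:
  assumes "module R M" "module R W" "module R Y" "finite_rank R M \<theta>"
    and u: "u \<in> linear_maps R W M"
    and D: "D \<in> carrier W \<rightarrow> carrier Y"
    and ex: "\<And>l. l \<in> linear_maps R M (regular_module R) \<Longrightarrow>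
      \<exists>\<kappa>\<in>linear_maps R Y (regular_module R). \<forall>x\<in>carrier W. l (u x) = \<kappa> (D x)"
  obtains w where "w \<in> linear_maps R Y M" "\<And>x. x \<in> carrier W \<Longrightarrow> w (D x) = \<theta> (u x)"
proof -
  interpret M: module R M by fact
  from assms(4) obtain n \<mu> p where
    \<mu>: "\<And>j. j < n \<Longrightarrow> \<mu> j \<in> linear_maps R M (regular_module R)" and p: "\<And>j. j < n \<Longrightarrow> p j \<in> carrier M"
    and \<theta>: "\<And>x. x \<in> carrier M \<Longrightarrow> \<theta> x = (\<Oplus>\<^bsub>M\<^esub>j\<in>{..<n::nat}. \<mu> j x \<odot>\<^bsub>M\<^esub> p j)"
    unfolding finite_rank_def by blast
  obtain \<kappa> where \<kappa>: "\<And>j. j < n \<Longrightarrow> \<kappa> j \<in> linear_maps R Y (regular_module R)"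
      "\<And>j x. j < n \<Longrightarrow> x \<in> carrier W \<Longrightarrow> \<mu> j (u x) = \<kappa> j (D x)"
    using ex[OF \<mu>] by metis
  show ?thesis
  proof (rule that)
    show "(\<lambda>y. \<Oplus>\<^bsub>M\<^esub>j\<in>{..<n}. \<kappa> j y \<odot>\<^bsub>M\<^esub> p j) \<in> linear_maps R Y M"
      using \<kappa> p by (intro finsum_linear_maps functional_smult_linear assms) auto
    fix x assume x: "x \<in> carrier W"
    show "(\<Oplus>\<^bsub>M\<^esub>j\<in>{..<n}. \<kappa> j (D x) \<odot>\<^bsub>M\<^esub> p j) = \<theta> (u x)"
      unfolding \<theta>[OF linear_mapsD(1)[OF u x]]
      using p \<kappa>(2) x linear_mapsD(1)[OF \<mu> linear_mapsD(1)[OF u x]]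
      by (intro M.M.finsum_cong') auto
  qed
qed

text \<open>The trace of an R-linear lift of \<open>u\<close> after \<open>\<theta>\<close> works:
  \<open>D\<close> and \<open>u\<close> are equivariant and so commute with averaging, and the
  average of \<open>\<theta>\<close> is the identity.\<close>

lemma group_projective_lift:
  assumes "group_module R K M a" "group_module R K W b" "group_module R K Y c" "finite (carrier K)"
    and free: "group_projective R K M a"
    and D: "D \<in> equivariant_maps R K W b Y c" and u: "u \<in> equivariant_maps R K M a Y c"
    and sub: "u ` carrier M \<subseteq> D ` carrier W"
  obtains h where "h \<in> equivariant_maps R K M a W b" "\<And>x. x \<in> carrier M \<Longrightarrow> D (h x) = u x"
proof -
  interpret M: group_module R K M a by fact
  interpret W: group_module R K W b by fact
  interpret Y: group_module R K Y c by fact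
  note D' = equivariant_mapsD[OF D] and u' = equivariant_mapsD[OF u]
  obtain \<theta> where \<theta>: "finite_rank R M \<theta>" "\<And>x. x \<in> carrier M \<Longrightarrow> trace_map K a M a \<theta> x = x"
    using free unfolding group_projective_def by blast
  obtain w where w: "w \<in> linear_maps R M W" "\<And>x. x \<in> carrier M \<Longrightarrow> D (w x) = u (\<theta> x)"
    using finite_rank_lift[OF M.module_axioms W.module_axioms Y.module_axioms \<theta>(1) D'(1) u'(1) sub] by blast
  note \<theta>cl = finite_rank_closed[OF M.module_axioms \<theta>(1)]
  show ?thesis
  proof (rule that)
    show "trace_map K a W b w \<in> equivariant_maps R K M a W b"
      by (rule trace_map_equivariant) fact+
    fix x assume x: "x \<in> carrier M"
    have ax: "k \<in> carrier K \<Longrightarrow> a (inv\<^bsub>K\<^esub> k) x \<in> carrier M" for k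
      using x by (simp add: M.act_closed)
    have "D (trace_map K a W b w x) = (\<Oplus>\<^bsub>Y\<^esub>k\<in>carrier K. D (b k (w (a (inv\<^bsub>K\<^esub> k) x))))"
      unfolding trace_map_def using ax linear_mapsD(1)[OF w(1)] W.act_closed
      by (intro linear_maps_finsum[OF W.module_axioms Y.module_axioms D'(1) assms(4)]) auto
    also have "\<dots> = (\<Oplus>\<^bsub>Y\<^esub>k\<in>carrier K. u (a k (\<theta> (a (inv\<^bsub>K\<^esub> k) x))))"
      using ax linear_mapsD(1)[OF w(1)] D'(2) u'(2) w(2) M.act_closed \<theta>cl u'(3) Y.act_closed
      by (intro Y.M.finsum_cong') auto
    also have "\<dots> = u (trace_map K a M a \<theta> x)"
      unfolding trace_map_def using ax M.act_closed \<theta>cl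
      by (intro linear_maps_finsum[OF M.module_axioms Y.module_axioms u'(1) assms(4), symmetric]) auto
    finally show "D (trace_map K a W b w x) = u x" using \<theta>(2)[OF x] by simp
  qed
qed

text \<open>An R-linear extension of \<open>\<theta>\<close> after \<open>u\<close> is averaged, as
  for lifts; equivariance of \<open>D\<close> and \<open>u\<close> makes the average an extension of
  \<open>u\<close>. The condition on functionals takes the place of the inclusion of images and will
  come from exactness of a dual complex.\<close>

lemma group_projective_extend:
  assumes "group_module R K M a" "group_module R K W b" "group_module R K Y c" "finite (carrier K)"
    and free: "group_projective R K M a"
    and D: "D \<in> equivariant_maps R K W b Y c" and u: "u \<in> equivariant_maps R K W b M a"
    and ex: "\<And>l. l \<in> linear_maps R M (regular_module R) \<Longrightarrow>
      \<exists>\<kappa>\<in>linear_maps R Y (regular_module R). \<forall>x\<in>carrier W. l (u x) = \<kappa> (D x)"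
  obtains h where "h \<in> equivariant_maps R K Y c M a" "\<And>x. x \<in> carrier W \<Longrightarrow> h (D x) = u x"
proof -
  interpret M: group_module R K M a by fact
  interpret W: group_module R K W b by fact
  interpret Y: group_module R K Y c by fact
  note D' = equivariant_mapsD[OF D] and u' = equivariant_mapsD[OF u]
  obtain \<theta> where \<theta>: "finite_rank R M \<theta>" "\<And>x. x \<in> carrier M \<Longrightarrow> trace_map K a M a \<theta> x = x"
    using free unfolding group_projective_def by blast
  obtain w where w: "w \<in> linear_maps R Y M" "\<And>x. x \<in> carrier W \<Longrightarrow> w (D x) = \<theta> (u x)"
    using finite_rank_extend[OF M.module_axioms W.module_axioms Y.module_axioms \<theta>(1) u'(1) _ ex] D'(3)
    by (metis (no_types, lifting) Pi_I')
  note \<theta>cl = finite_rank_closed[OF M.module_axioms \<theta>(1)]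
  show ?thesis
  proof (rule that)
    show "trace_map K c M a w \<in> equivariant_maps R K Y c M a"
      by (rule trace_map_equivariant) fact+
    fix x assume x: "x \<in> carrier W"
    have "trace_map K c M a w (D x) = trace_map K a M a \<theta> (u x)"
      unfolding trace_map_def
    proof (rule M.M.finsum_cong')
      fix k assume k: "k \<in> carrier K"
      then have "w (c (inv\<^bsub>K\<^esub> k) (D x)) = w (D (b (inv\<^bsub>K\<^esub> k) x))"
        using x by (simp add: D'(2))
      also have "\<dots> = \<theta> (u (b (inv\<^bsub>K\<^esub> k) x))"
        using k x by (simp add: w(2) W.act_closed)
      also have "\<dots> = \<theta> (a (inv\<^bsub>K\<^esub> k) (u x))"
        using k x by (simp add: u'(2))
      finally show "a k (w (c (inv\<^bsub>K\<^esub> k) (D x))) = a k (\<theta> (a (inv\<^bsub>K\<^esub> k) (u x)))" by simp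
    qed (use x u'(3) \<theta>cl M.act_closed in auto)
    then show "trace_map K c M a w (D x) = u x"
      using \<theta>(2) u'(3) x by simp
  qed
qed

section \<open>Comparison of complete resolutions\<close>

text \<open>\<open>S n x y\<close> relates a value \<open>x\<close> in degree \<open>n - 1\<close>
  to a value \<open>y\<close> in degree \<open>n\<close>. One sequence of choices runs upwards and
  one downwards from the common value \<open>x0\<close>.\<close>

lemma int_dependent_choice:
  fixes good :: "int \<Rightarrow> 'a \<Rightarrow> bool"
  assumes "good 0 x0"
    and up: "\<And>n x. good n x \<Longrightarrow> \<exists>y. good (n + 1) y \<and> S (n + 1) x y"
    and down: "\<And>n y. good n y \<Longrightarrow> \<exists>x. good (n - 1) x \<and> S n x y"
  shows "\<exists>h. h 0 = x0 \<and> (\<forall>n. good n (h n) \<and> S n (h (n - 1)) (h n))"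
proof -
  have "\<exists>f. \<forall>n::nat. (good (int n) (f n) \<and> (n = 0 \<longrightarrow> f n = x0)) \<and> S (int n + 1) (f n) (f (Suc n))"
  proof (rule dependent_nat_choice)
    fix x and n :: nat
    have eq: "int (Suc n) = int n + 1" by simp
    assume "good (int n) x \<and> (n = 0 \<longrightarrow> x = x0)"
    then show "\<exists>y. (good (int (Suc n)) y \<and> (Suc n = 0 \<longrightarrow> y = x0)) \<and> S (int n + 1) x y"
      using up[of "int n" x] unfolding eq by blast
  qed (use assms(1) in auto)
  then obtain u where u: "\<And>n::nat. good (int n) (u n)" "u 0 = x0" "\<And>n. S (int n + 1) (u n) (u (Suc n))"
    by blast
  have "\<exists>f. \<forall>n::nat. (good (- int n) (f n) \<and> (n = 0 \<longrightarrow> f n = x0)) \<and> S (- int n) (f (Suc n)) (f n)"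
  proof (rule dependent_nat_choice)
    fix x and n :: nat
    have eq: "- int (Suc n) = - int n - 1" by simp
    assume "good (- int n) x \<and> (n = 0 \<longrightarrow> x = x0)"
    then show "\<exists>y. (good (- int (Suc n)) y \<and> (Suc n = 0 \<longrightarrow> y = x0)) \<and> S (- int n) y x"
      using down[of "- int n" x] unfolding eq by blast
  qed (use assms(1) in auto)
  then obtain v where v: "\<And>n::nat. good (- int n) (v n)" "v 0 = x0" "\<And>n. S (- int n) (v (Suc n)) (v n)"
    by blast
  \<comment> \<open>Both halves equal \<open>x0\<close> at 0, so the relation survives the seam: it
    comes from \<open>u\<close> for positive \<open>n\<close> and from \<open>v\<close> for all
    other \<open>n\<close>.\<close>
  define h where "h n = (if n \<ge> 0 then u (nat n) else v (nat (- n)))" for n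
  have "good n (h n)" for n
    using u(1)[of "nat n"] v(1)[of "nat (- n)"] by (cases "n \<ge> 0") (auto simp: h_def)
  moreover have "S n (h (n - 1)) (h n)" for n
  proof (cases "n > 0")
    case True
    then obtain m where m: "n = int m + 1" using zero_less_imp_eq_int[of n] by (metis Suc_pred' of_nat_Suc of_nat_0_less_iff add.commute)
    then have "nat n = Suc m" "nat (n - 1) = m" by auto
    then show ?thesis using True u(3)[of m] m by (simp add: h_def)
  next
    case False
    define m where "m = nat (- n)"
    then have n: "n = - int m" and "nat (- (n - 1)) = Suc m" using False by auto
    moreover have "h n = v m" using False u(2) v(2) by (auto simp: h_def m_def)
    ultimately show ?thesis using False v(3)[of m] by (simp add: h_def)
  qed
  ultimately show ?thesis
    by (intro exI[of _ h]) (simp add: h_def u(2))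
qed

text \<open>Exactness as an equivalence includes that two successive differentials compose to
  zero.\<close>

locale exact_complex =
  fixes R :: "('r, 'x) ring_scheme" and K :: "('k, 'y) monoid_scheme"
    and P :: "int \<Rightarrow> ('r, 'p) module" and a :: "int \<Rightarrow> 'k \<Rightarrow> 'p \<Rightarrow> 'p" and d :: "int \<Rightarrow> 'p \<Rightarrow> 'p"
  assumes finite_group: "finite (carrier K)"
    and group_module: "group_module R K (P n) (a n)"
    and diff: "d n \<in> equivariant_maps R K (P n) (a n) (P (n - 1)) (a (n - 1))"
    and exact_iff: "x \<in> carrier (P n) \<Longrightarrow>
      d n x = \<zero>\<^bsub>P (n - 1)\<^esub> \<longleftrightarrow> x \<in> d (n + 1) ` carrier (P (n + 1))"
    and group_projective: "group_projective R K (P n) (a n)"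
begin

lemma module: "module R (P n)"
  using group_module[of n] by (simp add: group_module_def)

lemma diff_Suc: "d (n + 1) \<in> equivariant_maps R K (P (n + 1)) (a (n + 1)) (P n) (a n)"
  using diff[of "n + 1"] by simp

lemma diff_closed: "x \<in> carrier (P n) \<Longrightarrow> d n x \<in> carrier (P (n - 1))"
  using equivariant_mapsD(3)[OF diff] .

lemma diff_Suc_closed: "x \<in> carrier (P (n + 1)) \<Longrightarrow> d (n + 1) x \<in> carrier (P n)"
  using equivariant_mapsD(3)[OF diff_Suc] .

lemma diff_diff: "x \<in> carrier (P (n + 1)) \<Longrightarrow> d n (d (n + 1) x) = \<zero>\<^bsub>P (n - 1)\<^esub>"
  using diff_Suc_closed[of x n] exact_iff[of "d (n + 1) x" n] by auto

lemma diff_diff': "x \<in> carrier (P n) \<Longrightarrow> d (n - 1) (d n x) = \<zero>\<^bsub>P (n - 1 - 1)\<^esub>"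
  using diff_diff[of x "n - 1"] by simp

lemma lift_equivariant:
  assumes M: "group_module R K M b" "group_projective R K M b"
    and u: "u \<in> equivariant_maps R K M b (P n) (a n)"
    and z: "\<And>x. x \<in> carrier M \<Longrightarrow> d n (u x) = \<zero>\<^bsub>P (n - 1)\<^esub>"
  shows "\<exists>h\<in>equivariant_maps R K M b (P (n + 1)) (a (n + 1)). \<forall>x\<in>carrier M. d (n + 1) (h x) = u x"
proof -
  have "u ` carrier M \<subseteq> d (n + 1) ` carrier (P (n + 1))"
    using exact_iff z equivariant_mapsD(3)[OF u] by blast
  then show ?thesis
    using group_projective_lift[OF M(1) group_module group_module finite_group M(2) diff_Suc u] by metis
qed

text \<open>A homotopy raises the degree by one, so it is a degree-preserving family into the
  shifted complex. The minus sign makes the compatibility condition in \<open>extend_family\<close>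
  hold when \<open>g\<close> is a chain map, which lets chain maps and homotopies come from the same
  extension result.\<close>

lemma suspension:
  "exact_complex R K (\<lambda>n. P (n + 1)) (\<lambda>n. a (n + 1)) (\<lambda>n x. \<ominus>\<^bsub>P n\<^esub> d (n + 1) x)"
proof (rule exact_complex.intro)
  fix n
  interpret P: group_module R K "P n" "a n" by (rule group_module)
  show "(\<lambda>x. \<ominus>\<^bsub>P n\<^esub> d (n + 1) x)
      \<in> equivariant_maps R K (P (n + 1)) (a (n + 1)) (P (n - 1 + 1)) (a (n - 1 + 1))"
    using equivariant_maps_neg[OF group_module diff_Suc] by simp
  show "group_module R K (P (n + 1)) (a (n + 1))" by (rule group_module)
  show "group_projective R K (P (n + 1)) (a (n + 1))" by (rule group_projective)
next
  fix n x assume x: "x \<in> carrier (P (n + 1))"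
  interpret P: module R "P n" by (rule module)
  interpret P1: module R "P (n + 1)" by (rule module)
  interpret P2: module R "P (n + 1 + 1)" by (rule module)
  have "(\<ominus>\<^bsub>P n\<^esub> d (n + 1) x = \<zero>\<^bsub>P n\<^esub>) \<longleftrightarrow> d (n + 1) x = \<zero>\<^bsub>P n\<^esub>"
    using diff_Suc_closed[OF x] by simp
  also have "\<dots> \<longleftrightarrow> x \<in> d (n + 1 + 1) ` carrier (P (n + 1 + 1))"
    using exact_iff[of x "n + 1"] x by simp
  \<comment> \<open>The sign does not affect the image, since the carrier is closed under
    negation.\<close>
  also have "d (n + 1 + 1) ` carrier (P (n + 1 + 1)) = (\<lambda>x. \<ominus>\<^bsub>P (n + 1)\<^esub> d (n + 1 + 1) x) ` carrier (P (n + 1 + 1))"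
  proof -
    have *: "\<ominus>\<^bsub>P (n + 1)\<^esub> d (n + 1 + 1) y = d (n + 1 + 1) (\<ominus>\<^bsub>P (n + 1 + 1)\<^esub> y)" if "y \<in> carrier (P (n + 1 + 1))" for y
      using linear_maps_minus[OF module module equivariant_mapsD(1)[OF diff_Suc] that] by simp
    show ?thesis
    proof (intro equalityI subsetI; elim imageE)
      fix z y assume z: "z = d (n + 1 + 1) y" and y: "y \<in> carrier (P (n + 1 + 1))"
      have "\<ominus>\<^bsub>P (n + 1)\<^esub> d (n + 1 + 1) (\<ominus>\<^bsub>P (n + 1 + 1)\<^esub> y) = z"
        unfolding *[OF P2.M.a_inv_closed[OF y]] P2.M.minus_minus[OF y] z ..
      then show "z \<in> (\<lambda>x. \<ominus>\<^bsub>P (n + 1)\<^esub> d (n + 1 + 1) x) ` carrier (P (n + 1 + 1))"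
        using P2.M.a_inv_closed[OF y] by blast
    next
      fix z y assume z: "z = \<ominus>\<^bsub>P (n + 1)\<^esub> d (n + 1 + 1) y" and y: "y \<in> carrier (P (n + 1 + 1))"
      show "z \<in> d (n + 1 + 1) ` carrier (P (n + 1 + 1))"
        unfolding z *[OF y] using P2.M.a_inv_closed[OF y] by (rule imageI)
    qed
  qed
  finally show "(\<ominus>\<^bsub>P n\<^esub> d (n + 1) x = \<zero>\<^bsub>P (n - 1 + 1)\<^esub>) \<longleftrightarrow>
      x \<in> (\<lambda>x. \<ominus>\<^bsub>P (n + 1)\<^esub> d (n + 1 + 1) x) ` carrier (P (n + 1 + 1))"
    by simp
qed (rule finite_group)

end

text \<open>Exactness of the dual is required over \<open>R\<close> only: for a group ring, \<open>Hom\<^sub>R\<^sub>K(P, RK)\<close> and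
  \<open>Hom\<^sub>R(P, R)\<close> are naturally isomorphic.\<close>

locale complete_complex = exact_complex +
  assumes dual_exact: "\<lbrakk>l \<in> linear_maps R (P n) (regular_module R);
        \<And>x. x \<in> carrier (P (n + 1)) \<Longrightarrow> l (d (n + 1) x) = \<zero>\<^bsub>R\<^esub>\<rbrakk>
      \<Longrightarrow> \<exists>\<kappa>\<in>linear_maps R (P (n - 1)) (regular_module R). \<forall>x\<in>carrier (P n). l x = \<kappa> (d n x)"
begin

text \<open>A functional on the target turns \<open>u\<close> into a functional on
  \<open>P n\<close> that vanishes on boundaries, and dual exactness over R factors this through
  \<open>d n\<close>. That is the condition on functionals which the averaged extension asks
  for.\<close>

lemma extend_equivariant:
  assumes M: "group_module R K M b" "group_projective R K M b"
    and u: "u \<in> equivariant_maps R K (P n) (a n) M b"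
    and z: "\<And>x. x \<in> carrier (P (n + 1)) \<Longrightarrow> u (d (n + 1) x) = \<zero>\<^bsub>M\<^esub>"
  shows "\<exists>h\<in>equivariant_maps R K (P (n - 1)) (a (n - 1)) M b. \<forall>x\<in>carrier (P n). h (d n x) = u x"
proof -
  interpret M: group_module R K M b by fact
  have "\<exists>\<kappa>\<in>linear_maps R (P (n - 1)) (regular_module R). \<forall>x\<in>carrier (P n). l (u x) = \<kappa> (d n x)"
    if l: "l \<in> linear_maps R M (regular_module R)" for l
  proof (rule dual_exact)
    show "(\<lambda>x. l (u x)) \<in> linear_maps R (P n) (regular_module R)"
      by (rule linear_maps_compose[OF equivariant_mapsD(1)[OF u] l])
    have "l \<zero>\<^bsub>M\<^esub> = \<zero>\<^bsub>R\<^esub>"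
      using linear_maps_zero[OF M.module_axioms M.module_regular_module l] by simp
    then show "l (u (d (n + 1) x)) = \<zero>\<^bsub>R\<^esub>" if "x \<in> carrier (P (n + 1))" for x
      using z that by simp
  qed
  then show ?thesis
    using group_projective_extend[OF M(1) group_module group_module finite_group M(2) diff u] by metis
qed

text \<open>A family \<open>h\<close> as below is a chain map for \<open>g = 0\<close>, and a null homotopy when the target is a
  suspension.  A solution in degree \<open>0\<close> extends upwards because \<open>P\<close> is projective and \<open>Q\<close> is exact,
  and downwards because the dual of \<open>P\<close> is exact.\<close>

lemma extend_family:
  assumes "exact_complex R K Q b e"
    and g: "\<And>n. g n \<in> equivariant_maps R K (P n) (a n) (Q (n - 1)) (b (n - 1))"
    and eg: "\<And>n x. x \<in> carrier (P n) \<Longrightarrow> e (n - 1) (g n x) = \<ominus>\<^bsub>Q (n - 1 - 1)\<^esub> g (n - 1) (d n x)"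
    and u0: "u0 \<in> equivariant_maps R K (P 0) (a 0) (Q 0) (b 0)"
    and u0_eq: "\<And>x. x \<in> carrier (P 1) \<Longrightarrow> e 0 (u0 (d 1 x)) = g 0 (d 1 x)"
  shows "\<exists>h. h 0 = u0 \<and> (\<forall>n. h n \<in> equivariant_maps R K (P n) (a n) (Q n) (b n) \<and>
    (\<forall>x\<in>carrier (P n). e n (h n x) = g n x \<oplus>\<^bsub>Q (n - 1)\<^esub> h (n - 1) (d n x)))"
proof -
  interpret Q: exact_complex R K Q b e by fact
  \<comment> \<open>\<open>good\<close> is the equation of degree \<open>n\<close> tested on
    boundaries, where the term from degree \<open>n - 1\<close> drops out because two differentials
    compose to zero. It is what a step upwards and a step downwards both require.\<close>
  define good where "good n u \<longleftrightarrow> u \<in> equivariant_maps R K (P n) (a n) (Q n) (b n) \<and>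
    (\<forall>x\<in>carrier (P (n + 1)). e n (u (d (n + 1) x)) = g n (d (n + 1) x))" for n u
  define S where "S n v u \<longleftrightarrow> (\<forall>x\<in>carrier (P n). e n (u x) = g n x \<oplus>\<^bsub>Q (n - 1)\<^esub> v (d n x))" for n v u
  have "\<exists>h. h 0 = u0 \<and> (\<forall>n. good n (h n) \<and> S n (h (n - 1)) (h n))"
  proof (rule int_dependent_choice)
    show "good 0 u0" using u0 u0_eq by (simp add: good_def)
  next
    fix n u assume u: "good n u"
    interpret Qn: group_module R K "Q n" "b n" by (rule Q.group_module)
    interpret Qm: module R "Q (n - 1)" by (rule Q.module)
    have u': "u \<in> equivariant_maps R K (P n) (a n) (Q n) (b n)" using u by (simp add: good_def)
    have g': "g (n + 1) \<in> equivariant_maps R K (P (n + 1)) (a (n + 1)) (Q n) (b n)"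
      using g[of "n + 1"] by simp
    note gcl = equivariant_mapsD(3)[OF g']
    have ud: "(\<lambda>x. u (d (n + 1) x)) \<in> equivariant_maps R K (P (n + 1)) (a (n + 1)) (Q n) (b n)"
      by (rule equivariant_maps_compose[OF diff_Suc u'])
    note en = equivariant_mapsD[OF Q.diff[of n]]
    \<comment> \<open>The right-hand side of the equation in degree \<open>n + 1\<close> is a cycle:
      by \<open>eg\<close> and \<open>good\<close> the two terms cancel. Exactness of
      \<open>Q\<close> then provides the next map.\<close>
    have z: "e n (g (n + 1) x \<oplus>\<^bsub>Q n\<^esub> u (d (n + 1) x)) = \<zero>\<^bsub>Q (n - 1)\<^esub>" if x: "x \<in> carrier (P (n + 1))" for x
    proof -
      have "e n (g (n + 1) x \<oplus>\<^bsub>Q n\<^esub> u (d (n + 1) x)) = e n (g (n + 1) x) \<oplus>\<^bsub>Q (n - 1)\<^esub> e n (u (d (n + 1) x))"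
        using gcl[OF x] equivariant_mapsD(3)[OF ud x] by (rule en(4))
      also have "\<dots> = (\<ominus>\<^bsub>Q (n - 1)\<^esub> g n (d (n + 1) x)) \<oplus>\<^bsub>Q (n - 1)\<^esub> g n (d (n + 1) x)"
        using eg[of x "n + 1"] x u by (simp add: good_def)
      also have "\<dots> = \<zero>\<^bsub>Q (n - 1)\<^esub>"
        using equivariant_mapsD(3)[OF g[of n] diff_Suc_closed[OF x]] by (rule Qm.M.l_neg)
      finally show ?thesis .
    qed
    obtain v where v: "v \<in> equivariant_maps R K (P (n + 1)) (a (n + 1)) (Q (n + 1)) (b (n + 1))"
      "\<And>x. x \<in> carrier (P (n + 1)) \<Longrightarrow> e (n + 1) (v x) = g (n + 1) x \<oplus>\<^bsub>Q n\<^esub> u (d (n + 1) x)"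
      using Q.lift_equivariant[OF group_module group_projective
          equivariant_maps_add[OF Q.group_module g' ud] z] by blast
    have "e (n + 1) (v (d (n + 1 + 1) x)) = g (n + 1) (d (n + 1 + 1) x)" if x: "x \<in> carrier (P (n + 1 + 1))" for x
    proof -
      have dx: "d (n + 1 + 1) x \<in> carrier (P (n + 1))" by (rule diff_Suc_closed[OF x])
      have "u (d (n + 1) (d (n + 1 + 1) x)) = \<zero>\<^bsub>Q n\<^esub>"
        using diff_diff[OF x] linear_maps_zero[OF module Q.module equivariant_mapsD(1)[OF u']] by simp
      then show ?thesis using v(2)[OF dx] gcl[OF dx] by simp
    qed
    then have "good (n + 1) v" using v(1) by (simp add: good_def)
    moreover have "S (n + 1) u v" using v(2) by (simp add: S_def)
    ultimately show "\<exists>y. good (n + 1) y \<and> S (n + 1) u y" by blast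
  next
    fix n u assume u: "good n u"
    interpret Qm: group_module R K "Q (n - 1)" "b (n - 1)" by (rule Q.group_module)
    interpret Ql: module R "Q (n - 2)" by (rule Q.module)
    have u': "u \<in> equivariant_maps R K (P n) (a n) (Q n) (b n)" using u by (simp add: good_def)
    note gcl = equivariant_mapsD(3)[OF g]
    have eu: "(\<lambda>x. e n (u x)) \<in> equivariant_maps R K (P n) (a n) (Q (n - 1)) (b (n - 1))"
      by (rule equivariant_maps_compose[OF u' Q.diff])
    \<comment> \<open>Solving the equation of degree \<open>n\<close> for the unknown map in degree
      \<open>n - 1\<close> prescribes its value on \<open>d n x\<close> as this difference, which
      vanishes on boundaries by \<open>good\<close>.\<close>
    let ?w = "\<lambda>x. e n (u x) \<oplus>\<^bsub>Q (n - 1)\<^esub> (\<ominus>\<^bsub>Q (n - 1)\<^esub> g n x)"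
    have w: "?w \<in> equivariant_maps R K (P n) (a n) (Q (n - 1)) (b (n - 1))"
      by (rule equivariant_maps_add[OF Q.group_module eu equivariant_maps_neg[OF Q.group_module g]])
    have z: "?w (d (n + 1) x) = \<zero>\<^bsub>Q (n - 1)\<^esub>" if x: "x \<in> carrier (P (n + 1))" for x
      using u x gcl[OF diff_Suc_closed[OF x]] by (simp add: good_def Qm.M.r_neg)
    obtain v where v: "v \<in> equivariant_maps R K (P (n - 1)) (a (n - 1)) (Q (n - 1)) (b (n - 1))"
      "\<And>x. x \<in> carrier (P n) \<Longrightarrow> v (d n x) = ?w x"
      using extend_equivariant[OF Q.group_module Q.group_projective w z] by blast
    \<comment> \<open>The condition one degree lower is automatic: the first term dies because
      \<open>e\<close> composes with itself to zero, and \<open>eg\<close> evaluates the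
      second.\<close>
    have "e (n - 1) (v (d n x)) = g (n - 1) (d n x)" if x: "x \<in> carrier (P n)" for x
    proof -
      note en = equivariant_mapsD[OF Q.diff[of "n - 1"]]
      have "e (n - 1) (v (d n x)) = e (n - 1) (e n (u x)) \<oplus>\<^bsub>Q (n - 1 - 1)\<^esub> e (n - 1) (\<ominus>\<^bsub>Q (n - 1)\<^esub> g n x)"
        unfolding v(2)[OF x] using equivariant_mapsD(3)[OF eu x] gcl[OF x] by (intro en(4)) auto
      also have "e (n - 1) (e n (u x)) = \<zero>\<^bsub>Q (n - 1 - 1)\<^esub>"
        by (rule Q.diff_diff'[OF equivariant_mapsD(3)[OF u' x]])
      also have "e (n - 1) (\<ominus>\<^bsub>Q (n - 1)\<^esub> g n x) = \<ominus>\<^bsub>Q (n - 1 - 1)\<^esub> e (n - 1) (g n x)"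
        by (rule linear_maps_minus[OF Q.module Q.module en(1) gcl[OF x]])
      also have "e (n - 1) (g n x) = \<ominus>\<^bsub>Q (n - 1 - 1)\<^esub> g (n - 1) (d n x)"
        by (rule eg[OF x])
      finally show ?thesis using gcl[OF diff_closed[OF x]] by simp
    qed
    then have "good (n - 1) v" using v(1) by (simp add: good_def)
    moreover have "S n v u"
      unfolding S_def
    proof
      fix x assume x: "x \<in> carrier (P n)"
      show "e n (u x) = g n x \<oplus>\<^bsub>Q (n - 1)\<^esub> v (d n x)"
        unfolding v(2)[OF x] using equivariant_mapsD(3)[OF eu x] gcl[OF x]
        by (simp add: Qm.M.a_lcomm[of "g n x"] Qm.M.r_neg)
    qed
    ultimately show "\<exists>v. good (n - 1) v \<and> S n v u" by blast
  qed
  then show ?thesis by (auto simp: good_def S_def)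
qed

end

text \<open>Of the projective resolution and the chain map into it only the composite P 0 -> Q 0 ->
  M is kept, as \<open>\<eta>\<close>. Bijectivity of the chain map in degrees 0 and 1 is what turns
  exactness of the resolution at its end into the kernel condition.\<close>

locale complete_resolution_complex = complete_complex +
  fixes M :: "('r, 'm) module" and c :: "'k \<Rightarrow> 'm \<Rightarrow> 'm" and \<eta> :: "'p \<Rightarrow> 'm"
  assumes group_module_augmented: "group_module R K M c"
    and augmentation: "\<eta> \<in> equivariant_maps R K (P 0) (a 0) M c"
    and augmentation_surj: "\<eta> ` carrier (P 0) = carrier M"
    and augmentation_kernel: "x \<in> carrier (P 0) \<Longrightarrow>
      \<eta> x = \<zero>\<^bsub>M\<^esub> \<longleftrightarrow> x \<in> d 1 ` carrier (P 1)"

text \<open>The augmentations act in degree 0 only: \<open>\<eta>\<close> is lifted through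
  \<open>\<epsilon>\<close>, and the lift sends boundaries to boundaries because
  \<open>\<epsilon>\<close> kills their images. The other degrees are the extension result with
  \<open>g\<close> equal to zero.\<close>

lemma chain_map_exists:
  assumes "complete_resolution_complex R K P a d M c \<eta>"
    and "complete_resolution_complex R K Q b e M c \<epsilon>"
  shows "\<exists>f. (\<forall>n. f n \<in> equivariant_maps R K (P n) (a n) (Q n) (b n)) \<and>
    (\<forall>n. \<forall>x\<in>carrier (P n). e n (f n x) = f (n - 1) (d n x)) \<and>
    (\<forall>x\<in>carrier (P 0). \<epsilon> (f 0 x) = \<eta> x)"
proof -
  interpret P: complete_resolution_complex R K P a d M c \<eta> by fact
  interpret Q: complete_resolution_complex R K Q b e M c \<epsilon> by fact
  have "\<eta> ` carrier (P 0) \<subseteq> \<epsilon> ` carrier (Q 0)"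
    by (simp add: P.augmentation_surj Q.augmentation_surj)
  then obtain u where u: "u \<in> equivariant_maps R K (P 0) (a 0) (Q 0) (b 0)"
    "\<And>x. x \<in> carrier (P 0) \<Longrightarrow> \<epsilon> (u x) = \<eta> x"
    using group_projective_lift[OF P.group_module Q.group_module P.group_module_augmented
        P.finite_group P.group_projective Q.augmentation P.augmentation] by metis
  have zero: "\<zero>\<^bsub>Q n\<^esub> \<in> carrier (Q n)" for n
  proof -
    interpret module R "Q n" by (rule Q.module)
    show ?thesis by simp
  qed
  have bz: "b n k \<zero>\<^bsub>Q n\<^esub> = \<zero>\<^bsub>Q n\<^esub>" if "k \<in> carrier K" for n k
    using linear_maps_zero[OF Q.module Q.module group_module.act_linear[OF Q.group_module that]] .
  have "\<exists>h. h 0 = u \<and> (\<forall>n. h n \<in> equivariant_maps R K (P n) (a n) (Q n) (b n) \<and>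
    (\<forall>x\<in>carrier (P n). e n (h n x) = \<zero>\<^bsub>Q (n - 1)\<^esub> \<oplus>\<^bsub>Q (n - 1)\<^esub> h (n - 1) (d n x)))"
  proof (rule P.extend_family[OF Q.exact_complex_axioms, where g = "\<lambda>n _. \<zero>\<^bsub>Q (n - 1)\<^esub>"])
    fix n
    show "(\<lambda>_. \<zero>\<^bsub>Q (n - 1)\<^esub>) \<in> equivariant_maps R K (P n) (a n) (Q (n - 1)) (b (n - 1))"
      using bz by (intro equivariant_maps_zero_map Q.module)
    interpret module R "Q (n - 2)" by (rule Q.module)
    have minus_zero: "\<ominus>\<^bsub>Q (n - 2)\<^esub> \<zero>\<^bsub>Q (n - 2)\<^esub> = \<zero>\<^bsub>Q (n - 2)\<^esub>" by simp
    show "e (n - 1) \<zero>\<^bsub>Q (n - 1)\<^esub> = \<ominus>\<^bsub>Q (n - 1 - 1)\<^esub> \<zero>\<^bsub>Q (n - 1 - 1)\<^esub>"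
      using linear_maps_zero[OF Q.module Q.module equivariant_mapsD(1)[OF Q.diff]]
      by (simp add: minus_zero)
  next
    fix x assume x: "x \<in> carrier (P 1)"
    then have dx: "d 1 x \<in> carrier (P 0)" using P.diff_Suc_closed[of x 0] by simp
    have "\<epsilon> (u (d 1 x)) = \<zero>\<^bsub>M\<^esub>"
      using u(2)[OF dx] P.augmentation_kernel[OF dx] x by auto
    then obtain y where "y \<in> carrier (Q 1)" "u (d 1 x) = e 1 y"
      using Q.augmentation_kernel[OF equivariant_mapsD(3)[OF u(1) dx]] by blast
    then show "e 0 (u (d 1 x)) = \<zero>\<^bsub>Q (0 - 1)\<^esub>"
      using Q.diff_diff[of y 0] by simp
  qed (rule u(1))
  then obtain h where h: "h 0 = u" "\<And>n. h n \<in> equivariant_maps R K (P n) (a n) (Q n) (b n)"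
    "\<And>n x. x \<in> carrier (P n) \<Longrightarrow> e n (h n x) = \<zero>\<^bsub>Q (n - 1)\<^esub> \<oplus>\<^bsub>Q (n - 1)\<^esub> h (n - 1) (d n x)"
    by blast
  have "e n (h n x) = h (n - 1) (d n x)" if "x \<in> carrier (P n)" for n x
  proof -
    interpret module R "Q (n - 1)" by (rule Q.module)
    show ?thesis using h(3)[OF that] equivariant_mapsD(3)[OF h(2) P.diff_closed[OF that]] by simp
  qed
  then show ?thesis using h(1,2) u(2) by blast
qed

text \<open>A map killed by the augmentation lands in the boundaries in degree 0, so its negative
  lifts through \<open>e 1\<close>. This solves the equation of degree 0 with zero contribution from
  degree -1, and extending into the suspension gives the other degrees.\<close>

lemma null_homotopy_exists:
  assumes "complete_resolution_complex R K P a d M c \<eta>"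
    and "complete_resolution_complex R K Q b e M c \<epsilon>"
    and f: "\<And>n. f n \<in> equivariant_maps R K (P n) (a n) (Q n) (b n)"
    and f_diff: "\<And>n x. x \<in> carrier (P n) \<Longrightarrow> e n (f n x) = f (n - 1) (d n x)"
    and f_zero: "\<And>x. x \<in> carrier (P 0) \<Longrightarrow> \<epsilon> (f 0 x) = \<zero>\<^bsub>M\<^esub>"
  shows "\<exists>h. (\<forall>n. h n \<in> equivariant_maps R K (P n) (a n) (Q (n + 1)) (b (n + 1))) \<and>
    (\<forall>n. \<forall>x\<in>carrier (P n). \<ominus>\<^bsub>Q n\<^esub> e (n + 1) (h n x) = f n x \<oplus>\<^bsub>Q n\<^esub> h (n - 1) (d n x))"
proof -
  interpret P: complete_resolution_complex R K P a d M c \<eta> by fact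
  interpret Q: complete_resolution_complex R K Q b e M c \<epsilon> by fact
  interpret Q0: module R "Q 0" by (rule Q.module)
  have nf: "(\<lambda>x. \<ominus>\<^bsub>Q 0\<^esub> f 0 x) \<in> equivariant_maps R K (P 0) (a 0) (Q 0) (b 0)"
    by (rule equivariant_maps_neg[OF Q.group_module f])
  have Q1: "e 1 \<in> equivariant_maps R K (Q 1) (b 1) (Q 0) (b 0)"
    using Q.diff[of 1] by simp
  have "\<epsilon> (\<ominus>\<^bsub>Q 0\<^esub> f 0 x) = \<zero>\<^bsub>M\<^esub>" if "x \<in> carrier (P 0)" for x
  proof -
    interpret M: group_module R K M c by (rule P.group_module_augmented)
    show ?thesis
      using linear_maps_minus[OF Q.module M.module_axioms equivariant_mapsD(1)[OF Q.augmentation]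
          equivariant_mapsD(3)[OF f that]] f_zero[OF that] by simp
  qed
  then have "(\<lambda>x. \<ominus>\<^bsub>Q 0\<^esub> f 0 x) ` carrier (P 0) \<subseteq> e 1 ` carrier (Q 1)"
    using Q.augmentation_kernel equivariant_mapsD(3)[OF nf] by blast
  then obtain u where u: "u \<in> equivariant_maps R K (P 0) (a 0) (Q 1) (b 1)"
    "\<And>x. x \<in> carrier (P 0) \<Longrightarrow> e 1 (u x) = \<ominus>\<^bsub>Q 0\<^esub> f 0 x"
    using group_projective_lift[OF P.group_module Q.group_module Q.group_module
        P.finite_group P.group_projective Q1 nf] by metis
  have "\<exists>h. h 0 = u \<and> (\<forall>n. h n \<in> equivariant_maps R K (P n) (a n) (Q (n + 1)) (b (n + 1)) \<and>
    (\<forall>x\<in>carrier (P n). \<ominus>\<^bsub>Q n\<^esub> e (n + 1) (h n x) = f n x \<oplus>\<^bsub>Q (n - 1 + 1)\<^esub> h (n - 1) (d n x)))"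
  proof (rule P.extend_family[OF Q.suspension])
    fix n
    show "f n \<in> equivariant_maps R K (P n) (a n) (Q (n - 1 + 1)) (b (n - 1 + 1))"
      using f[of n] by simp
    fix x assume "x \<in> carrier (P n)"
    then show "\<ominus>\<^bsub>Q (n - 1)\<^esub> e (n - 1 + 1) (f n x) = \<ominus>\<^bsub>Q (n - 1 - 1 + 1)\<^esub> f (n - 1) (d n x)"
      using f_diff by simp
  next
    fix x assume "x \<in> carrier (P 1)"
    then have dx: "d 1 x \<in> carrier (P 0)" using P.diff_Suc_closed[of x 0] by simp
    show "\<ominus>\<^bsub>Q 0\<^esub> e (0 + 1) (u (d 1 x)) = f 0 (d 1 x)"
      using u(2)[OF dx] equivariant_mapsD(3)[OF f dx] by simp
  qed (use u(1) in simp)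
  then show ?thesis by auto
qed

text \<open>The identity minus \<open>f\<close> is a chain map killed by the augmentation, hence
  null homotopic. Thanks to the sign in the suspension, solving for \<open>f n x\<close> leaves only
  plus signs.\<close>

lemma homotopy_to_identity:
  assumes P: "complete_resolution_complex R K P a d M c \<eta>"
    and f: "\<And>n. f n \<in> equivariant_maps R K (P n) (a n) (P n) (a n)"
    and f_diff: "\<And>n x. x \<in> carrier (P n) \<Longrightarrow> d n (f n x) = f (n - 1) (d n x)"
    and f_aug: "\<And>x. x \<in> carrier (P 0) \<Longrightarrow> \<eta> (f 0 x) = \<eta> x"
  shows "\<exists>h. (\<forall>n. h n \<in> equivariant_maps R K (P n) (a n) (P (n + 1)) (a (n + 1))) \<and>
    (\<forall>n. \<forall>x\<in>carrier (P n). f n x = x \<oplus>\<^bsub>P n\<^esub> (h (n - 1) (d n x) \<oplus>\<^bsub>P n\<^esub> d (n + 1) (h n x)))"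
proof -
  interpret P: complete_resolution_complex R K P a d M c \<eta> by fact
  have "\<exists>h. (\<forall>n. h n \<in> equivariant_maps R K (P n) (a n) (P (n + 1)) (a (n + 1))) \<and>
    (\<forall>n. \<forall>x\<in>carrier (P n). \<ominus>\<^bsub>P n\<^esub> d (n + 1) (h n x)
        = (x \<oplus>\<^bsub>P n\<^esub> (\<ominus>\<^bsub>P n\<^esub> f n x)) \<oplus>\<^bsub>P n\<^esub> h (n - 1) (d n x))"
  proof (rule null_homotopy_exists[OF P P])
    fix n
    have "(\<lambda>x. x) \<in> equivariant_maps R K (P n) (a n) (P n) (a n)"
      by (simp add: equivariant_maps_def linear_maps_def)
    then show "(\<lambda>x. x \<oplus>\<^bsub>P n\<^esub> (\<ominus>\<^bsub>P n\<^esub> f n x)) \<in> equivariant_maps R K (P n) (a n) (P n) (a n)"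
      by (intro equivariant_maps_add equivariant_maps_neg P.group_module f)
    interpret Pn: module R "P n" by (rule P.module)
    fix x assume x: "x \<in> carrier (P n)"
    note fx = equivariant_mapsD(3)[OF f x]
    show "d n (x \<oplus>\<^bsub>P n\<^esub> (\<ominus>\<^bsub>P n\<^esub> f n x)) = d n x \<oplus>\<^bsub>P (n - 1)\<^esub> (\<ominus>\<^bsub>P (n - 1)\<^esub> f (n - 1) (d n x))"
      using x fx linear_maps_minus[OF P.module P.module equivariant_mapsD(1)[OF P.diff] fx]
      by (simp add: equivariant_mapsD(4)[OF P.diff] f_diff[symmetric])
  next
    interpret P0: module R "P 0" by (rule P.module)
    interpret M: group_module R K M c by (rule P.group_module_augmented)
    fix x assume x: "x \<in> carrier (P 0)"
    note fx = equivariant_mapsD(3)[OF f x]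
    note \<eta> = equivariant_mapsD[OF P.augmentation]
    show "\<eta> (x \<oplus>\<^bsub>P 0\<^esub> (\<ominus>\<^bsub>P 0\<^esub> f 0 x)) = \<zero>\<^bsub>M\<^esub>"
      using x fx linear_maps_minus[OF P.module M.module_axioms \<eta>(1) fx]
      by (simp add: \<eta>(4) f_aug \<eta>(3) M.M.r_neg)
  qed
  then obtain h where h: "\<And>n. h n \<in> equivariant_maps R K (P n) (a n) (P (n + 1)) (a (n + 1))"
    "\<And>n x. x \<in> carrier (P n) \<Longrightarrow> \<ominus>\<^bsub>P n\<^esub> d (n + 1) (h n x)
        = (x \<oplus>\<^bsub>P n\<^esub> (\<ominus>\<^bsub>P n\<^esub> f n x)) \<oplus>\<^bsub>P n\<^esub> h (n - 1) (d n x)"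
    by blast
  have "f n x = x \<oplus>\<^bsub>P n\<^esub> (h (n - 1) (d n x) \<oplus>\<^bsub>P n\<^esub> d (n + 1) (h n x))" if x: "x \<in> carrier (P n)" for n x
  proof -
    interpret Pn: module R "P n" by (rule P.module)
    note fx = equivariant_mapsD(3)[OF f x]
    have hd: "h (n - 1) (d n x) \<in> carrier (P n)"
      using equivariant_mapsD(3)[OF h(1) P.diff_closed[OF x]] by simp
    have dh: "d (n + 1) (h n x) \<in> carrier (P n)"
      by (rule P.diff_Suc_closed[OF equivariant_mapsD(3)[OF h(1) x]])
    have "f n x = f n x \<oplus>\<^bsub>P n\<^esub> ((\<ominus>\<^bsub>P n\<^esub> d (n + 1) (h n x)) \<oplus>\<^bsub>P n\<^esub> d (n + 1) (h n x))"
      using fx dh by (simp add: Pn.M.l_neg)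
    also have "\<dots> = f n x \<oplus>\<^bsub>P n\<^esub> (((x \<oplus>\<^bsub>P n\<^esub> (\<ominus>\<^bsub>P n\<^esub> f n x)) \<oplus>\<^bsub>P n\<^esub> h (n - 1) (d n x)) \<oplus>\<^bsub>P n\<^esub> d (n + 1) (h n x))"
      using h(2)[OF x] by simp
    also have "\<dots> = (f n x \<oplus>\<^bsub>P n\<^esub> (\<ominus>\<^bsub>P n\<^esub> f n x)) \<oplus>\<^bsub>P n\<^esub> (x \<oplus>\<^bsub>P n\<^esub> (h (n - 1) (d n x) \<oplus>\<^bsub>P n\<^esub> d (n + 1) (h n x)))"
      using fx dh hd x by (simp add: Pn.M.a_ac)
    finally show ?thesis using fx dh hd x by (simp add: Pn.M.r_neg)
  qed
  then show ?thesis using h(1) by blast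
qed

text \<open>The last two properties say that precomposition with \<open>f\<close> is injective and
  surjective on the cohomology of Hom into \<open>N\<close>, phrased with representatives. For chain
  maps \<open>f\<close> and \<open>g\<close> in the two directions, injectivity comes from f g being
  homotopic to the identity of \<open>P\<close>, surjectivity from g f being homotopic to the
  identity of \<open>Q\<close>.\<close>

lemma comparison:
  assumes P: "complete_resolution_complex R K P a d M c \<eta>"
    and Q: "complete_resolution_complex R K Q b e M c \<epsilon>"
    and N: "group_module R K N v"
  obtains f where "\<And>n. f n \<in> equivariant_maps R K (Q n) (b n) (P n) (a n)"
    and "\<And>n x. x \<in> carrier (Q n) \<Longrightarrow> d n (f n x) = f (n - 1) (e n x)"
    and "\<And>n \<phi> h. \<lbrakk>\<phi> \<in> equivariant_maps R K (P n) (a n) N v;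
        \<And>x. x \<in> carrier (P (n + 1)) \<Longrightarrow> \<phi> (d (n + 1) x) = \<zero>\<^bsub>N\<^esub>;
        h \<in> equivariant_maps R K (Q (n - 1)) (b (n - 1)) N v;
        \<And>x. x \<in> carrier (Q n) \<Longrightarrow> \<phi> (f n x) = h (e n x)\<rbrakk>
      \<Longrightarrow> \<exists>k\<in>equivariant_maps R K (P (n - 1)) (a (n - 1)) N v. \<forall>x\<in>carrier (P n). \<phi> x = k (d n x)"
    and "\<And>n \<psi>. \<lbrakk>\<psi> \<in> equivariant_maps R K (Q n) (b n) N v;
        \<And>x. x \<in> carrier (Q (n + 1)) \<Longrightarrow> \<psi> (e (n + 1) x) = \<zero>\<^bsub>N\<^esub>\<rbrakk>
      \<Longrightarrow> \<exists>\<phi>\<in>equivariant_maps R K (P n) (a n) N v.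
            (\<forall>x\<in>carrier (P (n + 1)). \<phi> (d (n + 1) x) = \<zero>\<^bsub>N\<^esub>) \<and>
            (\<exists>k\<in>equivariant_maps R K (Q (n - 1)) (b (n - 1)) N v.
              \<forall>x\<in>carrier (Q n). \<phi> (f n x) = \<psi> x \<oplus>\<^bsub>N\<^esub> k (e n x))"
proof -
  interpret P: complete_resolution_complex R K P a d M c \<eta> by fact
  interpret Q: complete_resolution_complex R K Q b e M c \<epsilon> by fact
  interpret N: group_module R K N v by fact
  obtain f where f: "\<And>n. f n \<in> equivariant_maps R K (Q n) (b n) (P n) (a n)"
    and f_d: "\<And>n x. x \<in> carrier (Q n) \<Longrightarrow> d n (f n x) = f (n - 1) (e n x)"
    and f_aug: "\<And>x. x \<in> carrier (Q 0) \<Longrightarrow> \<eta> (f 0 x) = \<epsilon> x"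
    using chain_map_exists[OF Q P] by blast
  obtain g where g: "\<And>n. g n \<in> equivariant_maps R K (P n) (a n) (Q n) (b n)"
    and g_d: "\<And>n x. x \<in> carrier (P n) \<Longrightarrow> e n (g n x) = g (n - 1) (d n x)"
    and g_aug: "\<And>x. x \<in> carrier (P 0) \<Longrightarrow> \<epsilon> (g 0 x) = \<eta> x"
    using chain_map_exists[OF P Q] by blast
  note fcl = equivariant_mapsD(3)[OF f] and gcl = equivariant_mapsD(3)[OF g]
  have "\<exists>h. (\<forall>n. h n \<in> equivariant_maps R K (P n) (a n) (P (n + 1)) (a (n + 1))) \<and>
    (\<forall>n. \<forall>x\<in>carrier (P n). f n (g n x) = x \<oplus>\<^bsub>P n\<^esub> (h (n - 1) (d n x) \<oplus>\<^bsub>P n\<^esub> d (n + 1) (h n x)))"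
  proof (rule homotopy_to_identity[OF P])
    show "(\<lambda>x. f n (g n x)) \<in> equivariant_maps R K (P n) (a n) (P n) (a n)" for n
      by (rule equivariant_maps_compose[OF g f])
    show "d n (f n (g n x)) = f (n - 1) (g (n - 1) (d n x))" if "x \<in> carrier (P n)" for n x
      using f_d[OF gcl[OF that]] g_d[OF that] by simp
    show "\<eta> (f 0 (g 0 x)) = \<eta> x" if "x \<in> carrier (P 0)" for x
      using f_aug[OF gcl[OF that]] g_aug[OF that] by simp
  qed
  then obtain h where h: "\<And>n. h n \<in> equivariant_maps R K (P n) (a n) (P (n + 1)) (a (n + 1))"
    and hfg: "\<And>n x. x \<in> carrier (P n) \<Longrightarrow>
      f n (g n x) = x \<oplus>\<^bsub>P n\<^esub> (h (n - 1) (d n x) \<oplus>\<^bsub>P n\<^esub> d (n + 1) (h n x))" by blast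
  have "\<exists>h. (\<forall>n. h n \<in> equivariant_maps R K (Q n) (b n) (Q (n + 1)) (b (n + 1))) \<and>
    (\<forall>n. \<forall>x\<in>carrier (Q n). g n (f n x) = x \<oplus>\<^bsub>Q n\<^esub> (h (n - 1) (e n x) \<oplus>\<^bsub>Q n\<^esub> e (n + 1) (h n x)))"
  proof (rule homotopy_to_identity[OF Q])
    show "(\<lambda>x. g n (f n x)) \<in> equivariant_maps R K (Q n) (b n) (Q n) (b n)" for n
      by (rule equivariant_maps_compose[OF f g])
    show "e n (g n (f n x)) = g (n - 1) (f (n - 1) (e n x))" if "x \<in> carrier (Q n)" for n x
      using g_d[OF fcl[OF that]] f_d[OF that] by simp
    show "\<epsilon> (g 0 (f 0 x)) = \<epsilon> x" if "x \<in> carrier (Q 0)" for x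
      using g_aug[OF fcl[OF that]] f_aug[OF that] by simp
  qed
  then obtain h' where h': "\<And>n. h' n \<in> equivariant_maps R K (Q n) (b n) (Q (n + 1)) (b (n + 1))"
    and hgf: "\<And>n x. x \<in> carrier (Q n) \<Longrightarrow>
      g n (f n x) = x \<oplus>\<^bsub>Q n\<^esub> (h' (n - 1) (e n x) \<oplus>\<^bsub>Q n\<^esub> e (n + 1) (h' n x))" by blast
  show ?thesis
  proof (rule that[of f])
    show "f n \<in> equivariant_maps R K (Q n) (b n) (P n) (a n)" for n by (rule f)
    show "d n (f n x) = f (n - 1) (e n x)" if "x \<in> carrier (Q n)" for n x by (rule f_d[OF that])
  next
    fix n \<phi> k
    assume \<phi>: "\<phi> \<in> equivariant_maps R K (P n) (a n) N v"
      and \<phi>d: "\<And>x. x \<in> carrier (P (n + 1)) \<Longrightarrow> \<phi> (d (n + 1) x) = \<zero>\<^bsub>N\<^esub>"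
      and k: "k \<in> equivariant_maps R K (Q (n - 1)) (b (n - 1)) N v"
      and \<phi>k: "\<And>x. x \<in> carrier (Q n) \<Longrightarrow> \<phi> (f n x) = k (e n x)"
    interpret Pn: module R "P n" by (rule P.module)
    have h1: "h (n - 1) \<in> equivariant_maps R K (P (n - 1)) (a (n - 1)) (P n) (a n)"
      using h[of "n - 1"] by simp
    \<comment> \<open>For the cocycle \<phi> the homotopy gives \<phi> f g = \<phi> + \<phi> h d,
      while the assumption gives \<phi> f g = k e g = k g d. Subtracting exhibits \<phi> as this map
      after d.\<close>
    let ?k = "\<lambda>x. k (g (n - 1) x) \<oplus>\<^bsub>N\<^esub> (\<ominus>\<^bsub>N\<^esub> \<phi> (h (n - 1) x))"
    have 1: "?k \<in> equivariant_maps R K (P (n - 1)) (a (n - 1)) N v"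
      by (intro equivariant_maps_add[OF N] equivariant_maps_neg[OF N]
          equivariant_maps_compose[OF g k] equivariant_maps_compose[OF h1 \<phi>])
    have 2: "\<phi> x = ?k (d n x)" if x: "x \<in> carrier (P n)" for x
    proof -
      note dx = P.diff_closed[OF x]
      have c1: "\<phi> x \<in> carrier N" "\<phi> (h (n - 1) (d n x)) \<in> carrier N"
        using equivariant_mapsD(3)[OF \<phi>] equivariant_mapsD(3)[OF h1 dx] x by auto
      have "k (g (n - 1) (d n x)) = \<phi> (f n (g n x))"
        using \<phi>k[OF gcl[OF x]] g_d[OF x] by simp
      also have "\<dots> = \<phi> x \<oplus>\<^bsub>N\<^esub> (\<phi> (h (n - 1) (d n x)) \<oplus>\<^bsub>N\<^esub> \<phi> (d (n + 1) (h n x)))"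
        using x equivariant_mapsD(3)[OF h1 dx] P.diff_Suc_closed[OF equivariant_mapsD(3)[OF h x]]
        by (simp add: hfg equivariant_mapsD(4)[OF \<phi>])
      also have "\<dots> = \<phi> x \<oplus>\<^bsub>N\<^esub> \<phi> (h (n - 1) (d n x))"
        using \<phi>d[OF equivariant_mapsD(3)[OF h x]] c1 by simp
      finally show ?thesis using c1 by (simp add: N.M.a_assoc N.M.r_neg)
    qed
    show "\<exists>k\<in>equivariant_maps R K (P (n - 1)) (a (n - 1)) N v. \<forall>x\<in>carrier (P n). \<phi> x = k (d n x)"
      using 2 by (intro bexI[OF _ 1] ballI)
  next
    fix n \<psi>
    assume \<psi>: "\<psi> \<in> equivariant_maps R K (Q n) (b n) N v"
      and \<psi>e: "\<And>x. x \<in> carrier (Q (n + 1)) \<Longrightarrow> \<psi> (e (n + 1) x) = \<zero>\<^bsub>N\<^esub>"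
    interpret Qn: module R "Q n" by (rule Q.module)
    have h1: "h' (n - 1) \<in> equivariant_maps R K (Q (n - 1)) (b (n - 1)) (Q n) (b n)"
      using h'[of "n - 1"] by simp
    \<comment> \<open>The class of \<psi> is hit by \<psi> g: its pullback \<psi> g f differs from
      \<psi> by \<psi> h' e, since \<psi> kills the other homotopy term.\<close>
    have 1: "(\<lambda>x. \<psi> (g n x)) \<in> equivariant_maps R K (P n) (a n) N v"
      by (rule equivariant_maps_compose[OF g \<psi>])
    have 2: "\<psi> (g n (d (n + 1) x)) = \<zero>\<^bsub>N\<^esub>" if "x \<in> carrier (P (n + 1))" for x
      using g_d[OF that] \<psi>e[OF gcl[OF that]] by simp
    have 3: "(\<lambda>x. \<psi> (h' (n - 1) x)) \<in> equivariant_maps R K (Q (n - 1)) (b (n - 1)) N v"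
      by (rule equivariant_maps_compose[OF h1 \<psi>])
    have 4: "\<psi> (g n (f n x)) = \<psi> x \<oplus>\<^bsub>N\<^esub> \<psi> (h' (n - 1) (e n x))" if x: "x \<in> carrier (Q n)" for x
    proof -
      note ex = Q.diff_closed[OF x]
      have "\<psi> (g n (f n x)) = \<psi> x \<oplus>\<^bsub>N\<^esub> (\<psi> (h' (n - 1) (e n x)) \<oplus>\<^bsub>N\<^esub> \<psi> (e (n + 1) (h' n x)))"
        using x equivariant_mapsD(3)[OF h1 ex] Q.diff_Suc_closed[OF equivariant_mapsD(3)[OF h' x]]
        by (simp add: hgf equivariant_mapsD(4)[OF \<psi>])
      then show ?thesis
        using \<psi>e[OF equivariant_mapsD(3)[OF h' x]]
          equivariant_mapsD(3)[OF \<psi>] equivariant_mapsD(3)[OF h1 ex] x by simp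
    qed
    show "\<exists>\<phi>\<in>equivariant_maps R K (P n) (a n) N v.
            (\<forall>x\<in>carrier (P (n + 1)). \<phi> (d (n + 1) x) = \<zero>\<^bsub>N\<^esub>) \<and>
            (\<exists>k\<in>equivariant_maps R K (Q (n - 1)) (b (n - 1)) N v.
              \<forall>x\<in>carrier (Q n). \<phi> (f n x) = \<psi> x \<oplus>\<^bsub>N\<^esub> k (e n x))"
    proof (rule bexI[OF _ 1], intro conjI ballI)
      show "\<psi> (g n (d (n + 1) x)) = \<zero>\<^bsub>N\<^esub>" if "x \<in> carrier (P (n + 1))" for x
        by (rule 2[OF that])
      show "\<exists>k\<in>equivariant_maps R K (Q (n - 1)) (b (n - 1)) N v.
              \<forall>x\<in>carrier (Q n). \<psi> (g n (f n x)) = \<psi> x \<oplus>\<^bsub>N\<^esub> k (e n x)"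
        using 4 by (intro bexI[OF _ 3] ballI)
    qed
  qed
qed

section \<open>Double sums and restriction to a subgroup\<close>

lemma (in abelian_monoid) finsum_Sigma:
  assumes "finite A" "\<And>x. x \<in> A \<Longrightarrow> finite (B x)" "\<And>x y. \<lbrakk>x \<in> A; y \<in> B x\<rbrakk> \<Longrightarrow> f x y \<in> carrier G"
  shows "(\<Oplus>x\<in>A. \<Oplus>y\<in>B x. f x y) = (\<Oplus>p\<in>Sigma A B. f (fst p) (snd p))"
  using assms
proof (induction A rule: finite_induct)
  case (insert a A)
  have eq: "Sigma (insert a A) B = Pair a ` B a \<union> Sigma A B" by auto
  have "(\<Oplus>p\<in>Sigma (insert a A) B. f (fst p) (snd p))
      = (\<Oplus>p\<in>Pair a ` B a. f (fst p) (snd p)) \<oplus> (\<Oplus>p\<in>Sigma A B. f (fst p) (snd p))"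
    unfolding eq using insert by (intro finsum_Un_disjoint) auto
  also have "(\<Oplus>p\<in>Pair a ` B a. f (fst p) (snd p)) = (\<Oplus>y\<in>B a. f a y)"
    using insert by (subst finsum_reindex) (auto simp: inj_on_def)
  finally show ?case using insert by (simp add: Pi_def)
qed simp

lemma (in abelian_monoid) finsum_swap:
  assumes "finite A" "finite B" "\<And>x y. \<lbrakk>x \<in> A; y \<in> B\<rbrakk> \<Longrightarrow> f x y \<in> carrier G"
  shows "(\<Oplus>x\<in>A. \<Oplus>y\<in>B. f x y) = (\<Oplus>y\<in>B. \<Oplus>x\<in>A. f x y)"
  using assms(1,3)
proof (induction A rule: finite_induct)
  case (insert a A)
  have "(\<Oplus>y\<in>B. \<Oplus>x\<in>insert a A. f x y) = (\<Oplus>y\<in>B. f a y \<oplus> (\<Oplus>x\<in>A. f x y))"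
    using insert by (intro finsum_cong') (auto simp: Pi_def intro!: finsum_closed)
  then show ?case using insert assms(2) by (simp add: finsum_addf Pi_def)
qed (simp add: assms(2))

text \<open>The factorisations of the \<open>\<theta> y\<close> through free modules combine to one
  through the direct sum of these, whose basis is indexed by the pairs
  \<open>(y, j)\<close>.\<close>

lemma finite_rank_sum:
  assumes M: "module R M" and Y: "finite Y" and L: "\<And>y. y \<in> Y \<Longrightarrow> module R (L y)"
    and \<theta>: "\<And>y. y \<in> Y \<Longrightarrow> finite_rank R (L y) (\<theta> y)"
    and \<alpha>: "\<And>y. y \<in> Y \<Longrightarrow> \<alpha> y \<in> linear_maps R M (L y)"
    and \<gamma>: "\<And>y. y \<in> Y \<Longrightarrow> \<gamma> y \<in> linear_maps R (L y) M"
  shows "finite_rank R M (\<lambda>x. \<Oplus>\<^bsub>M\<^esub>y\<in>Y. \<gamma> y (\<theta> y (\<alpha> y x)))"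
proof -
  interpret M: module R M by fact
  define spec where "spec y n \<mu> p \<longleftrightarrow>
    (\<forall>j<n. \<mu> j \<in> linear_maps R (L y) (regular_module R) \<and> p j \<in> carrier (L y)) \<and>
    (\<forall>x\<in>carrier (L y). \<theta> y x = (\<Oplus>\<^bsub>L y\<^esub>j\<in>{..<n::nat}. \<mu> j x \<odot>\<^bsub>L y\<^esub> p j))" for y n \<mu> p
  have "\<forall>y\<in>Y. \<exists>n \<mu> p. spec y n \<mu> p"
    using \<theta> unfolding finite_rank_def spec_def by blast
  then obtain n \<mu> p where spec: "\<And>y. y \<in> Y \<Longrightarrow> spec y (n y) (\<mu> y) (p y)"
    by metis
  then have \<mu>: "\<And>y j. \<lbrakk>y \<in> Y; j < n y\<rbrakk> \<Longrightarrow> \<mu> y j \<in> linear_maps R (L y) (regular_module R)"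
    and p: "\<And>y j. \<lbrakk>y \<in> Y; j < n y\<rbrakk> \<Longrightarrow> p y j \<in> carrier (L y)"
    and \<theta>_eq: "\<And>y x. \<lbrakk>y \<in> Y; x \<in> carrier (L y)\<rbrakk> \<Longrightarrow>
      \<theta> y x = (\<Oplus>\<^bsub>L y\<^esub>j\<in>{..<n y}. \<mu> y j x \<odot>\<^bsub>L y\<^esub> p y j)"
    by (simp_all add: spec_def)
  show ?thesis
  proof (rule finite_rankI[OF M, of "SIGMA y:Y. {..<n y}" "\<lambda>(y, j) x. \<mu> y j (\<alpha> y x)" "\<lambda>(y, j). \<gamma> y (p y j)"])
    fix x assume x: "x \<in> carrier M"
    note \<mu>cl = functional_closed[OF \<mu> linear_mapsD(1)[OF \<alpha> x]]
    note \<gamma>p = linear_mapsD(1)[OF \<gamma> p]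
    have "(\<Oplus>\<^bsub>M\<^esub>y\<in>Y. \<gamma> y (\<theta> y (\<alpha> y x))) = (\<Oplus>\<^bsub>M\<^esub>y\<in>Y. \<Oplus>\<^bsub>M\<^esub>j\<in>{..<n y}. \<mu> y j (\<alpha> y x) \<odot>\<^bsub>M\<^esub> \<gamma> y (p y j))"
    proof (rule M.M.finsum_cong')
      fix y assume y: "y \<in> Y"
      interpret L: module R "L y" by (rule L[OF y])
      have "\<gamma> y (\<theta> y (\<alpha> y x)) = (\<Oplus>\<^bsub>M\<^esub>j\<in>{..<n y}. \<gamma> y (\<mu> y j (\<alpha> y x) \<odot>\<^bsub>L y\<^esub> p y j))"
        unfolding \<theta>_eq[OF y linear_mapsD(1)[OF \<alpha>[OF y] x]]
        using y \<mu>cl p by (intro linear_maps_finsum[OF L.module_axioms M \<gamma>[OF y]]) auto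
      also have "\<dots> = (\<Oplus>\<^bsub>M\<^esub>j\<in>{..<n y}. \<mu> y j (\<alpha> y x) \<odot>\<^bsub>M\<^esub> \<gamma> y (p y j))"
        using y \<mu>cl p linear_mapsD(3)[OF \<gamma>[OF y]] \<gamma>p by (intro M.M.finsum_cong') auto
      finally show "\<gamma> y (\<theta> y (\<alpha> y x)) = (\<Oplus>\<^bsub>M\<^esub>j\<in>{..<n y}. \<mu> y j (\<alpha> y x) \<odot>\<^bsub>M\<^esub> \<gamma> y (p y j))" .
    qed (use \<mu>cl \<gamma>p in \<open>auto intro!: M.M.finsum_closed\<close>)
    also have "\<dots> = (\<Oplus>\<^bsub>M\<^esub>q\<in>(SIGMA y:Y. {..<n y}). \<mu> (fst q) (snd q) (\<alpha> (fst q) x) \<odot>\<^bsub>M\<^esub> \<gamma> (fst q) (p (fst q) (snd q)))"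
      using \<mu>cl \<gamma>p Y by (intro M.M.finsum_Sigma) auto
    finally show "(\<Oplus>\<^bsub>M\<^esub>y\<in>Y. \<gamma> y (\<theta> y (\<alpha> y x))) = (\<Oplus>\<^bsub>M\<^esub>q\<in>(SIGMA y:Y. {..<n y}).
        (case q of (y, j) \<Rightarrow> \<lambda>x. \<mu> y j (\<alpha> y x)) x \<odot>\<^bsub>M\<^esub> (case q of (y, j) \<Rightarrow> \<gamma> y (p y j)))"
      by (simp add: case_prod_beta)
  qed (use Y p linear_mapsD(1)[OF \<gamma>] linear_maps_compose[OF \<alpha> \<mu>] in auto)
qed

text \<open>\<open>V\<close> represents the cosets of the image of \<open>K\<close> in
  \<open>U\<close>. Summing the conjugates of \<open>\<theta>\<close> over \<open>V\<close> first
  and over \<open>K\<close> afterwards gives the trace over \<open>U\<close>, so the inner sum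
  \<open>\<theta>'\<close> witnesses projectivity over \<open>K\<close>.\<close>

lemma group_projective_restrict_group:
  assumes M: "group_module R U M a" and free: "group_projective R U M a"
    and K: "group K" "finite (carrier K)" and V: "finite V" "V \<subseteq> carrier U"
    and \<iota>: "\<iota> \<in> hom K U" and bij: "bij_betw (\<lambda>(k, v). \<iota> k \<otimes>\<^bsub>U\<^esub> v) (carrier K \<times> V) (carrier U)"
  shows "group_projective R K M (\<lambda>k. a (\<iota> k))"
proof -
  interpret M: group_module R U M a by fact
  interpret K: group K by fact
  interpret \<iota>: group_hom K U \<iota>
    using \<iota> by (simp add: group_hom_def group_hom_axioms_def K(1) M.K.group_axioms)
  obtain \<theta> where \<theta>: "finite_rank R M \<theta>" "\<And>x. x \<in> carrier M \<Longrightarrow> trace_map U a M a \<theta> x = x"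
    using free unfolding group_projective_def by blast
  note \<theta>cl = finite_rank_closed[OF M.module_axioms \<theta>(1)]
  define \<theta>' where "\<theta>' x = (\<Oplus>\<^bsub>M\<^esub>v\<in>V. a v (\<theta> (a (inv\<^bsub>U\<^esub> v) x)))" for x
  have Vcl: "v \<in> V \<Longrightarrow> v \<in> carrier U" for v using V(2) by auto
  have "finite_rank R M \<theta>'"
    unfolding \<theta>'_def using Vcl
    by (intro finite_rank_sum[OF M.module_axioms V(1) M.module_axioms \<theta>(1)] M.act_linear) auto
  moreover have "trace_map K (\<lambda>k. a (\<iota> k)) M (\<lambda>k. a (\<iota> k)) \<theta>' x = x" if x: "x \<in> carrier M" for x
  proof -
    let ?t = "\<lambda>u. a u (\<theta> (a (inv\<^bsub>U\<^esub> u) x))"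
    have tcl: "?t u \<in> carrier M" if "u \<in> carrier U" for u
      using that x by (intro M.act_closed \<theta>cl) auto
    have "trace_map K (\<lambda>k. a (\<iota> k)) M (\<lambda>k. a (\<iota> k)) \<theta>' x
        = (\<Oplus>\<^bsub>M\<^esub>k\<in>carrier K. \<Oplus>\<^bsub>M\<^esub>v\<in>V. ?t (\<iota> k \<otimes>\<^bsub>U\<^esub> v))"
      unfolding trace_map_def
    proof (rule M.M.finsum_cong')
      fix k assume k: "k \<in> carrier K"
      have c: "a (inv\<^bsub>U\<^esub> v) (a (inv\<^bsub>U\<^esub> (\<iota> k)) x) \<in> carrier M" if "v \<in> V" for v
        using that k x Vcl by (intro M.act_closed) auto
      have "a (\<iota> k) (\<theta>' (a (\<iota> (inv\<^bsub>K\<^esub> k)) x))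
          = (\<Oplus>\<^bsub>M\<^esub>v\<in>V. a (\<iota> k) (a v (\<theta> (a (inv\<^bsub>U\<^esub> v) (a (inv\<^bsub>U\<^esub> (\<iota> k)) x)))))"
        unfolding \<theta>'_def using k Vcl c \<theta>cl M.act_closed
        by (simp, intro linear_maps_finsum[OF M.module_axioms M.module_axioms M.act_linear V(1)]) auto
      also have "\<dots> = (\<Oplus>\<^bsub>M\<^esub>v\<in>V. ?t (\<iota> k \<otimes>\<^bsub>U\<^esub> v))"
        using k Vcl x \<theta>cl M.act_closed
        by (intro M.M.finsum_cong') (auto simp: M.K.inv_mult_group M.act_mult)
      finally show "a (\<iota> k) (\<theta>' (a (\<iota> (inv\<^bsub>K\<^esub> k)) x)) = (\<Oplus>\<^bsub>M\<^esub>v\<in>V. ?t (\<iota> k \<otimes>\<^bsub>U\<^esub> v))" .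
    qed (use tcl Vcl in \<open>auto intro!: M.M.finsum_closed\<close>)
    also have "\<dots> = (\<Oplus>\<^bsub>M\<^esub>q\<in>carrier K \<times> V. ?t (\<iota> (fst q) \<otimes>\<^bsub>U\<^esub> snd q))"
      using tcl Vcl K(2) V(1) by (intro M.M.finsum_Sigma) auto
    also have "\<dots> = (\<Oplus>\<^bsub>M\<^esub>u\<in>(\<lambda>(k, v). \<iota> k \<otimes>\<^bsub>U\<^esub> v) ` (carrier K \<times> V). ?t u)"
      using bij tcl by (subst M.M.finsum_reindex) (auto simp: bij_betw_def case_prod_beta)
    also have "\<dots> = trace_map U a M a \<theta> x"
      using bij by (simp add: bij_betw_def trace_map_def)
    finally show ?thesis using \<theta>(2)[OF x] by simp
  qed
  ultimately show ?thesis unfolding group_projective_def by blast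
qed

lemma group_module_restrict_group:
  assumes "group_module R U M a" "group K" "\<iota> \<in> hom K U"
  shows "group_module R K M (\<lambda>k. a (\<iota> k))"
proof -
  interpret M: group_module R U M a by fact
  interpret \<iota>: group_hom K U \<iota>
    using assms by (simp add: group_hom_def group_hom_axioms_def M.K.group_axioms)
  show ?thesis
    by (intro group_module.intro M.module_axioms assms(2) group_module_axioms.intro)
      (auto simp: M.act_linear M.act_one M.act_mult)
qed

lemma equivariant_maps_restrict_group:
  assumes "f \<in> equivariant_maps R U M a N b" "\<iota> \<in> hom K U"
  shows "f \<in> equivariant_maps R K M (\<lambda>k. a (\<iota> k)) N (\<lambda>k. b (\<iota> k))"
  using assms by (auto simp: equivariant_maps_def hom_def)

text \<open>Exactness and dual exactness are statements over R and do not see the acting group;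
  projectivity is the only condition that calls for the coset representatives.\<close>

lemma complete_resolution_complex_restrict_group:
  assumes P: "complete_resolution_complex R U P a d M c \<eta>"
    and K: "group K" "finite (carrier K)" and V: "finite V" "V \<subseteq> carrier U"
    and \<iota>: "\<iota> \<in> hom K U" and bij: "bij_betw (\<lambda>(k, v). \<iota> k \<otimes>\<^bsub>U\<^esub> v) (carrier K \<times> V) (carrier U)"
  shows "complete_resolution_complex R K P (\<lambda>n k. a n (\<iota> k)) d M (\<lambda>k. c (\<iota> k)) \<eta>"
proof -
  interpret P: complete_resolution_complex R U P a d M c \<eta> by fact
  show ?thesis
  proof (intro complete_resolution_complex.intro complete_complex.intro exact_complex.intro
      complete_resolution_complex_axioms.intro complete_complex_axioms.intro)
    show "group_module R K (P n) (\<lambda>k. a n (\<iota> k))" for n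
      by (rule group_module_restrict_group[OF P.group_module K(1) \<iota>])
    show "group_module R K M (\<lambda>k. c (\<iota> k))"
      by (rule group_module_restrict_group[OF P.group_module_augmented K(1) \<iota>])
    show "d n \<in> equivariant_maps R K (P n) (\<lambda>k. a n (\<iota> k)) (P (n - 1)) (\<lambda>k. a (n - 1) (\<iota> k))" for n
      by (rule equivariant_maps_restrict_group[OF P.diff \<iota>])
    show "\<eta> \<in> equivariant_maps R K (P 0) (\<lambda>k. a 0 (\<iota> k)) M (\<lambda>k. c (\<iota> k))"
      by (rule equivariant_maps_restrict_group[OF P.augmentation \<iota>])
    show "group_projective R K (P n) (\<lambda>k. a n (\<iota> k))" for n
      by (rule group_projective_restrict_group[OF P.group_module P.group_projective K V \<iota> bij])
  qed (fact K(2) P.exact_iff P.dual_exact P.augmentation_surj P.augmentation_kernel)+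
qed

section \<open>Modules over an algebra with a finite group as basis\<close>

lemma left_module_zero:
  assumes "left_module A M" "a \<in> carrier A" shows "a \<odot>\<^bsub>M\<^esub> \<zero>\<^bsub>M\<^esub> = \<zero>\<^bsub>M\<^esub>"
proof -
  interpret M: left_module A M by fact
  show ?thesis
    using M.smult_r_distr[OF assms(2) M.M.zero_closed M.M.zero_closed] M.smult_closed[OF assms(2) M.M.zero_closed]
    by (metis M.M.add.l_cancel_one' M.M.l_zero M.M.zero_closed)
qed

lemma left_module_zero_smult:
  assumes "left_module A M" "x \<in> carrier M" shows "\<zero>\<^bsub>A\<^esub> \<odot>\<^bsub>M\<^esub> x = \<zero>\<^bsub>M\<^esub>"
proof -
  interpret M: left_module A M by fact
  show ?thesis
    using M.smult_l_distr[OF M.R.zero_closed M.R.zero_closed assms(2)] M.smult_closed[OF M.R.zero_closed assms(2)]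
    by (metis M.M.add.l_cancel_one' M.R.l_zero M.R.zero_closed)
qed

lemma left_module_finsum:
  assumes "left_module A M" "a \<in> carrier A" "finite I" "f \<in> I \<rightarrow> carrier M"
  shows "a \<odot>\<^bsub>M\<^esub> (\<Oplus>\<^bsub>M\<^esub>i\<in>I. f i) = (\<Oplus>\<^bsub>M\<^esub>i\<in>I. a \<odot>\<^bsub>M\<^esub> f i)"
proof -
  interpret M: left_module A M by fact
  show ?thesis
    by (rule additive_finsum[OF M.M.abelian_group_axioms M.M.abelian_group_axioms])
      (use assms left_module_zero[OF assms(1,2)] M.smult_closed M.smult_r_distr in auto)
qed

lemma left_module_finsum_smult:
  assumes "left_module A M" "x \<in> carrier M" "finite I" "f \<in> I \<rightarrow> carrier A"
  shows "(\<Oplus>\<^bsub>A\<^esub>i\<in>I. f i) \<odot>\<^bsub>M\<^esub> x = (\<Oplus>\<^bsub>M\<^esub>i\<in>I. f i \<odot>\<^bsub>M\<^esub> x)"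
proof -
  interpret M: left_module A M by fact
  show ?thesis
    by (rule additive_finsum[OF M.R.abelian_group_axioms M.M.abelian_group_axioms, where f = "\<lambda>a. a \<odot>\<^bsub>M\<^esub> x"])
      (use assms left_module_zero_smult[OF assms(1,2)] M.smult_closed M.smult_l_distr in auto)
qed

lemma (in ring) left_module_regular_module: "left_module R (regular_module R)"
proof -
  have "abelian_group (regular_module R)"
    by (rule abelian_group_eqI[OF is_abelian_group]) simp_all
  then show ?thesis
    by (intro left_module.intro left_module_axioms.intro ring_axioms) (auto simp: l_distr r_distr m_assoc)
qed

lemma module_homsD:
  assumes "f \<in> module_homs A M N"
  shows "x \<in> carrier M \<Longrightarrow> f x \<in> carrier N"
    and "\<lbrakk>x \<in> carrier M; y \<in> carrier M\<rbrakk> \<Longrightarrow> f (x \<oplus>\<^bsub>M\<^esub> y) = f x \<oplus>\<^bsub>N\<^esub> f y"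
    and "\<lbrakk>a \<in> carrier A; x \<in> carrier M\<rbrakk> \<Longrightarrow> f (a \<odot>\<^bsub>M\<^esub> x) = a \<odot>\<^bsub>N\<^esub> f x"
    and "f \<in> extensional (carrier M)"
  using assms by (auto simp: module_homs_def PiE_def)

lemma module_homsI:
  assumes "\<And>x. x \<in> carrier M \<Longrightarrow> f x \<in> carrier N"
    and "\<And>x y. \<lbrakk>x \<in> carrier M; y \<in> carrier M\<rbrakk> \<Longrightarrow> f (x \<oplus>\<^bsub>M\<^esub> y) = f x \<oplus>\<^bsub>N\<^esub> f y"
    and "\<And>a x. \<lbrakk>a \<in> carrier A; x \<in> carrier M\<rbrakk> \<Longrightarrow> f (a \<odot>\<^bsub>M\<^esub> x) = a \<odot>\<^bsub>N\<^esub> f x"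
    and "f \<in> extensional (carrier M)"
  shows "f \<in> module_homs A M N"
  using assms by (auto simp: module_homs_def PiE_def)

text \<open>Meant for augmentations: \<open>complete_resolution\<close> does not itself demand that
  the resolved module satisfies the laws of a left module.\<close>

lemma left_module_of_surjection:
  assumes "left_module A M" "abelian_group N" "f \<in> module_homs A M N" "f ` carrier M = carrier N"
  shows "left_module A N"
proof -
  interpret M: left_module A M by fact
  interpret N: abelian_group N by fact
  note f = module_homsD[OF assms(3)]
  have ex: "\<exists>m\<in>carrier M. f m = x" if "x \<in> carrier N" for x
    using that assms(4) by (metis imageE)
  show ?thesis
  proof (intro left_module.intro left_module_axioms.intro M.R.ring_axioms assms(2))
    fix a x assume a: "a \<in> carrier A" and "x \<in> carrier N"
    then obtain m where "m \<in> carrier M" "f m = x" using ex by blast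
    then show "a \<odot>\<^bsub>N\<^esub> x \<in> carrier N" using f(1,3) a M.smult_closed by metis
  next
    fix a b x assume ab: "a \<in> carrier A" "b \<in> carrier A" and "x \<in> carrier N"
    then obtain m where m: "m \<in> carrier M" "f m = x" using ex by blast
    show "(a \<oplus>\<^bsub>A\<^esub> b) \<odot>\<^bsub>N\<^esub> x = a \<odot>\<^bsub>N\<^esub> x \<oplus>\<^bsub>N\<^esub> b \<odot>\<^bsub>N\<^esub> x"
      using f(2,3) ab m M.smult_closed M.smult_l_distr M.R.a_closed by metis
    show "(a \<otimes>\<^bsub>A\<^esub> b) \<odot>\<^bsub>N\<^esub> x = a \<odot>\<^bsub>N\<^esub> (b \<odot>\<^bsub>N\<^esub> x)"
      using f(3) ab m M.smult_closed M.smult_assoc M.R.m_closed by metis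
  next
    fix a x y assume a: "a \<in> carrier A" and "x \<in> carrier N" "y \<in> carrier N"
    then obtain m l where m: "m \<in> carrier M" "f m = x" "l \<in> carrier M" "f l = y" using ex by metis
    show "a \<odot>\<^bsub>N\<^esub> (x \<oplus>\<^bsub>N\<^esub> y) = a \<odot>\<^bsub>N\<^esub> x \<oplus>\<^bsub>N\<^esub> a \<odot>\<^bsub>N\<^esub> y"
      using f(2,3) a m M.smult_closed M.smult_r_distr M.M.a_closed by metis
  next
    fix x assume "x \<in> carrier N"
    then obtain m where "m \<in> carrier M" "f m = x" using ex by blast
    then show "\<one>\<^bsub>A\<^esub> \<odot>\<^bsub>N\<^esub> x = x" using f(3) M.smult_one M.R.one_closed by metis
  qed
qed

text \<open>The dual basis lemma. The free module in \<open>projective\<close> may have infinite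
  rank; finite generation leaves only the finite set \<open>J\<close> of coordinates that are
  nonzero on some generator.\<close>

lemma projective_dual_basis:
  fixes M :: "('a, 'm) module"
  assumes proj: "projective A M" and fg: "finitely_generated A M"
  shows "\<exists>(I :: 'm set) l p. finite I \<and> (\<forall>i\<in>I. l i \<in> module_homs A M (regular_module A) \<and> p i \<in> carrier M) \<and>
    (\<forall>x\<in>carrier M. x = (\<Oplus>\<^bsub>M\<^esub>i\<in>I. l i x \<odot>\<^bsub>M\<^esub> p i))"
proof -
  from proj have lm: "left_module A M" by (simp add: projective_def)
  interpret M: left_module A M by fact
  from proj obtain I :: "'m set" and j q where j: "j \<in> module_homs A M (free_module A I)"
    and q: "q \<in> module_homs A (free_module A I) M" and qj: "\<And>x. x \<in> carrier M \<Longrightarrow> q (j x) = x"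
    unfolding projective_def by blast
  from fg obtain S where S: "finite S" "S \<subseteq> carrier M"
    and gen: "\<And>x. x \<in> carrier M \<Longrightarrow> \<exists>c\<in>S \<rightarrow> carrier A. x = (\<Oplus>\<^bsub>M\<^esub>s\<in>S. c s \<odot>\<^bsub>M\<^esub> s)"
    unfolding finitely_generated_def by blast
  let ?F = "free_module A I"
  have F: "carrier ?F = {f \<in> I \<rightarrow>\<^sub>E carrier A. finite {i \<in> I. f i \<noteq> \<zero>\<^bsub>A\<^esub>}}"
    "\<And>f g. f \<oplus>\<^bsub>?F\<^esub> g = (\<lambda>i\<in>I. f i \<oplus>\<^bsub>A\<^esub> g i)" "\<And>a f. a \<odot>\<^bsub>?F\<^esub> f = (\<lambda>i\<in>I. a \<otimes>\<^bsub>A\<^esub> f i)"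
    by (simp_all add: free_module_def direct_sum_def)
  define l where "l i = (\<lambda>x\<in>carrier M. j x i)" for i
  have l: "l i \<in> module_homs A M (regular_module A)" if i: "i \<in> I" for i
    using module_homsD[OF j] i
    by (intro module_homsI) (auto simp: l_def F M.M.a_closed M.smult_closed dest: PiE_mem)
  define \<delta> where "\<delta> i = (\<lambda>k\<in>I. if k = i then \<one>\<^bsub>A\<^esub> else \<zero>\<^bsub>A\<^esub>)" for i
  have \<delta>: "\<delta> i \<in> carrier ?F" for i
  proof -
    have "finite {k \<in> I. \<delta> i k \<noteq> \<zero>\<^bsub>A\<^esub>}"
      by (rule finite_subset[of _ "{i}"]) (auto simp: \<delta>_def split: if_splits)
    then show ?thesis by (auto simp: F \<delta>_def)
  qed
  have q0: "q (\<lambda>i\<in>I. \<zero>\<^bsub>A\<^esub>) = \<zero>\<^bsub>M\<^esub>"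
  proof -
    have z: "(\<lambda>i\<in>I. \<zero>\<^bsub>A\<^esub>) \<in> carrier ?F" by (simp add: F)
    have "(\<lambda>i\<in>I. \<zero>\<^bsub>A\<^esub>) \<oplus>\<^bsub>?F\<^esub> (\<lambda>i\<in>I. \<zero>\<^bsub>A\<^esub>) = (\<lambda>i\<in>I. \<zero>\<^bsub>A\<^esub>)"
      by (auto simp: F)
    then show ?thesis
      using module_homsD(2)[OF q z z] module_homsD(1)[OF q z]
      by (metis M.M.add.l_cancel_one')
  qed
  \<comment> \<open>Expansion in the standard basis \<open>\<delta>\<close>, by induction on a
    finite set that contains the support.\<close>
  have q_eq: "q f = (\<Oplus>\<^bsub>M\<^esub>i\<in>J. f i \<odot>\<^bsub>M\<^esub> q (\<delta> i))"
    if "finite J" "J \<subseteq> I" "f \<in> carrier ?F" "\<And>i. i \<in> I - J \<Longrightarrow> f i = \<zero>\<^bsub>A\<^esub>" for J f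
    using that
  proof (induction J arbitrary: f rule: finite_induct)
    case empty
    then have "f = (\<lambda>i\<in>I. \<zero>\<^bsub>A\<^esub>)" by (intro ext) (auto simp: F PiE_def extensional_def)
    then show ?case by (simp only: q0 M.M.finsum_empty)
  next
    case (insert i J)
    define g where "g = f(i := \<zero>\<^bsub>A\<^esub>)"
    have fi: "f i \<in> carrier A" and iI: "i \<in> I" using insert.prems by (auto simp: F)
    have g: "g \<in> carrier ?F"
    proof -
      have "{k \<in> I. g k \<noteq> \<zero>\<^bsub>A\<^esub>} \<subseteq> {k \<in> I. f k \<noteq> \<zero>\<^bsub>A\<^esub>}" by (auto simp: g_def)
      then have "finite {k \<in> I. g k \<noteq> \<zero>\<^bsub>A\<^esub>}"
        by (rule finite_subset) (use insert.prems(2) in \<open>simp add: F\<close>)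
      then show ?thesis using insert.prems(2) iI by (auto simp: F g_def PiE_def extensional_def)
    qed
    have fcl: "\<And>k. k \<in> I \<Longrightarrow> f k \<in> carrier A" and "f \<in> extensional I"
      using insert.prems(2) by (auto simp: F PiE_def)
    then have dec: "f = (f i \<odot>\<^bsub>?F\<^esub> \<delta> i) \<oplus>\<^bsub>?F\<^esub> g"
      using fi iI by (intro ext) (auto simp: F g_def \<delta>_def extensional_def)
    have fd: "f i \<odot>\<^bsub>?F\<^esub> \<delta> i \<in> carrier ?F"
    proof -
      have "finite {k \<in> I. (f i \<odot>\<^bsub>?F\<^esub> \<delta> i) k \<noteq> \<zero>\<^bsub>A\<^esub>}"
        by (rule finite_subset[of _ "{i}"]) (use fi in \<open>auto simp: F \<delta>_def split: if_splits\<close>)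
      then show ?thesis using fi by (auto simp: F \<delta>_def)
    qed
    have "q f = f i \<odot>\<^bsub>M\<^esub> q (\<delta> i) \<oplus>\<^bsub>M\<^esub> q g"
      by (subst dec, subst module_homsD(2)[OF q fd g], subst module_homsD(3)[OF q fi \<delta>]) (rule refl)
    also have "q g = (\<Oplus>\<^bsub>M\<^esub>i\<in>J. g i \<odot>\<^bsub>M\<^esub> q (\<delta> i))"
      using insert.prems by (intro insert.IH g) (auto simp: g_def)
    also have "\<dots> = (\<Oplus>\<^bsub>M\<^esub>i\<in>J. f i \<odot>\<^bsub>M\<^esub> q (\<delta> i))"
      using insert fcl module_homsD(1)[OF q \<delta>]
      by (intro M.M.finsum_cong') (auto simp: g_def intro!: M.smult_closed)
    finally show ?case
      using insert fcl module_homsD(1)[OF q \<delta>] by (subst M.M.finsum_insert) (auto intro!: M.smult_closed)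
  qed
  define J where "J = (\<Union>s\<in>S. {i \<in> I. j s i \<noteq> \<zero>\<^bsub>A\<^esub>})"
  have J: "finite J" "J \<subseteq> I"
    using S module_homsD(1)[OF j] by (auto simp: J_def F)
  \<comment> \<open>A coordinate outside \<open>J\<close> vanishes on the generators and hence on
    all of \<open>M\<close>.\<close>
  have lJ: "l i x = \<zero>\<^bsub>A\<^esub>" if x: "x \<in> carrier M" and i: "i \<in> I - J" for i x
  proof -
    obtain c where c: "c \<in> S \<rightarrow> carrier A" "x = (\<Oplus>\<^bsub>M\<^esub>s\<in>S. c s \<odot>\<^bsub>M\<^esub> s)" using gen[OF x] by blast
    have li: "l i \<in> module_homs A M (regular_module A)" using l i by blast
    have l0: "l i \<zero>\<^bsub>M\<^esub> = \<zero>\<^bsub>A\<^esub>"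
      using module_homsD(2)[OF li M.M.zero_closed M.M.zero_closed] module_homsD(1)[OF li M.M.zero_closed]
      by simp
    have "l i x = (\<Oplus>\<^bsub>A\<^esub>s\<in>S. l i (c s \<odot>\<^bsub>M\<^esub> s))"
      unfolding c(2)
      by (rule additive_finsum[OF M.M.abelian_group_axioms M.R.abelian_group_axioms])
        (use l0 module_homsD[OF li] S c(1) in \<open>auto intro!: M.smult_closed\<close>)
    also have "\<dots> = \<zero>\<^bsub>A\<^esub>"
    proof (rule M.R.add.finprod_one_eqI)
      fix s assume s: "s \<in> S"
      then have "l i s = \<zero>\<^bsub>A\<^esub>" using i S by (auto simp: l_def J_def)
      then show "l i (c s \<odot>\<^bsub>M\<^esub> s) = \<zero>\<^bsub>A\<^esub>"
        using module_homsD(3)[OF li] s S(2) c(1) by (auto simp: Pi_def)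
    qed
    finally show ?thesis .
  qed
  show ?thesis
  proof (rule exI[of _ J], rule exI[of _ l], rule exI[of _ "\<lambda>i. q (\<delta> i)"], intro conjI ballI)
    show "finite J" by (rule J)
    show "l i \<in> module_homs A M (regular_module A)" if "i \<in> J" for i using that l J by blast
    show "q (\<delta> i) \<in> carrier M" for i by (rule module_homsD(1)[OF q \<delta>])
    fix x assume x: "x \<in> carrier M"
    have "x = q (j x)" using qj[OF x] by simp
    also have "\<dots> = (\<Oplus>\<^bsub>M\<^esub>i\<in>J. j x i \<odot>\<^bsub>M\<^esub> q (\<delta> i))"
      by (rule q_eq[OF J module_homsD(1)[OF j x]]) (use lJ[OF x] x in \<open>simp add: l_def\<close>)
    also have "\<dots> = (\<Oplus>\<^bsub>M\<^esub>i\<in>J. l i x \<odot>\<^bsub>M\<^esub> q (\<delta> i))"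
      using x by (simp add: l_def)
    finally show "x = (\<Oplus>\<^bsub>M\<^esub>i\<in>J. l i x \<odot>\<^bsub>M\<^esub> q (\<delta> i))" .
  qed
qed

section \<open>From modules over the algebra to modules with a group action\<close>

definition scalar_restriction :: "('r, 'a) module \<Rightarrow> ('a, 'm, 'z) module_scheme \<Rightarrow> ('r, 'm) module" where
  "scalar_restriction A M =
     \<lparr>carrier = carrier M, monoid.mult = undefined, one = undefined, ring.zero = \<zero>\<^bsub>M\<^esub>, add = add M,
      smult = (\<lambda>r x. (r \<odot>\<^bsub>A\<^esub> \<one>\<^bsub>A\<^esub>) \<odot>\<^bsub>M\<^esub> x)\<rparr>"

lemma scalar_restriction_simps [simp]:
  "carrier (scalar_restriction A M) = carrier M"
  "\<zero>\<^bsub>scalar_restriction A M\<^esub> = \<zero>\<^bsub>M\<^esub>"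
  "x \<oplus>\<^bsub>scalar_restriction A M\<^esub> y = x \<oplus>\<^bsub>M\<^esub> y"
  "r \<odot>\<^bsub>scalar_restriction A M\<^esub> x = (r \<odot>\<^bsub>A\<^esub> \<one>\<^bsub>A\<^esub>) \<odot>\<^bsub>M\<^esub> x"
  by (simp_all add: scalar_restriction_def)

lemma finsum_scalar_restriction [simp]: "finsum (scalar_restriction A M) f I = finsum M f I"
  by (rule finsum_eqI) (simp_all add: scalar_restriction_def)

text \<open>An \<open>R\<close>-algebra \<open>A\<close> with basis the image under \<open>\<rho>\<close> of a finite group \<open>U\<close>; \<open>\<epsilon>\<close> is the
  coefficient at the unit element.\<close>

locale based_algebra =
  fixes R :: "('r, 'x) ring_scheme" and A :: "('r, 'a) module" and U :: "('u, 'y) monoid_scheme"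
    and \<rho> :: "'u \<Rightarrow> 'a" and \<epsilon> :: "'a \<Rightarrow> 'r"
  assumes base_cring: "cring R" and algebra_ring: "ring A" and basis_group: "group U"
    and basis_finite: "finite (carrier U)"
    and scalar_hom: "(\<lambda>r. r \<odot>\<^bsub>A\<^esub> \<one>\<^bsub>A\<^esub>) \<in> ring_hom R A"
    and scalar_central: "\<lbrakk>r \<in> carrier R; a \<in> carrier A\<rbrakk> \<Longrightarrow>
      (r \<odot>\<^bsub>A\<^esub> \<one>\<^bsub>A\<^esub>) \<otimes>\<^bsub>A\<^esub> a = a \<otimes>\<^bsub>A\<^esub> (r \<odot>\<^bsub>A\<^esub> \<one>\<^bsub>A\<^esub>)"
    and basis_closed: "u \<in> carrier U \<Longrightarrow> \<rho> u \<in> carrier A"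
    and basis_mult: "\<lbrakk>u \<in> carrier U; v \<in> carrier U\<rbrakk> \<Longrightarrow> \<rho> (u \<otimes>\<^bsub>U\<^esub> v) = \<rho> u \<otimes>\<^bsub>A\<^esub> \<rho> v"
    and basis_one: "\<rho> \<one>\<^bsub>U\<^esub> = \<one>\<^bsub>A\<^esub>"
    and coeff_closed: "a \<in> carrier A \<Longrightarrow> \<epsilon> a \<in> carrier R"
    and coeff_add: "\<lbrakk>a \<in> carrier A; b \<in> carrier A\<rbrakk> \<Longrightarrow> \<epsilon> (a \<oplus>\<^bsub>A\<^esub> b) = \<epsilon> a \<oplus>\<^bsub>R\<^esub> \<epsilon> b"
    and coeff_scalar: "\<lbrakk>r \<in> carrier R; a \<in> carrier A\<rbrakk> \<Longrightarrow>
      \<epsilon> ((r \<odot>\<^bsub>A\<^esub> \<one>\<^bsub>A\<^esub>) \<otimes>\<^bsub>A\<^esub> a) = r \<otimes>\<^bsub>R\<^esub> \<epsilon> a"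
    and coeff_basis: "u \<in> carrier U \<Longrightarrow> \<epsilon> (\<rho> u) = (if u = \<one>\<^bsub>U\<^esub> then \<one>\<^bsub>R\<^esub> else \<zero>\<^bsub>R\<^esub>)"
    and basis_span: "\<lbrakk>Z \<subseteq> carrier A;
        \<And>r u. \<lbrakk>r \<in> carrier R; u \<in> carrier U\<rbrakk> \<Longrightarrow> (r \<odot>\<^bsub>A\<^esub> \<one>\<^bsub>A\<^esub>) \<otimes>\<^bsub>A\<^esub> \<rho> u \<in> Z;
        \<And>a b. \<lbrakk>a \<in> Z; b \<in> Z\<rbrakk> \<Longrightarrow> a \<oplus>\<^bsub>A\<^esub> b \<in> Z\<rbrakk> \<Longrightarrow> carrier A \<subseteq> Z"
begin

sublocale R: cring R by (rule base_cring)
sublocale A: ring A by (rule algebra_ring)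
sublocale U: group U by (rule basis_group)

definition scalar :: "'r \<Rightarrow> 'a" where "scalar r = r \<odot>\<^bsub>A\<^esub> \<one>\<^bsub>A\<^esub>"

lemma scalar_closed: "r \<in> carrier R \<Longrightarrow> scalar r \<in> carrier A"
  and scalar_add: "\<lbrakk>r \<in> carrier R; s \<in> carrier R\<rbrakk> \<Longrightarrow> scalar (r \<oplus>\<^bsub>R\<^esub> s) = scalar r \<oplus>\<^bsub>A\<^esub> scalar s"
  and scalar_mult: "\<lbrakk>r \<in> carrier R; s \<in> carrier R\<rbrakk> \<Longrightarrow> scalar (r \<otimes>\<^bsub>R\<^esub> s) = scalar r \<otimes>\<^bsub>A\<^esub> scalar s"
  and scalar_one: "scalar \<one>\<^bsub>R\<^esub> = \<one>\<^bsub>A\<^esub>"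
  using scalar_hom by (auto simp: scalar_def ring_hom_def)

lemma scalar_zero: "scalar \<zero>\<^bsub>R\<^esub> = \<zero>\<^bsub>A\<^esub>"
  using scalar_add[of "\<zero>\<^bsub>R\<^esub>" "\<zero>\<^bsub>R\<^esub>"] scalar_closed[of "\<zero>\<^bsub>R\<^esub>"] by simp

lemma module_scalar_restriction:
  assumes "left_module A M" shows "module R (scalar_restriction A M)"
proof -
  interpret M: left_module A M by fact
  have "abelian_group (scalar_restriction A M)"
    by (rule abelian_group_eqI[OF M.M.abelian_group_axioms]) (simp_all add: scalar_restriction_def)
  then show ?thesis
    by (intro moduleI R.is_cring)
      (simp_all add: scalar_def[symmetric] scalar_closed scalar_add scalar_mult scalar_one M.smult_one M.smult_closed
        M.smult_l_distr M.smult_r_distr M.smult_assoc)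
qed

abbreviation act :: "('a, 'm, 'z) module_scheme \<Rightarrow> 'u \<Rightarrow> 'm \<Rightarrow> 'm" where
  "act M \<equiv> (\<lambda>u x. \<rho> u \<odot>\<^bsub>M\<^esub> x)"

lemma group_module_scalar_restriction:
  assumes "left_module A M" shows "group_module R U (scalar_restriction A M) (act M)"
proof -
  interpret M: left_module A M by fact
  show ?thesis
  proof (intro group_module.intro module_scalar_restriction[OF assms] U.group_axioms group_module_axioms.intro)
    fix u assume u: "u \<in> carrier U"
    have "\<rho> u \<odot>\<^bsub>M\<^esub> (scalar r \<odot>\<^bsub>M\<^esub> x) = scalar r \<odot>\<^bsub>M\<^esub> (\<rho> u \<odot>\<^bsub>M\<^esub> x)"
      if "r \<in> carrier R" "x \<in> carrier M" for r x
      using that u scalar_central[of r "\<rho> u"]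
      by (simp add: M.smult_assoc[symmetric] scalar_closed basis_closed) (simp add: scalar_def)
    then show "act M u \<in> linear_maps R (scalar_restriction A M) (scalar_restriction A M)"
      using u by (intro linear_mapsI) (simp_all add: M.smult_closed M.smult_r_distr basis_closed scalar_def)
  qed (simp_all add: basis_one basis_mult basis_closed M.smult_one M.smult_assoc)
qed

text \<open>\<open>A\<close> is additively spanned by products of scalars and basis elements, so
  commuting with these two kinds of elements is commuting with \<open>A\<close>. Through this
  equivalence Hom sets over \<open>A\<close> become sets of equivariant R-linear maps.\<close>

lemma module_homs_iff_equivariant:
  assumes M: "left_module A M" and N: "left_module A N"
  shows "f \<in> module_homs A M N \<longleftrightarrow> f \<in> extensional (carrier M) \<and>
    f \<in> equivariant_maps R U (scalar_restriction A M) (act M) (scalar_restriction A N) (act N)"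
proof (intro iffI conjI; (elim conjE)?)
  assume f: "f \<in> module_homs A M N"
  then show "f \<in> extensional (carrier M)" by (rule module_homsD)
  show "f \<in> equivariant_maps R U (scalar_restriction A M) (act M) (scalar_restriction A N) (act N)"
    using module_homsD[OF f] scalar_closed
    by (intro equivariant_mapsI linear_mapsI) (simp_all add: scalar_def basis_closed)
next
  interpret M: left_module A M by fact
  interpret N: left_module A N by fact
  assume f: "f \<in> equivariant_maps R U (scalar_restriction A M) (act M) (scalar_restriction A N) (act N)"
    and ext: "f \<in> extensional (carrier M)"
  note f' = equivariant_mapsD[OF f, simplified, folded scalar_def]
  let ?Z = "{a \<in> carrier A. \<forall>x\<in>carrier M. f (a \<odot>\<^bsub>M\<^esub> x) = a \<odot>\<^bsub>N\<^esub> f x}"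
  have "carrier A \<subseteq> ?Z"
  proof (rule basis_span)
    show "(r \<odot>\<^bsub>A\<^esub> \<one>\<^bsub>A\<^esub>) \<otimes>\<^bsub>A\<^esub> \<rho> u \<in> ?Z" if "r \<in> carrier R" "u \<in> carrier U" for r u
      using that f' unfolding scalar_def[symmetric]
      by (simp add: scalar_closed basis_closed M.smult_assoc N.smult_assoc M.smult_closed)
    show "a \<oplus>\<^bsub>A\<^esub> b \<in> ?Z" if "a \<in> ?Z" "b \<in> ?Z" for a b
      using that f' by (simp add: M.smult_l_distr N.smult_l_distr M.smult_closed)
  qed blast
  then show "f \<in> module_homs A M N"
    using f' ext by (intro module_homsI) auto
qed

lemmas module_homs_equivariant = conjunct2[OF iffD1[OF module_homs_iff_equivariant]]

text \<open>The inverse of composition with \<open>\<epsilon>\<close>, under which A-linear maps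
  into \<open>A\<close> correspond to R-linear forms: a form \<open>l\<close> becomes the map that
  sends \<open>x\<close> to the sum over \<open>u\<close> of u l(u^-1 x).\<close>

definition hom_of_functional :: "('a, 'm, 'z) module_scheme \<Rightarrow> ('m \<Rightarrow> 'r) \<Rightarrow> 'm \<Rightarrow> 'a" where
  "hom_of_functional M l =
     trace_map U (act M) (scalar_restriction A (regular_module A)) (act (regular_module A)) (\<lambda>x. scalar (l x))"

lemma hom_of_functional_eq:
  "hom_of_functional M l x = (\<Oplus>\<^bsub>A\<^esub>u\<in>carrier U. \<rho> u \<otimes>\<^bsub>A\<^esub> scalar (l (\<rho> (inv\<^bsub>U\<^esub> u) \<odot>\<^bsub>M\<^esub> x)))"
  by (simp add: hom_of_functional_def trace_map_def)

lemma hom_of_functional_equivariant: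
  assumes "left_module A M" "l \<in> linear_maps R (scalar_restriction A M) (regular_module R)"
  shows "hom_of_functional M l \<in> equivariant_maps R U (scalar_restriction A M) (act M)
     (scalar_restriction A (regular_module A)) (act (regular_module A))"
  unfolding hom_of_functional_def
proof (rule trace_map_equivariant)
  show "group_module R U (scalar_restriction A M) (act M)"
    by (rule group_module_scalar_restriction[OF assms(1)])
  show "group_module R U (scalar_restriction A (regular_module A)) (act (regular_module A))"
    by (rule group_module_scalar_restriction[OF A.left_module_regular_module])
  show "(\<lambda>x. scalar (l x)) \<in> linear_maps R (scalar_restriction A M) (scalar_restriction A (regular_module A))"
    using linear_mapsD[OF assms(2)]
    by (intro linear_mapsI) (simp_all add: scalar_closed scalar_add scalar_mult scalar_def[symmetric])
qed (rule basis_finite)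

lemma coeff_linear: "\<epsilon> \<in> linear_maps R (scalar_restriction A (regular_module A)) (regular_module R)"
  by (intro linear_mapsI) (simp_all add: coeff_closed coeff_add coeff_scalar)

lemma coeff_finsum:
  assumes "finite I" "f \<in> I \<rightarrow> carrier A"
  shows "\<epsilon> (\<Oplus>\<^bsub>A\<^esub>i\<in>I. f i) = (\<Oplus>\<^bsub>R\<^esub>i\<in>I. \<epsilon> (f i))"
  using linear_maps_finsum[OF module_scalar_restriction[OF A.left_module_regular_module]
      R.module_regular_module coeff_linear assms(1), of f] assms(2) by simp

text \<open>Taking the coefficient at 1 leaves only the summand for the unit of
  \<open>U\<close>.\<close>

lemma coeff_hom_of_functional:
  assumes M: "left_module A M" and l: "l \<in> linear_maps R (scalar_restriction A M) (regular_module R)"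
    and x: "x \<in> carrier M"
  shows "\<epsilon> (hom_of_functional M l x) = l x"
proof -
  interpret M: left_module A M by fact
  have lcl: "l (\<rho> (inv\<^bsub>U\<^esub> u) \<odot>\<^bsub>M\<^esub> x) \<in> carrier R" if "u \<in> carrier U" for u
    using functional_closed[OF l] that x by (simp add: M.smult_closed basis_closed)
  have "\<epsilon> (hom_of_functional M l x)
      = (\<Oplus>\<^bsub>R\<^esub>u\<in>carrier U. \<epsilon> (\<rho> u \<otimes>\<^bsub>A\<^esub> scalar (l (\<rho> (inv\<^bsub>U\<^esub> u) \<odot>\<^bsub>M\<^esub> x))))"
    unfolding hom_of_functional_eq using lcl
    by (intro coeff_finsum basis_finite) (simp add: scalar_closed basis_closed)
  also have "\<dots> = (\<Oplus>\<^bsub>R\<^esub>u\<in>carrier U. if \<one>\<^bsub>U\<^esub> = u then l (\<rho> (inv\<^bsub>U\<^esub> u) \<odot>\<^bsub>M\<^esub> x) else \<zero>\<^bsub>R\<^esub>)"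
  proof (rule R.finsum_cong')
    fix u assume u: "u \<in> carrier U"
    have "\<epsilon> (\<rho> u \<otimes>\<^bsub>A\<^esub> scalar r) = r \<otimes>\<^bsub>R\<^esub> \<epsilon> (\<rho> u)" if "r \<in> carrier R" for r
      using coeff_scalar[OF that basis_closed[OF u]] scalar_central[OF that basis_closed[OF u]]
      by (simp add: scalar_def)
    then show "\<epsilon> (\<rho> u \<otimes>\<^bsub>A\<^esub> scalar (l (\<rho> (inv\<^bsub>U\<^esub> u) \<odot>\<^bsub>M\<^esub> x)))
        = (if \<one>\<^bsub>U\<^esub> = u then l (\<rho> (inv\<^bsub>U\<^esub> u) \<odot>\<^bsub>M\<^esub> x) else \<zero>\<^bsub>R\<^esub>)"
      using u lcl by (auto simp: coeff_basis)
  qed (use lcl in auto)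
  also have "\<dots> = l (\<rho> (inv\<^bsub>U\<^esub> \<one>\<^bsub>U\<^esub>) \<odot>\<^bsub>M\<^esub> x)"
    using lcl by (intro R.finsum_singleton basis_finite) auto
  finally show ?thesis using x by (simp add: basis_one M.smult_one)
qed

text \<open>This is the expansion of \<open>a\<close> in the basis, the coefficient at
  \<open>u\<close> being \<epsilon>(u^-1 a). As both sides are R-linear and equivariant, it is
  enough to compare them at 1.\<close>

lemma hom_of_functional_coeff:
  assumes "a \<in> carrier A"
  shows "hom_of_functional (regular_module A) \<epsilon> a = a"
proof -
  let ?h = "hom_of_functional (regular_module A) \<epsilon>"
  note h = equivariant_mapsD[OF hom_of_functional_equivariant[OF A.left_module_regular_module coeff_linear],
      simplified, folded scalar_def]
  let ?Z = "{a \<in> carrier A. ?h a = a}"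
  have "?h \<one>\<^bsub>A\<^esub> = (\<Oplus>\<^bsub>A\<^esub>u\<in>carrier U. if \<one>\<^bsub>U\<^esub> = u then \<rho> u else \<zero>\<^bsub>A\<^esub>)"
    unfolding hom_of_functional_eq
  proof (rule A.finsum_cong')
    fix u assume u: "u \<in> carrier U"
    then have "inv\<^bsub>U\<^esub> u = \<one>\<^bsub>U\<^esub> \<longleftrightarrow> u = \<one>\<^bsub>U\<^esub>" by (metis U.inv_inv U.inv_one)
    then show "\<rho> u \<otimes>\<^bsub>A\<^esub> scalar (\<epsilon> (\<rho> (inv\<^bsub>U\<^esub> u) \<odot>\<^bsub>regular_module A\<^esub> \<one>\<^bsub>A\<^esub>))
        = (if \<one>\<^bsub>U\<^esub> = u then \<rho> u else \<zero>\<^bsub>A\<^esub>)"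
      using u by (auto simp: basis_closed coeff_basis scalar_one scalar_zero)
  qed (auto simp: basis_closed)
  also have "\<dots> = \<one>\<^bsub>A\<^esub>"
    using basis_one by (subst A.finsum_singleton) (auto simp: basis_finite basis_closed)
  finally have h1: "?h \<one>\<^bsub>A\<^esub> = \<one>\<^bsub>A\<^esub>" .
  have "carrier A \<subseteq> ?Z"
  proof (rule basis_span)
    fix r u assume r: "r \<in> carrier R" and u: "u \<in> carrier U"
    have "?h (\<rho> u) = \<rho> u"
      using h(2)[OF u, of "\<one>\<^bsub>A\<^esub>"] h1 u by (simp add: basis_closed)
    then show "(r \<odot>\<^bsub>A\<^esub> \<one>\<^bsub>A\<^esub>) \<otimes>\<^bsub>A\<^esub> \<rho> u \<in> ?Z"
      using h(5)[OF r, of "\<rho> u"] r u by (simp add: scalar_def[symmetric] scalar_closed basis_closed)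
  qed (auto simp: h(4))
  then show ?thesis using assms by blast
qed

text \<open>For a dual basis \<open>l i\<close>, \<open>p i\<close>, let \<theta> send x to the sum
  of the \<epsilon>(l_i(x)) p_i. Its trace is the sum over i and u of u \<epsilon>(u^-1 l_i(x)) p_i,
  and the sum over u reassembles l_i(x).\<close>

lemma group_projective_of_projective:
  fixes M :: "('a, 'm) module"
  assumes proj: "projective A M" and fg: "finitely_generated A M"
  shows "group_projective R U (scalar_restriction A M) (act M)"
proof -
  from proj have lm: "left_module A M" by (simp add: projective_def)
  interpret M: left_module A M by fact
  interpret RM: module R "scalar_restriction A M" by (rule module_scalar_restriction[OF lm])
  obtain I :: "'m set" and l p where I: "finite I" and l: "\<And>i. i \<in> I \<Longrightarrow> l i \<in> module_homs A M (regular_module A)"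
    and p: "\<And>i. i \<in> I \<Longrightarrow> p i \<in> carrier M"
    and x_eq: "\<And>x. x \<in> carrier M \<Longrightarrow> x = (\<Oplus>\<^bsub>M\<^esub>i\<in>I. l i x \<odot>\<^bsub>M\<^esub> p i)"
    using projective_dual_basis[OF proj fg] by blast
  note l' = module_homsD[OF l, simplified]
  have \<mu>: "(\<lambda>x. \<epsilon> (l i x)) \<in> linear_maps R (scalar_restriction A M) (regular_module R)" if "i \<in> I" for i
  proof (rule linear_maps_compose[OF _ coeff_linear])
    show "l i \<in> linear_maps R (scalar_restriction A M) (scalar_restriction A (regular_module A))"
      by (rule equivariant_mapsD(1)[OF module_homs_equivariant[OF lm A.left_module_regular_module l[OF that]]])
  qed
  note \<mu>cl = functional_closed[OF \<mu>, simplified]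
  let ?\<theta> = "\<lambda>x. \<Oplus>\<^bsub>M\<^esub>i\<in>I. scalar (\<epsilon> (l i x)) \<odot>\<^bsub>M\<^esub> p i"
  have "finite_rank R (scalar_restriction A M) ?\<theta>"
    by (rule finite_rankI[OF RM.module_axioms I \<mu>]) (simp_all add: p scalar_def)
  moreover have "trace_map U (act M) (scalar_restriction A M) (act M) ?\<theta> x = x" if x: "x \<in> carrier M" for x
  proof -
    let ?t = "\<lambda>u i. (\<rho> u \<otimes>\<^bsub>A\<^esub> scalar (\<epsilon> (\<rho> (inv\<^bsub>U\<^esub> u) \<otimes>\<^bsub>A\<^esub> l i x))) \<odot>\<^bsub>M\<^esub> p i"
    have ecl: "\<epsilon> (\<rho> (inv\<^bsub>U\<^esub> u) \<otimes>\<^bsub>A\<^esub> l i x) \<in> carrier R" if "u \<in> carrier U" "i \<in> I" for u i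
      using that x l' by (intro coeff_closed) (simp add: basis_closed)
    have "trace_map U (act M) (scalar_restriction A M) (act M) ?\<theta> x
        = (\<Oplus>\<^bsub>M\<^esub>u\<in>carrier U. \<Oplus>\<^bsub>M\<^esub>i\<in>I. ?t u i)"
      unfolding trace_map_def finsum_scalar_restriction
    proof (rule M.M.finsum_cong')
      fix u assume u: "u \<in> carrier U"
      have "\<rho> u \<odot>\<^bsub>M\<^esub> ?\<theta> (\<rho> (inv\<^bsub>U\<^esub> u) \<odot>\<^bsub>M\<^esub> x)
          = (\<Oplus>\<^bsub>M\<^esub>i\<in>I. \<rho> u \<odot>\<^bsub>M\<^esub> (scalar (\<epsilon> (l i (\<rho> (inv\<^bsub>U\<^esub> u) \<odot>\<^bsub>M\<^esub> x))) \<odot>\<^bsub>M\<^esub> p i))"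
        using u x p
        by (intro left_module_finsum[OF lm basis_closed[OF u] I])
          (auto intro!: M.smult_closed scalar_closed basis_closed \<mu>cl)
      also have "\<dots> = (\<Oplus>\<^bsub>M\<^esub>i\<in>I. ?t u i)"
        using u x p l' ecl
        by (intro M.M.finsum_cong') (auto simp: M.smult_assoc basis_closed scalar_closed M.smult_closed)
      finally show "\<rho> u \<odot>\<^bsub>M\<^esub> ?\<theta> (\<rho> (inv\<^bsub>U\<^esub> u) \<odot>\<^bsub>M\<^esub> x) = (\<Oplus>\<^bsub>M\<^esub>i\<in>I. ?t u i)" .
    qed (use ecl p in \<open>auto intro!: M.M.finsum_closed M.smult_closed scalar_closed basis_closed\<close>)
    also have "\<dots> = (\<Oplus>\<^bsub>M\<^esub>i\<in>I. \<Oplus>\<^bsub>M\<^esub>u\<in>carrier U. ?t u i)"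
      using ecl p by (intro M.M.finsum_swap basis_finite I) (auto intro!: M.smult_closed scalar_closed basis_closed)
    also have "\<dots> = (\<Oplus>\<^bsub>M\<^esub>i\<in>I. l i x \<odot>\<^bsub>M\<^esub> p i)"
    proof (rule M.M.finsum_cong')
      fix i assume i: "i \<in> I"
      have "l i x = (\<Oplus>\<^bsub>A\<^esub>u\<in>carrier U. \<rho> u \<otimes>\<^bsub>A\<^esub> scalar (\<epsilon> (\<rho> (inv\<^bsub>U\<^esub> u) \<otimes>\<^bsub>A\<^esub> l i x)))"
        using hom_of_functional_coeff[OF l'(1)[OF i x]] by (simp add: hom_of_functional_eq)
      then show "(\<Oplus>\<^bsub>M\<^esub>u\<in>carrier U. ?t u i) = l i x \<odot>\<^bsub>M\<^esub> p i"
        using left_module_finsum_smult[OF lm p[OF i] basis_finite,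
            of "\<lambda>u. \<rho> u \<otimes>\<^bsub>A\<^esub> scalar (\<epsilon> (\<rho> (inv\<^bsub>U\<^esub> u) \<otimes>\<^bsub>A\<^esub> l i x))"] ecl i
        by (simp add: Pi_def basis_closed scalar_closed)
    qed (use l' p x in \<open>auto intro!: M.smult_closed\<close>)
    finally show ?thesis by (rule trans[OF _ x_eq[OF x, symmetric]])
  qed
  ultimately show ?thesis unfolding group_projective_def by (intro exI[of _ ?\<theta>] conjI ballI) simp_all
qed

text \<open>The form \<open>l\<close> is turned into an A-linear map into \<open>A\<close> whose
  coefficient at 1 it is. Each summand of that map vanishes on boundaries, so it is a cocycle and by
  assumption factors through \<open>d n\<close>; the coefficient at 1 of the factor is the form
  sought.\<close>

lemma dual_exact_of_hom_exact:
  assumes P: "chain_complex A P d"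
    and ex: "cocycles A P d (regular_module A) n = coboundaries A P d (regular_module A) n"
    and l: "l \<in> linear_maps R (scalar_restriction A (P n)) (regular_module R)"
    and ld: "\<And>x. x \<in> carrier (P (n + 1)) \<Longrightarrow> l (d (n + 1) x) = \<zero>\<^bsub>R\<^esub>"
  shows "\<exists>\<kappa>\<in>linear_maps R (scalar_restriction A (P (n - 1))) (regular_module R).
    \<forall>x\<in>carrier (P n). l x = \<kappa> (d n x)"
proof -
  have lm: "left_module A (P n)" for n using P by (simp add: chain_complex_def)
  interpret Pn: left_module A "P n" by (rule lm)
  interpret PS: left_module A "P (n + 1)" by (rule lm)
  have d: "d n \<in> module_homs A (P n) (P (n - 1))" for n using P by (simp add: chain_complex_def)
  have dS: "d (n + 1) \<in> module_homs A (P (n + 1)) (P n)" using d[of "n + 1"] by simp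
  let ?h = "\<lambda>x\<in>carrier (P n). hom_of_functional (P n) l x"
  note h = equivariant_mapsD[OF hom_of_functional_equivariant[OF lm l], simplified]
  have "?h \<in> cocycles A P d (regular_module A) n"
  proof -
    have "?h \<in> module_homs A (P n) (regular_module A)"
      unfolding module_homs_iff_equivariant[OF lm A.left_module_regular_module]
      using h by (intro conjI equivariant_mapsI linear_mapsI)
        (simp_all add: Pn.smult_closed scalar_closed[unfolded scalar_def] basis_closed)
    moreover have "?h (d (n + 1) x) = \<zero>\<^bsub>A\<^esub>" if x: "x \<in> carrier (P (n + 1))" for x
    proof -
      have "hom_of_functional (P n) l (d (n + 1) x) = \<zero>\<^bsub>A\<^esub>"
        unfolding hom_of_functional_eq
      proof (rule A.add.finprod_one_eqI)
        fix u assume u: "u \<in> carrier U"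
        have "\<rho> (inv\<^bsub>U\<^esub> u) \<odot>\<^bsub>P n\<^esub> d (n + 1) x = d (n + 1) (\<rho> (inv\<^bsub>U\<^esub> u) \<odot>\<^bsub>P (n + 1)\<^esub> x)"
          using module_homsD(3)[OF dS] u x by (simp add: basis_closed)
        then show "\<rho> u \<otimes>\<^bsub>A\<^esub> scalar (l (\<rho> (inv\<^bsub>U\<^esub> u) \<odot>\<^bsub>P n\<^esub> d (n + 1) x)) = \<zero>\<^bsub>A\<^esub>"
          using u x ld by (simp add: basis_closed PS.smult_closed scalar_zero)
      qed
      then show ?thesis using module_homsD(1)[OF dS x] by simp
    qed
    ultimately show ?thesis by (simp add: cocycles_def)
  qed
  then obtain k where k: "k \<in> module_homs A (P (n - 1)) (regular_module A)"
    and hk: "?h = compose (carrier (P n)) k (d n)"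
    unfolding ex coboundaries_def by blast
  show ?thesis
  proof (intro bexI ballI)
    show "(\<lambda>x. \<epsilon> (k x)) \<in> linear_maps R (scalar_restriction A (P (n - 1))) (regular_module R)"
      by (rule linear_maps_compose[OF _ coeff_linear])
        (rule equivariant_mapsD(1)[OF module_homs_equivariant[OF lm A.left_module_regular_module k]])
    fix x assume x: "x \<in> carrier (P n)"
    show "l x = \<epsilon> (k (d n x))"
      using fun_cong[OF hk, of x] coeff_hom_of_functional[OF lm l x] x by (simp add: compose_def)
  qed
qed

text \<open>The laws of a left module pass to \<open>M\<close> from \<open>Q 0\<close> along the
  augmentation. The augmentation of \<open>P\<close> is \<open>\<epsilon>'\<close> after
  \<open>\<phi> 0\<close>, and bijectivity of \<open>\<phi> 0\<close> and \<open>\<phi> 1\<close>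
  carries over its surjectivity and its kernel.\<close>

lemma complete_resolution_imp_complex:
  assumes cr: "complete_resolution A M P d" and M: "abelian_group M"
  shows "left_module A M \<and> (\<exists>\<eta>. complete_resolution_complex R U
    (\<lambda>n. scalar_restriction A (P n)) (\<lambda>n. act (P n)) d (scalar_restriction A M) (act M) \<eta>)"
proof -
  from cr have cc: "chain_complex A P d" and proj: "\<And>n. projective A (P n)"
    and fg: "\<And>n. finitely_generated A (P n)" and exact: "\<And>n. exact_at P d n"
    and dual: "\<And>n. cocycles A P d (regular_module A) n = coboundaries A P d (regular_module A) n"
    by (auto simp: complete_resolution_def)
  from cr obtain Q :: "int \<Rightarrow> ('a, 'c) module" and e \<epsilon>' \<phi> where res: "projective_resolution A M Q e \<epsilon>'"
    and cm: "chain_map A P d Q e \<phi>" and bij: "\<And>n. n \<ge> 0 \<Longrightarrow> bij_betw (\<phi> n) (carrier (P n)) (carrier (Q n))"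
    unfolding complete_resolution_def by blast
  have lmP: "left_module A (P n)" for n using cc by (simp add: chain_complex_def)
  have lmQ: "left_module A (Q n)" for n using res by (simp add: projective_resolution_def chain_complex_def)
  have d: "d n \<in> module_homs A (P n) (P (n - 1))" for n using cc by (simp add: chain_complex_def)
  have \<phi>: "\<phi> n \<in> module_homs A (P n) (Q n)" for n using cm by (simp add: chain_map_def)
  have \<epsilon>': "\<epsilon>' \<in> module_homs A (Q 0) M" and surj: "\<epsilon>' ` carrier (Q 0) = carrier M"
    and ker: "a_kernel (Q 0) M \<epsilon>' = e 1 ` carrier (Q 1)"
    using res by (auto simp: projective_resolution_def)
  have lmM: "left_module A M"
    by (rule left_module_of_surjection[OF lmQ M \<epsilon>' surj])
  let ?\<eta> = "\<lambda>x\<in>carrier (P 0). \<epsilon>' (\<phi> 0 x)"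
  interpret P0: left_module A "P 0" by (rule lmP)
  have im0: "\<phi> 0 ` carrier (P 0) = carrier (Q 0)" and inj0: "inj_on (\<phi> 0) (carrier (P 0))"
    using bij[of 0] by (auto simp: bij_betw_def)
  have im1: "\<phi> 1 ` carrier (P 1) = carrier (Q 1)"
    using bij[of 1] by (auto simp: bij_betw_def)
  have d1: "d 1 \<in> module_homs A (P 1) (P 0)" using d[of 1] by simp
  have ed: "e 1 (\<phi> 1 x) = \<phi> 0 (d 1 x)" if "x \<in> carrier (P 1)" for x
  proof -
    have "\<phi> (1 - 1) (d 1 x) = e 1 (\<phi> 1 x)" using cm that by (simp only: chain_map_def)
    then show ?thesis by simp
  qed
  have \<eta>: "?\<eta> \<in> module_homs A (P 0) M"
    using module_homsD[OF \<phi>[of 0]] module_homsD[OF \<epsilon>'] P0.smult_closed by (intro module_homsI) auto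
  have dual_ex: "\<exists>\<kappa>\<in>linear_maps R (scalar_restriction A (P (n - 1))) (regular_module R).
      \<forall>x\<in>carrier (P n). l x = \<kappa> (d n x)"
    if l: "l \<in> linear_maps R (scalar_restriction A (P n)) (regular_module R)"
      and ld: "\<And>x. x \<in> carrier (P (n + 1)) \<Longrightarrow> l (d (n + 1) x) = \<zero>\<^bsub>R\<^esub>" for n l
    by (rule dual_exact_of_hom_exact[where P = P and n = n and d = d, OF cc dual[of n] l ld])
  have "complete_resolution_complex R U
    (\<lambda>n. scalar_restriction A (P n)) (\<lambda>n. act (P n)) d (scalar_restriction A M) (act M) ?\<eta>"
  proof (intro complete_resolution_complex.intro complete_complex.intro exact_complex.intro
      complete_resolution_complex_axioms.intro complete_complex_axioms.intro; (unfold scalar_restriction_simps)?)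
    fix n
    show "group_module R U (scalar_restriction A (P n)) (act (P n))"
      by (rule group_module_scalar_restriction[OF lmP])
    show "d n \<in> equivariant_maps R U (scalar_restriction A (P n)) (act (P n))
        (scalar_restriction A (P (n - 1))) (act (P (n - 1)))"
      by (rule module_homs_equivariant[OF lmP lmP d])
    show "group_projective R U (scalar_restriction A (P n)) (act (P n))"
      by (rule group_projective_of_projective[OF proj fg])
    show "(d n x = \<zero>\<^bsub>P (n - 1)\<^esub>) = (x \<in> d (n + 1) ` carrier (P (n + 1)))" if "x \<in> carrier (P n)" for x
      using that by (simp add: exact[of n, unfolded exact_at_def] a_kernel_def kernel_def)
    show "\<exists>\<kappa>\<in>linear_maps R (scalar_restriction A (P (n - 1))) (regular_module R).
        \<forall>x\<in>carrier (P n). l x = \<kappa> (d n x)"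
      if "l \<in> linear_maps R (scalar_restriction A (P n)) (regular_module R)"
        "\<And>x. x \<in> carrier (P (n + 1)) \<Longrightarrow> l (d (n + 1) x) = \<zero>\<^bsub>R\<^esub>" for l
      using that by (rule dual_ex)
  next
    show "group_module R U (scalar_restriction A M) (act M)"
      by (rule group_module_scalar_restriction[OF lmM])
    show "?\<eta> \<in> equivariant_maps R U (scalar_restriction A (P 0)) (act (P 0)) (scalar_restriction A M) (act M)"
      by (rule module_homs_equivariant[OF lmP lmM \<eta>])
    show "?\<eta> ` carrier (P 0) = carrier M"
      unfolding surj[symmetric] im0[symmetric] image_image by (rule image_cong) auto
    fix x assume x: "x \<in> carrier (P 0)"
    have "?\<eta> x = \<zero>\<^bsub>M\<^esub> \<longleftrightarrow> \<phi> 0 x \<in> e 1 ` carrier (Q 1)"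
      using x module_homsD(1)[OF \<phi> x] ker by (auto simp: a_kernel_def kernel_def)
    also have "e 1 ` carrier (Q 1) = \<phi> 0 ` d 1 ` carrier (P 1)"
      unfolding im1[symmetric] image_image using ed by (intro image_cong) auto
    also have "\<phi> 0 x \<in> \<phi> 0 ` d 1 ` carrier (P 1) \<longleftrightarrow> x \<in> d 1 ` carrier (P 1)"
      using x module_homsD(1)[OF d1] by (intro inj_on_image_mem_iff[OF inj0]) auto
    finally show "(?\<eta> x = \<zero>\<^bsub>M\<^esub>) = (x \<in> d 1 ` carrier (P 1))" .
  qed (rule basis_finite)
  then show ?thesis using lmM by blast
qed

end

section \<open>Monoid rings\<close>

locale assoc_algebra =
  fixes R :: "('r, 'x) ring_scheme" and A :: "('r, 'a) module"
  assumes module: "module R A" and ring: "ring A"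
    and smult_mult_left: "\<lbrakk>r \<in> carrier R; a \<in> carrier A; b \<in> carrier A\<rbrakk> \<Longrightarrow>
      (r \<odot>\<^bsub>A\<^esub> a) \<otimes>\<^bsub>A\<^esub> b = r \<odot>\<^bsub>A\<^esub> (a \<otimes>\<^bsub>A\<^esub> b)"
    and smult_mult_right: "\<lbrakk>r \<in> carrier R; a \<in> carrier A; b \<in> carrier A\<rbrakk> \<Longrightarrow>
      a \<otimes>\<^bsub>A\<^esub> (r \<odot>\<^bsub>A\<^esub> b) = r \<odot>\<^bsub>A\<^esub> (a \<otimes>\<^bsub>A\<^esub> b)"

text \<open>Arbitrary monoids are allowed because two cases occur: a finite group, for its group
  ring, and the product of the multiplicative monoids of two algebras, for the tensor product. The
  second is infinite in general, so supports have to be tracked.\<close>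

locale monoid_algebra = R: cring R + H: monoid H
  for R :: "('r, 'x) ring_scheme" and H :: "('h, 'y) monoid_scheme"
begin

abbreviation F :: "('r, 'h \<Rightarrow> 'r) module" where "F \<equiv> monoid_ring R H"
abbreviation \<beta> :: "'h \<Rightarrow> 'h \<Rightarrow> 'r" where "\<beta> \<equiv> basis_element R H"
abbreviation supp :: "('h \<Rightarrow> 'r) \<Rightarrow> 'h set" where "supp f \<equiv> {x \<in> carrier H. f x \<noteq> \<zero>\<^bsub>R\<^esub>}"

lemma carrier_F: "carrier F = {f \<in> carrier H \<rightarrow>\<^sub>E carrier R. finite (supp f)}"
  and zero_F: "\<zero>\<^bsub>F\<^esub> = (\<lambda>x\<in>carrier H. \<zero>\<^bsub>R\<^esub>)"
  and add_F: "f \<oplus>\<^bsub>F\<^esub> g = (\<lambda>x\<in>carrier H. f x \<oplus>\<^bsub>R\<^esub> g x)"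
  and smult_F: "r \<odot>\<^bsub>F\<^esub> f = (\<lambda>x\<in>carrier H. r \<otimes>\<^bsub>R\<^esub> f x)"
  and one_F: "\<one>\<^bsub>F\<^esub> = \<beta> \<one>\<^bsub>H\<^esub>"
  by (simp_all add: monoid_ring_def free_module_def direct_sum_def)

lemma F_memI:
  "\<lbrakk>\<And>x. x \<in> carrier H \<Longrightarrow> f x \<in> carrier R; f \<in> extensional (carrier H); finite S; supp f \<subseteq> S\<rbrakk>
    \<Longrightarrow> f \<in> carrier F"
  by (auto simp: carrier_F PiE_def intro: finite_subset)

lemma F_mem:
  assumes "f \<in> carrier F"
  shows "x \<in> carrier H \<Longrightarrow> f x \<in> carrier R" "f \<in> extensional (carrier H)" "finite (supp f)"
  using assms by (auto simp: carrier_F PiE_def)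

lemma F_eqI:
  "\<lbrakk>f \<in> carrier F; g \<in> carrier F; \<And>x. x \<in> carrier H \<Longrightarrow> f x = g x\<rbrakk> \<Longrightarrow> f = g"
  by (rule extensionalityI[of _ "carrier H"]) (auto dest: F_mem(2))

lemma add_closed_F: "\<lbrakk>f \<in> carrier F; g \<in> carrier F\<rbrakk> \<Longrightarrow> f \<oplus>\<^bsub>F\<^esub> g \<in> carrier F"
  by (rule F_memI[where S = "supp f \<union> supp g"]) (auto simp: add_F dest: F_mem)

lemma smult_closed_F: "\<lbrakk>r \<in> carrier R; f \<in> carrier F\<rbrakk> \<Longrightarrow> r \<odot>\<^bsub>F\<^esub> f \<in> carrier F"
  by (rule F_memI[where S = "supp f"]) (auto simp: smult_F dest: F_mem)

lemma zero_closed_F: "\<zero>\<^bsub>F\<^esub> \<in> carrier F"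
  by (rule F_memI[where S = "{}"]) (auto simp: zero_F)

lemma \<beta>_closed: "\<beta> x \<in> carrier F"
  by (rule F_memI[where S = "{x}"]) (auto simp: basis_element_def)

lemma \<beta>_apply: "y \<in> carrier H \<Longrightarrow> \<beta> x y = (if y = x then \<one>\<^bsub>R\<^esub> else \<zero>\<^bsub>R\<^esub>)"
  by (simp add: basis_element_def)

lemma F_apply:
  "x \<in> carrier H \<Longrightarrow> \<zero>\<^bsub>F\<^esub> x = \<zero>\<^bsub>R\<^esub>"
  "x \<in> carrier H \<Longrightarrow> (f \<oplus>\<^bsub>F\<^esub> g) x = f x \<oplus>\<^bsub>R\<^esub> g x"
  "x \<in> carrier H \<Longrightarrow> (r \<odot>\<^bsub>F\<^esub> f) x = r \<otimes>\<^bsub>R\<^esub> f x"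
  by (simp_all add: zero_F add_F smult_F)

lemma abelian_group_F: "abelian_group F"
proof (rule abelian_groupI)
  fix f assume f: "f \<in> carrier F"
  note f' = F_mem[OF f]
  let ?g = "\<lambda>x\<in>carrier H. \<ominus>\<^bsub>R\<^esub> f x"
  have g: "?g \<in> carrier F"
  proof (rule F_memI)
    show "supp ?g \<subseteq> supp f" by auto
  qed (use f' in auto)
  moreover have "?g \<oplus>\<^bsub>F\<^esub> f = \<zero>\<^bsub>F\<^esub>"
    by (rule F_eqI[OF add_closed_F[OF g f] zero_closed_F])
      (simp add: F_apply R.l_neg f')
  ultimately show "\<exists>g\<in>carrier F. g \<oplus>\<^bsub>F\<^esub> f = \<zero>\<^bsub>F\<^esub>" by blast
next
  fix f g h assume fgh: "f \<in> carrier F" "g \<in> carrier F" "h \<in> carrier F"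
  then show "f \<oplus>\<^bsub>F\<^esub> g \<oplus>\<^bsub>F\<^esub> h = f \<oplus>\<^bsub>F\<^esub> (g \<oplus>\<^bsub>F\<^esub> h)"
    by (intro F_eqI) (simp_all add: add_closed_F F_apply R.a_assoc F_mem)
next
  fix f g assume fgh: "f \<in> carrier F" "g \<in> carrier F"
  then show "f \<oplus>\<^bsub>F\<^esub> g = g \<oplus>\<^bsub>F\<^esub> f"
    by (intro F_eqI) (simp_all add: add_closed_F F_apply R.a_comm F_mem)
next
  fix f assume "f \<in> carrier F"
  then show "\<zero>\<^bsub>F\<^esub> \<oplus>\<^bsub>F\<^esub> f = f"
    by (intro F_eqI) (simp_all add: add_closed_F zero_closed_F F_apply F_mem)
qed (auto simp: add_closed_F zero_closed_F)

sublocale F: abelian_group F by (rule abelian_group_F)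

lemma module_F: "module R F"
proof (rule moduleI)
  fix a b f assume ab: "a \<in> carrier R" "b \<in> carrier R" and f: "f \<in> carrier F"
  show "(a \<oplus>\<^bsub>R\<^esub> b) \<odot>\<^bsub>F\<^esub> f = a \<odot>\<^bsub>F\<^esub> f \<oplus>\<^bsub>F\<^esub> b \<odot>\<^bsub>F\<^esub> f"
    using ab f by (intro F_eqI) (simp_all add: smult_closed_F add_closed_F F_apply F_mem R.l_distr)
  show "(a \<otimes>\<^bsub>R\<^esub> b) \<odot>\<^bsub>F\<^esub> f = a \<odot>\<^bsub>F\<^esub> (b \<odot>\<^bsub>F\<^esub> f)"
    using ab f by (intro F_eqI) (simp_all add: smult_closed_F F_apply F_mem R.m_assoc)
next
  fix a f g assume "a \<in> carrier R" "f \<in> carrier F" "g \<in> carrier F"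
  then show "a \<odot>\<^bsub>F\<^esub> (f \<oplus>\<^bsub>F\<^esub> g) = a \<odot>\<^bsub>F\<^esub> f \<oplus>\<^bsub>F\<^esub> a \<odot>\<^bsub>F\<^esub> g"
    by (intro F_eqI) (simp_all add: smult_closed_F add_closed_F F_apply F_mem R.r_distr)
next
  fix f assume "f \<in> carrier F"
  then show "\<one>\<^bsub>R\<^esub> \<odot>\<^bsub>F\<^esub> f = f"
    by (intro F_eqI) (simp_all add: smult_closed_F F_apply F_mem)
qed (auto intro: abelian_group_F smult_closed_F R.is_cring)

text \<open>Linear induction. Identities in the monoid ring that are additive in one argument are
  reduced with it to scaled basis elements, in place of a comparison of convolution sums.\<close>

lemma F_span:
  assumes basis: "\<And>r x. \<lbrakk>r \<in> carrier R; x \<in> carrier H\<rbrakk> \<Longrightarrow> r \<odot>\<^bsub>F\<^esub> \<beta> x \<in> Z"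
    and add: "\<And>f g. \<lbrakk>f \<in> carrier F; g \<in> carrier F; f \<in> Z; g \<in> Z\<rbrakk> \<Longrightarrow> f \<oplus>\<^bsub>F\<^esub> g \<in> Z"
    and f: "f \<in> carrier F"
  shows "f \<in> Z"
proof -
  have *: "finite S \<Longrightarrow> f \<in> carrier F \<Longrightarrow> supp f \<subseteq> S \<Longrightarrow> f \<in> Z" for S f
  proof (induction S arbitrary: f rule: finite_induct)
    case empty
    \<comment> \<open>Zero is a basis element multiplied by the scalar 0, so the empty support is
      covered by \<open>basis\<close>.\<close>
    have "\<zero>\<^bsub>R\<^esub> \<odot>\<^bsub>F\<^esub> \<beta> \<one>\<^bsub>H\<^esub> = f"
      using empty by (intro F_eqI smult_closed_F \<beta>_closed) (auto simp: F_apply \<beta>_apply)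
    then show ?case using basis[OF R.zero_closed H.one_closed] by simp
  next
    case (insert s S)
    show ?case
    proof (cases "s \<in> carrier H")
      case True
      let ?g = "f(s := \<zero>\<^bsub>R\<^esub>)"
      have g: "?g \<in> carrier F"
        using F_mem[OF insert.prems(1)] True
        by (intro F_memI[where S = "supp f"]) (auto simp: extensional_def)
      have fs: "f s \<in> carrier R" using F_mem(1)[OF insert.prems(1) True] .
      have "?g \<in> Z" using insert.prems by (intro insert.IH g) auto
      moreover have "f s \<odot>\<^bsub>F\<^esub> \<beta> s \<oplus>\<^bsub>F\<^esub> ?g = f"
        using g fs insert.prems(1) True F_mem(1)[OF insert.prems(1)]
        by (intro F_eqI add_closed_F smult_closed_F \<beta>_closed) (auto simp: F_apply \<beta>_apply)
      ultimately show ?thesis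
        using add[OF smult_closed_F[OF fs \<beta>_closed] g basis[OF fs True]] by simp
    next
      case False
      then show ?thesis using insert.prems by (intro insert.IH) auto
    qed
  qed
  show ?thesis by (rule *[OF F_mem(3)[OF f] f]) simp
qed

text \<open>The defining sum ranges over the pairs in the supports with product \<open>z\<close>, a
  set that changes with the factors. Over a fixed finite rectangle containing the supports, sums for
  different factors can be added term by term.\<close>

lemma mult_F_apply:
  assumes f: "f \<in> carrier F" and g: "g \<in> carrier F" and z: "z \<in> carrier H"
    and S: "finite S" "supp f \<subseteq> S" "S \<subseteq> carrier H" and T: "finite T" "supp g \<subseteq> T" "T \<subseteq> carrier H"
  shows "(f \<otimes>\<^bsub>F\<^esub> g) z =
    (\<Oplus>\<^bsub>R\<^esub>p\<in>S \<times> T. if fst p \<otimes>\<^bsub>H\<^esub> snd p = z then f (fst p) \<otimes>\<^bsub>R\<^esub> g (snd p) else \<zero>\<^bsub>R\<^esub>)"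
proof -
  have cl: "f x \<in> carrier R" "g y \<in> carrier R" if "x \<in> S" "y \<in> T" for x y
    using that S T F_mem(1)[OF f] F_mem(1)[OF g] by auto
  have "(f \<otimes>\<^bsub>F\<^esub> g) z = (\<Oplus>\<^bsub>R\<^esub>p\<in>{(x, y) \<in> carrier H \<times> carrier H. f x \<noteq> \<zero>\<^bsub>R\<^esub> \<and> g y \<noteq> \<zero>\<^bsub>R\<^esub> \<and> x \<otimes>\<^bsub>H\<^esub> y = z}.
      f (fst p) \<otimes>\<^bsub>R\<^esub> g (snd p))"
    using z by (simp add: monoid_ring_def)
  also have "\<dots> = (\<Oplus>\<^bsub>R\<^esub>p\<in>S \<times> T. if fst p \<otimes>\<^bsub>H\<^esub> snd p = z then f (fst p) \<otimes>\<^bsub>R\<^esub> g (snd p) else \<zero>\<^bsub>R\<^esub>)"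
  proof (rule R.add.finprod_mono_neutral_cong_left)
    show "finite (S \<times> T)" using S T by simp
    show "{(x, y) \<in> carrier H \<times> carrier H. f x \<noteq> \<zero>\<^bsub>R\<^esub> \<and> g y \<noteq> \<zero>\<^bsub>R\<^esub> \<and> x \<otimes>\<^bsub>H\<^esub> y = z} \<subseteq> S \<times> T"
      using S T by auto
  qed (use S(3) T(3) cl in \<open>auto simp: subset_iff\<close>)
  finally show ?thesis .
qed

lemma mult_closed_F:
  assumes f: "f \<in> carrier F" and g: "g \<in> carrier F"
  shows "f \<otimes>\<^bsub>F\<^esub> g \<in> carrier F"
proof (rule F_memI)
  have cl: "f x \<in> carrier R" "g y \<in> carrier R" if "x \<in> carrier H" "y \<in> carrier H" for x y
    using that F_mem(1)[OF f] F_mem(1)[OF g] by auto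
  note eq = mult_F_apply[OF f g _ F_mem(3)[OF f] subset_refl _ F_mem(3)[OF g] subset_refl]
  show "(f \<otimes>\<^bsub>F\<^esub> g) z \<in> carrier R" if "z \<in> carrier H" for z
    using that cl by (subst eq) (auto intro!: R.finsum_closed)
  show "f \<otimes>\<^bsub>F\<^esub> g \<in> extensional (carrier H)" by (simp add: monoid_ring_def)
  show "finite ((\<lambda>(x, y). x \<otimes>\<^bsub>H\<^esub> y) ` (supp f \<times> supp g))"
    using F_mem(3)[OF f] F_mem(3)[OF g] by simp
  show "supp (f \<otimes>\<^bsub>F\<^esub> g) \<subseteq> (\<lambda>(x, y). x \<otimes>\<^bsub>H\<^esub> y) ` (supp f \<times> supp g)"
  proof (rule subsetI, rule ccontr)
    fix z assume z: "z \<in> supp (f \<otimes>\<^bsub>F\<^esub> g)" and n: "z \<notin> (\<lambda>(x, y). x \<otimes>\<^bsub>H\<^esub> y) ` (supp f \<times> supp g)"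
    have "(f \<otimes>\<^bsub>F\<^esub> g) z = \<zero>\<^bsub>R\<^esub>"
      using z n by (subst eq) (auto intro!: R.add.finprod_one_eqI)
    then show False using z by simp
  qed
qed

lemma l_distr_F:
  assumes "f \<in> carrier F" "f' \<in> carrier F" "g \<in> carrier F"
  shows "(f \<oplus>\<^bsub>F\<^esub> f') \<otimes>\<^bsub>F\<^esub> g = f \<otimes>\<^bsub>F\<^esub> g \<oplus>\<^bsub>F\<^esub> f' \<otimes>\<^bsub>F\<^esub> g"
proof (rule F_eqI)
  fix z assume z: "z \<in> carrier H"
  let ?S = "supp f \<union> supp f'"
  note cl = F_mem(1)[OF assms(1)] F_mem(1)[OF assms(2)] F_mem(1)[OF assms(3)]
  have fin: "finite ?S" "finite (supp g)" using assms F_mem(3) by auto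
  have sub: "supp (f \<oplus>\<^bsub>F\<^esub> f') \<subseteq> ?S" using cl by (auto simp: F_apply)
  have sub': "?S \<subseteq> carrier H" "supp g \<subseteq> carrier H" "supp f \<subseteq> ?S" "supp f' \<subseteq> ?S" by auto
  note eq = mult_F_apply[OF _ assms(3) z fin(1) _ sub'(1) fin(2) subset_refl sub'(2)]
  show "((f \<oplus>\<^bsub>F\<^esub> f') \<otimes>\<^bsub>F\<^esub> g) z = (f \<otimes>\<^bsub>F\<^esub> g \<oplus>\<^bsub>F\<^esub> f' \<otimes>\<^bsub>F\<^esub> g) z"
    unfolding F_apply(2)[OF z] eq[OF F.a_closed[OF assms(1,2)] sub] eq[OF assms(1) sub'(3)]
      eq[OF assms(2) sub'(4)]
    using cl sub'
    by (subst R.finsum_addf[symmetric]) (auto intro!: R.finsum_cong' simp: F_apply R.l_distr)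
qed (use assms in \<open>simp_all add: mult_closed_F\<close>)

lemma r_distr_F:
  assumes "f \<in> carrier F" "f' \<in> carrier F" "g \<in> carrier F"
  shows "g \<otimes>\<^bsub>F\<^esub> (f \<oplus>\<^bsub>F\<^esub> f') = g \<otimes>\<^bsub>F\<^esub> f \<oplus>\<^bsub>F\<^esub> g \<otimes>\<^bsub>F\<^esub> f'"
proof (rule F_eqI)
  fix z assume z: "z \<in> carrier H"
  let ?S = "supp f \<union> supp f'"
  note cl = F_mem(1)[OF assms(1)] F_mem(1)[OF assms(2)] F_mem(1)[OF assms(3)]
  have fin: "finite ?S" "finite (supp g)" using assms F_mem(3) by auto
  have sub: "supp (f \<oplus>\<^bsub>F\<^esub> f') \<subseteq> ?S" using cl by (auto simp: F_apply)
  have sub': "?S \<subseteq> carrier H" "supp g \<subseteq> carrier H" "supp f \<subseteq> ?S" "supp f' \<subseteq> ?S" by auto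
  note eq = mult_F_apply[OF assms(3) _ z fin(2) subset_refl sub'(2) fin(1) _ sub'(1)]
  show "(g \<otimes>\<^bsub>F\<^esub> (f \<oplus>\<^bsub>F\<^esub> f')) z = (g \<otimes>\<^bsub>F\<^esub> f \<oplus>\<^bsub>F\<^esub> g \<otimes>\<^bsub>F\<^esub> f') z"
    unfolding F_apply(2)[OF z] eq[OF F.a_closed[OF assms(1,2)] sub] eq[OF assms(1) sub'(3)]
      eq[OF assms(2) sub'(4)]
    using cl sub'
    by (subst R.finsum_addf[symmetric]) (auto intro!: R.finsum_cong' simp: F_apply R.r_distr)
qed (use assms in \<open>simp_all add: mult_closed_F\<close>)

lemma smult_mult_left_F:
  assumes "r \<in> carrier R" "f \<in> carrier F" "g \<in> carrier F"
  shows "(r \<odot>\<^bsub>F\<^esub> f) \<otimes>\<^bsub>F\<^esub> g = r \<odot>\<^bsub>F\<^esub> (f \<otimes>\<^bsub>F\<^esub> g)"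
proof (rule F_eqI)
  fix z assume z: "z \<in> carrier H"
  note cl = assms(1) F_mem(1)[OF assms(2)] F_mem(1)[OF assms(3)]
  have fin: "finite (supp f)" "finite (supp g)" using assms F_mem(3) by auto
  have sub: "supp (r \<odot>\<^bsub>F\<^esub> f) \<subseteq> supp f" using cl by (auto simp: F_apply)
  have sub': "supp f \<subseteq> carrier H" "supp g \<subseteq> carrier H" by auto
  note eq = mult_F_apply[OF _ assms(3) z fin(1) _ sub'(1) fin(2) subset_refl sub'(2)]
  show "((r \<odot>\<^bsub>F\<^esub> f) \<otimes>\<^bsub>F\<^esub> g) z = (r \<odot>\<^bsub>F\<^esub> (f \<otimes>\<^bsub>F\<^esub> g)) z"
    unfolding F_apply(3)[OF z] eq[OF smult_closed_F[OF assms(1,2)] sub] eq[OF assms(2) subset_refl]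
    using cl sub' fin
    by (subst R.finsum_rdistr) (auto intro!: R.finsum_cong' simp: F_apply R.m_assoc)
qed (use assms in \<open>simp_all add: mult_closed_F smult_closed_F\<close>)

lemma smult_mult_right_F:
  assumes "r \<in> carrier R" "f \<in> carrier F" "g \<in> carrier F"
  shows "f \<otimes>\<^bsub>F\<^esub> (r \<odot>\<^bsub>F\<^esub> g) = r \<odot>\<^bsub>F\<^esub> (f \<otimes>\<^bsub>F\<^esub> g)"
proof (rule F_eqI)
  fix z assume z: "z \<in> carrier H"
  note cl = assms(1) F_mem(1)[OF assms(2)] F_mem(1)[OF assms(3)]
  have fin: "finite (supp f)" "finite (supp g)" using assms F_mem(3) by auto
  have sub: "supp (r \<odot>\<^bsub>F\<^esub> g) \<subseteq> supp g" using cl by (auto simp: F_apply)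
  have sub': "supp f \<subseteq> carrier H" "supp g \<subseteq> carrier H" by auto
  note eq = mult_F_apply[OF assms(2) _ z fin(1) subset_refl sub'(1) fin(2) _ sub'(2)]
  show "(f \<otimes>\<^bsub>F\<^esub> (r \<odot>\<^bsub>F\<^esub> g)) z = (r \<odot>\<^bsub>F\<^esub> (f \<otimes>\<^bsub>F\<^esub> g)) z"
    unfolding F_apply(3)[OF z] eq[OF smult_closed_F[OF assms(1,3)] sub] eq[OF assms(3) subset_refl]
    using cl sub' fin
    by (subst R.finsum_rdistr) (auto intro!: R.finsum_cong' simp: F_apply R.m_lcomm)
qed (use assms in \<open>simp_all add: mult_closed_F smult_closed_F\<close>)

lemma \<beta>_mult:
  assumes "x \<in> carrier H" "y \<in> carrier H"
  shows "\<beta> x \<otimes>\<^bsub>F\<^esub> \<beta> y = \<beta> (x \<otimes>\<^bsub>H\<^esub> y)"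
proof (rule F_eqI)
  fix z assume z: "z \<in> carrier H"
  have "(\<beta> x \<otimes>\<^bsub>F\<^esub> \<beta> y) z = (\<Oplus>\<^bsub>R\<^esub>p\<in>{x} \<times> {y}. if fst p \<otimes>\<^bsub>H\<^esub> snd p = z
      then \<beta> x (fst p) \<otimes>\<^bsub>R\<^esub> \<beta> y (snd p) else \<zero>\<^bsub>R\<^esub>)"
    using assms by (intro mult_F_apply \<beta>_closed z) (auto simp: \<beta>_apply split: if_splits)
  then show "(\<beta> x \<otimes>\<^bsub>F\<^esub> \<beta> y) z = \<beta> (x \<otimes>\<^bsub>H\<^esub> y) z"
    using assms z by (auto simp: \<beta>_apply)
qed (simp_all add: mult_closed_F \<beta>_closed)

lemma \<beta>_smult_mult:
  assumes "r \<in> carrier R" "s \<in> carrier R" "x \<in> carrier H" "y \<in> carrier H"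
  shows "(r \<odot>\<^bsub>F\<^esub> \<beta> x) \<otimes>\<^bsub>F\<^esub> (s \<odot>\<^bsub>F\<^esub> \<beta> y) = (r \<otimes>\<^bsub>R\<^esub> s) \<odot>\<^bsub>F\<^esub> \<beta> (x \<otimes>\<^bsub>H\<^esub> y)"
  using assms
  by (simp add: smult_mult_left_F smult_mult_right_F \<beta>_closed smult_closed_F \<beta>_mult
      module.smult_assoc1[OF module_F, symmetric] R.m_comm)

text \<open>Linear induction in each of the three factors reduces the claim to scaled basis
  elements, where it is associativity in \<open>R\<close> and in \<open>H\<close>.\<close>

lemma m_assoc_F:
  assumes f: "f \<in> carrier F" and g: "g \<in> carrier F" and h: "h \<in> carrier F"
  shows "f \<otimes>\<^bsub>F\<^esub> g \<otimes>\<^bsub>F\<^esub> h = f \<otimes>\<^bsub>F\<^esub> (g \<otimes>\<^bsub>F\<^esub> h)"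
proof -
  have 1: "(r \<odot>\<^bsub>F\<^esub> \<beta> x) \<otimes>\<^bsub>F\<^esub> (s \<odot>\<^bsub>F\<^esub> \<beta> y) \<otimes>\<^bsub>F\<^esub> h = (r \<odot>\<^bsub>F\<^esub> \<beta> x) \<otimes>\<^bsub>F\<^esub> ((s \<odot>\<^bsub>F\<^esub> \<beta> y) \<otimes>\<^bsub>F\<^esub> h)"
    if "r \<in> carrier R" "x \<in> carrier H" "s \<in> carrier R" "y \<in> carrier H" for r x s y
  proof -
    have "h \<in> {h \<in> carrier F. (r \<odot>\<^bsub>F\<^esub> \<beta> x) \<otimes>\<^bsub>F\<^esub> (s \<odot>\<^bsub>F\<^esub> \<beta> y) \<otimes>\<^bsub>F\<^esub> h = (r \<odot>\<^bsub>F\<^esub> \<beta> x) \<otimes>\<^bsub>F\<^esub> ((s \<odot>\<^bsub>F\<^esub> \<beta> y) \<otimes>\<^bsub>F\<^esub> h)}"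
    proof (rule F_span[OF _ _ h])
      fix t z assume "t \<in> carrier R" "z \<in> carrier H"
      then show "t \<odot>\<^bsub>F\<^esub> \<beta> z \<in> {h \<in> carrier F. (r \<odot>\<^bsub>F\<^esub> \<beta> x) \<otimes>\<^bsub>F\<^esub> (s \<odot>\<^bsub>F\<^esub> \<beta> y) \<otimes>\<^bsub>F\<^esub> h = (r \<odot>\<^bsub>F\<^esub> \<beta> x) \<otimes>\<^bsub>F\<^esub> ((s \<odot>\<^bsub>F\<^esub> \<beta> y) \<otimes>\<^bsub>F\<^esub> h)}"
        using that by (simp add: \<beta>_smult_mult smult_closed_F \<beta>_closed R.m_assoc H.m_assoc)
    qed (use that in \<open>simp add: r_distr_F mult_closed_F smult_closed_F \<beta>_closed\<close>)
    then show ?thesis by simp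
  qed
  have 2: "(r \<odot>\<^bsub>F\<^esub> \<beta> x) \<otimes>\<^bsub>F\<^esub> g \<otimes>\<^bsub>F\<^esub> h = (r \<odot>\<^bsub>F\<^esub> \<beta> x) \<otimes>\<^bsub>F\<^esub> (g \<otimes>\<^bsub>F\<^esub> h)"
    if "r \<in> carrier R" "x \<in> carrier H" for r x
  proof -
    have "g \<in> {g \<in> carrier F. (r \<odot>\<^bsub>F\<^esub> \<beta> x) \<otimes>\<^bsub>F\<^esub> g \<otimes>\<^bsub>F\<^esub> h = (r \<odot>\<^bsub>F\<^esub> \<beta> x) \<otimes>\<^bsub>F\<^esub> (g \<otimes>\<^bsub>F\<^esub> h)}"
      by (rule F_span[OF _ _ g])
        (use that h in \<open>simp_all add: 1 r_distr_F l_distr_F mult_closed_F smult_closed_F \<beta>_closed\<close>)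
    then show ?thesis by simp
  qed
  have "f \<in> {f \<in> carrier F. f \<otimes>\<^bsub>F\<^esub> g \<otimes>\<^bsub>F\<^esub> h = f \<otimes>\<^bsub>F\<^esub> (g \<otimes>\<^bsub>F\<^esub> h)}"
    by (rule F_span[OF _ _ f])
      (use g h in \<open>simp_all add: 2 l_distr_F mult_closed_F smult_closed_F \<beta>_closed\<close>)
  then show ?thesis by simp
qed

lemma ring_F: "ring F"
proof (rule ringI[OF abelian_group_F])
  show "Group.monoid F"
  proof (rule monoidI)
    show "\<one>\<^bsub>F\<^esub> \<in> carrier F" by (simp add: one_F \<beta>_closed)
    fix f assume f: "f \<in> carrier F"
    have "f \<in> {f \<in> carrier F. \<one>\<^bsub>F\<^esub> \<otimes>\<^bsub>F\<^esub> f = f \<and> f \<otimes>\<^bsub>F\<^esub> \<one>\<^bsub>F\<^esub> = f}"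
      by (rule F_span[OF _ _ f])
        (simp_all add: one_F l_distr_F r_distr_F \<beta>_closed smult_closed_F smult_mult_left_F
          smult_mult_right_F \<beta>_mult)
    then show "\<one>\<^bsub>F\<^esub> \<otimes>\<^bsub>F\<^esub> f = f" "f \<otimes>\<^bsub>F\<^esub> \<one>\<^bsub>F\<^esub> = f" by auto
  qed (simp_all add: mult_closed_F m_assoc_F)
qed (simp_all add: l_distr_F r_distr_F)

lemma assoc_algebra_F: "assoc_algebra R F"
  by (intro assoc_algebra.intro module_F ring_F smult_mult_left_F smult_mult_right_F)

section \<open>Extending maps from the basis\<close>

definition linear_extension :: "('r, 'v, 'z) module_scheme \<Rightarrow> ('h \<Rightarrow> 'v) \<Rightarrow> ('h \<Rightarrow> 'r) \<Rightarrow> 'v" where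
  "linear_extension V l f = (\<Oplus>\<^bsub>V\<^esub>x\<in>supp f. f x \<odot>\<^bsub>V\<^esub> l x)"

context
  fixes V :: "('r, 'v, 'z) module_scheme"
  assumes V: "module R V"
begin

interpretation V: module R V by (rule V)

lemma linear_extension_superset:
  assumes "f \<in> carrier F" "l \<in> carrier H \<rightarrow> carrier V" "finite S" "supp f \<subseteq> S" "S \<subseteq> carrier H"
  shows "linear_extension V l f = (\<Oplus>\<^bsub>V\<^esub>x\<in>S. f x \<odot>\<^bsub>V\<^esub> l x)"
  unfolding linear_extension_def
  using assms F_mem(1)[OF assms(1)] funcset_mem[OF assms(2)]
  by (intro V.M.add.finprod_mono_neutral_cong_left) (auto simp: subset_iff)

lemma linear_extension_linear:
  assumes l: "l \<in> carrier H \<rightarrow> carrier V"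
  shows "linear_extension V l \<in> linear_maps R F V"
proof (rule linear_mapsI)
  fix f assume f: "f \<in> carrier F"
  note fcl = F_mem(1)[OF f]
  show "linear_extension V l f \<in> carrier V"
    unfolding linear_extension_def using funcset_mem[OF l] fcl by (auto intro!: V.M.finsum_closed V.smult_closed)
  fix r assume r: "r \<in> carrier R"
  have sub: "supp (r \<odot>\<^bsub>F\<^esub> f) \<subseteq> supp f" using r fcl by (auto simp: F_apply)
  have "linear_extension V l (r \<odot>\<^bsub>F\<^esub> f) = (\<Oplus>\<^bsub>V\<^esub>x\<in>supp f. (r \<odot>\<^bsub>F\<^esub> f) x \<odot>\<^bsub>V\<^esub> l x)"
    by (rule linear_extension_superset[OF smult_closed_F[OF r f] l F_mem(3)[OF f] sub]) auto
  also have "\<dots> = (\<Oplus>\<^bsub>V\<^esub>x\<in>supp f. r \<odot>\<^bsub>V\<^esub> (f x \<odot>\<^bsub>V\<^esub> l x))"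
    using r fcl funcset_mem[OF l] by (intro V.M.finsum_cong') (auto simp: F_apply V.smult_assoc1)
  finally show "linear_extension V l (r \<odot>\<^bsub>F\<^esub> f) = r \<odot>\<^bsub>V\<^esub> linear_extension V l f"
    unfolding linear_extension_def using r fcl funcset_mem[OF l] F_mem(3)[OF f]
    by (subst V.finsum_smult_ldistr) (auto intro!: V.smult_closed)
next
  fix f g assume f: "f \<in> carrier F" and g: "g \<in> carrier F"
  let ?S = "supp f \<union> supp g"
  note cl = F_mem(1)[OF f] F_mem(1)[OF g]
  have fin: "finite ?S" using F_mem(3) f g by auto
  have sub: "supp (f \<oplus>\<^bsub>F\<^esub> g) \<subseteq> ?S" "supp f \<subseteq> ?S" "supp g \<subseteq> ?S" "?S \<subseteq> carrier H"
    using cl by (auto simp: F_apply)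
  note eq = linear_extension_superset[OF _ l fin _ sub(4)]
  show "linear_extension V l (f \<oplus>\<^bsub>F\<^esub> g) = linear_extension V l f \<oplus>\<^bsub>V\<^esub> linear_extension V l g"
    unfolding eq[OF add_closed_F[OF f g] sub(1)] eq[OF f sub(2)] eq[OF g sub(3)]
  proof -
    note mem = cl funcset_mem[OF l]
    have "(\<Oplus>\<^bsub>V\<^esub>x\<in>?S. (f \<oplus>\<^bsub>F\<^esub> g) x \<odot>\<^bsub>V\<^esub> l x) = (\<Oplus>\<^bsub>V\<^esub>x\<in>?S. f x \<odot>\<^bsub>V\<^esub> l x \<oplus>\<^bsub>V\<^esub> g x \<odot>\<^bsub>V\<^esub> l x)"
      using mem by (intro V.M.finsum_cong') (auto simp: F_apply V.smult_l_distr)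
    also have "\<dots> = (\<Oplus>\<^bsub>V\<^esub>x\<in>?S. f x \<odot>\<^bsub>V\<^esub> l x) \<oplus>\<^bsub>V\<^esub> (\<Oplus>\<^bsub>V\<^esub>x\<in>?S. g x \<odot>\<^bsub>V\<^esub> l x)"
      using mem by (intro V.M.finsum_addf) auto
    finally show "(\<Oplus>\<^bsub>V\<^esub>x\<in>?S. (f \<oplus>\<^bsub>F\<^esub> g) x \<odot>\<^bsub>V\<^esub> l x)
        = (\<Oplus>\<^bsub>V\<^esub>x\<in>?S. f x \<odot>\<^bsub>V\<^esub> l x) \<oplus>\<^bsub>V\<^esub> (\<Oplus>\<^bsub>V\<^esub>x\<in>?S. g x \<odot>\<^bsub>V\<^esub> l x)" .
  qed
qed

lemma linear_extension_\<beta>: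
  assumes l: "l \<in> carrier H \<rightarrow> carrier V" and x: "x \<in> carrier H"
  shows "linear_extension V l (\<beta> x) = l x"
proof -
  have "linear_extension V l (\<beta> x) = (\<Oplus>\<^bsub>V\<^esub>y\<in>{x}. \<beta> x y \<odot>\<^bsub>V\<^esub> l y)"
    using x by (intro linear_extension_superset \<beta>_closed l) (auto simp: \<beta>_apply split: if_splits)
  then show ?thesis using funcset_mem[OF l x] x by (simp add: \<beta>_apply)
qed

text \<open>Multiplication by a basis element, on either side, translates the values on the basis.
  This is why the elements killed by all bilinear maps will form an ideal.\<close>

lemma linear_extension_\<beta>_mult:
  assumes l: "l \<in> carrier H \<rightarrow> carrier V" and x: "x \<in> carrier H" and f: "f \<in> carrier F"
  shows "linear_extension V l (\<beta> x \<otimes>\<^bsub>F\<^esub> f) = linear_extension V (\<lambda>y. l (x \<otimes>\<^bsub>H\<^esub> y)) f"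
    and "linear_extension V l (f \<otimes>\<^bsub>F\<^esub> \<beta> x) = linear_extension V (\<lambda>y. l (y \<otimes>\<^bsub>H\<^esub> x)) f"
proof -
  have l1: "(\<lambda>y. l (x \<otimes>\<^bsub>H\<^esub> y)) \<in> carrier H \<rightarrow> carrier V"
    and l2: "(\<lambda>y. l (y \<otimes>\<^bsub>H\<^esub> x)) \<in> carrier H \<rightarrow> carrier V" using l x by auto
  note L = linear_mapsD[OF linear_extension_linear[OF l]]
    and L1 = linear_mapsD[OF linear_extension_linear[OF l1]]
    and L2 = linear_mapsD[OF linear_extension_linear[OF l2]]
  have "f \<in> {f \<in> carrier F. linear_extension V l (\<beta> x \<otimes>\<^bsub>F\<^esub> f) = linear_extension V (\<lambda>y. l (x \<otimes>\<^bsub>H\<^esub> y)) f \<and>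
      linear_extension V l (f \<otimes>\<^bsub>F\<^esub> \<beta> x) = linear_extension V (\<lambda>y. l (y \<otimes>\<^bsub>H\<^esub> x)) f}"
  proof (rule F_span[OF _ _ f])
    fix r y assume r: "r \<in> carrier R" and y: "y \<in> carrier H"
    then show "r \<odot>\<^bsub>F\<^esub> \<beta> y \<in> {f \<in> carrier F. linear_extension V l (\<beta> x \<otimes>\<^bsub>F\<^esub> f) = linear_extension V (\<lambda>y. l (x \<otimes>\<^bsub>H\<^esub> y)) f \<and>
      linear_extension V l (f \<otimes>\<^bsub>F\<^esub> \<beta> x) = linear_extension V (\<lambda>y. l (y \<otimes>\<^bsub>H\<^esub> x)) f}"
      using x by (simp add: smult_closed_F \<beta>_closed smult_mult_right_F smult_mult_left_F \<beta>_mult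
          L(3) L1(3) L2(3) linear_extension_\<beta>[OF l] linear_extension_\<beta>[OF l1] linear_extension_\<beta>[OF l2])
  qed (simp add: r_distr_F l_distr_F \<beta>_closed mult_closed_F L(2) L1(2) L2(2))
  then show "linear_extension V l (\<beta> x \<otimes>\<^bsub>F\<^esub> f) = linear_extension V (\<lambda>y. l (x \<otimes>\<^bsub>H\<^esub> y)) f"
    and "linear_extension V l (f \<otimes>\<^bsub>F\<^esub> \<beta> x) = linear_extension V (\<lambda>y. l (y \<otimes>\<^bsub>H\<^esub> x)) f" by auto
qed

end

end

lemma (in assoc_algebra) scalar_mult_eq:
  assumes "r \<in> carrier R" "a \<in> carrier A"
  shows "(r \<odot>\<^bsub>A\<^esub> \<one>\<^bsub>A\<^esub>) \<otimes>\<^bsub>A\<^esub> a = r \<odot>\<^bsub>A\<^esub> a" "a \<otimes>\<^bsub>A\<^esub> (r \<odot>\<^bsub>A\<^esub> \<one>\<^bsub>A\<^esub>) = r \<odot>\<^bsub>A\<^esub> a"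
proof -
  interpret A: ring A by (rule ring)
  show "(r \<odot>\<^bsub>A\<^esub> \<one>\<^bsub>A\<^esub>) \<otimes>\<^bsub>A\<^esub> a = r \<odot>\<^bsub>A\<^esub> a" "a \<otimes>\<^bsub>A\<^esub> (r \<odot>\<^bsub>A\<^esub> \<one>\<^bsub>A\<^esub>) = r \<odot>\<^bsub>A\<^esub> a"
    using assms by (simp_all add: smult_mult_left smult_mult_right)
qed

lemma (in assoc_algebra) scalar_ring_hom: "(\<lambda>r. r \<odot>\<^bsub>A\<^esub> \<one>\<^bsub>A\<^esub>) \<in> ring_hom R A"
proof -
  interpret A: ring A by (rule ring)
  interpret M: module R A by (rule module)
  show ?thesis
    by (rule ring_hom_memI) (simp_all add: M.smult_l_distr scalar_mult_eq(1) M.smult_assoc1)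
qed

lemma group_ring_based_algebra:
  assumes R: "cring R" and K: "group K" and fin: "finite (carrier K)"
  shows "based_algebra R (monoid_ring R K) K (basis_element R K) (\<lambda>f. f \<one>\<^bsub>K\<^esub>)"
proof -
  interpret K: group K by fact
  interpret monoid_algebra R K by (intro monoid_algebra.intro R K.is_monoid)
  interpret assoc_algebra R F by (rule assoc_algebra_F)
  show ?thesis
  proof (rule based_algebra.intro)
    show "(\<lambda>r. r \<odot>\<^bsub>F\<^esub> \<one>\<^bsub>F\<^esub>) \<in> ring_hom R F" by (rule scalar_ring_hom)
    show "carrier F \<subseteq> Z" if "Z \<subseteq> carrier F"
        "\<And>r u. \<lbrakk>r \<in> carrier R; u \<in> carrier K\<rbrakk> \<Longrightarrow> (r \<odot>\<^bsub>F\<^esub> \<one>\<^bsub>F\<^esub>) \<otimes>\<^bsub>F\<^esub> \<beta> u \<in> Z"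
        "\<And>a b. \<lbrakk>a \<in> Z; b \<in> Z\<rbrakk> \<Longrightarrow> a \<oplus>\<^bsub>F\<^esub> b \<in> Z" for Z
    proof
      fix f assume f: "f \<in> carrier F"
      show "f \<in> Z"
        by (rule F_span[OF _ that(3) f]) (use that(2) in \<open>simp_all add: scalar_mult_eq \<beta>_closed\<close>)
    qed
    show "\<beta> u \<one>\<^bsub>K\<^esub> = (if u = \<one>\<^bsub>K\<^esub> then \<one>\<^bsub>R\<^esub> else \<zero>\<^bsub>R\<^esub>)" for u
      by (auto simp: \<beta>_apply)
    show "\<beta> \<one>\<^bsub>K\<^esub> = \<one>\<^bsub>F\<^esub>" by (rule one_F[symmetric])
    show "((r \<odot>\<^bsub>F\<^esub> \<one>\<^bsub>F\<^esub>) \<otimes>\<^bsub>F\<^esub> a) \<one>\<^bsub>K\<^esub> = r \<otimes>\<^bsub>R\<^esub> a \<one>\<^bsub>K\<^esub>" if "r \<in> carrier R" "a \<in> carrier F" for r a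
      using that by (simp add: scalar_mult_eq(1) F_apply)
    show "(r \<odot>\<^bsub>F\<^esub> \<one>\<^bsub>F\<^esub>) \<otimes>\<^bsub>F\<^esub> a = a \<otimes>\<^bsub>F\<^esub> (r \<odot>\<^bsub>F\<^esub> \<one>\<^bsub>F\<^esub>)" if "r \<in> carrier R" "a \<in> carrier F" for r a
      using that by (simp only: scalar_mult_eq)
  qed (simp_all add: R ring_F K fin \<beta>_closed \<beta>_mult F_apply F_mem(1))
qed

section \<open>Tensor products of algebras\<close>

lemma assoc_algebra_opposite:
  assumes "assoc_algebra R A" shows "assoc_algebra R (opposite_algebra A)"
proof -
  interpret assoc_algebra R A by fact
  interpret A: ring A by (rule ring)
  interpret M: module R A by (rule module)
  have sel: "carrier (opposite_algebra A) = carrier A" "add (opposite_algebra A) = add A"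
    "\<zero>\<^bsub>opposite_algebra A\<^esub> = \<zero>\<^bsub>A\<^esub>" "\<one>\<^bsub>opposite_algebra A\<^esub> = \<one>\<^bsub>A\<^esub>" "smult (opposite_algebra A) = smult A"
    "\<And>x y. x \<otimes>\<^bsub>opposite_algebra A\<^esub> y = y \<otimes>\<^bsub>A\<^esub> x"
    by (simp_all add: opposite_algebra_def)
  have ab: "abelian_group (opposite_algebra A)"
    by (rule abelian_group_eqI[OF A.abelian_group_axioms]) (simp_all add: sel)
  show ?thesis
  proof (rule assoc_algebra.intro)
    show "module R (opposite_algebra A)"
      by (rule moduleI[OF M.is_cring ab])
        (simp_all add: sel M.smult_l_distr M.smult_r_distr M.smult_assoc1)
    have "Group.monoid (opposite_algebra A)"
      by (rule monoidI) (simp_all add: sel A.m_assoc)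
    then show "ring (opposite_algebra A)"
      by (rule ringI[OF ab]) (simp_all add: sel A.l_distr A.r_distr)
  qed (simp_all add: sel smult_mult_left smult_mult_right)
qed

lemma ring_eqI:
  assumes "ring N" "carrier M = carrier N" "add M = add N" "\<zero>\<^bsub>M\<^esub> = \<zero>\<^bsub>N\<^esub>" "monoid.mult M = monoid.mult N"
    "\<one>\<^bsub>M\<^esub> = \<one>\<^bsub>N\<^esub>"
  shows "ring M"
proof -
  interpret N: ring N by fact
  have "Group.monoid M" by (rule monoidI) (simp_all add: assms N.m_assoc)
  then show ?thesis
    by (intro ringI abelian_group_eqI[OF N.abelian_group_axioms]) (simp_all add: assms N.l_distr N.r_distr)
qed

locale tensor_of_algebras = base: cring R
  for R :: "('r, 'x) ring_scheme" +
  fixes A :: "('r, 'a) module" and B :: "('r, 'b) module"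
  assumes A: "assoc_algebra R A" and B: "assoc_algebra R B"
begin

sublocale A: ring A by (rule assoc_algebra.ring[OF A])
sublocale B: ring B by (rule assoc_algebra.ring[OF B])
sublocale AM: module R A by (rule assoc_algebra.module[OF A])
sublocale BM: module R B by (rule assoc_algebra.module[OF B])
sublocale monoid_algebra R "A \<times>\<times> B"
  by (intro monoid_algebra.intro base.is_cring DirProd_monoid A.monoid_axioms B.monoid_axioms)
sublocale F: ring F by (rule ring_F)

lemma carrier_AB [simp]: "carrier (A \<times>\<times> B) = carrier A \<times> carrier B"
  and mult_AB [simp]: "(a, b) \<otimes>\<^bsub>A \<times>\<times> B\<^esub> (a', b') = (a \<otimes>\<^bsub>A\<^esub> a', b \<otimes>\<^bsub>B\<^esub> b')"
  and one_AB [simp]: "\<one>\<^bsub>A \<times>\<times> B\<^esub> = (\<one>\<^bsub>A\<^esub>, \<one>\<^bsub>B\<^esub>)"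
  by (simp_all add: DirProd_def)

abbreviation J :: "('a \<times> 'b \<Rightarrow> 'r) set" where "J \<equiv> Idl\<^bsub>F\<^esub> (tensor_relations R A B)"
abbreviation T :: "('r, ('a \<times> 'b \<Rightarrow> 'r) set) module" where "T \<equiv> tensor_algebra R A B"

definition bilinear :: "('r, 'v, 'z) module_scheme \<Rightarrow> ('a \<times> 'b \<Rightarrow> 'v) \<Rightarrow> bool" where
  "bilinear V l \<longleftrightarrow>
     (\<forall>a\<in>carrier A. \<forall>b\<in>carrier B. l (a, b) \<in> carrier V) \<and>
     (\<forall>a\<in>carrier A. \<forall>a'\<in>carrier A. \<forall>b\<in>carrier B. l (a \<oplus>\<^bsub>A\<^esub> a', b) = l (a, b) \<oplus>\<^bsub>V\<^esub> l (a', b)) \<and>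
     (\<forall>a\<in>carrier A. \<forall>b\<in>carrier B. \<forall>b'\<in>carrier B. l (a, b \<oplus>\<^bsub>B\<^esub> b') = l (a, b) \<oplus>\<^bsub>V\<^esub> l (a, b')) \<and>
     (\<forall>r\<in>carrier R. \<forall>a\<in>carrier A. \<forall>b\<in>carrier B.
        l (r \<odot>\<^bsub>A\<^esub> a, b) = r \<odot>\<^bsub>V\<^esub> l (a, b) \<and> l (a, r \<odot>\<^bsub>B\<^esub> b) = r \<odot>\<^bsub>V\<^esub> l (a, b))"

lemma bilinear_funcset: "bilinear V l \<Longrightarrow> l \<in> carrier (A \<times>\<times> B) \<rightarrow> carrier V"
  by (auto simp: bilinear_def)

lemma bilinear_translate:
  assumes l: "bilinear V l" and c: "c \<in> carrier A" and d: "d \<in> carrier B"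
  shows "bilinear V (\<lambda>y. l ((c, d) \<otimes>\<^bsub>A \<times>\<times> B\<^esub> y))" "bilinear V (\<lambda>y. l (y \<otimes>\<^bsub>A \<times>\<times> B\<^esub> (c, d)))"
  using l c d unfolding bilinear_def
  by (simp_all add: A.l_distr A.r_distr B.l_distr B.r_distr
      assoc_algebra.smult_mult_left[OF A] assoc_algebra.smult_mult_right[OF A]
      assoc_algebra.smult_mult_left[OF B] assoc_algebra.smult_mult_right[OF B])

lemma tensor_relations_closed: "tensor_relations R A B \<subseteq> carrier F"
  unfolding tensor_relations_def Let_def by (auto simp: \<beta>_closed smult_closed_F)

text \<open>The elements killed by every bilinear map form an ideal, since translates of bilinear maps
  are bilinear.\<close>

lemma bilinear_extension_kernel:
  assumes V: "module R V" and l: "bilinear V l" and f: "f \<in> J"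
  shows "linear_extension V l f = \<zero>\<^bsub>V\<^esub>"
proof -
  interpret V: module R V by fact
  note lin = linear_extension_linear[OF V bilinear_funcset]
  note L = linear_mapsD[OF lin] and L0 = linear_maps_zero[OF module_F V lin]
    and Lm = linear_maps_minus[OF module_F V lin]
  let ?N = "{f \<in> carrier F. \<forall>l. bilinear V l \<longrightarrow> linear_extension V l f = \<zero>\<^bsub>V\<^esub>}"
  have N: "ideal ?N F"
  proof (rule idealI[OF ring_F])
    show "subgroup ?N (add_monoid F)"
      by (rule subgroup.intro) (auto simp: a_inv_def[symmetric] L(2) L0 Lm)
  next
    fix f x assume f: "f \<in> ?N" and x: "x \<in> carrier F"
    have "x \<in> {x \<in> carrier F. x \<otimes>\<^bsub>F\<^esub> f \<in> ?N \<and> f \<otimes>\<^bsub>F\<^esub> x \<in> ?N}"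
    proof (rule F_span[OF _ _ x])
      fix r y assume r: "r \<in> carrier R" and y: "y \<in> carrier (A \<times>\<times> B)"
      obtain c d where y_eq: "y = (c, d)" "c \<in> carrier A" "d \<in> carrier B" using y by auto
      have "linear_extension V l (\<beta> y \<otimes>\<^bsub>F\<^esub> f) = \<zero>\<^bsub>V\<^esub>" "linear_extension V l (f \<otimes>\<^bsub>F\<^esub> \<beta> y) = \<zero>\<^bsub>V\<^esub>"
        if "bilinear V l" for l
        using linear_extension_\<beta>_mult[OF V bilinear_funcset[OF that] y, of f]
          bilinear_translate[OF that y_eq(2,3)] f by (auto simp: y_eq(1))
      then show "r \<odot>\<^bsub>F\<^esub> \<beta> y \<in> {x \<in> carrier F. x \<otimes>\<^bsub>F\<^esub> f \<in> ?N \<and> f \<otimes>\<^bsub>F\<^esub> x \<in> ?N}"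
        using f r by (simp add: smult_mult_left_F smult_mult_right_F \<beta>_closed smult_closed_F L(3))
    qed (use f in \<open>simp add: l_distr_F r_distr_F L(2)\<close>)
    then show "x \<otimes>\<^bsub>F\<^esub> f \<in> ?N" "f \<otimes>\<^bsub>F\<^esub> x \<in> ?N" by auto
  qed
  have "tensor_relations R A B \<subseteq> ?N"
  proof
    fix x assume x: "x \<in> tensor_relations R A B"
    have minus: "linear_extension V l (f \<ominus>\<^bsub>F\<^esub> g) = \<zero>\<^bsub>V\<^esub>"
      if "bilinear V l" "f \<in> carrier F" "g \<in> carrier F" "linear_extension V l f = linear_extension V l g" for l f g
      using that L(1)[OF that(1,3)] by (simp add: a_minus_def L(2) Lm V.M.r_neg)
    show "x \<in> ?N"
      using x subsetD[OF tensor_relations_closed x]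
      unfolding tensor_relations_def Let_def
      by (auto intro!: minus simp: \<beta>_closed smult_closed_F L(2,3) linear_extension_\<beta>[OF V bilinear_funcset])
        (auto simp: bilinear_def)
  qed
  then have "J \<subseteq> ?N" by (rule F.genideal_minimal[OF N])
  then show ?thesis using f l by blast
qed

lemma ideal_J: "ideal J F"
  by (rule F.genideal_ideal[OF tensor_relations_closed])

sublocale J: ideal J F by (rule ideal_J)

lemma T_sel:
  "carrier T = carrier (F Quot J)" "add T = add (F Quot J)" "\<zero>\<^bsub>T\<^esub> = \<zero>\<^bsub>F Quot J\<^esub>"
  "monoid.mult T = monoid.mult (F Quot J)" "\<one>\<^bsub>T\<^esub> = \<one>\<^bsub>F Quot J\<^esub>"
  "r \<odot>\<^bsub>T\<^esub> C = (J +>\<^bsub>F\<^esub> (r \<odot>\<^bsub>F\<^esub> \<one>\<^bsub>F\<^esub>)) \<otimes>\<^bsub>T\<^esub> C"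
  by (simp_all add: tensor_algebra_def Let_def)

lemma ring_T: "ring T"
  by (rule ring_eqI[OF J.quotient_is_ring]) (simp_all add: T_sel)

sublocale T: ring T by (rule ring_T)

definition proj :: "('a \<times> 'b \<Rightarrow> 'r) \<Rightarrow> ('a \<times> 'b \<Rightarrow> 'r) set" where "proj f = J +>\<^bsub>F\<^esub> f"

lemma proj_closed: "f \<in> carrier F \<Longrightarrow> proj f \<in> carrier T"
  and proj_add: "\<lbrakk>f \<in> carrier F; g \<in> carrier F\<rbrakk> \<Longrightarrow> proj (f \<oplus>\<^bsub>F\<^esub> g) = proj f \<oplus>\<^bsub>T\<^esub> proj g"
  and proj_mult: "\<lbrakk>f \<in> carrier F; g \<in> carrier F\<rbrakk> \<Longrightarrow> proj (f \<otimes>\<^bsub>F\<^esub> g) = proj f \<otimes>\<^bsub>T\<^esub> proj g"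
  and proj_one: "proj \<one>\<^bsub>F\<^esub> = \<one>\<^bsub>T\<^esub>"
  using J.rcos_ring_hom by (auto simp: ring_hom_def proj_def T_sel)

lemma T_cases:
  assumes "C \<in> carrier T" obtains f where "f \<in> carrier F" "C = proj f"
  using assms by (auto simp: T_sel FactRing_def A_RCOSETS_def' proj_def)

lemma scalar_T:
  assumes "r \<in> carrier R" shows "r \<odot>\<^bsub>T\<^esub> \<one>\<^bsub>T\<^esub> = proj (r \<odot>\<^bsub>F\<^esub> \<one>\<^bsub>F\<^esub>)"
  using assms T.r_one[OF proj_closed[OF smult_closed_F[OF assms F.one_closed]]]
  by (simp add: T_sel(6) proj_def)

lemma proj_smult:
  assumes "r \<in> carrier R" "f \<in> carrier F" shows "proj (r \<odot>\<^bsub>F\<^esub> f) = (r \<odot>\<^bsub>T\<^esub> \<one>\<^bsub>T\<^esub>) \<otimes>\<^bsub>T\<^esub> proj f"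
  unfolding scalar_T[OF assms(1)]
  using assms assoc_algebra.scalar_mult_eq(1)[OF assoc_algebra_F assms]
  by (simp add: proj_mult[symmetric] smult_closed_F)

lemma scalar_hom_T: "(\<lambda>r. r \<odot>\<^bsub>T\<^esub> \<one>\<^bsub>T\<^esub>) \<in> ring_hom R T"
proof -
  note hom = assoc_algebra.scalar_ring_hom[OF assoc_algebra_F]
  note h = ring_hom_closed[OF hom] ring_hom_mult[OF hom] ring_hom_add[OF hom] ring_hom_one[OF hom]
  show ?thesis
    by (rule ring_hom_memI) (simp_all add: scalar_T h proj_closed proj_add[symmetric] proj_mult[symmetric] proj_one)
qed

lemma scalar_central_T:
  assumes r: "r \<in> carrier R" and C: "C \<in> carrier T"
  shows "(r \<odot>\<^bsub>T\<^esub> \<one>\<^bsub>T\<^esub>) \<otimes>\<^bsub>T\<^esub> C = C \<otimes>\<^bsub>T\<^esub> (r \<odot>\<^bsub>T\<^esub> \<one>\<^bsub>T\<^esub>)"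
proof -
  obtain f where f: "f \<in> carrier F" "C = proj f" using C by (rule T_cases)
  show ?thesis
    using assoc_algebra.scalar_mult_eq[OF assoc_algebra_F r f(1)] f r
    by (simp add: scalar_T proj_mult[symmetric] smult_closed_F)
qed

definition tens :: "'a \<Rightarrow> 'b \<Rightarrow> ('a \<times> 'b \<Rightarrow> 'r) set" where "tens a b = proj (\<beta> (a, b))"

lemma tens_closed: "tens a b \<in> carrier T"
  by (simp add: tens_def proj_closed \<beta>_closed)

lemma tens_mult:
  "\<lbrakk>a \<in> carrier A; b \<in> carrier B; a' \<in> carrier A; b' \<in> carrier B\<rbrakk> \<Longrightarrow>
    tens a b \<otimes>\<^bsub>T\<^esub> tens a' b' = tens (a \<otimes>\<^bsub>A\<^esub> a') (b \<otimes>\<^bsub>B\<^esub> b')"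
  by (simp add: tens_def proj_mult[symmetric] \<beta>_closed \<beta>_mult)

lemma tens_one: "tens \<one>\<^bsub>A\<^esub> \<one>\<^bsub>B\<^esub> = \<one>\<^bsub>T\<^esub>"
  by (simp add: tens_def proj_one[symmetric] one_F)

lemma proj_eqI:
  assumes "f \<in> carrier F" "g \<in> carrier F" "f \<ominus>\<^bsub>F\<^esub> g \<in> tensor_relations R A B"
  shows "proj f = proj g"
  unfolding proj_def
  using F.genideal_self[OF tensor_relations_closed] assms F.quotient_eq_iff_same_a_r_cos[OF ideal_J] by blast

lemma tens_add_left: "\<lbrakk>a \<in> carrier A; a' \<in> carrier A; b \<in> carrier B\<rbrakk> \<Longrightarrow>
    tens (a \<oplus>\<^bsub>A\<^esub> a') b = tens a b \<oplus>\<^bsub>T\<^esub> tens a' b"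
  unfolding tens_def
  by (subst proj_add[symmetric], rule \<beta>_closed, rule \<beta>_closed, rule proj_eqI)
    (auto simp: \<beta>_closed tensor_relations_def Let_def)

lemma tens_add_right: "\<lbrakk>a \<in> carrier A; b \<in> carrier B; b' \<in> carrier B\<rbrakk> \<Longrightarrow>
    tens a (b \<oplus>\<^bsub>B\<^esub> b') = tens a b \<oplus>\<^bsub>T\<^esub> tens a b'"
  unfolding tens_def
  by (subst proj_add[symmetric], rule \<beta>_closed, rule \<beta>_closed, rule proj_eqI)
    (auto simp: \<beta>_closed tensor_relations_def Let_def)

lemma tens_smult_left: "\<lbrakk>r \<in> carrier R; a \<in> carrier A; b \<in> carrier B\<rbrakk> \<Longrightarrow>
    tens (r \<odot>\<^bsub>A\<^esub> a) b = (r \<odot>\<^bsub>T\<^esub> \<one>\<^bsub>T\<^esub>) \<otimes>\<^bsub>T\<^esub> tens a b"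
  unfolding tens_def
  by (subst proj_smult[symmetric], assumption, rule \<beta>_closed, rule proj_eqI)
    (auto simp: \<beta>_closed smult_closed_F tensor_relations_def Let_def)

lemma tens_smult_right: "\<lbrakk>r \<in> carrier R; a \<in> carrier A; b \<in> carrier B\<rbrakk> \<Longrightarrow>
    tens a (r \<odot>\<^bsub>B\<^esub> b) = (r \<odot>\<^bsub>T\<^esub> \<one>\<^bsub>T\<^esub>) \<otimes>\<^bsub>T\<^esub> tens a b"
  unfolding tens_def
  by (subst proj_smult[symmetric], assumption, rule \<beta>_closed, rule proj_eqI)
    (auto simp: \<beta>_closed smult_closed_F tensor_relations_def Let_def)

lemma T_span:
  assumes basis: "\<And>r a b. \<lbrakk>r \<in> carrier R; a \<in> carrier A; b \<in> carrier B\<rbrakk> \<Longrightarrow>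
      (r \<odot>\<^bsub>T\<^esub> \<one>\<^bsub>T\<^esub>) \<otimes>\<^bsub>T\<^esub> tens a b \<in> Z"
    and add: "\<And>C D. \<lbrakk>C \<in> Z; D \<in> Z\<rbrakk> \<Longrightarrow> C \<oplus>\<^bsub>T\<^esub> D \<in> Z"
  shows "carrier T \<subseteq> Z"
proof
  fix C assume "C \<in> carrier T"
  then obtain f where f: "f \<in> carrier F" "C = proj f" by (rule T_cases)
  have "f \<in> {f \<in> carrier F. proj f \<in> Z}"
  proof (rule F_span[OF _ _ f(1)])
    fix r x assume r: "r \<in> carrier R" and "x \<in> carrier (A \<times>\<times> B)"
    then obtain a b where "x = (a, b)" "a \<in> carrier A" "b \<in> carrier B" by auto
    then show "r \<odot>\<^bsub>F\<^esub> \<beta> x \<in> {f \<in> carrier F. proj f \<in> Z}"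
      using basis[OF r, of a b] r by (simp add: smult_closed_F \<beta>_closed proj_smult tens_def)
  qed (simp add: proj_add add)
  then show "C \<in> Z" using f(2) by simp
qed

text \<open>The coefficient at the unit and the action on a bimodule are both read off a coset by
  \<open>the_elem\<close>. The extension of a bilinear map kills \<open>J\<close> and so is constant
  on cosets, which makes the image a singleton.\<close>

lemma the_elem_extension:
  assumes V: "module R V" and l: "bilinear V l" and f: "f \<in> carrier F"
  shows "the_elem (linear_extension V l ` proj f) = linear_extension V l f"
proof -
  interpret V: module R V by fact
  note L = linear_mapsD[OF linear_extension_linear[OF V bilinear_funcset[OF l]]]
  have "linear_extension V l (j \<oplus>\<^bsub>F\<^esub> f) = linear_extension V l f" if "j \<in> J" for j
    using that f bilinear_extension_kernel[OF V l that] L(1)[OF f] by (simp add: L(2))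
  moreover have "proj f = (\<lambda>j. j \<oplus>\<^bsub>F\<^esub> f) ` J"
    by (auto simp: proj_def a_r_coset_def')
  ultimately have "linear_extension V l ` proj f = (\<lambda>_. linear_extension V l f) ` J"
    by (simp add: image_image cong: image_cong)
  also have "\<dots> = {linear_extension V l f}"
    by (rule image_constant) (rule additive_subgroup.zero_closed[OF J.additive_subgroup_axioms])
  finally show ?thesis by simp
qed

end

section \<open>The enveloping algebra of a group ring\<close>

locale finite_group_algebra = base: cring R + G: group G
  for R :: "('r, 'x) ring_scheme" and G :: "('g, 'y) monoid_scheme" +
  assumes finite_G: "finite (carrier G)"
begin

sublocale RG: monoid_algebra R G
  by (intro monoid_algebra.intro base.is_cring G.is_monoid)

abbreviation A :: "('r, 'g \<Rightarrow> 'r) module" where "A \<equiv> monoid_ring R G"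
abbreviation \<delta> :: "'g \<Rightarrow> 'g \<Rightarrow> 'r" where "\<delta> \<equiv> basis_element R G"

sublocale A: assoc_algebra R A by (rule RG.assoc_algebra_F)

sublocale E: tensor_of_algebras R A "opposite_algebra A"
  by (intro tensor_of_algebras.intro tensor_of_algebras_axioms.intro base.is_cring
      RG.assoc_algebra_F assoc_algebra_opposite)

lemma opposite_sel [simp]:
  "carrier (opposite_algebra A) = carrier A" "add (opposite_algebra A) = add A"
  "\<zero>\<^bsub>opposite_algebra A\<^esub> = \<zero>\<^bsub>A\<^esub>" "\<one>\<^bsub>opposite_algebra A\<^esub> = \<one>\<^bsub>A\<^esub>" "smult (opposite_algebra A) = smult A"
  "x \<otimes>\<^bsub>opposite_algebra A\<^esub> y = y \<otimes>\<^bsub>A\<^esub> x"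
  by (simp_all add: opposite_algebra_def)

text \<open>The inverse in the second factor makes the map multiplicative although that factor is
  the opposite algebra. On the bimodule RG the pair (g, h) acts by sending m to g m h^-1, so the
  diagonal acts by conjugation.\<close>

definition env_basis :: "'g \<times> 'g \<Rightarrow> (('g \<Rightarrow> 'r) \<times> ('g \<Rightarrow> 'r) \<Rightarrow> 'r) set" where
  "env_basis u = E.tens (\<delta> (fst u)) (\<delta> (inv\<^bsub>G\<^esub> (snd u)))"

text \<open>The coefficient at the basis element (1, 1): a pure tensor of \<open>a\<close> and
  \<open>b\<close> goes to a(1) b(1).\<close>

definition env_coeff :: "(('g \<Rightarrow> 'r) \<times> ('g \<Rightarrow> 'r) \<Rightarrow> 'r) set \<Rightarrow> 'r" where
  "env_coeff C = the_elem (E.linear_extension (regular_module R)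
     (\<lambda>(a, b). a \<one>\<^bsub>G\<^esub> \<otimes>\<^bsub>R\<^esub> b \<one>\<^bsub>G\<^esub>) ` C)"

lemma bilinear_coeff: "E.bilinear (regular_module R) (\<lambda>(a, b). a \<one>\<^bsub>G\<^esub> \<otimes>\<^bsub>R\<^esub> b \<one>\<^bsub>G\<^esub>)"
  unfolding E.bilinear_def
  by (auto simp: RG.F_apply RG.F_mem base.l_distr base.r_distr base.m_assoc base.m_lcomm)

lemma env_coeff_proj:
  "f \<in> carrier E.F \<Longrightarrow> env_coeff (E.proj f)
    = E.linear_extension (regular_module R) (\<lambda>(a, b). a \<one>\<^bsub>G\<^esub> \<otimes>\<^bsub>R\<^esub> b \<one>\<^bsub>G\<^esub>) f"
  unfolding env_coeff_def by (rule E.the_elem_extension[OF base.module_regular_module bilinear_coeff])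

text \<open>Linear induction in the second tensor factor and then in the first. The scalar
  \<open>r\<close> stays universally quantified throughout, because scalars pulled out of a factor
  are absorbed into it.\<close>

lemma env_span:
  assumes basis: "\<And>r u. \<lbrakk>r \<in> carrier R; u \<in> carrier (G \<times>\<times> G)\<rbrakk> \<Longrightarrow> (r \<odot>\<^bsub>E.T\<^esub> \<one>\<^bsub>E.T\<^esub>) \<otimes>\<^bsub>E.T\<^esub> env_basis u \<in> Z"
    and add: "\<And>C D. \<lbrakk>C \<in> Z; D \<in> Z\<rbrakk> \<Longrightarrow> C \<oplus>\<^bsub>E.T\<^esub> D \<in> Z"
  shows "carrier E.T \<subseteq> Z"
proof (rule E.T_span[OF _ add])
  note sc = ring_hom_closed[OF E.scalar_hom_T] ring_hom_mult[OF E.scalar_hom_T]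
  let ?s = "\<lambda>r. r \<odot>\<^bsub>E.T\<^esub> \<one>\<^bsub>E.T\<^esub>"
  \<comment> \<open>\<open>env_basis\<close> inverts its second entry, so the tensor with second
    factor \<open>\<delta> y\<close> belongs to the pair of \<open>x\<close> and the inverse of
    \<open>y\<close>.\<close>
  have 1: "?s r \<otimes>\<^bsub>E.T\<^esub> E.tens (\<delta> x) (\<delta> y) \<in> Z" if "r \<in> carrier R" "x \<in> carrier G" "y \<in> carrier G" for r x y
    using basis[of r "(x, inv\<^bsub>G\<^esub> y)"] that by (simp add: env_basis_def DirProd_def)
  have 2: "?s r \<otimes>\<^bsub>E.T\<^esub> E.tens (\<delta> x) b \<in> Z" if "r \<in> carrier R" "x \<in> carrier G" "b \<in> carrier A" for r x b
  proof -
    have "b \<in> {b \<in> carrier A. \<forall>r\<in>carrier R. ?s r \<otimes>\<^bsub>E.T\<^esub> E.tens (\<delta> x) b \<in> Z}"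
    proof (rule RG.F_span[OF _ _ that(3)])
      fix s y assume s: "s \<in> carrier R" and y: "y \<in> carrier G"
      have "?s r \<otimes>\<^bsub>E.T\<^esub> E.tens (\<delta> x) (s \<odot>\<^bsub>A\<^esub> \<delta> y) = ?s (r \<otimes>\<^bsub>R\<^esub> s) \<otimes>\<^bsub>E.T\<^esub> E.tens (\<delta> x) (\<delta> y)"
        if r: "r \<in> carrier R" for r
        using E.tens_smult_right[OF s RG.\<beta>_closed, of "\<delta> y" x] r s
        by (simp add: RG.\<beta>_closed sc E.T.m_assoc E.tens_closed)
      then show "s \<odot>\<^bsub>A\<^esub> \<delta> y \<in> {b \<in> carrier A. \<forall>r\<in>carrier R. ?s r \<otimes>\<^bsub>E.T\<^esub> E.tens (\<delta> x) b \<in> Z}"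
        using 1 s y \<open>x \<in> carrier G\<close> by (simp add: RG.smult_closed_F RG.\<beta>_closed)
    next
      fix b b' assume "b \<in> carrier A" "b' \<in> carrier A"
        "b \<in> {b \<in> carrier A. \<forall>r\<in>carrier R. ?s r \<otimes>\<^bsub>E.T\<^esub> E.tens (\<delta> x) b \<in> Z}"
        "b' \<in> {b \<in> carrier A. \<forall>r\<in>carrier R. ?s r \<otimes>\<^bsub>E.T\<^esub> E.tens (\<delta> x) b \<in> Z}"
      then show "b \<oplus>\<^bsub>A\<^esub> b' \<in> {b \<in> carrier A. \<forall>r\<in>carrier R. ?s r \<otimes>\<^bsub>E.T\<^esub> E.tens (\<delta> x) b \<in> Z}"
        using E.tens_add_right[of "\<delta> x" b b'] add
        by (simp add: RG.\<beta>_closed E.tens_closed sc E.T.r_distr)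
    qed
    then show ?thesis using that by simp
  qed
  show "?s r \<otimes>\<^bsub>E.T\<^esub> E.tens a b \<in> Z" if r: "r \<in> carrier R" and a: "a \<in> carrier A"
    and b: "b \<in> carrier (opposite_algebra A)" for r a b
  proof -
    have b': "b \<in> carrier A" using b by simp
    have "a \<in> {a \<in> carrier A. \<forall>r\<in>carrier R. ?s r \<otimes>\<^bsub>E.T\<^esub> E.tens a b \<in> Z}"
    proof (rule RG.F_span[OF _ _ a])
      fix s x assume s: "s \<in> carrier R" and x: "x \<in> carrier G"
      have "?s r \<otimes>\<^bsub>E.T\<^esub> E.tens (s \<odot>\<^bsub>A\<^esub> \<delta> x) b = ?s (r \<otimes>\<^bsub>R\<^esub> s) \<otimes>\<^bsub>E.T\<^esub> E.tens (\<delta> x) b"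
        if r: "r \<in> carrier R" for r
        using E.tens_smult_left[OF s RG.\<beta>_closed b, of x] r s
        by (simp add: sc E.T.m_assoc E.tens_closed)
      then show "s \<odot>\<^bsub>A\<^esub> \<delta> x \<in> {a \<in> carrier A. \<forall>r\<in>carrier R. ?s r \<otimes>\<^bsub>E.T\<^esub> E.tens a b \<in> Z}"
        using 2 s x b' by (simp add: RG.smult_closed_F RG.\<beta>_closed)
    next
      fix a a' assume "a \<in> carrier A" "a' \<in> carrier A"
        "a \<in> {a \<in> carrier A. \<forall>r\<in>carrier R. ?s r \<otimes>\<^bsub>E.T\<^esub> E.tens a b \<in> Z}"
        "a' \<in> {a \<in> carrier A. \<forall>r\<in>carrier R. ?s r \<otimes>\<^bsub>E.T\<^esub> E.tens a b \<in> Z}"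
      then show "a \<oplus>\<^bsub>A\<^esub> a' \<in> {a \<in> carrier A. \<forall>r\<in>carrier R. ?s r \<otimes>\<^bsub>E.T\<^esub> E.tens a b \<in> Z}"
        using E.tens_add_left[of a a' b] add b'
        by (simp add: E.tens_closed sc E.T.r_distr)
    qed
    then show ?thesis using r by simp
  qed
qed

lemma carrier_GG [simp]: "carrier (G \<times>\<times> G) = carrier G \<times> carrier G"
  and mult_GG [simp]: "(g, h) \<otimes>\<^bsub>G \<times>\<times> G\<^esub> (g', h') = (g \<otimes>\<^bsub>G\<^esub> g', h \<otimes>\<^bsub>G\<^esub> h')"
  and one_GG [simp]: "\<one>\<^bsub>G \<times>\<times> G\<^esub> = (\<one>\<^bsub>G\<^esub>, \<one>\<^bsub>G\<^esub>)"
  by (simp_all add: DirProd_def)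

lemma env_based_algebra: "based_algebra R E.T (G \<times>\<times> G) env_basis env_coeff"
proof (rule based_algebra.intro)
  note lin = linear_mapsD[OF E.linear_extension_linear[OF base.module_regular_module
        E.bilinear_funcset[OF bilinear_coeff]], simplified]
  show "group (G \<times>\<times> G)" by (rule DirProd_group) (rule G.group_axioms)+
  show "finite (carrier (G \<times>\<times> G))" using finite_G by simp
  show "env_basis u \<in> carrier E.T" for u by (simp add: env_basis_def E.tens_closed)
  show "env_basis (u \<otimes>\<^bsub>G \<times>\<times> G\<^esub> v) = env_basis u \<otimes>\<^bsub>E.T\<^esub> env_basis v"
    if "u \<in> carrier (G \<times>\<times> G)" "v \<in> carrier (G \<times>\<times> G)" for u v
    using that by (cases u; cases v)
      (simp add: env_basis_def E.tens_mult RG.\<beta>_closed RG.\<beta>_mult G.inv_mult_group)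
  show "env_basis \<one>\<^bsub>G \<times>\<times> G\<^esub> = \<one>\<^bsub>E.T\<^esub>"
    using E.tens_one by (simp add: env_basis_def RG.one_F)
  show "env_coeff C \<in> carrier R" if C: "C \<in> carrier E.T" for C
    by (rule E.T_cases[OF C]) (simp add: env_coeff_proj lin)
  show "env_coeff (C \<oplus>\<^bsub>E.T\<^esub> D) = env_coeff C \<oplus>\<^bsub>R\<^esub> env_coeff D"
    if C: "C \<in> carrier E.T" and D: "D \<in> carrier E.T" for C D
    by (rule E.T_cases[OF C], rule E.T_cases[OF D])
      (simp add: env_coeff_proj lin E.proj_add[symmetric] E.add_closed_F)
  show "env_coeff ((r \<odot>\<^bsub>E.T\<^esub> \<one>\<^bsub>E.T\<^esub>) \<otimes>\<^bsub>E.T\<^esub> C) = r \<otimes>\<^bsub>R\<^esub> env_coeff C"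
    if r: "r \<in> carrier R" and C: "C \<in> carrier E.T" for r C
    by (rule E.T_cases[OF C]) (simp add: env_coeff_proj lin E.proj_smult[symmetric] r E.smult_closed_F)
  show "env_coeff (env_basis u) = (if u = \<one>\<^bsub>G \<times>\<times> G\<^esub> then \<one>\<^bsub>R\<^esub> else \<zero>\<^bsub>R\<^esub>)"
    if u: "u \<in> carrier (G \<times>\<times> G)" for u
  proof -
    obtain g h where gh: "u = (g, h)" "g \<in> carrier G" "h \<in> carrier G" using u by auto
    have "env_coeff (env_basis u) = \<delta> g \<one>\<^bsub>G\<^esub> \<otimes>\<^bsub>R\<^esub> \<delta> (inv\<^bsub>G\<^esub> h) \<one>\<^bsub>G\<^esub>"
      using gh E.linear_extension_\<beta>[OF base.module_regular_module E.bilinear_funcset[OF bilinear_coeff],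
          of "(\<delta> g, \<delta> (inv\<^bsub>G\<^esub> h))"]
      by (simp add: env_basis_def E.tens_def env_coeff_proj E.\<beta>_closed RG.\<beta>_closed)
    moreover have "\<one>\<^bsub>G\<^esub> = inv\<^bsub>G\<^esub> h \<longleftrightarrow> h = \<one>\<^bsub>G\<^esub>"
      using gh(3) by (metis G.inv_inv G.inv_one)
    ultimately show ?thesis using gh by (auto simp: RG.\<beta>_apply)
  qed
  show "carrier E.T \<subseteq> Z"
    if "\<And>r u. \<lbrakk>r \<in> carrier R; u \<in> carrier (G \<times>\<times> G)\<rbrakk> \<Longrightarrow> (r \<odot>\<^bsub>E.T\<^esub> \<one>\<^bsub>E.T\<^esub>) \<otimes>\<^bsub>E.T\<^esub> env_basis u \<in> Z"
      "\<And>a b. \<lbrakk>a \<in> Z; b \<in> Z\<rbrakk> \<Longrightarrow> a \<oplus>\<^bsub>E.T\<^esub> b \<in> Z" for Z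
    using that by (rule env_span)
qed (rule base.is_cring E.ring_T E.scalar_hom_T E.scalar_central_T; assumption?)+

sublocale Env: based_algebra R E.T "G \<times>\<times> G" env_basis env_coeff
  by (rule env_based_algebra)

section \<open>The regular bimodule as a coinduced module\<close>

lemma \<delta>_mult_apply:
  assumes g: "g \<in> carrier G" and f: "f \<in> carrier A" and z: "z \<in> carrier G"
  shows "(\<delta> g \<otimes>\<^bsub>A\<^esub> f) z = f (inv\<^bsub>G\<^esub> g \<otimes>\<^bsub>G\<^esub> z)" "(f \<otimes>\<^bsub>A\<^esub> \<delta> g) z = f (z \<otimes>\<^bsub>G\<^esub> inv\<^bsub>G\<^esub> g)"
proof -
  have "f \<in> {f \<in> carrier A. (\<delta> g \<otimes>\<^bsub>A\<^esub> f) z = f (inv\<^bsub>G\<^esub> g \<otimes>\<^bsub>G\<^esub> z) \<and> (f \<otimes>\<^bsub>A\<^esub> \<delta> g) z = f (z \<otimes>\<^bsub>G\<^esub> inv\<^bsub>G\<^esub> g)}"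
  proof (rule RG.F_span[OF _ _ f])
    fix r x assume r: "r \<in> carrier R" and x: "x \<in> carrier G"
    have 1: "z = g \<otimes>\<^bsub>G\<^esub> x \<longleftrightarrow> inv\<^bsub>G\<^esub> g \<otimes>\<^bsub>G\<^esub> z = x"
      using g x z by (metis G.inv_solve_left)
    have 2: "z = x \<otimes>\<^bsub>G\<^esub> g \<longleftrightarrow> z \<otimes>\<^bsub>G\<^esub> inv\<^bsub>G\<^esub> g = x"
      using g x z by (metis G.inv_solve_right)
    show "r \<odot>\<^bsub>A\<^esub> \<delta> x \<in> {f \<in> carrier A. (\<delta> g \<otimes>\<^bsub>A\<^esub> f) z = f (inv\<^bsub>G\<^esub> g \<otimes>\<^bsub>G\<^esub> z) \<and> (f \<otimes>\<^bsub>A\<^esub> \<delta> g) z = f (z \<otimes>\<^bsub>G\<^esub> inv\<^bsub>G\<^esub> g)}"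
      using r x g z
      by (simp add: RG.smult_closed_F RG.\<beta>_closed RG.smult_mult_left_F RG.smult_mult_right_F RG.\<beta>_mult
          RG.F_apply RG.\<beta>_apply 1 2)
  qed (use g z in \<open>simp add: RG.add_closed_F RG.r_distr_F RG.l_distr_F RG.\<beta>_closed RG.F_apply\<close>)
  then show "(\<delta> g \<otimes>\<^bsub>A\<^esub> f) z = f (inv\<^bsub>G\<^esub> g \<otimes>\<^bsub>G\<^esub> z)" "(f \<otimes>\<^bsub>A\<^esub> \<delta> g) z = f (z \<otimes>\<^bsub>G\<^esub> inv\<^bsub>G\<^esub> g)" by auto
qed

abbreviation N :: "((('g \<Rightarrow> 'r) \<times> ('g \<Rightarrow> 'r) \<Rightarrow> 'r) set, 'g \<Rightarrow> 'r) module" where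
  "N \<equiv> regular_bimodule R A"

lemma N_sel [simp]: "carrier N = carrier A" "\<zero>\<^bsub>N\<^esub> = \<zero>\<^bsub>A\<^esub>" "add N = add A"
  by (simp_all add: regular_bimodule_def bimodule_to_left_module_def)

lemma bilinear_bimodule:
  assumes m: "m \<in> carrier A" shows "E.bilinear A (\<lambda>(a, b). a \<otimes>\<^bsub>A\<^esub> m \<otimes>\<^bsub>A\<^esub> b)"
  unfolding E.bilinear_def using m
  by (auto simp: E.A.l_distr E.A.r_distr RG.smult_mult_left_F RG.smult_mult_right_F)

text \<open>In the definition of the action the scalar sits inside the left factor. Pulling it out
  turns the sum into the linear extension of the bilinear map sending (a, b) to a m b, on which
  \<open>the_elem\<close> has been evaluated.\<close>

lemma smult_N_proj:
  assumes m: "m \<in> carrier A" and f: "f \<in> carrier E.F"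
  shows "E.proj f \<odot>\<^bsub>N\<^esub> m = E.linear_extension A (\<lambda>(a, b). a \<otimes>\<^bsub>A\<^esub> m \<otimes>\<^bsub>A\<^esub> b) f"
proof -
  have "(\<Oplus>\<^bsub>A\<^esub>p\<in>{p \<in> carrier A \<times> carrier A. h p \<noteq> \<zero>\<^bsub>R\<^esub>}. ((h p \<odot>\<^bsub>A\<^esub> fst p) \<otimes>\<^bsub>A\<^esub> m) \<otimes>\<^bsub>A\<^esub> snd p)
      = E.linear_extension A (\<lambda>(a, b). a \<otimes>\<^bsub>A\<^esub> m \<otimes>\<^bsub>A\<^esub> b) h" if h: "h \<in> carrier E.F" for h
    unfolding E.linear_extension_def
    using m E.F_mem(1)[OF h]
    by (intro RG.F.finsum_cong') (auto simp: RG.smult_mult_left_F RG.smult_closed_F)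
  moreover have "E.proj f \<subseteq> carrier E.F"
    unfolding E.proj_def using E.F.a_r_coset_subset_G[OF E.J.a_subset f] .
  ultimately have "(\<lambda>h. \<Oplus>\<^bsub>A\<^esub>p\<in>{p \<in> carrier A \<times> carrier A. h p \<noteq> \<zero>\<^bsub>R\<^esub>}. ((h p \<odot>\<^bsub>A\<^esub> fst p) \<otimes>\<^bsub>A\<^esub> m) \<otimes>\<^bsub>A\<^esub> snd p) ` E.proj f
      = E.linear_extension A (\<lambda>(a, b). a \<otimes>\<^bsub>A\<^esub> m \<otimes>\<^bsub>A\<^esub> b) ` E.proj f"
    by (intro image_cong) auto
  then show ?thesis
    using E.the_elem_extension[OF RG.module_F bilinear_bimodule[OF m] f]
    by (simp add: regular_bimodule_def bimodule_to_left_module_def)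
qed

lemma smult_N_tens:
  "\<lbrakk>m \<in> carrier A; a \<in> carrier A; b \<in> carrier A\<rbrakk> \<Longrightarrow> E.tens a b \<odot>\<^bsub>N\<^esub> m = a \<otimes>\<^bsub>A\<^esub> m \<otimes>\<^bsub>A\<^esub> b"
  unfolding E.tens_def
  by (subst smult_N_proj)
    (simp_all add: E.\<beta>_closed E.linear_extension_\<beta>[OF RG.module_F E.bilinear_funcset[OF bilinear_bimodule]])

lemma smult_N_scalar:
  assumes "r \<in> carrier R" "m \<in> carrier A"
  shows "(r \<odot>\<^bsub>E.T\<^esub> \<one>\<^bsub>E.T\<^esub>) \<odot>\<^bsub>N\<^esub> m = r \<odot>\<^bsub>A\<^esub> m"
proof -
  note lin = linear_mapsD(3)[OF E.linear_extension_linear[OF RG.module_F E.bilinear_funcset[OF bilinear_bimodule]]]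
  show ?thesis
    using assms unfolding E.scalar_T[OF assms(1)]
    by (subst smult_N_proj)
      (simp_all add: E.smult_closed_F E.one_F E.\<beta>_closed lin
        E.linear_extension_\<beta>[OF RG.module_F E.bilinear_funcset[OF bilinear_bimodule]])
qed

text \<open>For \<open>g = h\<close> this is conjugation on coefficient functions, the action that
  the induced complex has to reproduce.\<close>

lemma smult_N_basis:
  assumes "g \<in> carrier G" "h \<in> carrier G" "m \<in> carrier A" "z \<in> carrier G"
  shows "(env_basis (g, h) \<odot>\<^bsub>N\<^esub> m) z = m (inv\<^bsub>G\<^esub> g \<otimes>\<^bsub>G\<^esub> z \<otimes>\<^bsub>G\<^esub> h)"
  using assms
  by (simp add: env_basis_def smult_N_tens RG.\<beta>_closed RG.mult_closed_F \<delta>_mult_apply G.m_assoc)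

lemma abelian_group_N: "abelian_group N"
  by (rule abelian_group_eqI[OF RG.abelian_group_F]) simp_all

abbreviation triv :: "'u \<Rightarrow> 'r \<Rightarrow> 'r" where "triv \<equiv> (\<lambda>_ x. x)"

text \<open>The inverse of taking the coefficient at \<open>1\<close>.\<close>

definition coinduced_hom ::
    "((('g \<Rightarrow> 'r) \<times> ('g \<Rightarrow> 'r) \<Rightarrow> 'r) set, 'm) module \<Rightarrow> ('m \<Rightarrow> 'r) \<Rightarrow> 'm \<Rightarrow> 'g \<Rightarrow> 'r" where
  "coinduced_hom M \<phi> = (\<lambda>x\<in>carrier M. \<lambda>z\<in>carrier G. \<phi> (env_basis (inv\<^bsub>G\<^esub> z, \<one>\<^bsub>G\<^esub>) \<odot>\<^bsub>M\<^esub> x))"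

context
  fixes M :: "((('g \<Rightarrow> 'r) \<times> ('g \<Rightarrow> 'r) \<Rightarrow> 'r) set, 'm) module"
  assumes M: "left_module E.T M" and N: "left_module E.T N"
begin

interpretation M: left_module E.T M by (rule M)
interpretation GM: group_module R "G \<times>\<times> G" "scalar_restriction E.T M" "Env.act M"
  by (rule Env.group_module_scalar_restriction[OF M])

text \<open>Conjugation fixes the unit of the group, so the diagonal leaves the coefficient at 1
  unchanged.\<close>

lemma coeff_one_equivariant:
  assumes f: "f \<in> module_homs E.T M N"
  shows "(\<lambda>x. f x \<one>\<^bsub>G\<^esub>) \<in> equivariant_maps R G (scalar_restriction E.T M) (\<lambda>g. Env.act M (g, g)) (regular_module R) triv"
proof (intro equivariant_mapsI linear_mapsI; simp)
  note f' = module_homsD[OF f, simplified]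
  fix x assume x: "x \<in> carrier M"
  show "f x \<one>\<^bsub>G\<^esub> \<in> carrier R" using RG.F_mem(1)[OF f'(1)[OF x]] by simp
  show "f (x \<oplus>\<^bsub>M\<^esub> y) \<one>\<^bsub>G\<^esub> = f x \<one>\<^bsub>G\<^esub> \<oplus>\<^bsub>R\<^esub> f y \<one>\<^bsub>G\<^esub>" if "y \<in> carrier M" for y
    using f' x that by (simp add: RG.F_apply)
  show "f ((r \<odot>\<^bsub>E.T\<^esub> \<one>\<^bsub>E.T\<^esub>) \<odot>\<^bsub>M\<^esub> x) \<one>\<^bsub>G\<^esub> = r \<otimes>\<^bsub>R\<^esub> f x \<one>\<^bsub>G\<^esub>" if "r \<in> carrier R" for r
    using f' x that by (simp add: ring_hom_closed[OF E.scalar_hom_T] smult_N_scalar RG.F_apply)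
  show "f (env_basis (g, g) \<odot>\<^bsub>M\<^esub> x) \<one>\<^bsub>G\<^esub> = f x \<one>\<^bsub>G\<^esub>" if "g \<in> carrier G" for g
    using f' x that by (simp add: Env.basis_closed smult_N_basis G.l_inv)
qed

lemma coinduced_hom_module_homs:
  assumes \<phi>: "\<phi> \<in> equivariant_maps R G (scalar_restriction E.T M) (\<lambda>g. Env.act M (g, g)) (regular_module R) triv"
  shows "coinduced_hom M \<phi> \<in> module_homs E.T M N"
proof -
  interpret N: left_module E.T N by (rule N)
  note \<phi>' = equivariant_mapsD[OF \<phi>, simplified]
  note ac = GM.act_closed[simplified] and am = GM.act_mult[simplified]
    and al = linear_mapsD[OF GM.act_linear, simplified]
  have cl: "coinduced_hom M \<phi> x \<in> carrier A" if "x \<in> carrier M" for x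
    using that \<phi>'(3) ac finite_G
    by (intro RG.F_memI[where S = "carrier G"]) (auto simp: coinduced_hom_def)
  have eval: "coinduced_hom M \<phi> x z = \<phi> (env_basis (inv\<^bsub>G\<^esub> z, \<one>\<^bsub>G\<^esub>) \<odot>\<^bsub>M\<^esub> x)"
    if "x \<in> carrier M" "z \<in> carrier G" for x z
    using that by (simp add: coinduced_hom_def)
  have sc: "(r \<odot>\<^bsub>E.T\<^esub> \<one>\<^bsub>E.T\<^esub>) \<in> carrier E.T" if "r \<in> carrier R" for r
    using ring_hom_closed[OF E.scalar_hom_T that] .
  show ?thesis
    unfolding Env.module_homs_iff_equivariant[OF M N]
  proof (intro conjI equivariant_mapsI linear_mapsI; (simp only: scalar_restriction_simps carrier_GG N_sel)?)
    show "coinduced_hom M \<phi> \<in> extensional (carrier M)" by (simp add: coinduced_hom_def)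
    fix x assume x: "x \<in> carrier M"
    show "coinduced_hom M \<phi> x \<in> carrier A" by (rule cl[OF x])
    show "coinduced_hom M \<phi> (x \<oplus>\<^bsub>M\<^esub> y) = coinduced_hom M \<phi> x \<oplus>\<^bsub>A\<^esub> coinduced_hom M \<phi> y"
      if y: "y \<in> carrier M" for y
      using x y by (intro RG.F_eqI cl RG.add_closed_F) (simp_all add: eval RG.F_apply al \<phi>'(4) ac)
    show "coinduced_hom M \<phi> ((r \<odot>\<^bsub>E.T\<^esub> \<one>\<^bsub>E.T\<^esub>) \<odot>\<^bsub>M\<^esub> x) = (r \<odot>\<^bsub>E.T\<^esub> \<one>\<^bsub>E.T\<^esub>) \<odot>\<^bsub>N\<^esub> coinduced_hom M \<phi> x"
      if r: "r \<in> carrier R" for r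
      unfolding smult_N_scalar[OF r cl[OF x]]
      using x r by (intro RG.F_eqI cl RG.smult_closed_F) (simp_all add: eval RG.F_apply al \<phi>'(5) ac sc M.smult_closed)
    show "coinduced_hom M \<phi> (env_basis u \<odot>\<^bsub>M\<^esub> x) = env_basis u \<odot>\<^bsub>N\<^esub> coinduced_hom M \<phi> x"
      if u: "u \<in> carrier G \<times> carrier G" for u
    proof -
      obtain g h where gh: "u = (g, h)" "g \<in> carrier G" "h \<in> carrier G" using u by auto
      have Ncl: "env_basis u \<odot>\<^bsub>N\<^esub> coinduced_hom M \<phi> x \<in> carrier A"
        using N.smult_closed[OF Env.basis_closed, of u "coinduced_hom M \<phi> x"] u cl[OF x] by simp
      show ?thesis
      proof (rule RG.F_eqI[OF cl Ncl])
        show "env_basis u \<odot>\<^bsub>M\<^esub> x \<in> carrier M" using ac u x by blast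
        fix z assume z: "z \<in> carrier G"
        let ?w = "inv\<^bsub>G\<^esub> g \<otimes>\<^bsub>G\<^esub> z \<otimes>\<^bsub>G\<^esub> h"
        \<comment> \<open>The pair (z^-1, 1) (g, h) is split into a diagonal element, which \<phi>
          ignores, and a pair with trivial second entry. The first entry of the latter is the
          inverse of \<open>?w\<close>, the point at which (g, h) evaluates an element of RG when
          the coefficient at z is taken.\<close>
        have eq: "(h, h) \<otimes>\<^bsub>G \<times>\<times> G\<^esub> (inv\<^bsub>G\<^esub> ?w, \<one>\<^bsub>G\<^esub>) = (inv\<^bsub>G\<^esub> z, \<one>\<^bsub>G\<^esub>) \<otimes>\<^bsub>G \<times>\<times> G\<^esub> (g, h)"
          using gh z by (simp add: G.inv_mult_group G.m_assoc[symmetric])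
        have "coinduced_hom M \<phi> (env_basis u \<odot>\<^bsub>M\<^esub> x) z = \<phi> (env_basis ((inv\<^bsub>G\<^esub> z, \<one>\<^bsub>G\<^esub>) \<otimes>\<^bsub>G \<times>\<times> G\<^esub> (g, h)) \<odot>\<^bsub>M\<^esub> x)"
          using gh x z by (subst eval) (simp_all add: ac am[symmetric])
        also have "\<dots> = \<phi> (env_basis (h, h) \<odot>\<^bsub>M\<^esub> (env_basis (inv\<^bsub>G\<^esub> ?w, \<one>\<^bsub>G\<^esub>) \<odot>\<^bsub>M\<^esub> x))"
          unfolding eq[symmetric] using gh x z by (subst am[symmetric]) simp_all
        also have "\<dots> = \<phi> (env_basis (inv\<^bsub>G\<^esub> ?w, \<one>\<^bsub>G\<^esub>) \<odot>\<^bsub>M\<^esub> x)"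
          using gh x z by (intro \<phi>'(2) ac) auto
        also have "\<dots> = (env_basis u \<odot>\<^bsub>N\<^esub> coinduced_hom M \<phi> x) z"
          using gh x z cl[OF x] by (simp add: smult_N_basis eval)
        finally show "coinduced_hom M \<phi> (env_basis u \<odot>\<^bsub>M\<^esub> x) z = (env_basis u \<odot>\<^bsub>N\<^esub> coinduced_hom M \<phi> x) z" .
      qed
    qed
  qed
qed

lemma coinduced_hom_one:
  assumes "\<phi> \<in> equivariant_maps R G (scalar_restriction E.T M) (\<lambda>g. Env.act M (g, g)) (regular_module R) triv"
    and "x \<in> carrier M"
  shows "coinduced_hom M \<phi> x \<one>\<^bsub>G\<^esub> = \<phi> x"
  using assms(2) GM.act_one by (simp add: coinduced_hom_def)

text \<open>The element (z^-1, 1) moves the coefficient at \<open>z\<close> to 1, so a homomorphism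
  into RG is determined by its coefficient at 1.\<close>

lemma module_hom_eq_of_coeff_one:
  assumes f: "f \<in> module_homs E.T M N" and x: "x \<in> carrier M" and z: "z \<in> carrier G"
  shows "f x z = f (env_basis (inv\<^bsub>G\<^esub> z, \<one>\<^bsub>G\<^esub>) \<odot>\<^bsub>M\<^esub> x) \<one>\<^bsub>G\<^esub>"
  using module_homsD[OF f] x z by (simp add: Env.basis_closed smult_N_basis)

end

end

section \<open>Assembling resolutions over centralizers\<close>

lemma (in group) subgroup_centralizer:
  assumes "x \<in> carrier G" shows "subgroup (carrier (centralizer G x)) G"
proof
  fix h assume "h \<in> carrier (centralizer G x)"
  then have h: "h \<in> carrier G" "h \<otimes> x = x \<otimes> h" by (auto simp: centralizer_def)
  have "inv h \<otimes> x = inv h \<otimes> (x \<otimes> h) \<otimes> inv h" using h(1) assms by (simp add: m_assoc)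
  also have "\<dots> = x \<otimes> inv h" using h(1) assms unfolding h(2)[symmetric] by (simp add: m_assoc[symmetric])
  finally show "inv h \<in> carrier (centralizer G x)" using h by (simp add: centralizer_def)
next
  fix h k assume "h \<in> carrier (centralizer G x)" "k \<in> carrier (centralizer G x)"
  then show "h \<otimes> k \<in> carrier (centralizer G x)"
    using assms by (simp add: centralizer_def m_assoc) (metis m_assoc)
qed (use assms in \<open>auto simp: centralizer_def\<close>)

lemma (in group) group_centralizer:
  assumes "x \<in> carrier G" shows "group (centralizer G x)"
  using subgroup_imp_group[OF subgroup_centralizer[OF assms]] by (simp add: centralizer_def)

lemma centralizer_sel [simp]:
  "h \<otimes>\<^bsub>centralizer G x\<^esub> k = h \<otimes>\<^bsub>G\<^esub> k" "\<one>\<^bsub>centralizer G x\<^esub> = \<one>\<^bsub>G\<^esub>"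
  by (simp_all add: centralizer_def)

lemma (in group) inv_centralizer:
  assumes "x \<in> carrier G" "h \<in> carrier (centralizer G x)"
  shows "inv\<^bsub>centralizer G x\<^esub> h = inv h"
  using m_inv_consistent[OF subgroup_centralizer[OF assms(1)] assms(2)] by (simp add: centralizer_def)

text \<open>\<open>Q i\<close> resolves the trivial module over the centralizer of \<open>g i\<close>.  Choosing, for each \<open>y\<close>, an
  index \<open>idx y\<close> and an element \<open>s y\<close> conjugating \<open>g (idx y)\<close> to \<open>y\<close> identifies the module induced
  from the modules \<open>Q i n\<close> with the product over \<open>y \<in> G\<close> of the modules \<open>Q (idx y) n\<close>.\<close>

locale centralizer_resolutions = finite_group_algebra R G
  for R :: "('r, 'x) ring_scheme" and G :: "('g, 'y) monoid_scheme" +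
  fixes I :: "'i set" and g :: "'i \<Rightarrow> 'g" and idx :: "'g \<Rightarrow> 'i" and s :: "'g \<Rightarrow> 'g"
    and Q :: "'i \<Rightarrow> int \<Rightarrow> ('r, 'q) module" and b :: "'i \<Rightarrow> int \<Rightarrow> 'g \<Rightarrow> 'q \<Rightarrow> 'q"
    and e :: "'i \<Rightarrow> int \<Rightarrow> 'q \<Rightarrow> 'q" and \<epsilon> :: "'i \<Rightarrow> 'q \<Rightarrow> 'r"
  assumes resolution: "i \<in> I \<Longrightarrow> complete_resolution_complex R (centralizer G (g i)) (Q i) (b i) (e i)
      (regular_module R) triv (\<epsilon> i)"
    and g_closed: "i \<in> I \<Longrightarrow> g i \<in> carrier G"
    and idx_closed: "y \<in> carrier G \<Longrightarrow> idx y \<in> I"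
    and s_closed: "y \<in> carrier G \<Longrightarrow> s y \<in> carrier G"
    and s_conj: "y \<in> carrier G \<Longrightarrow> s y \<otimes>\<^bsub>G\<^esub> g (idx y) = y \<otimes>\<^bsub>G\<^esub> s y"
    and idx_g: "i \<in> I \<Longrightarrow> idx (g i) = i"
    and s_g: "i \<in> I \<Longrightarrow> s (g i) = \<one>\<^bsub>G\<^esub>"
    and idx_conj: "\<lbrakk>y \<in> carrier G; h \<in> carrier G\<rbrakk> \<Longrightarrow> idx (inv\<^bsub>G\<^esub> h \<otimes>\<^bsub>G\<^esub> y \<otimes>\<^bsub>G\<^esub> h) = idx y"
    and left_module_N: "left_module E.T N"
begin

definition conjugate :: "'g \<Rightarrow> 'g \<Rightarrow> 'g" where "conjugate h y = inv\<^bsub>G\<^esub> h \<otimes>\<^bsub>G\<^esub> y \<otimes>\<^bsub>G\<^esub> h"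

text \<open>Determined by h s(y') = s(y) cen(h, y), where y' is \<open>conjugate h y\<close>. It is
  the cocycle that describes an induced module in terms of chosen coset representatives.\<close>

definition cen :: "'g \<Rightarrow> 'g \<Rightarrow> 'g" where "cen h y = inv\<^bsub>G\<^esub> (s y) \<otimes>\<^bsub>G\<^esub> h \<otimes>\<^bsub>G\<^esub> s (conjugate h y)"

lemma conj_closed: "\<lbrakk>y \<in> carrier G; h \<in> carrier G\<rbrakk> \<Longrightarrow> conjugate h y \<in> carrier G"
  by (simp add: conjugate_def)

lemma conj_one: "y \<in> carrier G \<Longrightarrow> conjugate \<one>\<^bsub>G\<^esub> y = y"
  by (simp add: conjugate_def)

lemma conj_conj: "\<lbrakk>y \<in> carrier G; h \<in> carrier G; k \<in> carrier G\<rbrakk> \<Longrightarrow> conjugate k (conjugate h y) = conjugate (h \<otimes>\<^bsub>G\<^esub> k) y"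
  by (simp add: conjugate_def G.inv_mult_group G.m_assoc)

lemma conj_eq_iff: "\<lbrakk>y \<in> carrier G; h \<in> carrier G; z \<in> carrier G\<rbrakk> \<Longrightarrow> conjugate h y = z \<longleftrightarrow> y \<otimes>\<^bsub>G\<^esub> h = h \<otimes>\<^bsub>G\<^esub> z"
  unfolding conjugate_def by (metis G.inv_closed G.inv_solve_left G.m_assoc G.m_closed)

lemma idx_conj': "\<lbrakk>y \<in> carrier G; h \<in> carrier G\<rbrakk> \<Longrightarrow> idx (conjugate h y) = idx y"
  by (simp add: conjugate_def idx_conj)

lemma conj_s: "y \<in> carrier G \<Longrightarrow> conjugate (s y) y = g (idx y)"
  by (simp add: conj_eq_iff s_closed g_closed idx_closed s_conj)

lemma conj_inj: "\<lbrakk>y \<in> carrier G; z \<in> carrier G; h \<in> carrier G; conjugate h y = conjugate h z\<rbrakk> \<Longrightarrow> y = z"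
  by (metis conj_conj conj_one G.r_inv G.inv_closed)

text \<open>Both s(y) and h s(y'), with y' the conjugate of y by h, conjugate the representative of
  the class to y. They therefore differ by an element of its centralizer.\<close>

lemma cen_closed:
  assumes y: "y \<in> carrier G" and h: "h \<in> carrier G"
  shows "cen h y \<in> carrier (centralizer G (g (idx y)))"
proof -
  let ?z = "conjugate h y" and ?i = "idx y"
  have cl: "?z \<in> carrier G" "s y \<in> carrier G" "s ?z \<in> carrier G" "g ?i \<in> carrier G"
    using y h by (auto simp: conj_closed s_closed g_closed idx_closed)
  have 1: "s ?z \<otimes>\<^bsub>G\<^esub> g ?i = ?z \<otimes>\<^bsub>G\<^esub> s ?z" using s_conj[OF cl(1)] y h by (simp add: idx_conj')
  have 2: "h \<otimes>\<^bsub>G\<^esub> ?z = y \<otimes>\<^bsub>G\<^esub> h" using y h cl(1) conj_eq_iff[of y h ?z] by simp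
  have 3: "inv\<^bsub>G\<^esub> (s y) \<otimes>\<^bsub>G\<^esub> y = g ?i \<otimes>\<^bsub>G\<^esub> inv\<^bsub>G\<^esub> (s y)"
    using s_conj[OF y] y cl
    by (metis G.inv_closed G.inv_solve_left G.inv_solve_right G.m_assoc G.m_closed)
  have "cen h y \<otimes>\<^bsub>G\<^esub> g ?i = inv\<^bsub>G\<^esub> (s y) \<otimes>\<^bsub>G\<^esub> (h \<otimes>\<^bsub>G\<^esub> (s ?z \<otimes>\<^bsub>G\<^esub> g ?i))"
    using h cl by (simp add: cen_def G.m_assoc)
  also have "\<dots> = inv\<^bsub>G\<^esub> (s y) \<otimes>\<^bsub>G\<^esub> ((h \<otimes>\<^bsub>G\<^esub> ?z) \<otimes>\<^bsub>G\<^esub> s ?z)"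
    using h cl by (simp add: 1 G.m_assoc)
  also have "\<dots> = (inv\<^bsub>G\<^esub> (s y) \<otimes>\<^bsub>G\<^esub> y) \<otimes>\<^bsub>G\<^esub> (h \<otimes>\<^bsub>G\<^esub> s ?z)"
    using h y cl by (simp add: 2 G.m_assoc)
  also have "\<dots> = g ?i \<otimes>\<^bsub>G\<^esub> cen h y"
    using h y cl by (simp add: 3 cen_def G.m_assoc)
  finally show ?thesis using h cl by (simp add: centralizer_def cen_def)
qed

lemma cen_one: "y \<in> carrier G \<Longrightarrow> cen \<one>\<^bsub>G\<^esub> y = \<one>\<^bsub>G\<^esub>"
  by (simp add: cen_def conj_one s_closed)

text \<open>The cocycle identity, which makes the action \<open>w\<close> multiplicative. The
  representatives at the intermediate point cancel.\<close>

lemma cen_mult: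
  assumes "y \<in> carrier G" "h \<in> carrier G" "k \<in> carrier G"
  shows "cen (h \<otimes>\<^bsub>G\<^esub> k) y = cen h y \<otimes>\<^bsub>G\<^esub> cen k (conjugate h y)"
proof -
  have "s (conjugate h y) \<otimes>\<^bsub>G\<^esub> (inv\<^bsub>G\<^esub> (s (conjugate h y)) \<otimes>\<^bsub>G\<^esub> z) = z" if "z \<in> carrier G" for z
    using that assms by (simp add: G.m_assoc[symmetric] s_closed conj_closed)
  then show ?thesis
    using assms by (simp add: cen_def conj_conj G.m_assoc s_closed conj_closed)
qed

lemma complex: "i \<in> I \<Longrightarrow> exact_complex R (centralizer G (g i)) (Q i) (b i) (e i)"
  using resolution by (simp add: complete_resolution_complex_def complete_complex_def)

lemma Q_group_module: "i \<in> I \<Longrightarrow> group_module R (centralizer G (g i)) (Q i n) (b i n)"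
  by (rule exact_complex.group_module[OF complex])

lemma Q_module: "i \<in> I \<Longrightarrow> module R (Q i n)"
  by (rule exact_complex.module[OF complex])

lemma Q_module_idx: "y \<in> carrier G \<Longrightarrow> module R (Q (idx y) n)"
  by (rule Q_module[OF idx_closed])

lemmas b_linear = linear_mapsD[OF group_module.act_linear[OF Q_group_module[OF idx_closed] cen_closed]]

lemma e_equivariant: "i \<in> I \<Longrightarrow>
    e i n \<in> equivariant_maps R (centralizer G (g i)) (Q i n) (b i n) (Q i (n - 1)) (b i (n - 1))"
  by (rule exact_complex.diff[OF complex])

lemmas e_idx = equivariant_mapsD[OF e_equivariant[OF idx_closed]]

section \<open>The complex induced from the centralizers\<close>

definition W :: "int \<Rightarrow> ('r, 'g \<Rightarrow> 'q) module" where
  "W n = direct_sum (carrier G) (\<lambda>y. Q (idx y) n)"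

text \<open>The condition of finite support in \<open>direct_sum\<close> disappears because the
  group is finite, so \<open>W n\<close> is a full product.\<close>

lemma W_sel:
  "carrier (W n) = (\<Pi>\<^sub>E y\<in>carrier G. carrier (Q (idx y) n))"
  "\<zero>\<^bsub>W n\<^esub> = (\<lambda>y\<in>carrier G. \<zero>\<^bsub>Q (idx y) n\<^esub>)"
  "f \<oplus>\<^bsub>W n\<^esub> f' = (\<lambda>y\<in>carrier G. f y \<oplus>\<^bsub>Q (idx y) n\<^esub> f' y)"
  "r \<odot>\<^bsub>W n\<^esub> f = (\<lambda>y\<in>carrier G. r \<odot>\<^bsub>Q (idx y) n\<^esub> f y)"
  using finite_G by (auto simp: W_def direct_sum_def)

lemma W_memI: "(\<And>y. y \<in> carrier G \<Longrightarrow> h y \<in> carrier (Q (idx y) n)) \<Longrightarrow> (\<lambda>y\<in>carrier G. h y) \<in> carrier (W n)"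
  by (auto simp: W_sel(1))

lemma W_mem: "\<lbrakk>f \<in> carrier (W n); y \<in> carrier G\<rbrakk> \<Longrightarrow> f y \<in> carrier (Q (idx y) n)"
  by (auto simp: W_sel)

lemma W_eqI:
  "\<lbrakk>f \<in> carrier (W n); f' \<in> carrier (W n'); \<And>y. y \<in> carrier G \<Longrightarrow> f y = f' y\<rbrakk> \<Longrightarrow> f = f'"
  by (rule extensionalityI[of _ "carrier G"]) (auto simp: W_sel PiE_def)

lemma module_W: "module R (W n)"
proof -
  note M = Q_module_idx[of _ n]
  note ops = module.smult_l_distr[OF M] module.smult_r_distr[OF M] module.smult_assoc1[OF M]
    module.smult_one[OF M] module.smult_closed[OF M]
  note gr = abelian_groupE[OF module.axioms(2)[OF M]]
  have "abelian_group (W n)"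
  proof (rule abelian_groupI)
    fix f assume f: "f \<in> carrier (W n)"
    have "\<forall>y\<in>carrier G. \<exists>z. z \<in> carrier (Q (idx y) n) \<and> z \<oplus>\<^bsub>Q (idx y) n\<^esub> f y = \<zero>\<^bsub>Q (idx y) n\<^esub>"
      using gr(6) W_mem[OF f] by blast
    then obtain h where h: "\<And>y. y \<in> carrier G \<Longrightarrow> h y \<in> carrier (Q (idx y) n)"
      "\<And>y. y \<in> carrier G \<Longrightarrow> h y \<oplus>\<^bsub>Q (idx y) n\<^esub> f y = \<zero>\<^bsub>Q (idx y) n\<^esub>" by metis
    show "\<exists>h\<in>carrier (W n). h \<oplus>\<^bsub>W n\<^esub> f = \<zero>\<^bsub>W n\<^esub>"
      by (rule bexI[of _ "restrict h (carrier G)"]) (auto simp: W_sel h intro!: restrict_ext)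
  next
    fix f f' f'' assume "f \<in> carrier (W n)" "f' \<in> carrier (W n)" "f'' \<in> carrier (W n)"
    then show "f \<oplus>\<^bsub>W n\<^esub> f' \<oplus>\<^bsub>W n\<^esub> f'' = f \<oplus>\<^bsub>W n\<^esub> (f' \<oplus>\<^bsub>W n\<^esub> f'')"
      using gr(3) W_mem by (auto simp: W_sel(2-4) intro!: restrict_ext)
  next
    fix f f' assume "f \<in> carrier (W n)" "f' \<in> carrier (W n)"
    then show "f \<oplus>\<^bsub>W n\<^esub> f' = f' \<oplus>\<^bsub>W n\<^esub> f"
      using gr(4) W_mem
      by (auto simp: W_sel(2-4) intro!: restrict_ext)
  next
    fix f assume f: "f \<in> carrier (W n)"
    show "\<zero>\<^bsub>W n\<^esub> \<oplus>\<^bsub>W n\<^esub> f = f"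
      using f gr(5) W_mem[OF f] by (intro extensionalityI[of _ "carrier G"]) (auto simp: W_sel PiE_def)
  next
    fix f f' assume "f \<in> carrier (W n)" "f' \<in> carrier (W n)"
    then show "f \<oplus>\<^bsub>W n\<^esub> f' \<in> carrier (W n)"
      unfolding W_sel(3) by (intro W_memI gr(1)) (simp_all add: W_mem)
  qed (use gr in \<open>auto simp: W_sel\<close>)
  then show ?thesis
  proof (rule moduleI[OF base.is_cring])
    fix r f assume "r \<in> carrier R" "f \<in> carrier (W n)"
    then show "r \<odot>\<^bsub>W n\<^esub> f \<in> carrier (W n)"
      unfolding W_sel(4) by (intro W_memI ops(5)) (simp_all add: W_mem)
  next
    fix f assume f: "f \<in> carrier (W n)"
    show "\<one>\<^bsub>R\<^esub> \<odot>\<^bsub>W n\<^esub> f = f"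
      using f ops W_mem[OF f] by (intro extensionalityI[of _ "carrier G"]) (auto simp: W_sel PiE_def)
  qed (use ops W_mem in \<open>auto simp: W_sel(3,4) intro!: restrict_ext\<close>)
qed

text \<open>The action on the induced module, fibre by fibre: \<open>h\<close> carries the fibre
  over \<open>conjugate h y\<close> to the fibre over \<open>y\<close>. The chosen representatives
  match only up to \<open>cen h y\<close>, and this correction acts inside the fibre.\<close>

definition w :: "int \<Rightarrow> 'g \<Rightarrow> ('g \<Rightarrow> 'q) \<Rightarrow> 'g \<Rightarrow> 'q" where
  "w n h f = (\<lambda>y\<in>carrier G. b (idx y) n (cen h y) (f (conjugate h y)))"

lemma W_mem_conj: "\<lbrakk>f \<in> carrier (W n); y \<in> carrier G; h \<in> carrier G\<rbrakk> \<Longrightarrow> f (conjugate h y) \<in> carrier (Q (idx y) n)"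
  using W_mem[of f n "conjugate h y"] by (simp add: conj_closed idx_conj')

lemma w_closed: "\<lbrakk>f \<in> carrier (W n); h \<in> carrier G\<rbrakk> \<Longrightarrow> w n h f \<in> carrier (W n)"
  unfolding w_def by (intro W_memI b_linear(1)) (simp_all add: W_mem_conj)

lemma group_module_W: "group_module R G (W n) (w n)"
proof (intro group_module.intro module_W G.group_axioms group_module_axioms.intro)
  fix h assume h: "h \<in> carrier G"
  show "w n h \<in> linear_maps R (W n) (W n)"
    using h W_mem_conj
    by (intro linear_mapsI w_closed) (auto simp: W_sel(3,4) w_def b_linear conj_closed idx_conj' intro!: restrict_ext)
next
  fix f assume f: "f \<in> carrier (W n)"
  show "w n \<one>\<^bsub>G\<^esub> f = f"
    using group_module.act_one[OF Q_group_module[OF idx_closed] W_mem[OF f]]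
    by (intro W_eqI[OF w_closed f]) (simp_all add: f w_def cen_one conj_one)
next
  fix h k f assume h: "h \<in> carrier G" "k \<in> carrier G" and f: "f \<in> carrier (W n)"
  show "w n (h \<otimes>\<^bsub>G\<^esub> k) f = w n h (w n k f)"
  proof (rule W_eqI[OF w_closed[OF f] w_closed[OF w_closed[OF f]]])
    fix y assume y: "y \<in> carrier G"
    have "cen k (conjugate h y) \<in> carrier (centralizer G (g (idx y)))"
      using cen_closed[of "conjugate h y" k] y h by (simp add: conj_closed idx_conj')
    then show "w n (h \<otimes>\<^bsub>G\<^esub> k) f y = w n h (w n k f) y"
      using group_module.act_mult[OF Q_group_module[OF idx_closed[OF y]] cen_closed[OF y h(1)], of "cen k (conjugate h y)" "f (conjugate k (conjugate h y))" n]
        W_mem_conj[OF f y, of "h \<otimes>\<^bsub>G\<^esub> k"] y h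
      by (simp add: w_def cen_mult conj_closed idx_conj' conj_conj)
  qed (use h in auto)
qed

definition D :: "int \<Rightarrow> ('g \<Rightarrow> 'q) \<Rightarrow> 'g \<Rightarrow> 'q" where
  "D n f = (\<lambda>y\<in>carrier G. e (idx y) n (f y))"

lemma D_closed: "f \<in> carrier (W n) \<Longrightarrow> D n f \<in> carrier (W (n - 1))"
  unfolding D_def by (intro W_memI e_idx(3)) (simp_all add: W_mem)

lemma D_equivariant: "D n \<in> equivariant_maps R G (W n) (w n) (W (n - 1)) (w (n - 1))"
proof (intro equivariant_mapsI linear_mapsI)
  fix f assume f: "f \<in> carrier (W n)"
  note fW = W_mem[OF f] and fc = W_mem_conj[OF f]
  show "D n f \<in> carrier (W (n - 1))" by (rule D_closed[OF f])
  show "D n (f \<oplus>\<^bsub>W n\<^esub> f') = D n f \<oplus>\<^bsub>W (n - 1)\<^esub> D n f'" if "f' \<in> carrier (W n)" for f'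
    unfolding D_def W_sel(3) using fW W_mem[OF that] by (intro restrict_ext) (simp add: e_idx(4))
  show "D n (r \<odot>\<^bsub>W n\<^esub> f) = r \<odot>\<^bsub>W (n - 1)\<^esub> D n f" if "r \<in> carrier R" for r
    unfolding D_def W_sel(4) using fW that by (intro restrict_ext) (simp add: e_idx(5))
  show "D n (w n h f) = w (n - 1) h (D n f)" if h: "h \<in> carrier G" for h
    unfolding D_def w_def
  proof (rule restrict_ext)
    fix y assume y: "y \<in> carrier G"
    show "e (idx y) n (restrict (\<lambda>y. b (idx y) n (cen h y) (f (conjugate h y))) (carrier G) y)
        = b (idx y) (n - 1) (cen h y) (restrict (\<lambda>y. e (idx y) n (f y)) (carrier G) (conjugate h y))"
      using y h e_idx(2)[OF y cen_closed[OF y h] fc[OF y h]] by (simp add: conj_closed idx_conj')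
  qed
qed

text \<open>One scalar for each group element: the values are read as an element of the group
  ring.\<close>

definition \<eta> :: "('g \<Rightarrow> 'q) \<Rightarrow> 'g \<Rightarrow> 'r" where
  "\<eta> f = (\<lambda>y\<in>carrier G. \<epsilon> (idx y) (f y))"

lemmas \<epsilon>_idx = equivariant_mapsD[OF complete_resolution_complex.augmentation[OF resolution[OF idx_closed]], simplified]

lemma \<eta>_closed: "f \<in> carrier (W 0) \<Longrightarrow> \<eta> f \<in> carrier A"
  using finite_G by (intro RG.F_memI[where S = "carrier G"]) (auto simp: \<eta>_def \<epsilon>_idx(3) W_mem)

section \<open>Fibres over single group elements\<close>

definition single :: "int \<Rightarrow> 'g \<Rightarrow> 'q \<Rightarrow> 'g \<Rightarrow> 'q" where
  "single n y q = (\<lambda>z\<in>carrier G. if z = y then q else \<zero>\<^bsub>Q (idx z) n\<^esub>)"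

lemma Q_zero: "y \<in> carrier G \<Longrightarrow> \<zero>\<^bsub>Q (idx y) n\<^esub> \<in> carrier (Q (idx y) n)"
  using abelian_groupE(2)[OF module.axioms(2)[OF Q_module_idx]] .

lemma single_linear:
  assumes y: "y \<in> carrier G" shows "single n y \<in> linear_maps R (Q (idx y) n) (W n)"
proof -
  note z = Q_zero and zz = abelian_groupE(5)[OF module.axioms(2)[OF Q_module_idx] Q_zero]
    and rz = module.smult_r_null[OF Q_module_idx]
  show ?thesis
    using y z zz rz by (intro linear_mapsI) (auto simp: single_def W_sel intro!: restrict_ext)
qed

lemmas single_closed = linear_mapsD(1)[OF single_linear]

lemma eval_linear:
  assumes y: "y \<in> carrier G" shows "(\<lambda>f. f y) \<in> linear_maps R (W n) (Q (idx y) n)"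
  using y W_mem by (intro linear_mapsI) (auto simp: W_sel(3,4))

lemma finsum_single:
  assumes Y: "Y \<subseteq> carrier G" and v: "\<And>y. y \<in> Y \<Longrightarrow> v y \<in> carrier (Q (idx y) n)"
  shows "(\<Oplus>\<^bsub>W n\<^esub>y\<in>Y. single n y (v y)) = (\<lambda>z\<in>carrier G. if z \<in> Y then v z else \<zero>\<^bsub>Q (idx z) n\<^esub>)"
proof (rule W_eqI)
  interpret W: module R "W n" by (rule module_W)
  have fin: "finite Y" using Y finite_G finite_subset by blast
  have cl: "single n y (v y) \<in> carrier (W n)" if "y \<in> Y" for y using that Y v by (auto intro: single_closed)
  then show "(\<Oplus>\<^bsub>W n\<^esub>y\<in>Y. single n y (v y)) \<in> carrier (W n)" by (auto intro!: W.M.finsum_closed)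
  show "(\<lambda>z\<in>carrier G. if z \<in> Y then v z else \<zero>\<^bsub>Q (idx z) n\<^esub>) \<in> carrier (W n)"
    using v Q_zero by (intro W_memI) simp
  fix z assume z: "z \<in> carrier G"
  interpret Qz: module R "Q (idx z) n" by (rule Q_module_idx[OF z])
  have "(\<Oplus>\<^bsub>W n\<^esub>y\<in>Y. single n y (v y)) z = (\<Oplus>\<^bsub>Q (idx z) n\<^esub>y\<in>Y. single n y (v y) z)"
    using cl by (intro linear_maps_finsum[OF module_W Q_module_idx[OF z] eval_linear[OF z] fin]) auto
  also have "\<dots> = (\<Oplus>\<^bsub>Q (idx z) n\<^esub>y\<in>Y. if z = y then v y else \<zero>\<^bsub>Q (idx z) n\<^esub>)"
    using z v by (intro Qz.M.finsum_cong') (auto simp: single_def)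
  also have "\<dots> = (if z \<in> Y then v z else \<zero>\<^bsub>Q (idx z) n\<^esub>)"
  proof (cases "z \<in> Y")
    case True
    have "(\<Oplus>\<^bsub>Q (idx z) n\<^esub>y\<in>Y. if z = y then v z else \<zero>\<^bsub>Q (idx z) n\<^esub>) = v z"
      using True v fin by (intro Qz.M.finsum_singleton) auto
    moreover have "(\<Oplus>\<^bsub>Q (idx z) n\<^esub>y\<in>Y. if z = y then v y else \<zero>\<^bsub>Q (idx z) n\<^esub>)
        = (\<Oplus>\<^bsub>Q (idx z) n\<^esub>y\<in>Y. if z = y then v z else \<zero>\<^bsub>Q (idx z) n\<^esub>)"
      using v True by (intro Qz.M.finsum_cong') auto
    ultimately show ?thesis using True by simp
  next
    case False
    then show ?thesis by (auto intro!: Qz.M.add.finprod_one_eqI)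
  qed
  finally show "(\<Oplus>\<^bsub>W n\<^esub>y\<in>Y. single n y (v y)) z = (\<lambda>z\<in>carrier G. if z \<in> Y then v z else \<zero>\<^bsub>Q (idx z) n\<^esub>) z"
    using z by simp
qed

lemma sum_single: "f \<in> carrier (W n) \<Longrightarrow> f = (\<Oplus>\<^bsub>W n\<^esub>y\<in>carrier G. single n y (f y))"
  using finsum_single[of "carrier G" f n] W_mem[of f n]
  by (auto simp: W_sel(1) PiE_def intro!: extensionalityI[of _ "carrier G"])

lemma D_single:
  assumes y: "y \<in> carrier G" and q: "q \<in> carrier (Q (idx y) n)"
  shows "D n (single n y q) = single (n - 1) y (e (idx y) n q)"
  using y linear_maps_zero[OF Q_module_idx Q_module_idx e_idx(1)]
  by (auto simp: D_def single_def intro!: restrict_ext)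

text \<open>The element \<open>s y\<close> carries the fibre over the representative to the fibre
  over \<open>y\<close>. No correction appears because \<open>s\<close> is 1 at representatives,
  which makes \<open>cen (s y) y\<close> trivial.\<close>

lemma w_single:
  assumes y: "y \<in> carrier G" and q: "q \<in> carrier (Q (idx y) n)"
  shows "w n (s y) (single n (g (idx y)) q) = single n y q"
proof (rule W_eqI[OF w_closed single_closed[OF y q]])
  have gi: "g (idx y) \<in> carrier G" "idx (g (idx y)) = idx y"
    using y by (auto simp: g_closed idx_closed idx_g)
  then show "single n (g (idx y)) q \<in> carrier (W n)" using single_closed[OF gi(1)] q by simp
  fix z assume z: "z \<in> carrier G"
  show "w n (s y) (single n (g (idx y)) q) z = single n y q z"
  proof (cases "z = y")
    case True
    have "cen (s y) y = \<one>\<^bsub>G\<^esub>"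
      using y by (simp add: cen_def conj_s s_g idx_closed s_closed)
    then show ?thesis
      using True y q group_module.act_one[OF Q_group_module[OF idx_closed[OF y]] q] gi
      by (simp add: w_def single_def conj_s)
  next
    case False
    then have "conjugate (s y) z \<noteq> g (idx y)"
      using conj_inj[OF z y s_closed[OF y]] y by (auto simp: conj_s)
    then show ?thesis
      using False y z linear_maps_zero[OF Q_module_idx Q_module_idx
          group_module.act_linear[OF Q_group_module[OF idx_closed[OF z]] cen_closed[OF z s_closed[OF y]]]]
      by (simp add: w_def single_def conj_closed s_closed idx_conj')
  qed
qed (rule s_closed[OF y])

text \<open>One half of Frobenius reciprocity: an invariant form takes the same values on the fibre
  over \<open>y\<close> as on the fibre over the representative of its class, so the latter fibres
  determine it.\<close>

lemma equivariant_eq_sum: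
  assumes \<phi>: "\<phi> \<in> equivariant_maps R G (W n) (w n) (regular_module R) triv" and f: "f \<in> carrier (W n)"
  shows "\<phi> f = (\<Oplus>\<^bsub>R\<^esub>y\<in>carrier G. \<phi> (single n (g (idx y)) (f y)))"
proof -
  note \<phi>' = equivariant_mapsD[OF \<phi>, simplified]
  have acl: "single n y (f y) \<in> carrier (W n)" if "y \<in> carrier G" for y
    using that W_mem[OF f] by (intro single_closed)
  have gcl: "single n (g (idx y)) (f y) \<in> carrier (W n)" if "y \<in> carrier G" for y
    using single_closed[OF g_closed[OF idx_closed[OF that]]] W_mem[OF f that] that
    by (simp add: idx_g idx_closed)
  have "\<phi> f = \<phi> (\<Oplus>\<^bsub>W n\<^esub>y\<in>carrier G. single n y (f y))"
    by (rule arg_cong[OF sum_single[OF f]])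
  also have "\<dots> = (\<Oplus>\<^bsub>R\<^esub>y\<in>carrier G. \<phi> (single n y (f y)))"
    using linear_maps_finsum[OF module_W base.module_regular_module \<phi>'(1) finite_G, of "\<lambda>y. single n y (f y)"] acl
    by simp
  also have "\<dots> = (\<Oplus>\<^bsub>R\<^esub>y\<in>carrier G. \<phi> (single n (g (idx y)) (f y)))"
  proof (rule base.finsum_cong')
    fix y assume y: "y \<in> carrier G"
    have "\<phi> (w n (s y) (single n (g (idx y)) (f y))) = \<phi> (single n (g (idx y)) (f y))"
      using y by (intro \<phi>'(2) s_closed gcl)
    then show "\<phi> (single n y (f y)) = \<phi> (single n (g (idx y)) (f y))"
      using y W_mem[OF f y] by (simp add: w_single)
  qed (use \<phi>'(3) gcl in auto)
  finally show ?thesis .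
qed

text \<open>A centralizer element \<open>c\<close> fixes \<open>g i\<close> under conjugation, and
  \<open>cen c (g i)\<close> is \<open>c\<close> because \<open>s\<close> is 1 at representatives.
  On the fibre over \<open>g i\<close> the induced action is therefore the given one.\<close>

lemma equivariant_restrict:
  assumes \<phi>: "\<phi> \<in> equivariant_maps R G (W n) (w n) (regular_module R) triv" and i: "i \<in> I"
  shows "(\<lambda>q. \<phi> (single n (g i) q)) \<in> equivariant_maps R (centralizer G (g i)) (Q i n) (b i n) (regular_module R) triv"
proof (rule equivariant_mapsI)
  note \<phi>' = equivariant_mapsD[OF \<phi>, simplified]
  note gi = g_closed[OF i] and ii = idx_g[OF i]
  have lin: "single n (g i) \<in> linear_maps R (Q i n) (W n)" using single_linear[OF gi] ii by simp
  show "(\<lambda>q. \<phi> (single n (g i) q)) \<in> linear_maps R (Q i n) (regular_module R)"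
    by (rule linear_maps_compose[OF lin \<phi>'(1)])
  fix c q assume c: "c \<in> carrier (centralizer G (g i))" and q: "q \<in> carrier (Q i n)"
  have c': "c \<in> carrier G" "g i \<otimes>\<^bsub>G\<^esub> c = c \<otimes>\<^bsub>G\<^esub> g i" using c by (auto simp: centralizer_def)
  then have conj_c: "conjugate c (g i) = g i" using gi by (simp add: conj_eq_iff)
  then have cen_c: "cen c (g i) = c" using c' i by (simp add: cen_def s_g)
  have acl: "single n (g i) q \<in> carrier (W n)" by (rule linear_mapsD(1)[OF lin q])
  have "w n c (single n (g i) q) = single n (g i) (b i n c q)"
  proof (rule W_eqI[OF w_closed[OF acl c'(1)]])
    show "single n (g i) (b i n c q) \<in> carrier (W n)"
      by (rule linear_mapsD(1)[OF lin group_module.act_closed[OF Q_group_module[OF i] c q]])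
    fix z assume z: "z \<in> carrier G"
    show "w n c (single n (g i) q) z = single n (g i) (b i n c q) z"
    proof (cases "z = g i")
      case True then show ?thesis using gi by (simp add: w_def single_def conj_c cen_c ii)
    next
      case False
      then have "conjugate c z \<noteq> g i" using conj_inj[OF z gi c'(1)] conj_c by auto
      then show ?thesis
        using False z c'(1) linear_maps_zero[OF Q_module_idx Q_module_idx
            group_module.act_linear[OF Q_group_module[OF idx_closed[OF z]] cen_closed[OF z c'(1)]]]
        by (simp add: w_def single_def conj_closed idx_conj')
    qed
  qed
  then show "\<phi> (single n (g i) (b i n c q)) = \<phi> (single n (g i) q)"
    using \<phi>'(2)[OF c'(1) acl] by simp
qed

text \<open>The other half of Frobenius reciprocity. Conjugation permutes the group, so reindexing
  absorbs the movement between fibres, and invariance of the forms \<open>\<psi> i\<close> absorbs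
  \<open>cen\<close>. The second claim says that restriction to the fibres over the
  \<open>g i\<close> gives back the \<open>\<psi> i\<close>.\<close>

lemma equivariant_extend:
  assumes \<psi>: "\<And>i. i \<in> I \<Longrightarrow> \<psi> i \<in> equivariant_maps R (centralizer G (g i)) (Q i n) (b i n) (regular_module R) triv"
  defines "\<phi> \<equiv> \<lambda>f. \<Oplus>\<^bsub>R\<^esub>y\<in>carrier G. \<psi> (idx y) (f y)"
  shows "\<phi> \<in> equivariant_maps R G (W n) (w n) (regular_module R) triv"
    and "\<And>i q. \<lbrakk>i \<in> I; q \<in> carrier (Q i n)\<rbrakk> \<Longrightarrow> \<phi> (single n (g i) q) = \<psi> i q"
proof -
  note \<psi>' = equivariant_mapsD[OF \<psi>, simplified] and \<psi>i = equivariant_mapsD[OF \<psi>[OF idx_closed], simplified]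
  have lin: "\<phi> \<in> linear_maps R (W n) (regular_module R)"
    unfolding \<phi>_def finsum_regular_module[of R, symmetric]
  proof (rule finsum_linear_maps[OF module_W base.module_regular_module finite_G])
    show "(\<lambda>f. \<psi> (idx y) (f y)) \<in> linear_maps R (W n) (regular_module R)" if "y \<in> carrier G" for y
      by (rule linear_maps_compose[OF eval_linear[OF that] \<psi>i(1)[OF that]])
  qed
  show "\<phi> \<in> equivariant_maps R G (W n) (w n) (regular_module R) triv"
  proof (rule equivariant_mapsI[OF lin])
    fix h f assume h: "h \<in> carrier G" and f: "f \<in> carrier (W n)"
    have im: "conjugate h ` carrier G = carrier G" and inj: "inj_on (conjugate h) (carrier G)"
    proof -
      show inj: "inj_on (conjugate h) (carrier G)" using conj_inj h by (auto intro!: inj_onI)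
      have "y \<in> conjugate h ` carrier G" if y: "y \<in> carrier G" for y
        using y h conj_conj[of y "inv\<^bsub>G\<^esub> h" h]
        by (intro image_eqI[of _ _ "conjugate (inv\<^bsub>G\<^esub> h) y"]) (auto simp: conj_closed conj_one)
      then show "conjugate h ` carrier G = carrier G" using h by (auto simp: conj_closed)
    qed
    have "\<phi> (w n h f) = (\<Oplus>\<^bsub>R\<^esub>y\<in>carrier G. \<psi> (idx (conjugate h y)) (f (conjugate h y)))"
      unfolding \<phi>_def
      using h W_mem_conj[OF f] \<psi>i(2)[OF _ cen_closed] \<psi>i(3)
      by (intro base.finsum_cong') (auto simp: w_def idx_conj')
    also have "\<dots> = (\<Oplus>\<^bsub>R\<^esub>y\<in>conjugate h ` carrier G. \<psi> (idx y) (f y))"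
      using \<psi>i(3) W_mem[OF f] by (intro base.finsum_reindex[symmetric] inj) (auto simp: im)
    finally show "\<phi> (w n h f) = \<phi> f" by (simp add: im \<phi>_def)
  qed
  fix i q assume i: "i \<in> I" and q: "q \<in> carrier (Q i n)"
  have z: "\<psi> (idx y) \<zero>\<^bsub>Q (idx y) n\<^esub> = \<zero>\<^bsub>R\<^esub>" if "y \<in> carrier G" for y
    using linear_maps_zero[OF Q_module_idx[OF that] base.module_regular_module \<psi>i(1)[OF that]] by simp
  have "\<phi> (single n (g i) q) = (\<Oplus>\<^bsub>R\<^esub>y\<in>carrier G. if g i = y then \<psi> i q else \<zero>\<^bsub>R\<^esub>)"
    unfolding \<phi>_def using z i q \<psi>'(3)
    by (intro base.finsum_cong') (auto simp: single_def idx_g)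
  also have "\<dots> = \<psi> i q"
    using i q g_closed finite_G \<psi>'(3) by (intro base.finsum_singleton) auto
  finally show "\<phi> (single n (g i) q) = \<psi> i q" .
qed

text \<open>Induction preserves Higman's criterion. The endomorphisms of the \<open>Q i n\<close>
  are applied on the fibres over the representatives only; averaging over the group moves them to
  every fibre, where they add up to the trace over a centralizer.\<close>

lemma group_projective_W: "group_projective R G (W n) (w n)"
proof -
  have "\<forall>i\<in>I. \<exists>\<theta>. finite_rank R (Q i n) \<theta> \<and>
      (\<forall>x\<in>carrier (Q i n). trace_map (centralizer G (g i)) (b i n) (Q i n) (b i n) \<theta> x = x)"
    using exact_complex.group_projective[OF complex] unfolding group_projective_def by blast
  then obtain \<theta> where \<theta>: "\<And>i. i \<in> I \<Longrightarrow> finite_rank R (Q i n) (\<theta> i)"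
    and tr: "\<And>i x. \<lbrakk>i \<in> I; x \<in> carrier (Q i n)\<rbrakk> \<Longrightarrow>
      trace_map (centralizer G (g i)) (b i n) (Q i n) (b i n) (\<theta> i) x = x"
    by metis
  note \<theta>cl = finite_rank_closed[OF Q_module \<theta>]
  \<comment> \<open>These are the values \<open>g i\<close>, and their fibres contain each module
    \<open>Q i n\<close> once.\<close>
  let ?Y = "{y \<in> carrier G. y = g (idx y)}"
  let ?\<theta> = "\<lambda>f. \<Oplus>\<^bsub>W n\<^esub>y\<in>?Y. single n y (\<theta> (idx y) (f y))"
  have "finite_rank R (W n) ?\<theta>"
    using finite_G
    by (intro finite_rank_sum[OF module_W, where L = "\<lambda>y. Q (idx y) n" and \<alpha> = "\<lambda>y f. f y"])
      (auto intro: Q_module_idx \<theta> idx_closed eval_linear single_linear)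
  moreover have "trace_map G (w n) (W n) (w n) ?\<theta> f = f" if f: "f \<in> carrier (W n)" for f
  proof (rule W_eqI[OF _ f])
    interpret W: group_module R G "W n" "w n" by (rule group_module_W)
    have \<theta>_eq: "?\<theta> f = (\<lambda>z\<in>carrier G. if z \<in> ?Y then \<theta> (idx z) (f z) else \<zero>\<^bsub>Q (idx z) n\<^esub>)"
      if "f \<in> carrier (W n)" for f
      using that by (intro finsum_single) (auto simp: \<theta>cl idx_closed W_mem)
    have \<theta>W: "?\<theta> f \<in> carrier (W n)" if "f \<in> carrier (W n)" for f
      using that by (intro W.M.finsum_closed) (auto simp: single_closed \<theta>cl idx_closed W_mem)
    have tcl: "w n h (?\<theta> (w n (inv\<^bsub>G\<^esub> h) f)) \<in> carrier (W n)" if "h \<in> carrier G" for h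
      using that f by (intro w_closed \<theta>W) auto
    then show "trace_map G (w n) (W n) (w n) ?\<theta> f \<in> carrier (W n)"
      unfolding trace_map_def by (auto intro!: W.M.finsum_closed)
    fix y assume y: "y \<in> carrier G"
    let ?i = "idx y" let ?C = "centralizer G (g ?i)"
    have i: "?i \<in> I" and gi: "g ?i \<in> carrier G" and sy: "s y \<in> carrier G"
      using y by (auto simp: idx_closed g_closed s_closed)
    interpret C: group ?C by (rule G.group_centralizer[OF gi])
    interpret Qi: group_module R ?C "Q ?i n" "b ?i n" by (rule Q_group_module[OF i])
    have CG: "c \<in> carrier G" "g ?i \<otimes>\<^bsub>G\<^esub> c = c \<otimes>\<^bsub>G\<^esub> g ?i" if "c \<in> carrier ?C" for c
      using that by (auto simp: centralizer_def)
    let ?t = "\<lambda>h. w n h (?\<theta> (w n (inv\<^bsub>G\<^esub> h) f)) y"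
    have ycl: "f y \<in> carrier (Q ?i n)" by (rule W_mem[OF f y])
    have summand: "b ?i n c (\<theta> ?i (b ?i n (inv\<^bsub>?C\<^esub> c) (f y))) \<in> carrier (Q ?i n)" if "c \<in> carrier ?C" for c
      using that ycl by (intro Qi.act_closed \<theta>cl i) auto
    \<comment> \<open>The inverse of s(y) c brings the component over \<open>y\<close> to the
      representative with correction c^-1, and s(y) c brings the result back with correction c. This
      is the summand for c in the trace over the centralizer.\<close>
    have t_in: "?t (s y \<otimes>\<^bsub>G\<^esub> c) = b ?i n c (\<theta> ?i (b ?i n (inv\<^bsub>?C\<^esub> c) (f y)))" if c: "c \<in> carrier ?C" for c
    proof -
      let ?h = "s y \<otimes>\<^bsub>G\<^esub> c"
      have h: "?h \<in> carrier G" using sy CG[OF c] by simp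
      have "conjugate c (g ?i) = g ?i" using CG[OF c] gi by (simp add: conj_eq_iff)
      then have conj_h: "conjugate ?h y = g ?i"
        using conj_conj[OF y sy CG(1)[OF c]] by (simp add: conj_s y)
      have cen_h: "cen ?h y = c"
        using sy CG[OF c] y i by (simp add: cen_def conj_h s_g G.m_assoc[symmetric])
      have conj_inv: "conjugate (inv\<^bsub>G\<^esub> ?h) (g ?i) = y"
        using conj_conj[OF y h, of "inv\<^bsub>G\<^esub> ?h"] h y by (simp add: conj_h conj_one)
      have "cen (inv\<^bsub>G\<^esub> ?h) (g ?i) = inv\<^bsub>G\<^esub> ?h \<otimes>\<^bsub>G\<^esub> s y"
        using h i by (simp add: cen_def conj_inv s_g)
      also have "\<dots> = inv\<^bsub>G\<^esub> c"
        using sy CG(1)[OF c] by (simp add: G.inv_mult_group G.m_assoc)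
      finally have "cen (inv\<^bsub>G\<^esub> ?h) (g ?i) = inv\<^bsub>G\<^esub> c" .
      then have "w n (inv\<^bsub>G\<^esub> ?h) f (g ?i) = b ?i n (inv\<^bsub>?C\<^esub> c) (f y)"
        using gi i by (simp add: w_def conj_inv idx_g G.inv_centralizer[OF gi c])
      then show ?thesis
        using h f y gi i by (subst \<theta>_eq) (simp_all add: w_closed, simp add: w_def conj_h cen_h idx_g)
    qed
    \<comment> \<open>For any other \<open>h\<close> the point \<open>conjugate h y\<close> is not a
      representative, and the endomorphism has zero component there.\<close>
    have t_out: "?t h = \<zero>\<^bsub>Q ?i n\<^esub>" if h: "h \<in> carrier G" and n: "h \<notin> (\<lambda>c. s y \<otimes>\<^bsub>G\<^esub> c) ` carrier ?C" for h
    proof -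
      have "conjugate h y \<noteq> g ?i"
      proof
        assume eq: "conjugate h y = g ?i"
        let ?c = "inv\<^bsub>G\<^esub> (s y) \<otimes>\<^bsub>G\<^esub> h"
        have "cen h y = ?c" using eq sy h i by (simp add: cen_def s_g)
        then have "?c \<in> carrier ?C" using cen_closed[OF y h] by simp
        moreover have "h = s y \<otimes>\<^bsub>G\<^esub> ?c" using sy h by (simp add: G.m_assoc[symmetric])
        ultimately show False using n by blast
      qed
      then have "?\<theta> (w n (inv\<^bsub>G\<^esub> h) f) (conjugate h y) = \<zero>\<^bsub>Q ?i n\<^esub>"
        using h f y by (subst \<theta>_eq) (auto simp: w_closed conj_closed idx_conj')
      then show ?thesis
        using h y linear_maps_zero[OF Q_module[OF i] Q_module[OF i] Qi.act_linear[OF cen_closed[OF y h]]]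
        by (simp add: w_def)
    qed
    have "trace_map G (w n) (W n) (w n) ?\<theta> f y = (\<Oplus>\<^bsub>Q ?i n\<^esub>h\<in>carrier G. ?t h)"
      unfolding trace_map_def
      using tcl by (intro linear_maps_finsum[OF module_W Q_module_idx[OF y] eval_linear[OF y] finite_G]) auto
    also have "\<dots> = (\<Oplus>\<^bsub>Q ?i n\<^esub>h\<in>(\<lambda>c. s y \<otimes>\<^bsub>G\<^esub> c) ` carrier ?C. ?t h)"
    proof (rule Qi.M.add.finprod_mono_neutral_cong_right[OF finite_G])
      show "(\<lambda>c. s y \<otimes>\<^bsub>G\<^esub> c) ` carrier ?C \<subseteq> carrier G" using sy CG by auto
      show "?t h = \<zero>\<^bsub>Q ?i n\<^esub>" if "h \<in> carrier G - (\<lambda>c. s y \<otimes>\<^bsub>G\<^esub> c) ` carrier ?C" for h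
        using t_out that by blast
    qed (use W_mem[OF tcl y] in auto)
    also have "\<dots> = (\<Oplus>\<^bsub>Q ?i n\<^esub>c\<in>carrier ?C. ?t (s y \<otimes>\<^bsub>G\<^esub> c))"
    proof (rule Qi.M.finsum_reindex)
      show "inj_on (\<lambda>c. s y \<otimes>\<^bsub>G\<^esub> c) (carrier ?C)" using sy CG(1) by (auto intro!: inj_onI)
    qed (use W_mem[OF tcl y] sy CG(1) in auto)
    also have "\<dots> = (\<Oplus>\<^bsub>Q ?i n\<^esub>c\<in>carrier ?C. b ?i n c (\<theta> ?i (b ?i n (inv\<^bsub>?C\<^esub> c) (f y))))"
      using t_in summand by (intro Qi.M.finsum_cong') auto
    also have "\<dots> = f y"
      using tr[OF i ycl] by (simp add: trace_map_def)
    finally show "trace_map G (w n) (W n) (w n) ?\<theta> f y = f y" .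
  qed
  ultimately show ?thesis unfolding group_projective_def by blast
qed

lemma D_exact:
  assumes f: "f \<in> carrier (W n)"
  shows "D n f = \<zero>\<^bsub>W (n - 1)\<^esub> \<longleftrightarrow> f \<in> D (n + 1) ` carrier (W (n + 1))"
proof -
  note ex = exact_complex.exact_iff[OF complex[OF idx_closed] W_mem[OF f]]
  have "D n f = \<zero>\<^bsub>W (n - 1)\<^esub> \<longleftrightarrow> (\<forall>y\<in>carrier G. e (idx y) n (f y) = \<zero>\<^bsub>Q (idx y) (n - 1)\<^esub>)"
    by (auto simp: D_def W_sel(2) fun_eq_iff)
  also have "\<dots> \<longleftrightarrow> (\<forall>y\<in>carrier G. \<exists>q\<in>carrier (Q (idx y) (n + 1)). f y = e (idx y) (n + 1) q)"
    using ex by (auto simp: image_iff)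
  also have "\<dots> \<longleftrightarrow> f \<in> D (n + 1) ` carrier (W (n + 1))"
  proof
    assume "\<forall>y\<in>carrier G. \<exists>q\<in>carrier (Q (idx y) (n + 1)). f y = e (idx y) (n + 1) q"
    then obtain q where q: "\<And>y. y \<in> carrier G \<Longrightarrow> q y \<in> carrier (Q (idx y) (n + 1))"
      "\<And>y. y \<in> carrier G \<Longrightarrow> f y = e (idx y) (n + 1) (q y)" by metis
    have q': "restrict q (carrier G) \<in> carrier (W (n + 1))" using q(1) by (auto simp: W_sel)
    moreover have "f = D (n + 1) (restrict q (carrier G))"
      using D_closed[OF q'] by (intro W_eqI[OF f, of _ "n + 1 - 1"]) (auto simp: D_def q(2))
    ultimately show "f \<in> D (n + 1) ` carrier (W (n + 1))" by blast
  qed (auto simp: D_def intro!: W_mem)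
  finally show ?thesis .
qed

text \<open>A linear form on a finite product is the sum of its restrictions to the factors, and
  every factor is dual exact. Invariance plays no part, since the dual is taken over R.\<close>

lemma dual_exact_W:
  assumes l: "l \<in> linear_maps R (W n) (regular_module R)"
    and lD: "\<And>f. f \<in> carrier (W (n + 1)) \<Longrightarrow> l (D (n + 1) f) = \<zero>\<^bsub>R\<^esub>"
  shows "\<exists>\<kappa>\<in>linear_maps R (W (n - 1)) (regular_module R). \<forall>f\<in>carrier (W n). l f = \<kappa> (D n f)"
proof -
  have "\<forall>y\<in>carrier G. \<exists>\<kappa>. \<kappa> \<in> linear_maps R (Q (idx y) (n - 1)) (regular_module R) \<and>
      (\<forall>q\<in>carrier (Q (idx y) n). l (single n y q) = \<kappa> (e (idx y) n q))"
  proof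
    fix y assume y: "y \<in> carrier G"
    interpret Qy: complete_resolution_complex R "centralizer G (g (idx y))" "Q (idx y)" "b (idx y)" "e (idx y)"
      "regular_module R" triv "\<epsilon> (idx y)" by (rule resolution[OF idx_closed[OF y]])
    have "l (single n y (e (idx y) (n + 1) q)) = \<zero>\<^bsub>R\<^esub>" if q: "q \<in> carrier (Q (idx y) (n + 1))" for q
      using lD[OF single_closed[OF y q]] D_single[OF y q] by simp
    then have "\<exists>\<kappa>\<in>linear_maps R (Q (idx y) (n - 1)) (regular_module R).
      \<forall>q\<in>carrier (Q (idx y) n). l (single n y q) = \<kappa> (e (idx y) n q)"
      by (rule Qy.dual_exact[OF linear_maps_compose[OF single_linear[OF y] l]])
    then show "\<exists>\<kappa>. \<kappa> \<in> linear_maps R (Q (idx y) (n - 1)) (regular_module R) \<and>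
      (\<forall>q\<in>carrier (Q (idx y) n). l (single n y q) = \<kappa> (e (idx y) n q))"
      by (simp only: Bex_def)
  qed
  from bchoice[OF this] obtain \<kappa> where \<kappa>l:
    "\<forall>y\<in>carrier G. \<kappa> y \<in> linear_maps R (Q (idx y) (n - 1)) (regular_module R) \<and>
      (\<forall>q\<in>carrier (Q (idx y) n). l (single n y q) = \<kappa> y (e (idx y) n q))" ..
  have \<kappa>: "\<kappa> y \<in> linear_maps R (Q (idx y) (n - 1)) (regular_module R)" if "y \<in> carrier G" for y
    using bspec[OF \<kappa>l that] by (rule conjunct1)
  have l\<kappa>: "l (single n y q) = \<kappa> y (e (idx y) n q)" if "y \<in> carrier G" "q \<in> carrier (Q (idx y) n)" for y q
    using bspec[OF conjunct2[OF bspec[OF \<kappa>l that(1)]] that(2)] .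
  have lin: "(\<lambda>f. \<Oplus>\<^bsub>R\<^esub>y\<in>carrier G. \<kappa> y (f y)) \<in> linear_maps R (W (n - 1)) (regular_module R)"
    unfolding finsum_regular_module[of R, symmetric]
  proof (rule finsum_linear_maps[OF module_W base.module_regular_module finite_G])
    show "(\<lambda>f. \<kappa> y (f y)) \<in> linear_maps R (W (n - 1)) (regular_module R)" if "y \<in> carrier G" for y
      by (rule linear_maps_compose[OF eval_linear[OF that] \<kappa>[OF that]])
  qed
  have "l f = (\<Oplus>\<^bsub>R\<^esub>y\<in>carrier G. \<kappa> y (D n f y))" if f: "f \<in> carrier (W n)" for f
  proof -
    have "l f = l (\<Oplus>\<^bsub>W n\<^esub>y\<in>carrier G. single n y (f y))"
      by (rule arg_cong[OF sum_single[OF f]])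
    also have "\<dots> = (\<Oplus>\<^bsub>R\<^esub>y\<in>carrier G. l (single n y (f y)))"
      using linear_maps_finsum[OF module_W base.module_regular_module l finite_G, of "\<lambda>y. single n y (f y)"]
        single_closed W_mem[OF f] by simp
    also have "\<dots> = (\<Oplus>\<^bsub>R\<^esub>y\<in>carrier G. \<kappa> y (D n f y))"
      using l\<kappa> W_mem[OF f] functional_closed[OF \<kappa>] e_idx(3)
      by (intro base.finsum_cong') (auto simp: D_def)
    finally show ?thesis .
  qed
  then show ?thesis by (intro bexI[OF _ lin] ballI)
qed

text \<open>The centralizers act trivially on R, so \<open>cen\<close> disappears under the
  augmentation and only the movement of fibres remains. This is the conjugation action on RG, that
  is, the action of the diagonal on the regular bimodule.\<close>

lemma complete_resolution_W:
  "complete_resolution_complex R G W w D (scalar_restriction E.T N) (\<lambda>h. Env.act N (h, h)) \<eta>"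
proof (intro complete_resolution_complex.intro complete_complex.intro exact_complex.intro
    complete_resolution_complex_axioms.intro complete_complex_axioms.intro)
  have diag: "(\<lambda>h. (h, h)) \<in> hom G (G \<times>\<times> G)" by (auto simp: hom_def)
  show "group_module R G (scalar_restriction E.T N) (\<lambda>h. Env.act N (h, h))"
    using group_module_restrict_group[OF Env.group_module_scalar_restriction[OF left_module_N] G.group_axioms diag]
    by simp
  interpret N: left_module E.T N by (rule left_module_N)
  show "\<eta> \<in> equivariant_maps R G (W 0) (w 0) (scalar_restriction E.T N) (\<lambda>h. Env.act N (h, h))"
  proof (intro equivariant_mapsI linear_mapsI; (simp only: scalar_restriction_simps N_sel)?)
    fix f assume f: "f \<in> carrier (W 0)"
    show "\<eta> f \<in> carrier A" by (rule \<eta>_closed[OF f])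
    show "\<eta> (f \<oplus>\<^bsub>W 0\<^esub> f') = \<eta> f \<oplus>\<^bsub>A\<^esub> \<eta> f'" if "f' \<in> carrier (W 0)" for f'
      using f that W_mem by (auto simp: \<eta>_def W_sel(3) RG.add_F \<epsilon>_idx(4) intro!: restrict_ext)
    show "\<eta> (r \<odot>\<^bsub>W 0\<^esub> f) = (r \<odot>\<^bsub>E.T\<^esub> \<one>\<^bsub>E.T\<^esub>) \<odot>\<^bsub>N\<^esub> \<eta> f" if r: "r \<in> carrier R" for r
      unfolding smult_N_scalar[OF r \<eta>_closed[OF f]]
      using f r W_mem by (auto simp: \<eta>_def W_sel(4) RG.smult_F \<epsilon>_idx(5) intro!: restrict_ext)
    show "\<eta> (w 0 h f) = env_basis (h, h) \<odot>\<^bsub>N\<^esub> \<eta> f" if h: "h \<in> carrier G" for h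
    proof (rule RG.F_eqI[OF \<eta>_closed[OF w_closed[OF f h]]])
      show "env_basis (h, h) \<odot>\<^bsub>N\<^esub> \<eta> f \<in> carrier A"
        using N.smult_closed[OF Env.basis_closed, of "(h, h)" "\<eta> f"] h \<eta>_closed[OF f] by simp
      fix z assume z: "z \<in> carrier G"
      have "\<eta> (w 0 h f) z = \<epsilon> (idx z) (f (conjugate h z))"
        using z h \<epsilon>_idx(2)[OF z cen_closed[OF z h] W_mem_conj[OF f z h]] by (simp add: \<eta>_def w_def)
      also have "\<dots> = \<eta> f (conjugate h z)" using z h by (simp add: \<eta>_def conj_closed idx_conj')
      finally show "\<eta> (w 0 h f) z = (env_basis (h, h) \<odot>\<^bsub>N\<^esub> \<eta> f) z"
        using z h \<eta>_closed[OF f] by (simp add: smult_N_basis conjugate_def)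
    qed
  qed
  show "\<eta> ` carrier (W 0) = carrier (scalar_restriction E.T N)"
  proof (intro equalityI subsetI)
    fix m assume m: "m \<in> carrier (scalar_restriction E.T N)"
    then have mA: "m \<in> carrier A" by simp
    have "\<exists>q\<in>carrier (Q (idx y) 0). \<epsilon> (idx y) q = m y" if y: "y \<in> carrier G" for y
      using complete_resolution_complex.augmentation_surj[OF resolution[OF idx_closed[OF y]]]
        RG.F_mem(1)[OF mA y] by (metis carrier_regular_module imageE)
    then obtain q where q: "\<And>y. y \<in> carrier G \<Longrightarrow> q y \<in> carrier (Q (idx y) 0)"
      "\<And>y. y \<in> carrier G \<Longrightarrow> \<epsilon> (idx y) (q y) = m y" by metis
    have q': "restrict q (carrier G) \<in> carrier (W 0)" using q(1) by (auto simp: W_sel)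
    moreover have "m = \<eta> (restrict q (carrier G))"
      by (rule RG.F_eqI[OF mA \<eta>_closed[OF q']]) (simp add: \<eta>_def q(2))
    ultimately show "m \<in> \<eta> ` carrier (W 0)" by blast
  qed (auto simp: \<eta>_closed)
  fix f assume f: "f \<in> carrier (W 0)"
  have ker: "\<epsilon> (idx y) (f y) = \<zero>\<^bsub>R\<^esub> \<longleftrightarrow> (\<exists>q\<in>carrier (Q (idx y) 1). f y = e (idx y) 1 q)" if y: "y \<in> carrier G" for y
    using complete_resolution_complex.augmentation_kernel[OF resolution[OF idx_closed[OF y]] W_mem[OF f y]]
    by (auto simp: image_iff)
  have "\<eta> f = \<zero>\<^bsub>A\<^esub> \<longleftrightarrow> (\<forall>y\<in>carrier G. \<epsilon> (idx y) (f y) = \<zero>\<^bsub>R\<^esub>)"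
    by (auto simp: \<eta>_def RG.zero_F fun_eq_iff)
  also have "\<dots> \<longleftrightarrow> f \<in> D 1 ` carrier (W 1)"
  proof
    assume "\<forall>y\<in>carrier G. \<epsilon> (idx y) (f y) = \<zero>\<^bsub>R\<^esub>"
    then obtain q where q: "\<And>y. y \<in> carrier G \<Longrightarrow> q y \<in> carrier (Q (idx y) 1)"
      "\<And>y. y \<in> carrier G \<Longrightarrow> f y = e (idx y) 1 (q y)" using ker by metis
    have q': "restrict q (carrier G) \<in> carrier (W 1)" using q(1) by (auto simp: W_sel)
    moreover have "f = D 1 (restrict q (carrier G))"
      using D_closed[OF q'] by (intro W_eqI[OF f, of _ "1 - 1"]) (auto simp: D_def q(2))
    ultimately show "f \<in> D 1 ` carrier (W 1)" by blast
  next
    assume "f \<in> D 1 ` carrier (W 1)"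
    then show "\<forall>y\<in>carrier G. \<epsilon> (idx y) (f y) = \<zero>\<^bsub>R\<^esub>"
      using ker W_mem by (auto simp: D_def)
  qed
  finally show "\<eta> f = \<zero>\<^bsub>scalar_restriction E.T N\<^esub> \<longleftrightarrow> f \<in> D 1 ` carrier (W 1)" by simp
qed (fact finite_G group_module_W D_equivariant D_exact group_projective_W dual_exact_W)+

end

section \<open>Isomorphisms of cohomology\<close>

locale module_quotient = Z?: module R Z + B?: submodule B R Z
  for R :: "('r, 'x) ring_scheme" and Z :: "('r, 'z) module" and B :: "'z set"
begin

sublocale BZ: abelian_subgroup B Z
  by (rule abelian_subgroupI3)
    (auto intro!: additive_subgroupI simp: subgroup_axioms Z.M.abelian_group_axioms)

abbreviation coset :: "'z \<Rightarrow> 'z set" where "coset f \<equiv> B +>\<^bsub>Z\<^esub> f"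

lemma coset_mem_iff: "f \<in> carrier Z \<Longrightarrow> x \<in> coset f \<longleftrightarrow> (\<exists>b\<in>B. x = b \<oplus>\<^bsub>Z\<^esub> f)"
  by (auto simp: a_r_coset_def')

lemma B_carrier: "b \<in> B \<Longrightarrow> b \<in> carrier Z"
  using BZ.a_subset by blast

lemma coset_eqI:
  assumes "f \<in> carrier Z" "f' \<in> carrier Z" "b \<in> B" "f = f' \<oplus>\<^bsub>Z\<^esub> b"
  shows "coset f = coset f'"
proof -
  have "f \<in> coset f'"
    using assms B_carrier[OF assms(3)] by (auto simp: coset_mem_iff Z.M.a_comm)
  then show ?thesis
    using Z.M.a_repr_independence[OF _ assms(2) subgroup_axioms] by simp
qed

lemma coset_eqD:
  assumes "f \<in> carrier Z" "f' \<in> carrier Z" "coset f = coset f'"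
  obtains b where "b \<in> B" "f = b \<oplus>\<^bsub>Z\<^esub> f'"
  using BZ.a_rcos_self[OF assms(1)] assms(2) by (auto simp: assms(3) coset_mem_iff)

lemma quotient_sel:
  "carrier (quotient_module Z B) = coset ` carrier Z"
  "\<zero>\<^bsub>quotient_module Z B\<^esub> = coset \<zero>\<^bsub>Z\<^esub>"
  "\<lbrakk>f \<in> carrier Z; f' \<in> carrier Z\<rbrakk> \<Longrightarrow> coset f \<oplus>\<^bsub>quotient_module Z B\<^esub> coset f' = coset (f \<oplus>\<^bsub>Z\<^esub> f')"
proof -
  show "carrier (quotient_module Z B) = coset ` carrier Z"
    unfolding quotient_module_def A_RCOSETS_def' by auto
  show "\<zero>\<^bsub>quotient_module Z B\<^esub> = coset \<zero>\<^bsub>Z\<^esub>"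
    unfolding quotient_module_def Z.M.a_coset_add_zero[OF BZ.a_subset] by simp
  show "coset f \<oplus>\<^bsub>quotient_module Z B\<^esub> coset f' = coset (f \<oplus>\<^bsub>Z\<^esub> f')"
    if "f \<in> carrier Z" "f' \<in> carrier Z"
    unfolding BZ.a_rcos_sum[OF that, symmetric] by (simp add: quotient_module_def)
qed

lemma quotient_cases:
  assumes "C \<in> carrier (quotient_module Z B)" obtains f where "f \<in> carrier Z" "C = coset f"
  using assms unfolding quotient_sel(1) by (rule imageE) (rule that)

text \<open>\<open>quotient_module\<close> forms a union over all members of the coset; the cosets
  united there all coincide, since multiples of elements of \<open>B\<close> stay in
  \<open>B\<close>.\<close>

lemma smult_coset:
  assumes r: "r \<in> carrier R" and f: "f \<in> carrier Z"
  shows "r \<odot>\<^bsub>quotient_module Z B\<^esub> coset f = coset (r \<odot>\<^bsub>Z\<^esub> f)"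
proof -
  have "coset (r \<odot>\<^bsub>Z\<^esub> x) = coset (r \<odot>\<^bsub>Z\<^esub> f)" if x: "x \<in> coset f" for x
  proof -
    obtain b where b: "b \<in> B" "x = b \<oplus>\<^bsub>Z\<^esub> f" using x f by (auto simp: coset_mem_iff)
    show ?thesis
      using r f b B_carrier[OF b(1)]
      by (intro coset_eqI[of _ _ "r \<odot>\<^bsub>Z\<^esub> b"]) (auto simp: Z.smult_r_distr Z.M.a_comm)
  qed
  then have "(\<Union>x\<in>coset f. coset (r \<odot>\<^bsub>Z\<^esub> x)) = (\<Union>x\<in>coset f. coset (r \<odot>\<^bsub>Z\<^esub> f))"
    by (intro SUP_cong refl)
  also have "\<dots> = coset (r \<odot>\<^bsub>Z\<^esub> f)"
    by (rule UN_constant_eq[OF BZ.a_rcos_self[OF f]]) simp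
  finally show ?thesis by (simp add: quotient_module_def)
qed

end

text \<open>With these facts, finitely supported families of classes remain finitely supported under
  sums and scalar multiples.\<close>

lemma (in module_quotient) quotient_module_closed:
  shows "\<zero>\<^bsub>quotient_module Z B\<^esub> \<in> carrier (quotient_module Z B)"
    and "\<lbrakk>C \<in> carrier (quotient_module Z B); D \<in> carrier (quotient_module Z B)\<rbrakk> \<Longrightarrow>
      C \<oplus>\<^bsub>quotient_module Z B\<^esub> D \<in> carrier (quotient_module Z B)"
    and "\<zero>\<^bsub>quotient_module Z B\<^esub> \<oplus>\<^bsub>quotient_module Z B\<^esub> \<zero>\<^bsub>quotient_module Z B\<^esub> = \<zero>\<^bsub>quotient_module Z B\<^esub>"
    and "\<lbrakk>r \<in> carrier R; C \<in> carrier (quotient_module Z B)\<rbrakk> \<Longrightarrow>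
      r \<odot>\<^bsub>quotient_module Z B\<^esub> C \<in> carrier (quotient_module Z B)"
    and "r \<in> carrier R \<Longrightarrow> r \<odot>\<^bsub>quotient_module Z B\<^esub> \<zero>\<^bsub>quotient_module Z B\<^esub> = \<zero>\<^bsub>quotient_module Z B\<^esub>"
proof -
  show "\<zero>\<^bsub>quotient_module Z B\<^esub> \<in> carrier (quotient_module Z B)"
    unfolding quotient_sel(1,2) by (rule imageI) (rule Z.M.zero_closed)
  show "C \<oplus>\<^bsub>quotient_module Z B\<^esub> D \<in> carrier (quotient_module Z B)"
    if C: "C \<in> carrier (quotient_module Z B)" and D: "D \<in> carrier (quotient_module Z B)"
  proof -
    obtain f where f: "f \<in> carrier Z" "C = coset f" by (rule quotient_cases[OF C])
    obtain h where h: "h \<in> carrier Z" "D = coset h" by (rule quotient_cases[OF D])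
    show ?thesis
      unfolding f(2) h(2) quotient_sel(3)[OF f(1) h(1)] unfolding quotient_sel(1)
      by (rule imageI) (rule Z.M.a_closed[OF f(1) h(1)])
  qed
  show "\<zero>\<^bsub>quotient_module Z B\<^esub> \<oplus>\<^bsub>quotient_module Z B\<^esub> \<zero>\<^bsub>quotient_module Z B\<^esub> = \<zero>\<^bsub>quotient_module Z B\<^esub>"
    unfolding quotient_sel(2) quotient_sel(3)[OF Z.M.zero_closed Z.M.zero_closed]
    by (simp only: Z.M.l_zero[OF Z.M.zero_closed])
  show "r \<odot>\<^bsub>quotient_module Z B\<^esub> C \<in> carrier (quotient_module Z B)"
    if r: "r \<in> carrier R" and C: "C \<in> carrier (quotient_module Z B)"
  proof -
    obtain f where f: "f \<in> carrier Z" "C = coset f" by (rule quotient_cases[OF C])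
    show ?thesis
      unfolding f(2) smult_coset[OF r f(1)] unfolding quotient_sel(1)
      by (rule imageI) (rule Z.smult_closed[OF r f(1)])
  qed
  show "r \<odot>\<^bsub>quotient_module Z B\<^esub> \<zero>\<^bsub>quotient_module Z B\<^esub> = \<zero>\<^bsub>quotient_module Z B\<^esub>" if r: "r \<in> carrier R"
    unfolding quotient_sel(2) smult_coset[OF r Z.M.zero_closed]
    by (simp only: Z.smult_r_null[OF r])
qed

text \<open>The family \<open>\<theta>\<close> induces an isomorphism from the quotient onto a
  product of quotients: \<open>ker\<close> makes it well defined and injective, \<open>surj\<close>
  surjective. The conclusion is spelled out operation by operation, ready for reassembly over all
  degrees.\<close>

lemma quotient_isomorphism:
  fixes Z :: "('r, 'z) module" and Z' :: "'i \<Rightarrow> ('r, 'w) module" and \<theta> :: "'i \<Rightarrow> 'z \<Rightarrow> 'w"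
  assumes Z: "module_quotient R Z B" and Z': "\<And>i. i \<in> J \<Longrightarrow> module_quotient R (Z' i) (B' i)"
    and \<theta>: "\<And>i. i \<in> J \<Longrightarrow> \<theta> i \<in> linear_maps R Z (Z' i)"
    and ker: "\<And>f. f \<in> carrier Z \<Longrightarrow> f \<in> B \<longleftrightarrow> (\<forall>i\<in>J. \<theta> i f \<in> B' i)"
    and surj: "\<And>\<psi>. (\<And>i. i \<in> J \<Longrightarrow> \<psi> i \<in> carrier (Z' i)) \<Longrightarrow>
      \<exists>f\<in>carrier Z. \<forall>i\<in>J. \<exists>b\<in>B' i. \<theta> i f = \<psi> i \<oplus>\<^bsub>Z' i\<^esub> b"
  shows "\<exists>T. bij_betw T (carrier (quotient_module Z B)) (\<Pi>\<^sub>E i\<in>J. carrier (quotient_module (Z' i) (B' i))) \<and>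
    T \<zero>\<^bsub>quotient_module Z B\<^esub> = (\<lambda>i\<in>J. \<zero>\<^bsub>quotient_module (Z' i) (B' i)\<^esub>) \<and>
    (\<forall>C\<in>carrier (quotient_module Z B). \<forall>D\<in>carrier (quotient_module Z B).
      T (C \<oplus>\<^bsub>quotient_module Z B\<^esub> D) = (\<lambda>i\<in>J. T C i \<oplus>\<^bsub>quotient_module (Z' i) (B' i)\<^esub> T D i)) \<and>
    (\<forall>r\<in>carrier R. \<forall>C\<in>carrier (quotient_module Z B).
      T (r \<odot>\<^bsub>quotient_module Z B\<^esub> C) = (\<lambda>i\<in>J. r \<odot>\<^bsub>quotient_module (Z' i) (B' i)\<^esub> T C i))"
proof -
  interpret Z: module_quotient R Z B by (rule Z)
  let ?c' = "\<lambda>i. module_quotient.coset (Z' i) (B' i)"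
  \<comment> \<open>The union over the members of a class avoids choosing a representative; by
    \<open>ker\<close> all cosets in it are equal.\<close>
  define T where "T C = (\<lambda>i\<in>J. \<Union>f\<in>C. B' i +>\<^bsub>Z' i\<^esub> \<theta> i f)" for C
  note \<theta>' = linear_mapsD[OF \<theta>]
  have \<theta>0: "\<theta> i \<zero>\<^bsub>Z\<^esub> = \<zero>\<^bsub>Z' i\<^esub>" if "i \<in> J" for i
    using linear_maps_zero[OF Z.Z.module_axioms _ \<theta>[OF that]] Z'[OF that] by (simp add: module_quotient_def)
  have T: "T (Z.coset f) = (\<lambda>i\<in>J. B' i +>\<^bsub>Z' i\<^esub> \<theta> i f)" if f: "f \<in> carrier Z" for f
  proof -
    have "B' i +>\<^bsub>Z' i\<^esub> \<theta> i x = B' i +>\<^bsub>Z' i\<^esub> \<theta> i f" if i: "i \<in> J" and x: "x \<in> Z.coset f" for i x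
    proof -
      interpret Zi: module_quotient R "Z' i" "B' i" by (rule Z'[OF i])
      obtain b where b: "b \<in> B" "x = b \<oplus>\<^bsub>Z\<^esub> f" using x f by (auto simp: Z.coset_mem_iff)
      have bZ: "b \<in> carrier Z" by (rule Z.B_carrier[OF b(1)])
      show ?thesis
        using ker[OF bZ] b(1) i f bZ \<theta>'(1)[OF i] \<theta>'(2)[OF i]
        by (intro Zi.coset_eqI[of _ _ "\<theta> i b"]) (auto simp: b(2) Zi.Z.M.a_comm)
    qed
    then show ?thesis
      unfolding T_def using Z.BZ.a_rcos_self[OF f] by (intro restrict_ext) blast
  qed
  have "inj_on T (carrier (quotient_module Z B))"
  proof (rule inj_onI, unfold Z.quotient_sel(1), elim imageE)
    fix C D f h assume eq: "T C = T D" and CD: "C = Z.coset f" "D = Z.coset h" and fh: "f \<in> carrier Z" "h \<in> carrier Z"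
    \<comment> \<open>The difference of the two representatives: equal images force it into every
      \<open>B' i\<close>, and \<open>ker\<close> brings this back to \<open>B\<close>.\<close>
    let ?k = "f \<oplus>\<^bsub>Z\<^esub> (\<ominus>\<^bsub>Z\<^esub> h)"
    have k: "?k \<in> carrier Z" using fh by simp
    have fk: "f = h \<oplus>\<^bsub>Z\<^esub> ?k"
      using fh by (simp add: Z.Z.M.a_lcomm[of h] Z.Z.M.r_neg)
    have "\<theta> i ?k \<in> B' i" if i: "i \<in> J" for i
    proof -
      interpret Zi: module_quotient R "Z' i" "B' i" by (rule Z'[OF i])
      have "Zi.coset (\<theta> i f) = Zi.coset (\<theta> i h)"
        using fun_cong[OF eq, of i] i fh by (simp add: CD T)
      then obtain b where b: "b \<in> B' i" "\<theta> i f = b \<oplus>\<^bsub>Z' i\<^esub> \<theta> i h"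
        using Zi.coset_eqD[OF \<theta>'(1)[OF i fh(1)] \<theta>'(1)[OF i fh(2)]] by blast
      have "\<theta> i f = \<theta> i ?k \<oplus>\<^bsub>Z' i\<^esub> \<theta> i h"
        using \<theta>'(2)[OF i fh(2) k] fk fh k \<theta>'(1)[OF i] by (simp add: Zi.Z.M.a_comm)
      then have "\<theta> i ?k = b"
        using b Zi.B_carrier[OF b(1)] \<theta>'(1)[OF i k] \<theta>'(1)[OF i fh(2)] by simp
      then show ?thesis using b(1) by simp
    qed
    then have "?k \<in> B" using ker[OF k] by blast
    then show "C = D" unfolding CD using Z.coset_eqI[OF fh(1,2) _ fk] by blast
  qed
  moreover have "T ` carrier (quotient_module Z B) = (\<Pi>\<^sub>E i\<in>J. carrier (quotient_module (Z' i) (B' i)))"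
  proof (intro equalityI subsetI)
    fix F assume "F \<in> T ` carrier (quotient_module Z B)"
    then obtain f where f: "f \<in> carrier Z" "F = T (Z.coset f)" by (auto simp: Z.quotient_sel(1))
    show "F \<in> (\<Pi>\<^sub>E i\<in>J. carrier (quotient_module (Z' i) (B' i)))"
      unfolding f(2) T[OF f(1)]
      using f \<theta>'(1) module_quotient.quotient_sel(1)[OF Z'] by auto
  next
    fix F assume F: "F \<in> (\<Pi>\<^sub>E i\<in>J. carrier (quotient_module (Z' i) (B' i)))"
    have "\<forall>i\<in>J. \<exists>p. p \<in> carrier (Z' i) \<and> F i = B' i +>\<^bsub>Z' i\<^esub> p"
      using F module_quotient.quotient_sel(1)[OF Z'] by (auto simp: PiE_def Pi_def image_iff)
    then obtain \<psi> where \<psi>: "\<And>i. i \<in> J \<Longrightarrow> \<psi> i \<in> carrier (Z' i)" "\<And>i. i \<in> J \<Longrightarrow> F i = B' i +>\<^bsub>Z' i\<^esub> \<psi> i"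
      by metis
    obtain f where f: "f \<in> carrier Z" and f\<psi>: "\<And>i. i \<in> J \<Longrightarrow> \<exists>b\<in>B' i. \<theta> i f = \<psi> i \<oplus>\<^bsub>Z' i\<^esub> b"
      using surj[OF \<psi>(1)] by blast
    have "F = T (Z.coset f)"
    proof (rule extensionalityI[of _ J])
      fix i assume i: "i \<in> J"
      obtain b where b: "b \<in> B' i" "\<theta> i f = \<psi> i \<oplus>\<^bsub>Z' i\<^esub> b" using f\<psi>[OF i] by blast
      show "F i = T (Z.coset f) i"
        using module_quotient.coset_eqI[OF Z'[OF i] \<theta>'(1)[OF i f] \<psi>(1)[OF i] b] i
        by (simp add: T[OF f] \<psi>(2))
    qed (use F in \<open>auto simp: T_def PiE_def\<close>)
    then show "F \<in> T ` carrier (quotient_module Z B)"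
      using f by (auto simp: Z.quotient_sel(1))
  qed
  moreover have "T \<zero>\<^bsub>quotient_module Z B\<^esub> = (\<lambda>i\<in>J. \<zero>\<^bsub>quotient_module (Z' i) (B' i)\<^esub>)"
    unfolding Z.quotient_sel(2) T[OF Z.Z.M.zero_closed]
    using \<theta>0 module_quotient.quotient_sel(2)[OF Z'] by (intro restrict_ext) simp
  moreover have "T (C \<oplus>\<^bsub>quotient_module Z B\<^esub> D) = (\<lambda>i\<in>J. T C i \<oplus>\<^bsub>quotient_module (Z' i) (B' i)\<^esub> T D i)"
    if C: "C \<in> carrier (quotient_module Z B)" and D: "D \<in> carrier (quotient_module Z B)" for C D
  proof -
    obtain f where f: "f \<in> carrier Z" "C = Z.coset f" by (rule Z.quotient_cases[OF C])
    obtain h where h: "h \<in> carrier Z" "D = Z.coset h" by (rule Z.quotient_cases[OF D])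
    note fh = f h
    show ?thesis
      unfolding fh(2,4) Z.quotient_sel(3)[OF fh(1,3)] T[OF Z.Z.M.a_closed[OF fh(1,3)]] T[OF fh(1)] T[OF fh(3)]
      using fh \<theta>'(1,2) module_quotient.quotient_sel(3)[OF Z'] by (intro restrict_ext) simp
  qed
  moreover have "T (r \<odot>\<^bsub>quotient_module Z B\<^esub> C) = (\<lambda>i\<in>J. r \<odot>\<^bsub>quotient_module (Z' i) (B' i)\<^esub> T C i)"
    if r: "r \<in> carrier R" and C: "C \<in> carrier (quotient_module Z B)" for r C
  proof -
    obtain f where f: "f \<in> carrier Z" "C = Z.coset f" by (rule Z.quotient_cases[OF C])
    show ?thesis
      unfolding f(2) Z.smult_coset[OF r f(1)] T[OF Z.Z.smult_closed[OF r f(1)]] T[OF f(1)]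
      using f(1) r \<theta>'(1,3) module_quotient.smult_coset[OF Z'] by (intro restrict_ext) simp
  qed
  ultimately show ?thesis unfolding bij_betw_def by (intro exI[of _ T] conjI ballI)
qed

text \<open>The degreewise maps are combined by interchanging the degree with the index in
  \<open>J\<close>. Finiteness of \<open>J\<close> ensures that a family of finitely supported
  sequences is nonzero in only finitely many degrees altogether.\<close>

lemma graded_isomorphic_of_degreewise:
  fixes H :: "int \<Rightarrow> ('r, 'z) module" and H' :: "'i \<Rightarrow> int \<Rightarrow> ('r, 'w) module"
  assumes J: "finite J"
    and T: "\<And>n. \<exists>T. bij_betw T (carrier (H n)) (\<Pi>\<^sub>E i\<in>J. carrier (H' i n)) \<and>
      T \<zero>\<^bsub>H n\<^esub> = (\<lambda>i\<in>J. \<zero>\<^bsub>H' i n\<^esub>) \<and>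
      (\<forall>C\<in>carrier (H n). \<forall>D\<in>carrier (H n). T (C \<oplus>\<^bsub>H n\<^esub> D) = (\<lambda>i\<in>J. T C i \<oplus>\<^bsub>H' i n\<^esub> T D i)) \<and>
      (\<forall>r\<in>carrier R. \<forall>C\<in>carrier (H n). T (r \<odot>\<^bsub>H n\<^esub> C) = (\<lambda>i\<in>J. r \<odot>\<^bsub>H' i n\<^esub> T C i))"
    and zero: "\<And>n. \<zero>\<^bsub>H n\<^esub> \<in> carrier (H n)"
    and add: "\<And>n C D. \<lbrakk>C \<in> carrier (H n); D \<in> carrier (H n)\<rbrakk> \<Longrightarrow> C \<oplus>\<^bsub>H n\<^esub> D \<in> carrier (H n)"
    and add_zero: "\<And>n. \<zero>\<^bsub>H n\<^esub> \<oplus>\<^bsub>H n\<^esub> \<zero>\<^bsub>H n\<^esub> = \<zero>\<^bsub>H n\<^esub>"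
    and smult: "\<And>n r C. \<lbrakk>r \<in> carrier R; C \<in> carrier (H n)\<rbrakk> \<Longrightarrow> r \<odot>\<^bsub>H n\<^esub> C \<in> carrier (H n)"
    and smult_zero: "\<And>n r. r \<in> carrier R \<Longrightarrow> r \<odot>\<^bsub>H n\<^esub> \<zero>\<^bsub>H n\<^esub> = \<zero>\<^bsub>H n\<^esub>"
  shows "graded_isomorphic R (total_graded H) (graded_direct_sum J (\<lambda>i. total_graded (H' i)))"
proof -
  define spec where "spec n T \<longleftrightarrow> bij_betw T (carrier (H n)) (\<Pi>\<^sub>E i\<in>J. carrier (H' i n)) \<and>
      T \<zero>\<^bsub>H n\<^esub> = (\<lambda>i\<in>J. \<zero>\<^bsub>H' i n\<^esub>) \<and>
      (\<forall>C\<in>carrier (H n). \<forall>D\<in>carrier (H n). T (C \<oplus>\<^bsub>H n\<^esub> D) = (\<lambda>i\<in>J. T C i \<oplus>\<^bsub>H' i n\<^esub> T D i)) \<and>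
      (\<forall>r\<in>carrier R. \<forall>C\<in>carrier (H n). T (r \<odot>\<^bsub>H n\<^esub> C) = (\<lambda>i\<in>J. r \<odot>\<^bsub>H' i n\<^esub> T C i))" for n T
  have "\<forall>n. \<exists>T. spec n T" using T unfolding spec_def by blast
  then obtain S where S: "\<And>n. spec n (S n)" by metis
  have bij: "bij_betw (S n) (carrier (H n)) (\<Pi>\<^sub>E i\<in>J. carrier (H' i n))"
    and S0: "S n \<zero>\<^bsub>H n\<^esub> = (\<lambda>i\<in>J. \<zero>\<^bsub>H' i n\<^esub>)"
    and Sadd: "\<lbrakk>C \<in> carrier (H n); D \<in> carrier (H n)\<rbrakk> \<Longrightarrow> S n (C \<oplus>\<^bsub>H n\<^esub> D) = (\<lambda>i\<in>J. S n C i \<oplus>\<^bsub>H' i n\<^esub> S n D i)"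
    and Ssmult: "\<lbrakk>r \<in> carrier R; C \<in> carrier (H n)\<rbrakk> \<Longrightarrow> S n (r \<odot>\<^bsub>H n\<^esub> C) = (\<lambda>i\<in>J. r \<odot>\<^bsub>H' i n\<^esub> S n C i)"
    for n C D r
    using S[of n] by (simp_all add: spec_def)
  have Scl: "S n C i \<in> carrier (H' i n)" if "C \<in> carrier (H n)" "i \<in> J" for n C i
    using bij_betwE[OF bij] that by (auto simp: PiE_def Pi_def)
  have Sext: "S n C \<in> extensional J" if "C \<in> carrier (H n)" for n C
    using bij_betwE[OF bij] that by (auto simp: PiE_def)
  \<comment> \<open>Recognising zero componentwise gives both the finite support of preimages and
    the agreement of homogeneous parts.\<close>
  have S_eq0: "C = \<zero>\<^bsub>H n\<^esub> \<longleftrightarrow> (\<forall>i\<in>J. S n C i = \<zero>\<^bsub>H' i n\<^esub>)" if C: "C \<in> carrier (H n)" for n C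
  proof
    assume "\<forall>i\<in>J. S n C i = \<zero>\<^bsub>H' i n\<^esub>"
    then have "S n C = S n \<zero>\<^bsub>H n\<^esub>"
      unfolding S0 using Sext[OF C] by (intro extensionalityI[of _ J]) auto
    then show "C = \<zero>\<^bsub>H n\<^esub>" using bij_betw_imp_inj_on[OF bij] C zero by (auto dest: inj_onD)
  qed (simp add: S0)
  let ?V = "direct_sum UNIV H" and ?W = "direct_sum J (\<lambda>i. direct_sum UNIV (H' i))"
  have V: "carrier ?V = {f. (\<forall>n. f n \<in> carrier (H n)) \<and> finite {n. f n \<noteq> \<zero>\<^bsub>H n\<^esub>}}"
    by (auto simp: direct_sum_def)
  have W: "carrier ?W = {F \<in> extensional J. \<forall>i\<in>J. (\<forall>n. F i n \<in> carrier (H' i n)) \<and> finite {n. F i n \<noteq> \<zero>\<^bsub>H' i n\<^esub>}}"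
  proof -
    have "finite {i \<in> J. F i \<noteq> \<zero>\<^bsub>direct_sum UNIV (H' i)\<^esub>}" for F using J by simp
    then show ?thesis by (auto simp: direct_sum_def PiE_def Pi_def)
  qed
  define \<Phi> where "\<Phi> = (\<lambda>f\<in>carrier ?V. \<lambda>i\<in>J. \<lambda>n. S n (f n) i)"
  have \<Phi>: "\<Phi> f i n = S n (f n) i" if "f \<in> carrier ?V" "i \<in> J" for f i n
    using that by (simp add: \<Phi>_def)
  have \<Phi>ext: "\<Phi> f \<in> extensional J" if "f \<in> carrier ?V" for f using that by (simp add: \<Phi>_def)
  have \<Phi>cl: "\<Phi> f \<in> carrier ?W" if f: "f \<in> carrier ?V" for f
  proof -
    have "finite {n. \<Phi> f i n \<noteq> \<zero>\<^bsub>H' i n\<^esub>}" if i: "i \<in> J" for i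
    proof (rule finite_subset)
      show "{n. \<Phi> f i n \<noteq> \<zero>\<^bsub>H' i n\<^esub>} \<subseteq> {n. f n \<noteq> \<zero>\<^bsub>H n\<^esub>}"
        using i f by (auto simp: \<Phi> S0)
      show "finite {n. f n \<noteq> \<zero>\<^bsub>H n\<^esub>}" using f by (simp add: V)
    qed
    then show ?thesis using f Scl \<Phi>ext[OF f] by (auto simp: W \<Phi> V)
  qed
  have inj: "inj_on \<Phi> (carrier ?V)"
  proof (intro inj_onI ext)
    fix f h n assume f: "f \<in> carrier ?V" and h: "h \<in> carrier ?V" and eq: "\<Phi> f = \<Phi> h"
    have fh: "f n \<in> carrier (H n)" "h n \<in> carrier (H n)" using f h by (auto simp: V)
    have "S n (f n) i = S n (h n) i" if "i \<in> J" for i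
      using \<Phi>[OF f that, of n] \<Phi>[OF h that, of n] eq by simp
    then have "S n (f n) = S n (h n)"
      using Sext fh by (intro extensionalityI[of _ J]) auto
    then show "f n = h n" using bij_betw_imp_inj_on[OF bij] fh by (auto dest: inj_onD)
  qed
  have surj: "\<exists>f\<in>carrier ?V. \<Phi> f = F" if F: "F \<in> carrier ?W" for F
  proof -
    have "\<exists>C\<in>carrier (H n). S n C = (\<lambda>i\<in>J. F i n)" for n
    proof -
      have "(\<lambda>i\<in>J. F i n) \<in> (\<Pi>\<^sub>E i\<in>J. carrier (H' i n))" using F by (auto simp: W)
      then show ?thesis using bij_betw_imp_surj_on[OF bij, of n] by (metis imageE)
    qed
    then obtain f where f: "\<And>n. f n \<in> carrier (H n)" "\<And>n. S n (f n) = (\<lambda>i\<in>J. F i n)" by metis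
    have "{n. f n \<noteq> \<zero>\<^bsub>H n\<^esub>} \<subseteq> (\<Union>i\<in>J. {n. F i n \<noteq> \<zero>\<^bsub>H' i n\<^esub>})"
      using S_eq0[OF f(1)] by (auto simp: f(2))
    then have "finite {n. f n \<noteq> \<zero>\<^bsub>H n\<^esub>}"
      by (rule finite_subset) (use F J in \<open>auto simp: W\<close>)
    then have fV: "f \<in> carrier ?V" using f(1) by (simp add: V)
    moreover have "\<Phi> f = F"
    proof (rule extensionalityI[OF \<Phi>ext[OF fV]])
      show "F \<in> extensional J" using F by (simp add: W)
      show "\<Phi> f i = F i" if "i \<in> J" for i
        by (rule ext) (simp add: \<Phi>[OF fV that] f(2) that)
    qed
    ultimately show ?thesis by blast
  qed
  have \<Phi>bij: "bij_betw \<Phi> (carrier ?V) (carrier ?W)"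
    unfolding bij_betw_def
  proof (intro conjI equalityI subsetI inj)
    show "F \<in> \<Phi> ` carrier ?V" if "F \<in> carrier ?W" for F using surj[OF that] by blast
  qed (use \<Phi>cl in blast)
  have ops: "(f \<oplus>\<^bsub>?V\<^esub> h) = (\<lambda>n. f n \<oplus>\<^bsub>H n\<^esub> h n)" "(r \<odot>\<^bsub>?V\<^esub> f) = (\<lambda>n. r \<odot>\<^bsub>H n\<^esub> f n)" for f h r
    by (simp_all add: direct_sum_def restrict_def)
  have opsW: "(F \<oplus>\<^bsub>?W\<^esub> K) = (\<lambda>i\<in>J. \<lambda>n. F i n \<oplus>\<^bsub>H' i n\<^esub> K i n)" "(r \<odot>\<^bsub>?W\<^esub> F) = (\<lambda>i\<in>J. \<lambda>n. r \<odot>\<^bsub>H' i n\<^esub> F i n)" for F K r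
    by (simp_all add: direct_sum_def restrict_def)
  have addV: "f \<oplus>\<^bsub>?V\<^esub> h \<in> carrier ?V" if f: "f \<in> carrier ?V" and h: "h \<in> carrier ?V" for f h
  proof -
    have "{n. f n \<oplus>\<^bsub>H n\<^esub> h n \<noteq> \<zero>\<^bsub>H n\<^esub>} \<subseteq> {n. f n \<noteq> \<zero>\<^bsub>H n\<^esub>} \<union> {n. h n \<noteq> \<zero>\<^bsub>H n\<^esub>}"
      using add_zero by auto
    then have "finite {n. f n \<oplus>\<^bsub>H n\<^esub> h n \<noteq> \<zero>\<^bsub>H n\<^esub>}"
      by (rule finite_subset) (use f h in \<open>simp add: V\<close>)
    then show ?thesis using f h add by (simp add: V ops)
  qed
  have smultV: "r \<odot>\<^bsub>?V\<^esub> f \<in> carrier ?V" if r: "r \<in> carrier R" and f: "f \<in> carrier ?V" for r f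
  proof -
    have "{n. r \<odot>\<^bsub>H n\<^esub> f n \<noteq> \<zero>\<^bsub>H n\<^esub>} \<subseteq> {n. f n \<noteq> \<zero>\<^bsub>H n\<^esub>}"
      using smult_zero[OF r] by auto
    then have "finite {n. r \<odot>\<^bsub>H n\<^esub> f n \<noteq> \<zero>\<^bsub>H n\<^esub>}"
      by (rule finite_subset) (use f in \<open>simp add: V\<close>)
    then show ?thesis using f r smult by (simp add: V ops)
  qed
  have fV: "f n \<in> carrier (H n)" if "f \<in> carrier ?V" for f n using that by (simp add: V)
  have hom: "\<Phi> \<in> module_homs R ?V ?W"
  proof (rule module_homsI[OF \<Phi>cl])
    fix f h assume f: "f \<in> carrier ?V" and h: "h \<in> carrier ?V"
    show "\<Phi> (f \<oplus>\<^bsub>?V\<^esub> h) = \<Phi> f \<oplus>\<^bsub>?W\<^esub> \<Phi> h"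
    proof (rule extensionalityI[OF \<Phi>ext[OF addV[OF f h]]])
      show "\<Phi> (f \<oplus>\<^bsub>?V\<^esub> h) i = (\<Phi> f \<oplus>\<^bsub>?W\<^esub> \<Phi> h) i" if i: "i \<in> J" for i
        by (rule ext, subst \<Phi>[OF addV[OF f h] i]) (simp add: opsW \<Phi>[OF f i] \<Phi>[OF h i] i ops Sadd[OF fV[OF f] fV[OF h]])
    qed (simp add: opsW)
  next
    fix r f assume r: "r \<in> carrier R" and f: "f \<in> carrier ?V"
    show "\<Phi> (r \<odot>\<^bsub>?V\<^esub> f) = r \<odot>\<^bsub>?W\<^esub> \<Phi> f"
    proof (rule extensionalityI[OF \<Phi>ext[OF smultV[OF r f]]])
      show "\<Phi> (r \<odot>\<^bsub>?V\<^esub> f) i = (r \<odot>\<^bsub>?W\<^esub> \<Phi> f) i" if i: "i \<in> J" for i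
        by (rule ext, subst \<Phi>[OF smultV[OF r f] i]) (simp add: opsW \<Phi>[OF f i] i ops Ssmult[OF r fV[OF f]])
    qed (simp add: opsW)
  next
    show "\<Phi> \<in> extensional (carrier ?V)" unfolding \<Phi>_def by (rule restrict_extensional)
  qed
  have zW: "\<zero>\<^bsub>direct_sum UNIV (H' i)\<^esub> = (\<lambda>n. \<zero>\<^bsub>H' i n\<^esub>)" for i
    by (simp add: direct_sum_def restrict_def)
  have Wi: "F i \<in> carrier (direct_sum UNIV (H' i))" if "F \<in> carrier ?W" "i \<in> J" for F i
    using that by (auto simp: direct_sum_def)
  have deg: "(\<forall>k. k \<noteq> n \<longrightarrow> f k = \<zero>\<^bsub>H k\<^esub>) \<longleftrightarrow> (\<forall>i\<in>J. \<forall>k. k \<noteq> n \<longrightarrow> \<Phi> f i k = \<zero>\<^bsub>H' i k\<^esub>)"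
    if f: "f \<in> carrier ?V" for f n
    using S_eq0[OF fV[OF f]] \<Phi>[OF f] by auto
  have sndW: "snd (graded_direct_sum J (\<lambda>i. total_graded (H' i))) n
      = {F \<in> carrier ?W. \<forall>i\<in>J. \<forall>k. k \<noteq> n \<longrightarrow> F i k = \<zero>\<^bsub>H' i k\<^esub>}" for n
    using Wi by (simp add: graded_direct_sum_def total_graded_def) blast
  have sndV: "snd (total_graded H) n = {f \<in> carrier ?V. \<forall>k. k \<noteq> n \<longrightarrow> f k = \<zero>\<^bsub>H k\<^esub>}" for n
    by (simp add: total_graded_def)
  have img: "\<Phi> ` snd (total_graded H) n = snd (graded_direct_sum J (\<lambda>i. total_graded (H' i))) n" for n
    unfolding sndW sndV
  proof (intro equalityI subsetI)
    fix F assume "F \<in> \<Phi> ` {f \<in> carrier ?V. \<forall>k. k \<noteq> n \<longrightarrow> f k = \<zero>\<^bsub>H k\<^esub>}"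
    then obtain f where f: "f \<in> carrier ?V" "\<forall>k. k \<noteq> n \<longrightarrow> f k = \<zero>\<^bsub>H k\<^esub>" "F = \<Phi> f" by blast
    then show "F \<in> {F \<in> carrier ?W. \<forall>i\<in>J. \<forall>k. k \<noteq> n \<longrightarrow> F i k = \<zero>\<^bsub>H' i k\<^esub>}"
      using \<Phi>cl[OF f(1)] deg[OF f(1), of n] by simp
  next
    fix F assume F: "F \<in> {F \<in> carrier ?W. \<forall>i\<in>J. \<forall>k. k \<noteq> n \<longrightarrow> F i k = \<zero>\<^bsub>H' i k\<^esub>}"
    then obtain f where f: "f \<in> carrier ?V" "\<Phi> f = F" using surj[of F] by auto
    then have "\<forall>k. k \<noteq> n \<longrightarrow> f k = \<zero>\<^bsub>H k\<^esub>" using F deg[OF f(1), of n] by simp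
    then show "F \<in> \<Phi> ` {f \<in> carrier ?V. \<forall>k. k \<noteq> n \<longrightarrow> f k = \<zero>\<^bsub>H k\<^esub>}" using f by blast
  qed
  have fsts: "fst (total_graded H) = ?V" "fst (graded_direct_sum J (\<lambda>i. total_graded (H' i))) = ?W"
    by (simp_all add: graded_direct_sum_def total_graded_def)
  show ?thesis
    unfolding graded_isomorphic_def fsts
    using hom \<Phi>bij img by (intro bexI[of _ \<Phi>] conjI allI)
qed

section \<open>Cohomology as a quotient of Hom modules\<close>

lemma (in module) submodule_of_closed:
  assumes "H \<subseteq> carrier M" "\<zero>\<^bsub>M\<^esub> \<in> H" "\<And>a b. \<lbrakk>a \<in> H; b \<in> H\<rbrakk> \<Longrightarrow> a \<oplus>\<^bsub>M\<^esub> b \<in> H"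
    and "\<And>r a. \<lbrakk>r \<in> carrier R; a \<in> H\<rbrakk> \<Longrightarrow> r \<odot>\<^bsub>M\<^esub> a \<in> H"
  shows "submodule H R M"
proof (rule submoduleI[OF assms(1,2) _ assms(3,4)])
  fix a assume a: "a \<in> H"
  then have "\<ominus>\<^bsub>M\<^esub> a = (\<ominus>\<^bsub>R\<^esub> \<one>\<^bsub>R\<^esub>) \<odot>\<^bsub>M\<^esub> a"
    using assms(1) by (subst smult_l_minus) auto
  then show "\<ominus>\<^bsub>M\<^esub> a \<in> H" using assms(4)[OF _ a] by simp
qed

lemma hom_module_sel [simp]:
  "carrier (hom_module A M N) = module_homs A M N"
  "\<zero>\<^bsub>hom_module A M N\<^esub> = (\<lambda>x\<in>carrier M. \<zero>\<^bsub>N\<^esub>)"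
  "f \<oplus>\<^bsub>hom_module A M N\<^esub> h = (\<lambda>x\<in>carrier M. f x \<oplus>\<^bsub>N\<^esub> h x)"
  "r \<odot>\<^bsub>hom_module A M N\<^esub> f = (\<lambda>x\<in>carrier M. (r \<odot>\<^bsub>A\<^esub> \<one>\<^bsub>A\<^esub>) \<odot>\<^bsub>N\<^esub> f x)"
  by (simp_all add: hom_module_def)

context based_algebra
begin

text \<open>A scalar multiple of an A-linear map is again A-linear because the scalars are central
  in \<open>A\<close>.\<close>

lemma module_hom_module:
  assumes M: "left_module A M" and N: "left_module A N"
  shows "module R (hom_module A M N)"
proof -
  interpret M: left_module A M by fact
  interpret N: left_module A N by fact
  have add: "(\<lambda>x\<in>carrier M. f x \<oplus>\<^bsub>N\<^esub> h x) \<in> module_homs A M N"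
    if "f \<in> module_homs A M N" "h \<in> module_homs A M N" for f h
    using module_homsD[OF that(1)] module_homsD[OF that(2)]
    by (intro module_homsI) (simp_all add: M.smult_closed N.smult_r_distr N.M.a_ac)
  have smult: "(\<lambda>x\<in>carrier M. scalar r \<odot>\<^bsub>N\<^esub> f x) \<in> module_homs A M N"
    if r: "r \<in> carrier R" and f: "f \<in> module_homs A M N" for r f
    using module_homsD[OF f] r scalar_central[OF r, folded scalar_def]
    by (intro module_homsI)
      (simp_all add: M.smult_closed N.smult_closed N.smult_r_distr scalar_closed N.smult_assoc[symmetric])
  have zero: "(\<lambda>x\<in>carrier M. \<zero>\<^bsub>N\<^esub>) \<in> module_homs A M N"
    by (intro module_homsI) (simp_all add: M.smult_closed left_module_zero[OF N])
  have neg: "(\<lambda>x\<in>carrier M. \<ominus>\<^bsub>N\<^esub> f x) \<in> module_homs A M N" if f: "f \<in> module_homs A M N" for f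
  proof (intro module_homsI)
    note f' = module_homsD[OF f]
    fix a x assume a: "a \<in> carrier A" and x: "x \<in> carrier M"
    have "a \<odot>\<^bsub>N\<^esub> (\<ominus>\<^bsub>N\<^esub> f x) \<oplus>\<^bsub>N\<^esub> a \<odot>\<^bsub>N\<^esub> f x = \<zero>\<^bsub>N\<^esub>"
      using a x f'(1)[OF x] by (simp add: N.smult_r_distr[symmetric] N.M.l_neg left_module_zero[OF N])
    then have "\<ominus>\<^bsub>N\<^esub> (a \<odot>\<^bsub>N\<^esub> f x) = a \<odot>\<^bsub>N\<^esub> (\<ominus>\<^bsub>N\<^esub> f x)"
      using a x f'(1)[OF x] by (intro N.M.minus_equality) (simp_all add: N.smult_closed)
    then show "(\<lambda>x\<in>carrier M. \<ominus>\<^bsub>N\<^esub> f x) (a \<odot>\<^bsub>M\<^esub> x) = a \<odot>\<^bsub>N\<^esub> (\<lambda>x\<in>carrier M. \<ominus>\<^bsub>N\<^esub> f x) x"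
      using a x f' by (simp add: M.smult_closed)
  qed (use module_homsD[OF f] in \<open>simp_all add: N.M.minus_add N.M.a_comm\<close>)
  have ext: "f = h" if "f \<in> extensional (carrier M)" "h \<in> extensional (carrier M)" "\<And>x. x \<in> carrier M \<Longrightarrow> f x = h x" for f h
    using that by (rule extensionalityI)
  have "abelian_group (hom_module A M N)"
  proof (rule abelian_groupI; (unfold hom_module_sel)?)
    fix f assume f: "f \<in> module_homs A M N"
    show "\<exists>h\<in>module_homs A M N. (\<lambda>x\<in>carrier M. h x \<oplus>\<^bsub>N\<^esub> f x) = (\<lambda>x\<in>carrier M. \<zero>\<^bsub>N\<^esub>)"
      by (rule bexI[OF _ neg[OF f]], rule restrict_ext) (simp add: module_homsD(1)[OF f] N.M.l_neg)
    show "(\<lambda>x\<in>carrier M. (\<lambda>x\<in>carrier M. \<zero>\<^bsub>N\<^esub>) x \<oplus>\<^bsub>N\<^esub> f x) = f"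
      using module_homsD(1,4)[OF f] by (intro ext) simp_all
    fix h assume h: "h \<in> module_homs A M N"
    show "(\<lambda>x\<in>carrier M. f x \<oplus>\<^bsub>N\<^esub> h x) = (\<lambda>x\<in>carrier M. h x \<oplus>\<^bsub>N\<^esub> f x)"
      using module_homsD(1)[OF f] module_homsD(1)[OF h] by (intro restrict_ext N.M.a_comm)
    fix k assume k: "k \<in> module_homs A M N"
    show "(\<lambda>x\<in>carrier M. (\<lambda>x\<in>carrier M. f x \<oplus>\<^bsub>N\<^esub> h x) x \<oplus>\<^bsub>N\<^esub> k x)
        = (\<lambda>x\<in>carrier M. f x \<oplus>\<^bsub>N\<^esub> (\<lambda>x\<in>carrier M. h x \<oplus>\<^bsub>N\<^esub> k x) x)"
      using module_homsD(1)[OF f] module_homsD(1)[OF h] module_homsD(1)[OF k]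
      by (intro restrict_ext) (simp add: N.M.a_assoc)
  qed (fact add zero)+
  then show ?thesis
  proof (rule moduleI[OF R.is_cring]; (unfold hom_module_sel scalar_def[symmetric])?)
    fix f assume f: "f \<in> module_homs A M N"
    show "(\<lambda>x\<in>carrier M. scalar \<one>\<^bsub>R\<^esub> \<odot>\<^bsub>N\<^esub> f x) = f"
      using module_homsD(1,4)[OF f] by (intro ext) (simp_all add: scalar_one N.smult_one)
    fix a assume a: "a \<in> carrier R"
    show "(\<lambda>x\<in>carrier M. scalar a \<odot>\<^bsub>N\<^esub> f x) \<in> module_homs A M N" by (rule smult[OF a f])
    show "(\<lambda>x\<in>carrier M. scalar a \<odot>\<^bsub>N\<^esub> (\<lambda>x\<in>carrier M. f x \<oplus>\<^bsub>N\<^esub> h x) x)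
      = (\<lambda>x\<in>carrier M. (\<lambda>x\<in>carrier M. scalar a \<odot>\<^bsub>N\<^esub> f x) x \<oplus>\<^bsub>N\<^esub> (\<lambda>x\<in>carrier M. scalar a \<odot>\<^bsub>N\<^esub> h x) x)"
      if h: "h \<in> module_homs A M N" for h
      using module_homsD(1)[OF f] module_homsD(1)[OF h] a
      by (intro restrict_ext) (simp add: N.smult_r_distr scalar_closed)
    fix b assume b: "b \<in> carrier R"
    show "(\<lambda>x\<in>carrier M. scalar (a \<oplus>\<^bsub>R\<^esub> b) \<odot>\<^bsub>N\<^esub> f x)
      = (\<lambda>x\<in>carrier M. (\<lambda>x\<in>carrier M. scalar a \<odot>\<^bsub>N\<^esub> f x) x \<oplus>\<^bsub>N\<^esub> (\<lambda>x\<in>carrier M. scalar b \<odot>\<^bsub>N\<^esub> f x) x)"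
      using module_homsD(1)[OF f] a b
      by (intro restrict_ext) (simp add: N.smult_l_distr scalar_closed scalar_add)
    show "(\<lambda>x\<in>carrier M. scalar (a \<otimes>\<^bsub>R\<^esub> b) \<odot>\<^bsub>N\<^esub> f x)
      = (\<lambda>x\<in>carrier M. scalar a \<odot>\<^bsub>N\<^esub> (\<lambda>x\<in>carrier M. scalar b \<odot>\<^bsub>N\<^esub> f x) x)"
      using module_homsD(1)[OF f] a b
      by (intro restrict_ext) (simp add: N.smult_assoc scalar_closed scalar_mult)
  qed
qed

lemma cohomology_module_quotient:
  assumes P: "chain_complex A P d" and N: "left_module A N"
  shows "module_quotient R ((hom_module A (P n) N)\<lparr>carrier := cocycles A P d N n\<rparr>) (coboundaries A P d N n)"
proof -
  have lm: "left_module A (P n)" for n using P by (simp add: chain_complex_def)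
  have d: "d n \<in> module_homs A (P n) (P (n - 1))" for n using P by (simp add: chain_complex_def)
  have dS: "d (n + 1) \<in> module_homs A (P (n + 1)) (P n)" using d[of "n + 1"] by simp
  have dd: "d n (d (n + 1) x) = \<zero>\<^bsub>P (n - 1)\<^esub>" if "x \<in> carrier (P (n + 1))" for x
    using P that by (simp add: chain_complex_def)
  interpret N: left_module A N by fact
  interpret Pn: left_module A "P n" by (rule lm)
  interpret Pm: left_module A "P (n - 1)" by (rule lm)
  interpret H: module R "hom_module A (P n) N" by (rule module_hom_module[OF lm N])
  interpret Hm: module R "hom_module A (P (n - 1)) N" by (rule module_hom_module[OF lm N])
  note dcl = module_homsD(1)[OF d[of n]] and dScl = module_homsD(1)[OF dS]
  have cob: "coboundaries A P d N n \<subseteq> cocycles A P d N n"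
  proof
    fix f assume "f \<in> coboundaries A P d N n"
    then obtain h where h: "h \<in> module_homs A (P (n - 1)) N" "f = compose (carrier (P n)) h (d n)"
      by (auto simp: coboundaries_def)
    note h' = module_homsD[OF h(1)] and d' = module_homsD[OF d[of n]]
    have "h \<zero>\<^bsub>P (n - 1)\<^esub> \<oplus>\<^bsub>N\<^esub> h \<zero>\<^bsub>P (n - 1)\<^esub> = h \<zero>\<^bsub>P (n - 1)\<^esub>"
      by (simp add: h'(2)[symmetric])
    then have h0: "h \<zero>\<^bsub>P (n - 1)\<^esub> = \<zero>\<^bsub>N\<^esub>" using h'(1) by simp
    have "f \<in> module_homs A (P n) N"
      using h' d' by (intro module_homsI) (simp_all add: h(2) compose_def Pn.smult_closed)
    then show "f \<in> cocycles A P d N n"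
      using dd dScl h0 by (simp add: cocycles_def h(2) compose_def)
  qed
  have "submodule (cocycles A P d N n) R (hom_module A (P n) N)"
  proof (rule H.submodule_of_closed)
    show "cocycles A P d N n \<subseteq> carrier (hom_module A (P n) N)" by (auto simp: cocycles_def)
    show "\<zero>\<^bsub>hom_module A (P n) N\<^esub> \<in> cocycles A P d N n"
      using H.M.zero_closed dScl by (simp add: cocycles_def)
    show "f \<oplus>\<^bsub>hom_module A (P n) N\<^esub> h \<in> cocycles A P d N n"
      if "f \<in> cocycles A P d N n" "h \<in> cocycles A P d N n" for f h
      using H.M.a_closed[of f h] that dScl by (simp add: cocycles_def)
    show "r \<odot>\<^bsub>hom_module A (P n) N\<^esub> f \<in> cocycles A P d N n"
      if "r \<in> carrier R" "f \<in> cocycles A P d N n" for r f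
      using H.smult_closed[of r f] that dScl left_module_zero[OF N, of "r \<odot>\<^bsub>A\<^esub> \<one>\<^bsub>A\<^esub>"] scalar_closed[of r]
      by (simp add: cocycles_def scalar_def)
  qed
  then have Z: "module R ((hom_module A (P n) N)\<lparr>carrier := cocycles A P d N n\<rparr>)"
    by (rule submodule.submodule_is_module) (rule H.module_axioms)
  have "submodule (coboundaries A P d N n) R (hom_module A (P n) N)"
  proof (rule H.submodule_of_closed)
    show "coboundaries A P d N n \<subseteq> carrier (hom_module A (P n) N)" using cob by (auto simp: cocycles_def)
    show "\<zero>\<^bsub>hom_module A (P n) N\<^esub> \<in> coboundaries A P d N n"
      unfolding coboundaries_def
      by (rule image_eqI[OF _ Hm.M.zero_closed[unfolded hom_module_sel]])
        (auto simp: compose_def dcl intro!: restrict_ext)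
    show "f \<oplus>\<^bsub>hom_module A (P n) N\<^esub> h \<in> coboundaries A P d N n"
      if f: "f \<in> coboundaries A P d N n" and h: "h \<in> coboundaries A P d N n" for f h
    proof -
      obtain f' where f': "f' \<in> module_homs A (P (n - 1)) N" "f = compose (carrier (P n)) f' (d n)"
        using f by (auto simp: coboundaries_def)
      obtain h' where h': "h' \<in> module_homs A (P (n - 1)) N" "h = compose (carrier (P n)) h' (d n)"
        using h by (auto simp: coboundaries_def)
      show ?thesis
        unfolding coboundaries_def
        by (rule image_eqI[OF _ Hm.M.a_closed[of f' h', unfolded hom_module_sel, OF f'(1) h'(1)]])
          (auto simp: compose_def dcl f'(2) h'(2) intro!: restrict_ext)
    qed
    show "r \<odot>\<^bsub>hom_module A (P n) N\<^esub> f \<in> coboundaries A P d N n"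
      if r: "r \<in> carrier R" and f: "f \<in> coboundaries A P d N n" for r f
    proof -
      obtain f' where f': "f' \<in> module_homs A (P (n - 1)) N" "f = compose (carrier (P n)) f' (d n)"
        using f by (auto simp: coboundaries_def)
      show ?thesis
        unfolding coboundaries_def
        by (rule image_eqI[OF _ Hm.smult_closed[of r f', unfolded hom_module_sel, OF r f'(1)]])
          (auto simp: compose_def dcl f'(2) intro!: restrict_ext)
    qed
  qed
  then have "module R ((hom_module A (P n) N)\<lparr>carrier := coboundaries A P d N n\<rparr>)"
    by (rule submodule.submodule_is_module) (rule H.module_axioms)
  then have "submodule (coboundaries A P d N n) R ((hom_module A (P n) N)\<lparr>carrier := cocycles A P d N n\<rparr>)"
    using cob by (intro module.module_incl_imp_submodule[OF Z]) simp_all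
  with Z show ?thesis by (rule module_quotient.intro)
qed

end

text \<open>Used to pass from the trivial module, with scalars restricted to R, to R itself:
  different records with the same operations on a common carrier.\<close>

lemma complete_resolution_complex_target_cong:
  assumes P: "complete_resolution_complex R K P a d M c \<eta>" and M': "group_module R K M' c'"
    and eq: "carrier M' = carrier M" "\<zero>\<^bsub>M'\<^esub> = \<zero>\<^bsub>M\<^esub>" "add M' = add M"
    and smult: "\<And>r x. \<lbrakk>r \<in> carrier R; x \<in> carrier M\<rbrakk> \<Longrightarrow> r \<odot>\<^bsub>M'\<^esub> x = r \<odot>\<^bsub>M\<^esub> x"
    and act: "\<And>k x. \<lbrakk>k \<in> carrier K; x \<in> carrier M\<rbrakk> \<Longrightarrow> c' k x = c k x"
  shows "complete_resolution_complex R K P a d M' c' \<eta>"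
proof -
  interpret P: complete_resolution_complex R K P a d M c \<eta> by fact
  note \<eta> = equivariant_mapsD[OF P.augmentation]
  have "\<eta> \<in> equivariant_maps R K (P 0) (a 0) M' c'"
    using \<eta>(2-5) by (intro equivariant_mapsI linear_mapsI) (simp_all add: eq smult act)
  then show ?thesis
    by (intro complete_resolution_complex.intro complete_resolution_complex_axioms.intro P.complete_complex_axioms M')
      (simp_all add: eq P.augmentation_surj P.augmentation_kernel)
qed

section \<open>The trivial module\<close>

lemma trivial_module_sel [simp]:
  "carrier (trivial_module R K) = carrier R" "\<zero>\<^bsub>trivial_module R K\<^esub> = \<zero>\<^bsub>R\<^esub>"
  "add (trivial_module R K) = add R"
  "f \<odot>\<^bsub>trivial_module R K\<^esub> x = (\<Oplus>\<^bsub>R\<^esub>k\<in>carrier K. f k) \<otimes>\<^bsub>R\<^esub> x"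
  by (simp_all add: trivial_module_def)

locale finite_group_trivial = base: cring R + K: group K
  for R :: "('r, 'x) ring_scheme" and K :: "('k, 'y) monoid_scheme" +
  assumes finite_K: "finite (carrier K)"
begin

sublocale RK: monoid_algebra R K
  by (intro monoid_algebra.intro base.is_cring K.is_monoid)

sublocale BK: based_algebra R "monoid_ring R K" K "basis_element R K" "\<lambda>f. f \<one>\<^bsub>K\<^esub>"
  by (rule group_ring_based_algebra) (use base.is_cring K.group_axioms finite_K in auto)

lemma trivial_smult_basis:
  assumes r: "r \<in> carrier R" and k: "k \<in> carrier K" and x: "x \<in> carrier R"
  shows "(r \<odot>\<^bsub>monoid_ring R K\<^esub> basis_element R K k) \<odot>\<^bsub>trivial_module R K\<^esub> x = r \<otimes>\<^bsub>R\<^esub> x"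
proof -
  have "(\<Oplus>\<^bsub>R\<^esub>l\<in>carrier K. (r \<odot>\<^bsub>monoid_ring R K\<^esub> basis_element R K k) l)
      = (\<Oplus>\<^bsub>R\<^esub>l\<in>carrier K. if k = l then r else \<zero>\<^bsub>R\<^esub>)"
    using r by (intro base.finsum_cong') (auto simp: RK.F_apply RK.\<beta>_apply)
  also have "\<dots> = r"
    using r k finite_K by (intro base.finsum_singleton) auto
  finally show ?thesis by simp
qed

lemma trivial_smult_one:
  "\<lbrakk>r \<in> carrier R; x \<in> carrier R\<rbrakk> \<Longrightarrow>
    (r \<odot>\<^bsub>monoid_ring R K\<^esub> \<one>\<^bsub>monoid_ring R K\<^esub>) \<odot>\<^bsub>trivial_module R K\<^esub> x = r \<otimes>\<^bsub>R\<^esub> x"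
  unfolding RK.one_F by (rule trivial_smult_basis) auto

lemma trivial_smult_\<beta>:
  assumes "k \<in> carrier K" "x \<in> carrier R"
  shows "basis_element R K k \<odot>\<^bsub>trivial_module R K\<^esub> x = x"
  using trivial_smult_basis[OF base.one_closed assms] assms
  by (simp only: module.smult_one[OF RK.module_F RK.\<beta>_closed] base.l_one)

lemma abelian_group_trivial: "abelian_group (trivial_module R K)"
  by (rule abelian_group_eqI[OF base.is_abelian_group]) simp_all

lemma group_module_trivial: "group_module R K (regular_module R) (\<lambda>_ x. x)"
  by (intro group_module.intro base.module_regular_module K.group_axioms group_module_axioms.intro)
    (auto simp: linear_maps_def)

lemma trivial_resolution:
  assumes "complete_resolution (monoid_ring R K) (trivial_module R K) P d"
  shows "left_module (monoid_ring R K) (trivial_module R K) \<and>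
    (\<exists>\<eta>. complete_resolution_complex R K (\<lambda>n. scalar_restriction (monoid_ring R K) (P n))
      (\<lambda>n. BK.act (P n)) d (regular_module R) (\<lambda>_ x. x) \<eta>)"
proof -
  obtain \<eta> where lm: "left_module (monoid_ring R K) (trivial_module R K)"
    and \<eta>: "complete_resolution_complex R K (\<lambda>n. scalar_restriction (monoid_ring R K) (P n))
      (\<lambda>n. BK.act (P n)) d (scalar_restriction (monoid_ring R K) (trivial_module R K))
      (BK.act (trivial_module R K)) \<eta>"
    using BK.complete_resolution_imp_complex[OF assms abelian_group_trivial] by (elim conjE exE)
  have "complete_resolution_complex R K (\<lambda>n. scalar_restriction (monoid_ring R K) (P n))
      (\<lambda>n. BK.act (P n)) d (regular_module R) (\<lambda>_ x. x) \<eta>"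
  proof (rule complete_resolution_complex_target_cong[OF \<eta> group_module_trivial])
    show "add (regular_module R) = add (scalar_restriction (monoid_ring R K) (trivial_module R K))"
      by (intro ext) simp
  qed (simp_all only: carrier_regular_module zero_regular_module smult_regular_module
      scalar_restriction_simps trivial_module_sel(1,2) trivial_smult_one trivial_smult_\<beta>)
  then show ?thesis using lm by blast
qed

text \<open>The group ring acts on the trivial module through the sum of coefficients, so scalars
  act by multiplication and group elements as the identity. Homomorphisms into it are thus the
  invariant linear forms.\<close>

lemma trivial_module_homs_iff:
  assumes M: "left_module (monoid_ring R K) M" and T: "left_module (monoid_ring R K) (trivial_module R K)"
  shows "f \<in> module_homs (monoid_ring R K) M (trivial_module R K) \<longleftrightarrow> f \<in> extensional (carrier M) \<and>
    f \<in> equivariant_maps R K (scalar_restriction (monoid_ring R K) M) (BK.act M) (regular_module R) (\<lambda>_ x. x)"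
proof -
  have "f \<in> equivariant_maps R K (scalar_restriction (monoid_ring R K) M) (BK.act M)
      (scalar_restriction (monoid_ring R K) (trivial_module R K)) (BK.act (trivial_module R K)) \<longleftrightarrow>
    f \<in> equivariant_maps R K (scalar_restriction (monoid_ring R K) M) (BK.act M) (regular_module R) (\<lambda>_ x. x)"
  proof
    assume f: "f \<in> equivariant_maps R K (scalar_restriction (monoid_ring R K) M) (BK.act M)
      (scalar_restriction (monoid_ring R K) (trivial_module R K)) (BK.act (trivial_module R K))"
    note f' = equivariant_mapsD[OF f, unfolded scalar_restriction_simps trivial_module_sel(1,3)]
    show "f \<in> equivariant_maps R K (scalar_restriction (monoid_ring R K) M) (BK.act M) (regular_module R) (\<lambda>_ x. x)"
      by (intro equivariant_mapsI linear_mapsI;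
          unfold scalar_restriction_simps carrier_regular_module add_regular_module smult_regular_module)
        (simp_all only: f'(2-5) trivial_smult_one trivial_smult_\<beta>)
  next
    assume f: "f \<in> equivariant_maps R K (scalar_restriction (monoid_ring R K) M) (BK.act M) (regular_module R) (\<lambda>_ x. x)"
    note f' = equivariant_mapsD[OF f, unfolded scalar_restriction_simps carrier_regular_module
        add_regular_module smult_regular_module]
    show "f \<in> equivariant_maps R K (scalar_restriction (monoid_ring R K) M) (BK.act M)
      (scalar_restriction (monoid_ring R K) (trivial_module R K)) (BK.act (trivial_module R K))"
      by (intro equivariant_mapsI linear_mapsI; unfold scalar_restriction_simps trivial_module_sel(1,3))
        (simp_all only: f'(2-5) trivial_smult_one trivial_smult_\<beta>)
  qed
  then show ?thesis unfolding BK.module_homs_iff_equivariant[OF M T] by (rule conj_cong[OF refl])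
qed

end

section \<open>The isomorphism in each degree\<close>

lemma equivariant_maps_restrict:
  assumes M: "group_module R K M a" and f: "f \<in> equivariant_maps R K M a N b"
  shows "restrict f (carrier M) \<in> equivariant_maps R K M a N b"
proof -
  interpret M: group_module R K M a by fact
  note f' = equivariant_mapsD[OF f]
  show ?thesis
    using f'(2-5) by (intro equivariant_mapsI linear_mapsI) (simp_all add: M.act_closed)
qed

context finite_group_algebra
begin

text \<open>A cocycle is sent to forms on the \<open>Q i n\<close> by taking the coefficient at 1,
  pulling back along the comparison map \<open>\<alpha>\<close> from the induced complex to
  \<open>P\<close>, and restricting to the fibre over \<open>g i\<close>. The first and the last
  operation are bijective already on cochains, the middle one on cohomology.\<close>

lemma tate_ext_isomorphism:
  fixes P :: "int \<Rightarrow> ((('g \<Rightarrow> 'r) \<times> ('g \<Rightarrow> 'r) \<Rightarrow> 'r) set, 'p) module"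
    and Q :: "'i \<Rightarrow> int \<Rightarrow> ('g \<Rightarrow> 'r, 'q) module"
  assumes P: "complete_resolution E.T N P d"
    and Q: "\<And>i. i \<in> I \<Longrightarrow> complete_resolution (monoid_ring R (centralizer G (g i)))
        (trivial_module R (centralizer G (g i))) (Q i) (e i)"
    and g: "\<And>i. i \<in> I \<Longrightarrow> g i \<in> carrier G"
    and idx: "\<And>y. y \<in> carrier G \<Longrightarrow> idx y \<in> I"
    and s: "\<And>y. y \<in> carrier G \<Longrightarrow> s y \<in> carrier G"
    and s_conj: "\<And>y. y \<in> carrier G \<Longrightarrow> s y \<otimes>\<^bsub>G\<^esub> g (idx y) = y \<otimes>\<^bsub>G\<^esub> s y"
    and idx_g: "\<And>i. i \<in> I \<Longrightarrow> idx (g i) = i"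
    and s_g: "\<And>i. i \<in> I \<Longrightarrow> s (g i) = \<one>\<^bsub>G\<^esub>"
    and idx_conj: "\<And>y h. \<lbrakk>y \<in> carrier G; h \<in> carrier G\<rbrakk> \<Longrightarrow> idx (inv\<^bsub>G\<^esub> h \<otimes>\<^bsub>G\<^esub> y \<otimes>\<^bsub>G\<^esub> h) = idx y"
  defines "H \<equiv> tate_ext E.T N P d"
    and "H' \<equiv> \<lambda>i. tate_ext (monoid_ring R (centralizer G (g i))) (trivial_module R (centralizer G (g i))) (Q i) (e i)"
  shows "\<exists>T. bij_betw T (carrier (H n)) (\<Pi>\<^sub>E i\<in>I. carrier (H' i n)) \<and>
      T \<zero>\<^bsub>H n\<^esub> = (\<lambda>i\<in>I. \<zero>\<^bsub>H' i n\<^esub>) \<and>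
      (\<forall>C\<in>carrier (H n). \<forall>D\<in>carrier (H n). T (C \<oplus>\<^bsub>H n\<^esub> D) = (\<lambda>i\<in>I. T C i \<oplus>\<^bsub>H' i n\<^esub> T D i)) \<and>
      (\<forall>r\<in>carrier R. \<forall>C\<in>carrier (H n). T (r \<odot>\<^bsub>H n\<^esub> C) = (\<lambda>i\<in>I. r \<odot>\<^bsub>H' i n\<^esub> T C i))"
proof -
  let ?C = "\<lambda>i. centralizer G (g i)"
  let ?A = "\<lambda>i. monoid_ring R (?C i)" and ?Tr = "\<lambda>i. trivial_module R (?C i)"
  let ?b = "\<lambda>i n c x. basis_element R (?C i) c \<odot>\<^bsub>Q i n\<^esub> x"
  let ?Q = "\<lambda>i n. scalar_restriction (?A i) (Q i n)"
  have triv_group: "finite_group_trivial R (?C i)" if i: "i \<in> I" for i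
  proof (intro finite_group_trivial.intro finite_group_trivial_axioms.intro base.is_cring G.group_centralizer g i)
    show "finite (carrier (?C i))" using finite_G by (simp add: centralizer_def)
  qed
  have ccP: "chain_complex E.T P d" using P by (simp add: complete_resolution_def)
  have ccQ: "chain_complex (?A i) (Q i) (e i)" if "i \<in> I" for i
    using Q[OF that] by (simp add: complete_resolution_def)
  have lmP: "left_module E.T (P n)" for n using ccP by (simp add: chain_complex_def)
  have lmQ: "left_module (?A i) (Q i n)" if "i \<in> I" for i n using ccQ[OF that] by (simp add: chain_complex_def)
  have dhom: "d n \<in> module_homs E.T (P n) (P (n - 1))" for n using ccP by (simp add: chain_complex_def)
  have ehom: "e i n \<in> module_homs (?A i) (Q i n) (Q i (n - 1))" if "i \<in> I" for i n
    using ccQ[OF that] by (simp add: chain_complex_def)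
  note dcl = module_homsD(1)[OF dhom] and ecl = module_homsD(1)[OF ehom]
  have dSS: "d (n + 1) x \<in> carrier (P n)" if "x \<in> carrier (P (n + 1))" for n x
    using dcl[OF that] by simp
  have eSS: "e i (n + 1) q \<in> carrier (Q i n)" if "i \<in> I" "q \<in> carrier (Q i (n + 1))" for i n q
    using ecl[OF that] by simp
  obtain \<eta> where lmN: "left_module E.T N"
    and \<eta>: "complete_resolution_complex R (G \<times>\<times> G) (\<lambda>n. scalar_restriction E.T (P n)) (\<lambda>n. Env.act (P n)) d
      (scalar_restriction E.T N) (Env.act N) \<eta>"
    using Env.complete_resolution_imp_complex[OF P abelian_group_N] by (elim conjE exE)
  have trQ: "left_module (?A i) (?Tr i) \<and> (\<exists>\<eta>. complete_resolution_complex R (?C i) (?Q i) (?b i) (e i)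
      (regular_module R) (\<lambda>_ x. x) \<eta>)" if i: "i \<in> I" for i
    by (rule finite_group_trivial.trivial_resolution[OF triv_group[OF i] Q[OF i]])
  have lmT: "left_module (?A i) (?Tr i)" if i: "i \<in> I" for i
    by (rule conjunct1[OF trQ[OF i]])
  define \<epsilon> where "\<epsilon> i = (SOME \<eta>. complete_resolution_complex R (?C i) (?Q i) (?b i) (e i)
      (regular_module R) (\<lambda>_ x. x) \<eta>)" for i
  have \<epsilon>: "complete_resolution_complex R (?C i) (?Q i) (?b i) (e i) (regular_module R) (\<lambda>_ x. x) (\<epsilon> i)"
    if i: "i \<in> I" for i
    unfolding \<epsilon>_def by (rule someI_ex[OF conjunct2[OF trQ[OF i]]])
  interpret S: centralizer_resolutions R G I g idx s ?Q ?b e \<epsilon>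
    by (intro centralizer_resolutions.intro centralizer_resolutions_axioms.intro finite_group_algebra_axioms)
      (fact \<epsilon> g idx s s_conj idx_g s_g idx_conj lmN)+
  have homP: "complete_resolution_complex R G (\<lambda>n. scalar_restriction E.T (P n)) (\<lambda>n h. Env.act (P n) (h, h)) d
      (scalar_restriction E.T N) (\<lambda>h. Env.act N (h, h)) \<eta>"
  proof (rule complete_resolution_complex_restrict_group[OF \<eta> G.group_axioms finite_G])
    \<comment> \<open>Coset representatives for the diagonal: (x, y) = (x, x) (1, x^-1 y).\<close>
    let ?V = "(\<lambda>v. (\<one>\<^bsub>G\<^esub>, v)) ` carrier G"
    show "finite ?V" using finite_G by simp
    show "?V \<subseteq> carrier (G \<times>\<times> G)" by auto
    show "(\<lambda>h. (h, h)) \<in> hom G (G \<times>\<times> G)" by (auto simp: hom_def)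
    show "bij_betw (\<lambda>(k, v). (k, k) \<otimes>\<^bsub>G \<times>\<times> G\<^esub> v) (carrier G \<times> ?V) (carrier (G \<times>\<times> G))"
    proof (rule bij_betw_imageI)
      show "inj_on (\<lambda>(k, v). (k, k) \<otimes>\<^bsub>G \<times>\<times> G\<^esub> v) (carrier G \<times> ?V)"
        by (auto intro!: inj_onI)
      show "(\<lambda>(k, v). (k, k) \<otimes>\<^bsub>G \<times>\<times> G\<^esub> v) ` (carrier G \<times> ?V) = carrier (G \<times>\<times> G)"
      proof (intro equalityI subsetI)
        fix u assume "u \<in> carrier (G \<times>\<times> G)"
        then obtain x y where u: "u = (x, y)" "x \<in> carrier G" "y \<in> carrier G" by auto
        have "u = (\<lambda>(k, v). (k, k) \<otimes>\<^bsub>G \<times>\<times> G\<^esub> v) (x, (\<one>\<^bsub>G\<^esub>, inv\<^bsub>G\<^esub> x \<otimes>\<^bsub>G\<^esub> y))"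
          using u by (simp add: G.m_assoc[symmetric])
        then show "u \<in> (\<lambda>(k, v). (k, k) \<otimes>\<^bsub>G \<times>\<times> G\<^esub> v) ` (carrier G \<times> ?V)"
          by (rule image_eqI) (use u in auto)
      qed auto
    qed
  qed
  have trivR: "group_module R G (regular_module R) (\<lambda>_ x. x)"
    by (intro group_module.intro base.module_regular_module G.group_axioms group_module_axioms.intro)
      (auto simp: linear_maps_def)
  note GP = exact_complex.group_module[OF complete_complex.axioms(1)[OF complete_resolution_complex.axioms(1)[OF homP]]]
  let ?eP = "\<lambda>n. equivariant_maps R G (scalar_restriction E.T (P n)) (\<lambda>h. Env.act (P n) (h, h)) (regular_module R) (\<lambda>_ x. x)"
  let ?eW = "\<lambda>n. equivariant_maps R G (S.W n) (S.w n) (regular_module R) (\<lambda>_ x. x)"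
  let ?eQ = "\<lambda>i n. equivariant_maps R (?C i) (?Q i n) (?b i n) (regular_module R) (\<lambda>_ x. x)"
  obtain \<alpha> where \<alpha>: "\<And>n. \<alpha> n \<in> equivariant_maps R G (S.W n) (S.w n) (scalar_restriction E.T (P n)) (\<lambda>h. Env.act (P n) (h, h))"
    and d\<alpha>: "\<And>n x. x \<in> carrier (S.W n) \<Longrightarrow> d n (\<alpha> n x) = \<alpha> (n - 1) (S.D n x)"
    and cmp_inj: "\<And>n \<phi> h. \<lbrakk>\<phi> \<in> ?eP n; \<And>x. x \<in> carrier (scalar_restriction E.T (P (n + 1))) \<Longrightarrow> \<phi> (d (n + 1) x) = \<zero>\<^bsub>regular_module R\<^esub>;
        h \<in> ?eW (n - 1); \<And>x. x \<in> carrier (S.W n) \<Longrightarrow> \<phi> (\<alpha> n x) = h (S.D n x)\<rbrakk>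
      \<Longrightarrow> \<exists>k\<in>?eP (n - 1). \<forall>x\<in>carrier (scalar_restriction E.T (P n)). \<phi> x = k (d n x)"
    and cmp_surj: "\<And>n \<psi>. \<lbrakk>\<psi> \<in> ?eW n; \<And>x. x \<in> carrier (S.W (n + 1)) \<Longrightarrow> \<psi> (S.D (n + 1) x) = \<zero>\<^bsub>regular_module R\<^esub>\<rbrakk>
      \<Longrightarrow> \<exists>\<phi>\<in>?eP n. (\<forall>x\<in>carrier (scalar_restriction E.T (P (n + 1))). \<phi> (d (n + 1) x) = \<zero>\<^bsub>regular_module R\<^esub>) \<and>
            (\<exists>k\<in>?eW (n - 1). \<forall>x\<in>carrier (S.W n). \<phi> (\<alpha> n x) = \<psi> x \<oplus>\<^bsub>regular_module R\<^esub> k (S.D n x))"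
  proof (rule comparison[OF homP S.complete_resolution_W trivR], goal_cases)
    case (1 f)
    show thesis
      by (rule 1(1)[of f]; (rule 1(2) | (rule 1(3), assumption) | (rule 1(4), assumption+) | (rule 1(5), assumption+)))
  qed
  let ?sg = "\<lambda>n i q. S.single n (g i) q"
  have sg: "?sg n i q \<in> carrier (S.W n)" if "i \<in> I" "q \<in> carrier (Q i n)" for n i q
    using S.single_closed[OF g[OF that(1)], of q n] that by (simp add: idx_g)
  have D_sg: "S.D n (?sg n i q) = ?sg (n - 1) i (e i n q)" if "i \<in> I" "q \<in> carrier (Q i n)" for n i q
    using S.D_single[OF g[OF that(1)], of q n] that by (simp add: idx_g)
  have \<alpha>sg: "\<alpha> n (?sg n i q) \<in> carrier (P n)" if "i \<in> I" "q \<in> carrier (Q i n)" for n i q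
    using equivariant_mapsD(3)[OF \<alpha> sg[OF that]] by simp
  have WmemQ: "x y \<in> carrier (Q (idx y) n)" if "x \<in> carrier (S.W n)" "y \<in> carrier G" for x y n
    using S.W_mem[OF that] by simp
  \<comment> \<open>Invariant forms on the induced module agree once they agree on the fibres over
    the representatives. All identities between such forms are tested there.\<close>
  have eW_eqI: "\<phi> x = \<psi> x" if "\<phi> \<in> ?eW n" "\<psi> \<in> ?eW n" "x \<in> carrier (S.W n)"
    "\<And>i q. \<lbrakk>i \<in> I; q \<in> carrier (Q i n)\<rbrakk> \<Longrightarrow> \<phi> (?sg n i q) = \<psi> (?sg n i q)" for \<phi> \<psi> n x
    unfolding S.equivariant_eq_sum[OF that(1,3)] S.equivariant_eq_sum[OF that(2,3)]
    using equivariant_mapsD(3)[OF that(2) sg] that(4) WmemQ[OF that(3)] idx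
    by (intro base.finsum_cong') auto
  define \<theta> where "\<theta> n i f = (\<lambda>q\<in>carrier (Q i n). f (\<alpha> n (?sg n i q)) \<one>\<^bsub>G\<^esub>)" for n i and f :: "'p \<Rightarrow> 'g \<Rightarrow> 'r"
  have coeff: "(\<lambda>x. f x \<one>\<^bsub>G\<^esub>) \<in> ?eP n" if "f \<in> module_homs E.T (P n) N" for f n
    by (rule coeff_one_equivariant[OF lmP lmN that])
  have coeffW: "(\<lambda>x. f (\<alpha> n x) \<one>\<^bsub>G\<^esub>) \<in> ?eW n" if "f \<in> module_homs E.T (P n) N" for f n
    by (rule equivariant_maps_compose[OF \<alpha> coeff[OF that]])
  have toTr: "restrict h (carrier (Q i n)) \<in> module_homs (?A i) (Q i n) (?Tr i)" if i: "i \<in> I" and h: "h \<in> ?eQ i n" for i n h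
    unfolding finite_group_trivial.trivial_module_homs_iff[OF triv_group[OF i] lmQ[OF i] lmT[OF i]]
    using equivariant_maps_restrict[OF S.Q_group_module[OF i] h] by simp
  have fromTr: "h \<in> ?eQ i n" if i: "i \<in> I" and h: "h \<in> module_homs (?A i) (Q i n) (?Tr i)" for i n h
    using h unfolding finite_group_trivial.trivial_module_homs_iff[OF triv_group[OF i] lmQ[OF i] lmT[OF i]]
    by (rule conjunct2)
  have \<theta>_hom: "\<theta> n i f \<in> module_homs (?A i) (Q i n) (?Tr i)" if "i \<in> I" "f \<in> module_homs E.T (P n) N" for n i f
    unfolding \<theta>_def by (rule toTr[OF that(1) S.equivariant_restrict[OF coeffW[OF that(2)] that(1)]])
  have \<theta>_compose: "\<theta> n i (compose (carrier (P n)) h (d n)) = compose (carrier (Q i n)) (\<theta> (n - 1) i h) (e i n)"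
    if i: "i \<in> I" for n i h
    unfolding \<theta>_def compose_def
    by (rule restrict_ext) (simp add: i \<alpha>sg d\<alpha> sg D_sg ecl)
  have hom_zero: "f \<zero>\<^bsub>P n\<^esub> = \<zero>\<^bsub>A\<^esub>" if f: "f \<in> module_homs E.T (P n) N" for f n
  proof -
    have "f \<in> equivariant_maps R (G \<times>\<times> G) (scalar_restriction E.T (P n)) (Env.act (P n)) (scalar_restriction E.T N) (Env.act N)"
      by (rule Env.module_homs_equivariant[OF lmP lmN f])
    from linear_maps_zero[OF Env.module_scalar_restriction[OF lmP] Env.module_scalar_restriction[OF lmN] equivariant_mapsD(1)[OF this]]
    show ?thesis by simp
  qed
  let ?Z = "(hom_module E.T (P n) N)\<lparr>carrier := cocycles E.T P d N n\<rparr>" and ?B = "coboundaries E.T P d N n"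
  let ?Z' = "\<lambda>i. (hom_module (?A i) (Q i n) (?Tr i))\<lparr>carrier := cocycles (?A i) (Q i) (e i) (?Tr i) n\<rparr>"
    and ?B' = "\<lambda>i. coboundaries (?A i) (Q i) (e i) (?Tr i) n"
  have cocP: "f \<in> module_homs E.T (P n) N" "\<And>x. x \<in> carrier (P (n + 1)) \<Longrightarrow> f (d (n + 1) x) = \<zero>\<^bsub>A\<^esub>"
    if "f \<in> cocycles E.T P d N n" for f
    using that by (auto simp: cocycles_def)
  show ?thesis
    unfolding H_def H'_def tate_ext_def
  proof (rule quotient_isomorphism[where \<theta> = "\<theta> n"])
    show "module_quotient R ?Z ?B"
      by (rule Env.cohomology_module_quotient[OF ccP lmN])
    show "module_quotient R (?Z' i) (?B' i)" if i: "i \<in> I" for i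
    proof -
      interpret Ci: finite_group_trivial R "?C i" by (rule triv_group[OF i])
      show ?thesis by (rule Ci.BK.cohomology_module_quotient[OF ccQ[OF i] lmT[OF i]])
    qed
  next
    fix i assume i: "i \<in> I"
    show "\<theta> n i \<in> linear_maps R ?Z (?Z' i)"
    proof (rule linear_mapsI)
      fix f assume f: "f \<in> carrier ?Z"
      then have f': "f \<in> cocycles E.T P d N n" by simp
      note fc = cocP[OF f']
      have "\<theta> n i f (e i (n + 1) q) = \<zero>\<^bsub>R\<^esub>" if q: "q \<in> carrier (Q i (n + 1))" for q
      proof -
        have "\<alpha> n (?sg n i (e i (n + 1) q)) = d (n + 1) (\<alpha> (n + 1) (?sg (n + 1) i q))"
          using d\<alpha>[OF sg[OF i q]] D_sg[OF i q] by simp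
        then show ?thesis
          using fc(2)[OF \<alpha>sg[OF i q]] eSS[OF i q] by (simp add: \<theta>_def RG.F_apply)
      qed
      then show "\<theta> n i f \<in> carrier (?Z' i)"
        using \<theta>_hom[OF i fc(1)] by (simp add: cocycles_def)
      show "\<theta> n i (f \<oplus>\<^bsub>?Z\<^esub> h) = \<theta> n i f \<oplus>\<^bsub>?Z' i\<^esub> \<theta> n i h" if "h \<in> carrier ?Z" for h
      proof -
        have "\<theta> n i (\<lambda>x\<in>carrier (P n). f x \<oplus>\<^bsub>A\<^esub> h x) = (\<lambda>q\<in>carrier (Q i n). \<theta> n i f q \<oplus>\<^bsub>R\<^esub> \<theta> n i h q)"
          unfolding \<theta>_def by (rule restrict_ext) (simp add: \<alpha>sg[OF i] RG.F_apply)
        then show ?thesis by simp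
      qed
      show "\<theta> n i (r \<odot>\<^bsub>?Z\<^esub> f) = r \<odot>\<^bsub>?Z' i\<^esub> \<theta> n i f" if r: "r \<in> carrier R" for r
      proof -
        have "\<theta> n i (\<lambda>x\<in>carrier (P n). (r \<odot>\<^bsub>E.T\<^esub> \<one>\<^bsub>E.T\<^esub>) \<odot>\<^bsub>N\<^esub> f x)
            = (\<lambda>q\<in>carrier (Q i n). (r \<odot>\<^bsub>?A i\<^esub> \<one>\<^bsub>?A i\<^esub>) \<odot>\<^bsub>?Tr i\<^esub> \<theta> n i f q)"
        proof -
          have "((r \<odot>\<^bsub>E.T\<^esub> \<one>\<^bsub>E.T\<^esub>) \<odot>\<^bsub>N\<^esub> f x) \<one>\<^bsub>G\<^esub> = r \<otimes>\<^bsub>R\<^esub> f x \<one>\<^bsub>G\<^esub>" if "x \<in> carrier (P n)" for x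
            using module_homsD(1)[OF fc(1) that] r by (simp add: smult_N_scalar RG.F_apply)
          moreover have "\<theta> n i f q \<in> carrier R" if "q \<in> carrier (Q i n)" for q
            using module_homsD(1)[OF \<theta>_hom[OF i fc(1)] that] by simp
          ultimately show ?thesis
            using finite_group_trivial.trivial_smult_one[OF triv_group[OF i] r]
            by (intro extensionalityI[of _ "carrier (Q i n)"]) (simp_all add: \<theta>_def \<alpha>sg[OF i] del: trivial_module_sel)
        qed
        then show ?thesis by simp
      qed
    qed
  next
    fix f assume "f \<in> carrier ?Z"
    then have f': "f \<in> cocycles E.T P d N n" by simp
    note fc = cocP[OF f']
    show "f \<in> ?B \<longleftrightarrow> (\<forall>i\<in>I. \<theta> n i f \<in> ?B' i)"
    proof
      assume "f \<in> ?B"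
      then obtain h where h: "h \<in> module_homs E.T (P (n - 1)) N" "f = compose (carrier (P n)) h (d n)"
        by (auto simp: coboundaries_def)
      show "\<forall>i\<in>I. \<theta> n i f \<in> ?B' i"
        unfolding h(2) coboundaries_def using \<theta>_compose \<theta>_hom[OF _ h(1)] by blast
    next
      assume "\<forall>i\<in>I. \<theta> n i f \<in> ?B' i"
      then have "\<forall>i\<in>I. \<exists>k. k \<in> module_homs (?A i) (Q i (n - 1)) (?Tr i) \<and> \<theta> n i f = compose (carrier (Q i n)) k (e i n)"
        by (auto simp: coboundaries_def)
      from bchoice[OF this] obtain k where k: "\<forall>i\<in>I. k i \<in> module_homs (?A i) (Q i (n - 1)) (?Tr i) \<and>
          \<theta> n i f = compose (carrier (Q i n)) (k i) (e i n)" ..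
      have k1: "k i \<in> ?eQ i (n - 1)" if "i \<in> I" for i
        by (rule fromTr[OF that conjunct1[OF bspec[OF k that]]])
      have k2: "\<theta> n i f = compose (carrier (Q i n)) (k i) (e i n)" if "i \<in> I" for i
        by (rule conjunct2[OF bspec[OF k that]])
      \<comment> \<open>The primitives \<open>k i\<close> on the given resolutions are assembled
        into one invariant form, which shows that the pullback of \<open>f\<close> along
        \<open>\<alpha>\<close> is a coboundary on the induced complex.\<close>
      define h where "h = (\<lambda>x. \<Oplus>\<^bsub>R\<^esub>y\<in>carrier G. k (idx y) (x y))"
      have hW: "h \<in> ?eW (n - 1)" unfolding h_def by (rule S.equivariant_extend(1)[OF k1])
      have hk: "h (?sg (n - 1) i q) = k i q" if i: "i \<in> I" and q: "q \<in> carrier (Q i (n - 1))" for i q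
        unfolding h_def by (rule S.equivariant_extend(2)[OF k1 i]) (use q in simp_all)
      have "f (\<alpha> n x) \<one>\<^bsub>G\<^esub> = h (S.D n x)" if x: "x \<in> carrier (S.W n)" for x
      proof (rule eW_eqI[OF coeffW[OF fc(1)] equivariant_maps_compose[OF S.D_equivariant hW] x])
        fix i q assume i: "i \<in> I" and q: "q \<in> carrier (Q i n)"
        have "f (\<alpha> n (?sg n i q)) \<one>\<^bsub>G\<^esub> = \<theta> n i f q" using q by (simp add: \<theta>_def)
        also have "\<dots> = k i (e i n q)" using q by (simp add: k2[OF i] compose_def)
        also have "\<dots> = h (S.D n (?sg n i q))" using hk[OF i ecl[OF i q]] D_sg[OF i q] by simp
        finally show "f (\<alpha> n (?sg n i q)) \<one>\<^bsub>G\<^esub> = h (S.D n (?sg n i q))" .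
      qed
      moreover have "f (d (n + 1) x) \<one>\<^bsub>G\<^esub> = \<zero>\<^bsub>regular_module R\<^esub>"
        if "x \<in> carrier (scalar_restriction E.T (P (n + 1)))" for x
        using fc(2) that by (simp add: RG.F_apply)
      ultimately have "\<exists>k\<in>?eP (n - 1). \<forall>x\<in>carrier (scalar_restriction E.T (P n)). f x \<one>\<^bsub>G\<^esub> = k (d n x)"
        by (intro cmp_inj[OF coeff[OF fc(1)] _ hW])
      then obtain \<kappa> where \<kappa>: "\<kappa> \<in> ?eP (n - 1)" "\<forall>x\<in>carrier (P n). f x \<one>\<^bsub>G\<^esub> = \<kappa> (d n x)"
        unfolding scalar_restriction_simps ..
      have co: "coinduced_hom (P (n - 1)) \<kappa> \<in> module_homs E.T (P (n - 1)) N"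
        by (rule coinduced_hom_module_homs[OF lmP lmN \<kappa>(1)])
      \<comment> \<open>The coefficient of \<open>f x\<close> at \<open>z\<close> is the coefficient
        at 1 of \<open>f\<close> at a translate of \<open>x\<close>. The primitive of the
        coefficient at 1 therefore yields a primitive of \<open>f\<close> once it is
        coinduced.\<close>
      have "f = compose (carrier (P n)) (coinduced_hom (P (n - 1)) \<kappa>) (d n)"
      proof (rule extensionalityI[of _ "carrier (P n)"])
        show "f \<in> extensional (carrier (P n))" by (rule module_homsD(4)[OF fc(1)])
        show "compose (carrier (P n)) (coinduced_hom (P (n - 1)) \<kappa>) (d n) \<in> extensional (carrier (P n))"
          by (rule compose_extensional)
        fix x assume x: "x \<in> carrier (P n)"
        have "f x = coinduced_hom (P (n - 1)) \<kappa> (d n x)"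
        proof (rule RG.F_eqI)
          show "f x \<in> carrier A" using module_homsD(1)[OF fc(1) x] by simp
          show "coinduced_hom (P (n - 1)) \<kappa> (d n x) \<in> carrier A" using module_homsD(1)[OF co dcl[OF x]] by simp
          fix z assume z: "z \<in> carrier G"
          let ?u = "env_basis (inv\<^bsub>G\<^esub> z, \<one>\<^bsub>G\<^esub>)"
          have u: "?u \<in> carrier E.T" using z by (intro Env.basis_closed) simp
          have ux: "?u \<odot>\<^bsub>P n\<^esub> x \<in> carrier (P n)"
            by (rule left_module.smult_closed[OF lmP u x])
          have "f x z = f (?u \<odot>\<^bsub>P n\<^esub> x) \<one>\<^bsub>G\<^esub>"
            by (rule module_hom_eq_of_coeff_one[OF lmP lmN fc(1) x z])
          also have "\<dots> = \<kappa> (?u \<odot>\<^bsub>P (n - 1)\<^esub> d n x)"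
            using bspec[OF \<kappa>(2) ux] module_homsD(3)[OF dhom u x] by simp
          also have "\<dots> = coinduced_hom (P (n - 1)) \<kappa> (d n x) z"
            using z dcl[OF x] by (simp add: coinduced_hom_def)
          finally show "f x z = coinduced_hom (P (n - 1)) \<kappa> (d n x) z" .
        qed
        then show "f x = compose (carrier (P n)) (coinduced_hom (P (n - 1)) \<kappa>) (d n) x"
          using x by (simp add: compose_def)
      qed
      then show "f \<in> ?B" unfolding coboundaries_def using co by (rule image_eqI)
    qed
  next
    fix \<psi> assume \<psi>: "\<And>i. i \<in> I \<Longrightarrow> \<psi> i \<in> carrier (?Z' i)"
    have \<psi>1: "\<psi> i \<in> module_homs (?A i) (Q i n) (?Tr i)" "\<And>q. q \<in> carrier (Q i (n + 1)) \<Longrightarrow> \<psi> i (e i (n + 1) q) = \<zero>\<^bsub>R\<^esub>"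
      if "i \<in> I" for i
      using \<psi>[OF that] by (auto simp: cocycles_def)
    note \<psi>e = fromTr[OF _ \<psi>1(1)]
    \<comment> \<open>Surjectivity runs the construction backwards: the forms
      \<open>\<psi> i\<close> are assembled on the induced complex, moved to \<open>P\<close> up to
      a coboundary, and coinduced to a homomorphism into RG.\<close>
    define \<chi> where "\<chi> = (\<lambda>x. \<Oplus>\<^bsub>R\<^esub>y\<in>carrier G. \<psi> (idx y) (x y))"
    have \<chi>: "\<chi> \<in> ?eW n" unfolding \<chi>_def by (rule S.equivariant_extend(1)) (rule \<psi>e)
    have \<chi>\<psi>: "\<chi> (?sg n i q) = \<psi> i q" if i: "i \<in> I" and q: "q \<in> carrier (Q i n)" for i q
      unfolding \<chi>_def by (rule S.equivariant_extend(2)) (use q i \<psi>e in simp_all)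
    have \<chi>D: "\<chi> (S.D (n + 1) x) = \<zero>\<^bsub>regular_module R\<^esub>" if x: "x \<in> carrier (S.W (n + 1))" for x
    proof -
      have DS: "S.D (n + 1) \<in> equivariant_maps R G (S.W (n + 1)) (S.w (n + 1)) (S.W n) (S.w n)"
        using S.D_equivariant[of "n + 1"] by simp
      have z: "(\<lambda>_. \<zero>\<^bsub>regular_module R\<^esub>) \<in> ?eW (n + 1)"
        by (intro equivariant_maps_zero_map base.module_regular_module) simp
      show ?thesis
      proof (rule eW_eqI[OF equivariant_maps_compose[OF DS \<chi>] z x])
        fix i q assume i: "i \<in> I" and q: "q \<in> carrier (Q i (n + 1))"
        have "S.D (n + 1) (?sg (n + 1) i q) = ?sg n i (e i (n + 1) q)"
          using D_sg[OF i q] by simp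
        then show "\<chi> (S.D (n + 1) (?sg (n + 1) i q)) = \<zero>\<^bsub>regular_module R\<^esub>"
          using \<chi>\<psi>[OF i eSS[OF i q]] \<psi>1(2)[OF i q] by simp
      qed
    qed
    from cmp_surj[OF \<chi> \<chi>D] obtain \<phi> where \<phi>: "\<phi> \<in> ?eP n"
      and \<phi>_rest: "(\<forall>x\<in>carrier (scalar_restriction E.T (P (n + 1))). \<phi> (d (n + 1) x) = \<zero>\<^bsub>regular_module R\<^esub>) \<and>
            (\<exists>k\<in>?eW (n - 1). \<forall>x\<in>carrier (S.W n). \<phi> (\<alpha> n x) = \<chi> x \<oplus>\<^bsub>regular_module R\<^esub> k (S.D n x))" ..
    from conjunct2[OF \<phi>_rest] obtain k where k: "k \<in> ?eW (n - 1)"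
      and \<phi>k: "\<forall>x\<in>carrier (S.W n). \<phi> (\<alpha> n x) = \<chi> x \<oplus>\<^bsub>regular_module R\<^esub> k (S.D n x)" ..
    have \<phi>d: "\<phi> (d (n + 1) x) = \<zero>\<^bsub>R\<^esub>" if "x \<in> carrier (P (n + 1))" for x
      using bspec[OF conjunct1[OF \<phi>_rest], of x] that by simp
    let ?f = "coinduced_hom (P n) \<phi>"
    have f: "?f \<in> module_homs E.T (P n) N" by (rule coinduced_hom_module_homs[OF lmP lmN \<phi>])
    have "?f (d (n + 1) x) = \<zero>\<^bsub>A\<^esub>" if x: "x \<in> carrier (P (n + 1))" for x
    proof (rule RG.F_eqI[OF _ RG.zero_closed_F])
      show "?f (d (n + 1) x) \<in> carrier A" using module_homsD(1)[OF f dSS[OF x]] by simp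
      fix z assume z: "z \<in> carrier G"
      let ?u = "env_basis (inv\<^bsub>G\<^esub> z, \<one>\<^bsub>G\<^esub>)"
      have u: "?u \<in> carrier E.T" using z by (intro Env.basis_closed) simp
      have ux: "?u \<odot>\<^bsub>P (n + 1)\<^esub> x \<in> carrier (P (n + 1))"
        by (rule left_module.smult_closed[OF lmP u x])
      have "?f (d (n + 1) x) z = \<phi> (?u \<odot>\<^bsub>P n\<^esub> d (n + 1) x)"
        using z dSS[OF x] by (simp add: coinduced_hom_def)
      also have "?u \<odot>\<^bsub>P n\<^esub> d (n + 1) x = d (n + 1) (?u \<odot>\<^bsub>P (n + 1)\<^esub> x)"
        using module_homsD(3)[OF dhom[of "n + 1"] u x] by simp
      finally show "?f (d (n + 1) x) z = \<zero>\<^bsub>A\<^esub> z"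
        using \<phi>d[OF ux] z by (simp add: RG.F_apply)
    qed
    then have fZ: "?f \<in> carrier ?Z" using f by (simp add: cocycles_def)
    have "\<exists>b\<in>?B' i. \<theta> n i ?f = \<psi> i \<oplus>\<^bsub>?Z' i\<^esub> b" if i: "i \<in> I" for i
    proof
      \<comment> \<open>The coboundary left over by the comparison, restricted to the fibre over
        \<open>g i\<close>, is the permitted error.\<close>
      let ?k = "restrict (\<lambda>q. k (?sg (n - 1) i q)) (carrier (Q i (n - 1)))"
      have "?k \<in> module_homs (?A i) (Q i (n - 1)) (?Tr i)"
        by (rule toTr[OF i S.equivariant_restrict[OF k i]])
      then show "compose (carrier (Q i n)) ?k (e i n) \<in> ?B' i"
        unfolding coboundaries_def by (rule imageI)
      have "\<theta> n i ?f q = \<psi> i q \<oplus>\<^bsub>R\<^esub> k (?sg (n - 1) i (e i n q))" if q: "q \<in> carrier (Q i n)" for q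
      proof -
        have "\<theta> n i ?f q = \<phi> (\<alpha> n (?sg n i q))"
          using q coinduced_hom_one[OF lmP lmN \<phi> \<alpha>sg[OF i q]] by (simp add: \<theta>_def)
        then show ?thesis
          using bspec[OF \<phi>k sg[OF i q]] \<chi>\<psi>[OF i q] D_sg[OF i q] by simp
      qed
      then show "\<theta> n i ?f = \<psi> i \<oplus>\<^bsub>?Z' i\<^esub> compose (carrier (Q i n)) ?k (e i n)"
        by (intro extensionalityI[of _ "carrier (Q i n)"])
          (simp_all add: compose_def ecl[OF i] module_homsD(4)[OF \<theta>_hom[OF i f]])
    qed
    then show "\<exists>f\<in>carrier ?Z. \<forall>i\<in>I. \<exists>b\<in>?B' i. \<theta> n i f = \<psi> i \<oplus>\<^bsub>?Z' i\<^esub> b"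
      using fZ by blast
  qed
qed

end

section \<open>Conjugacy classes and the choice of conjugating elements\<close>

lemma (in group) orbit_conjugation:
  "x \<in> carrier G \<Longrightarrow> orbit G (conjugation G) x = {h \<otimes> x \<otimes> inv h | h. h \<in> carrier G}"
  by (auto simp: orbit_def conjugation_def)

lemma (in group) orbit_conjugation_eq:
  assumes x: "x \<in> carrier G" and h: "h \<in> carrier G"
  shows "orbit G (conjugation G) (h \<otimes> x \<otimes> inv h) = orbit G (conjugation G) x"
proof -
  have *: "orbit G (conjugation G) (h \<otimes> x \<otimes> inv h) \<subseteq> orbit G (conjugation G) x"
    if x: "x \<in> carrier G" and h: "h \<in> carrier G" for x h
  proof
    fix y assume "y \<in> orbit G (conjugation G) (h \<otimes> x \<otimes> inv h)"
    then obtain k where k: "k \<in> carrier G" "y = k \<otimes> (h \<otimes> x \<otimes> inv h) \<otimes> inv k"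
      using x h by (auto simp: orbit_conjugation)
    then have "y = (k \<otimes> h) \<otimes> x \<otimes> inv (k \<otimes> h)"
      using x h by (simp add: m_assoc inv_mult_group)
    then show "y \<in> orbit G (conjugation G) x"
      unfolding orbit_conjugation[OF x] using k h by blast
  qed
  have "inv h \<otimes> (h \<otimes> x \<otimes> inv h) \<otimes> inv (inv h) = x"
    using x h by (simp add: m_assoc) (simp add: m_assoc[symmetric])
  then show ?thesis using *[OF x h] *[of "h \<otimes> x \<otimes> inv h" "inv h"] x h by auto
qed

lemma (in group) conjugacy_class_choice:
  assumes "conjugacy_class_representatives G t g"
  obtains idx s where "\<And>i. i \<in> {1..t} \<Longrightarrow> g i \<in> carrier G"
    and "\<And>y. y \<in> carrier G \<Longrightarrow> idx y \<in> {1..t}"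
    and "\<And>y. y \<in> carrier G \<Longrightarrow> s y \<in> carrier G"
    and "\<And>y. y \<in> carrier G \<Longrightarrow> s y \<otimes> g (idx y) = y \<otimes> s y"
    and "\<And>i. i \<in> {1..t} \<Longrightarrow> idx (g i) = i"
    and "\<And>i. i \<in> {1..t} \<Longrightarrow> s (g i) = \<one>"
    and "\<And>y h. \<lbrakk>y \<in> carrier G; h \<in> carrier G\<rbrakk> \<Longrightarrow> idx (inv h \<otimes> y \<otimes> h) = idx y"
proof -
  let ?o = "orbit G (conjugation G)"
  have g: "g i \<in> carrier G" if "i \<in> {1..t}" for i
    using assms that by (auto simp: conjugacy_class_representatives_def)
  have bij: "bij_betw (\<lambda>i. ?o (g i)) {1..t} (orbits G (carrier G) (conjugation G))"
    using assms by (simp add: conjugacy_class_representatives_def)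
  \<comment> \<open>The index depends on \<open>y\<close> only through its orbit, hence is constant
    on conjugacy classes.\<close>
  define idx where "idx y = inv_into {1..t} (\<lambda>i. ?o (g i)) (?o y)" for y
  have o_mem: "?o y \<in> (\<lambda>i. ?o (g i)) ` {1..t}" if "y \<in> carrier G" for y
    using that bij_betw_imp_surj_on[OF bij] by (auto simp: orbits_def)
  have idx: "idx y \<in> {1..t}" if "y \<in> carrier G" for y
    unfolding idx_def by (rule inv_into_into[OF o_mem[OF that]])
  have o_idx: "?o (g (idx y)) = ?o y" if "y \<in> carrier G" for y
    unfolding idx_def by (rule f_inv_into_f[OF o_mem[OF that]])
  have idx_g: "idx (g i) = i" if "i \<in> {1..t}" for i
    unfolding idx_def by (rule inv_into_f_f[OF bij_betw_imp_inj_on[OF bij] that])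
  have ex: "\<exists>h. h \<in> carrier G \<and> h \<otimes> g (idx y) = y \<otimes> h" if y: "y \<in> carrier G" for y
  proof -
    have "y = \<one> \<otimes> y \<otimes> inv \<one>" using y by simp
    then have "y \<in> ?o (g (idx y))" unfolding o_idx[OF y] orbit_conjugation[OF y] by blast
    then obtain h where h: "h \<in> carrier G" "y = h \<otimes> g (idx y) \<otimes> inv h"
      unfolding orbit_conjugation[OF g[OF idx[OF y]]] by blast
    have "y \<otimes> h = h \<otimes> g (idx y)"
      using h(1) g[OF idx[OF y]] by (subst h(2)) (simp add: m_assoc)
    then show ?thesis using h(1) by auto
  qed
  \<comment> \<open>At a representative the conjugating element is fixed to be 1, so that the
    induced action restricts to the given one on its fibre. Elsewhere any conjugating element will
    do.\<close>
  define s where "s y = (if y = g (idx y) then \<one> else SOME h. h \<in> carrier G \<and> h \<otimes> g (idx y) = y \<otimes> h)" for y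
  have s: "s y \<in> carrier G \<and> s y \<otimes> g (idx y) = y \<otimes> s y" if y: "y \<in> carrier G" for y
  proof (cases "y = g (idx y)")
    case True
    then show ?thesis using y by (simp add: s_def)
  next
    case False
    then show ?thesis using someI_ex[OF ex[OF y]] by (simp add: s_def)
  qed
  show thesis
  proof (rule that[of idx s])
    show "s (g i) = \<one>" if "i \<in> {1..t}" for i by (simp add: s_def idx_g[OF that])
    show "idx (inv h \<otimes> y \<otimes> h) = idx y" if "y \<in> carrier G" "h \<in> carrier G" for y h
      using orbit_conjugation_eq[OF that(1), of "inv h"] that(2) by (simp add: idx_def)
  qed (use g idx s idx_g in auto)
qed

theorem mainTheorem3:
  fixes G :: "('g, 'y) monoid_scheme"
    and R :: "('r, 'x) ring_scheme"
    and g :: "nat \<Rightarrow> 'g"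
    and P :: "int \<Rightarrow> ((('g \<Rightarrow> 'r) \<times> ('g \<Rightarrow> 'r) \<Rightarrow> 'r) set, 'p) module"
    and d :: "int \<Rightarrow> 'p \<Rightarrow> 'p"
    and Q :: "nat \<Rightarrow> int \<Rightarrow> ('g \<Rightarrow> 'r, 'q) module"
    and e :: "nat \<Rightarrow> int \<Rightarrow> 'q \<Rightarrow> 'q"
  assumes "group G" and "finite (carrier G)"
    and "cring R"
    and "\<Z> \<simeq> R \<or> (field R \<and> ring_char R > 0 \<and> ring_char R dvd order G)"
    and "conjugacy_class_representatives G t g"
    and "complete_resolution (enveloping_algebra R (monoid_ring R G))
           (regular_bimodule R (monoid_ring R G)) P d"
    and "\<And>i. i \<in> {1..t} \<Longrightarrow>
           complete_resolution (monoid_ring R (centralizer G (g i)))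
             (trivial_module R (centralizer G (g i))) (Q i) (e i)"
  shows "graded_isomorphic R
           (tate_hochschild_cohomology R (monoid_ring R G)
             (regular_bimodule R (monoid_ring R G)) P d)
           (graded_direct_sum {1..t} (\<lambda>i.
             tate_cohomology R (centralizer G (g i))
               (trivial_module R (centralizer G (g i))) (Q i) (e i)))"
proof -
  interpret finite_group_algebra R G
    using assms(1-3) by (simp add: finite_group_algebra_def finite_group_algebra_axioms_def)
  have P: "complete_resolution E.T N P d"
    using assms(6) by (simp add: enveloping_algebra_def)
  \<comment> \<open>That RG satisfies the laws of a left module over the enveloping algebra is read
    off from its resolution, as the image of the augmentation.\<close>
  have "left_module E.T N" using Env.complete_resolution_imp_complex[OF P abelian_group_N] by (rule conjunct1)
  moreover have "chain_complex E.T P d" using P by (simp add: complete_resolution_def)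
  ultimately have quot: "module_quotient R ((hom_module E.T (P n) N)\<lparr>carrier := cocycles E.T P d N n\<rparr>)
      (coboundaries E.T P d N n)" for n
    by (intro Env.cohomology_module_quotient)
  obtain idx s where choice: "\<And>i. i \<in> {1..t} \<Longrightarrow> g i \<in> carrier G"
      "\<And>y. y \<in> carrier G \<Longrightarrow> idx y \<in> {1..t}"
      "\<And>y. y \<in> carrier G \<Longrightarrow> s y \<in> carrier G"
      "\<And>y. y \<in> carrier G \<Longrightarrow> s y \<otimes>\<^bsub>G\<^esub> g (idx y) = y \<otimes>\<^bsub>G\<^esub> s y"
      "\<And>i. i \<in> {1..t} \<Longrightarrow> idx (g i) = i"
      "\<And>i. i \<in> {1..t} \<Longrightarrow> s (g i) = \<one>\<^bsub>G\<^esub>"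
      "\<And>y h. \<lbrakk>y \<in> carrier G; h \<in> carrier G\<rbrakk> \<Longrightarrow> idx (inv\<^bsub>G\<^esub> h \<otimes>\<^bsub>G\<^esub> y \<otimes>\<^bsub>G\<^esub> h) = idx y"
  proof (rule G.conjugacy_class_choice[OF assms(5)], goal_cases)
    case (1 idx s)
    show thesis by (rule 1(1)[of idx s]; rule 1(2-8); assumption)
  qed
  show ?thesis
    unfolding tate_hochschild_cohomology_def tate_cohomology_def enveloping_algebra_def
  proof (rule graded_isomorphic_of_degreewise)
    fix n
    show "\<exists>T. bij_betw T (carrier (tate_ext E.T N P d n))
        (\<Pi>\<^sub>E i\<in>{1..t}. carrier (tate_ext (monoid_ring R (centralizer G (g i))) (trivial_module R (centralizer G (g i))) (Q i) (e i) n)) \<and>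
      T \<zero>\<^bsub>tate_ext E.T N P d n\<^esub> = (\<lambda>i\<in>{1..t}. \<zero>\<^bsub>tate_ext (monoid_ring R (centralizer G (g i))) (trivial_module R (centralizer G (g i))) (Q i) (e i) n\<^esub>) \<and>
      (\<forall>C\<in>carrier (tate_ext E.T N P d n). \<forall>D\<in>carrier (tate_ext E.T N P d n).
        T (C \<oplus>\<^bsub>tate_ext E.T N P d n\<^esub> D) = (\<lambda>i\<in>{1..t}. T C i
          \<oplus>\<^bsub>tate_ext (monoid_ring R (centralizer G (g i))) (trivial_module R (centralizer G (g i))) (Q i) (e i) n\<^esub> T D i)) \<and>
      (\<forall>r\<in>carrier R. \<forall>C\<in>carrier (tate_ext E.T N P d n).
        T (r \<odot>\<^bsub>tate_ext E.T N P d n\<^esub> C) = (\<lambda>i\<in>{1..t}. r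
          \<odot>\<^bsub>tate_ext (monoid_ring R (centralizer G (g i))) (trivial_module R (centralizer G (g i))) (Q i) (e i) n\<^esub> T C i))"
      by (rule tate_ext_isomorphism[OF P assms(7) choice])
  qed (unfold tate_ext_def, simp, (rule module_quotient.quotient_module_closed[OF quot]; assumption)+)
qed

end
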